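(* Let $S$ be a compact surface, possibly with boundary, with $\chi(S)<0$, endowed with a negatively curved Riemannian metric $m$ for which $\partial S$ is totally geodesic. The space $\mathcal L(S)$ of all geodesic laminations on $S$, with the topology induced by the Hausdorff metric $d_{\mathrm H}$, is totally disconnected.
   Context: A geodesic is complete if it admits a parametrization by arc length defined on all of $\left]-\infty,+\infty\right[$ (closed geodesics are complete; a geodesic may be contained in $\partial S$); it is simple if it has no transverse self-intersection. A geodesic lamination on $(S,m)$ is a non-empty closed subset of $S$ which can be decomposed as a union of disjoint simple complete geodesics, called its leaves (the decomposition is unique). The projective tangent bundle $PT(S)$ is the set of pairs $(x,l)$ with $x\in S$ and $l$ a line through the origin in $T_xS$; the Levi-Civita connection of $m$ lifts $m$ to a Riemannian metric on $PT(S)$, making $PT(S)$ a metric space. A geodesic lamination $\lambda$ lifts to the closed subset $\widehat\lambda=\{(x,T_x\lambda): x\in\lambda\}\subset PT(S)$, where $T_x\lambda$ is the line tangent at $x$ to the leaf of $\lambda$ through $x$. The Hausdorff distance is $d_{\mathrm H}(\lambda,\lambda')=\inf\{\varepsilon: \widehat\lambda\subset N_\varepsilon(\widehat\lambda'),\ \widehat\lambda'\subset N_\varepsilon(\widehat\lambda)\}$, where $N_\varepsilon$ denotes the $\varepsilon$-neighborhood in $PT(S)$. *)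

theory Defs
  imports "HOL-Analysis.Analysis" "HOL-Homology.Homology"
begin

section \<open>Smooth functions on relatively open subsets of a half-plane\<close>

definition half_plane :: "(real^2) set" where
  "half_plane = {p. 0 \<le> p $ 2}"

text \<open>The derivative is taken within \<open>V\<close>, so it is one-sided at the edge of the half-plane.
  For \<open>V\<close> relatively open in the half-plane it is unique.\<close>

definition partial :: "(real^2) set \<Rightarrow> 2 \<Rightarrow> (real^2 \<Rightarrow> real) \<Rightarrow> real^2 \<Rightarrow> real" where
  "partial V i f p = frechet_derivative f (at p within V) (axis i 1)"

fun Ck_on :: "nat \<Rightarrow> (real^2) set \<Rightarrow> (real^2 \<Rightarrow> real) \<Rightarrow> bool" where
  "Ck_on 0 V f \<longleftrightarrow> continuous_on V f"
| "Ck_on (Suc k) V f \<longleftrightarrow> f differentiable_on V \<and> (\<forall>i. Ck_on k V (partial V i f))"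

definition smooth_on :: "(real^2) set \<Rightarrow> (real^2 \<Rightarrow> real) \<Rightarrow> bool" where
  "smooth_on V f \<longleftrightarrow> (\<forall>k. Ck_on k V f)"


section \<open>Riemannian surfaces with boundary\<close>

type_synonym 'a chart = "'a set \<times> ('a \<Rightarrow> real^2)"

abbreviation cdom :: "'a chart \<Rightarrow> 'a set" where "cdom \<equiv> fst"
abbreviation cmap :: "'a chart \<Rightarrow> 'a \<Rightarrow> real^2" where "cmap \<equiv> snd"
abbreviation cimg :: "'a chart \<Rightarrow> (real^2) set" where "cimg c \<equiv> cmap c ` cdom c"

definition is_chart :: "'a topology \<Rightarrow> 'a chart \<Rightarrow> bool" where
  "is_chart X c \<longleftrightarrow>
     openin X (cdom c) \<and>
     openin (top_of_set half_plane) (cimg c) \<and>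
     homeomorphic_map (subtopology X (cdom c)) (top_of_set (cimg c)) (cmap c)"

definition overlap :: "'a chart \<Rightarrow> 'a chart \<Rightarrow> (real^2) set" where
  "overlap c d = cmap c ` (cdom c \<inter> cdom d)"

definition transition :: "'a chart \<Rightarrow> 'a chart \<Rightarrow> real^2 \<Rightarrow> real^2" where
  "transition c d = cmap d \<circ> inv_into (cdom c) (cmap c)"

definition smooth_atlas :: "'a topology \<Rightarrow> 'a chart set \<Rightarrow> bool" where
  "smooth_atlas X A \<longleftrightarrow>
     (\<forall>c\<in>A. is_chart X c) \<and>
     (\<Union>c\<in>A. cdom c) = topspace X \<and>
     (\<forall>c\<in>A. \<forall>d\<in>A. \<forall>i. smooth_on (overlap c d) (\<lambda>p. transition c d p $ i))"

text \<open>\<open>surf_metric M c p\<close> is the Gram matrix, in the chart \<open>c\<close>, of the Riemannian metric at the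
  point with coordinates \<open>p\<close>.\<close>

record 'a surface =
  surf_top :: "'a topology"
  surf_atlas :: "'a chart set"
  surf_metric :: "'a chart \<Rightarrow> real^2 \<Rightarrow> real^2^2"

definition riemannian_surface :: "'a surface \<Rightarrow> bool" where
  "riemannian_surface M \<longleftrightarrow>
     Hausdorff_space (surf_top M) \<and>
     smooth_atlas (surf_top M) (surf_atlas M) \<and>
     (\<forall>c\<in>surf_atlas M.
        (\<forall>i j. smooth_on (cimg c) (\<lambda>p. surf_metric M c p $ i $ j)) \<and>
        (\<forall>p\<in>cimg c. transpose (surf_metric M c p) = surf_metric M c p \<and>
                     (\<forall>v. v \<noteq> 0 \<longrightarrow> v \<bullet> (surf_metric M c p *v v) > 0))) \<and>
     (\<forall>c\<in>surf_atlas M. \<forall>d\<in>surf_atlas M. \<forall>p\<in>overlap c d. \<forall>v w.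
        let D = frechet_derivative (transition c d) (at p within overlap c d) in
          v \<bullet> (surf_metric M c p *v w) = D v \<bullet> (surf_metric M d (transition c d p) *v D w))"

text \<open>The predicate above does not include compactness; a compact Hausdorff space with such an
  atlas is automatically second countable.\<close>


section \<open>Levi-Civita connection and curvature\<close>

definition christoffel :: "'a surface \<Rightarrow> 'a chart \<Rightarrow> 2 \<Rightarrow> 2 \<Rightarrow> 2 \<Rightarrow> real^2 \<Rightarrow> real" where
  "christoffel M c k i j p =
     (\<Sum>l\<in>UNIV. matrix_inv (surf_metric M c p) $ k $ l *
        (partial (cimg c) i (\<lambda>q. surf_metric M c q $ j $ l) p
         + partial (cimg c) j (\<lambda>q. surf_metric M c q $ i $ l) p
         - partial (cimg c) l (\<lambda>q. surf_metric M c q $ i $ j) p)) / 2"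

text \<open>The \<open>l\<close>-th component of \<open>R(\<partial>\<^sub>i, \<partial>\<^sub>j)\<partial>\<^sub>k\<close>, where
  \<open>R(X, Y)Z = \<nabla>\<^sub>X\<nabla>\<^sub>YZ - \<nabla>\<^sub>Y\<nabla>\<^sub>XZ - \<nabla>\<^bsub>[X, Y]\<^esub>Z\<close>.\<close>

definition riemann :: "'a surface \<Rightarrow> 'a chart \<Rightarrow> 2 \<Rightarrow> 2 \<Rightarrow> 2 \<Rightarrow> 2 \<Rightarrow> real^2 \<Rightarrow> real" where
  "riemann M c l i j k p =
     partial (cimg c) i (christoffel M c l j k) p
     - partial (cimg c) j (christoffel M c l i k) p
     + (\<Sum>m\<in>UNIV. christoffel M c l i m p * christoffel M c m j k p
                 - christoffel M c l j m p * christoffel M c m i k p)"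

text \<open>\<open>\<langle>R(\<partial>\<^sub>1, \<partial>\<^sub>2)\<partial>\<^sub>2, \<partial>\<^sub>1\<rangle> / (|\<partial>\<^sub>1|\<^sup>2 |\<partial>\<^sub>2|\<^sup>2 - \<langle>\<partial>\<^sub>1, \<partial>\<^sub>2\<rangle>\<^sup>2)\<close>\<close>

definition gauss_curvature :: "'a surface \<Rightarrow> 'a chart \<Rightarrow> real^2 \<Rightarrow> real" where
  "gauss_curvature M c p =
     (\<Sum>l\<in>UNIV. surf_metric M c p $ 1 $ l * riemann M c l 1 2 2 p) / det (surf_metric M c p)"

definition negatively_curved :: "'a surface \<Rightarrow> bool" where
  "negatively_curved M \<longleftrightarrow> (\<forall>c\<in>surf_atlas M. \<forall>p\<in>cimg c. gauss_curvature M c p < 0)"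

text \<open>In a chart the boundary is the line \<open>p $ 2 = 0\<close>, with tangent field \<open>\<partial>\<^sub>1\<close>. Its second
  fundamental form is the normal part of \<open>\<nabla>\<^bsub>\<partial>\<^sub>1\<^esub>\<partial>\<^sub>1\<close>, which vanishes iff the
  \<open>\<partial>\<^sub>2\<close>-component of \<open>\<nabla>\<^bsub>\<partial>\<^sub>1\<^esub>\<partial>\<^sub>1\<close> does. The boundary may be empty.\<close>

definition totally_geodesic_boundary :: "'a surface \<Rightarrow> bool" where
  "totally_geodesic_boundary M \<longleftrightarrow>
     (\<forall>c\<in>surf_atlas M. \<forall>p\<in>cimg c. p $ 2 = 0 \<longrightarrow> christoffel M c 2 1 1 p = 0)"


section \<open>Euler characteristic\<close>

definition abelian_rank :: "('b, 'c) monoid_scheme \<Rightarrow> nat" where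
  "abelian_rank G =
     Sup {card B |B. finite B \<and> B \<subseteq> carrier G \<and>
        (\<forall>k :: 'b \<Rightarrow> int. finprod G (\<lambda>b. b [^]\<^bsub>G\<^esub> k b) B = \<one>\<^bsub>G\<^esub> \<longrightarrow> (\<forall>b\<in>B. k b = 0))}"

text \<open>This is only meant for surfaces: their integral singular homology is zero above degree 2, and for
  compact surfaces it is finitely generated.\<close>

definition euler_characteristic :: "'a topology \<Rightarrow> int" where
  "euler_characteristic X =
     (\<Sum>p\<le>2. (-1) ^ p * int (abelian_rank (homology_group (int p) X)))"


section \<open>Tangent vectors and the projective tangent bundle\<close>

text \<open>A tangent vector at \<open>x\<close> is the family of its coordinate vectors in all charts around \<open>x\<close>,
  extended by zero to all other charts.\<close>

type_synonym 'a tvec = "'a chart \<Rightarrow> real^2"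

definition tangent_space :: "'a surface \<Rightarrow> 'a \<Rightarrow> 'a tvec set" where
  "tangent_space M x =
     {\<xi>. (\<forall>c\<in>surf_atlas M. \<forall>d\<in>surf_atlas M. x \<in> cdom c \<inter> cdom d \<longrightarrow>
            \<xi> d = frechet_derivative (transition c d) (at (cmap c x) within overlap c d) (\<xi> c)) \<and>
         (\<forall>c. \<not> (c \<in> surf_atlas M \<and> x \<in> cdom c) \<longrightarrow> \<xi> c = 0)}"

text \<open>The value of the inner product does not depend on the chosen chart around \<open>x\<close>.\<close>

definition tangent_norm :: "'a surface \<Rightarrow> 'a \<Rightarrow> 'a tvec \<Rightarrow> real" where
  "tangent_norm M x \<xi> =
     (let c = (SOME c. c \<in> surf_atlas M \<and> x \<in> cdom c) in
        sqrt (\<xi> c \<bullet> (surf_metric M c (cmap c x) *v \<xi> c)))"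

definition line_of :: "'a tvec \<Rightarrow> 'a tvec set" where
  "line_of \<xi> = {\<lambda>c. r *\<^sub>R \<xi> c |r. True}"

definition PT :: "'a surface \<Rightarrow> ('a \<times> 'a tvec set) set" where
  "PT M = {(x, line_of \<xi>) |x \<xi>.
     x \<in> topspace (surf_top M) \<and> \<xi> \<in> tangent_space M x \<and> \<xi> \<noteq> (\<lambda>_. 0)}"

definition velocity :: "'a surface \<Rightarrow> (real \<Rightarrow> 'a) \<Rightarrow> real \<Rightarrow> 'a tvec" where
  "velocity M \<gamma> t =
     (\<lambda>c. if c \<in> surf_atlas M \<and> \<gamma> t \<in> cdom c
          then vector_derivative (cmap c \<circ> \<gamma>) (at t) else 0)"

text \<open>Covariant derivative along \<open>\<gamma>\<close> of a vector field \<open>V\<close> along \<open>\<gamma>\<close>.\<close>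

definition cov_deriv ::
    "'a surface \<Rightarrow> (real \<Rightarrow> 'a) \<Rightarrow> (real \<Rightarrow> 'a tvec) \<Rightarrow> real \<Rightarrow> 'a tvec" where
  "cov_deriv M \<gamma> V t =
     (\<lambda>c. if c \<in> surf_atlas M \<and> \<gamma> t \<in> cdom c
          then \<chi> k. vector_derivative (\<lambda>s. V s c) (at t) $ k
                  + (\<Sum>i\<in>UNIV. \<Sum>j\<in>UNIV. christoffel M c k i j (cmap c (\<gamma> t))
                                         * velocity M \<gamma> t c $ i * V t c $ j)
          else 0)"

definition C1_along ::
    "'a surface \<Rightarrow> real set \<Rightarrow> (real \<Rightarrow> 'a) \<Rightarrow> (real \<Rightarrow> 'a tvec) \<Rightarrow> bool" where
  "C1_along M T \<gamma> V \<longleftrightarrow>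
     (\<forall>c\<in>surf_atlas M.
        (cmap c \<circ> \<gamma>) C1_differentiable_on {t\<in>T. \<gamma> t \<in> cdom c} \<and>
        (\<lambda>t. V t c) C1_differentiable_on {t\<in>T. \<gamma> t \<in> cdom c})"

text \<open>A piecewise \<open>C\<^sup>1\<close> path in the projective tangent bundle lifts to the unit tangent bundle,
  which covers it doubly. So such a path \<open>t \<mapsto> (\<gamma> t, l t)\<close> is given by \<open>\<gamma>\<close> and a
  unit vector field \<open>V\<close> along \<open>\<gamma>\<close> that spans \<open>l t\<close>.\<close>

definition PT_path :: "'a surface \<Rightarrow> (real \<Rightarrow> 'a) \<Rightarrow> (real \<Rightarrow> 'a tvec) \<Rightarrow> bool" where
  "PT_path M \<gamma> V \<longleftrightarrow>
     continuous_map (top_of_set {0..1}) (surf_top M) \<gamma> \<and>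
     (\<forall>t\<in>{0..1}. V t \<in> tangent_space M (\<gamma> t) \<and> tangent_norm M (\<gamma> t) (V t) = 1) \<and>
     (\<forall>c\<in>surf_atlas M. continuous_on {t\<in>{0..1}. \<gamma> t \<in> cdom c} (\<lambda>t. V t c)) \<and>
     (\<exists>F. finite F \<and> C1_along M ({0<..<1} - F) \<gamma> V)"

text \<open>Length for the lifted metric: a tangent vector of the projective tangent bundle splits by
  the connection into a horizontal part, measured by the metric of the surface, and a vertical
  part, the rotation speed of the line, which is the norm of \<open>\<nabla>\<^bsub>\<gamma>'\<^esub>V\<close> for a
  unit field \<open>V\<close> spanning the line.\<close>

definition PT_length :: "'a surface \<Rightarrow> (real \<Rightarrow> 'a) \<Rightarrow> (real \<Rightarrow> 'a tvec) \<Rightarrow> ennreal" where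
  "PT_length M \<gamma> V =
     (\<integral>\<^sup>+t\<in>{0..1}. ennreal (sqrt ((tangent_norm M (\<gamma> t) (velocity M \<gamma> t))\<^sup>2
                               + (tangent_norm M (\<gamma> t) (cov_deriv M \<gamma> V t))\<^sup>2)) \<partial>lborel)"

text \<open>Distances are extended reals: connectedness of the surface is not required, and points over
  different components have distance \<open>\<infinity>\<close>. On a connected surface all values are finite.\<close>

definition PT_dist ::
    "'a surface \<Rightarrow> 'a \<times> 'a tvec set \<Rightarrow> 'a \<times> 'a tvec set \<Rightarrow> ennreal" where
  "PT_dist M P Q =
     Inf {PT_length M \<gamma> V |\<gamma> V. PT_path M \<gamma> V \<and>
            P = (\<gamma> 0, line_of (V 0)) \<and> Q = (\<gamma> 1, line_of (V 1))}"

definition PT_nbhd ::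
    "'a surface \<Rightarrow> real \<Rightarrow> ('a \<times> 'a tvec set) set \<Rightarrow> ('a \<times> 'a tvec set) set" where
  "PT_nbhd M \<epsilon> B = {P \<in> PT M. \<exists>Q\<in>B. PT_dist M P Q < ennreal \<epsilon>}"


section \<open>Geodesic laminations\<close>

text \<open>\<open>\<gamma>\<close> is an arc length parametrization, defined on the whole line, of a geodesic.\<close>

definition complete_geodesic :: "'a surface \<Rightarrow> (real \<Rightarrow> 'a) \<Rightarrow> bool" where
  "complete_geodesic M \<gamma> \<longleftrightarrow>
     continuous_map euclideanreal (surf_top M) \<gamma> \<and>
     C1_along M UNIV \<gamma> (velocity M \<gamma>) \<and>
     (\<forall>t. tangent_norm M (\<gamma> t) (velocity M \<gamma> t) = 1) \<and>
     (\<forall>t. cov_deriv M \<gamma> (velocity M \<gamma>) t = (\<lambda>_. 0))"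

text \<open>No transverse self-intersection; closed geodesics are allowed.\<close>

definition simple_complete_geodesic :: "'a surface \<Rightarrow> (real \<Rightarrow> 'a) \<Rightarrow> bool" where
  "simple_complete_geodesic M \<gamma> \<longleftrightarrow>
     complete_geodesic M \<gamma> \<and>
     (\<forall>s t. \<gamma> s = \<gamma> t \<longrightarrow> line_of (velocity M \<gamma> s) = line_of (velocity M \<gamma> t))"

definition leaf_decomposition :: "'a surface \<Rightarrow> 'a set \<Rightarrow> 'a set set \<Rightarrow> bool" where
  "leaf_decomposition M \<Lambda> \<L> \<longleftrightarrow>
     (\<forall>L\<in>\<L>. \<exists>\<gamma>. simple_complete_geodesic M \<gamma> \<and> L = range \<gamma>) \<and> disjoint \<L> \<and> \<Union>\<L> = \<Lambda>"

definition geodesic_lamination :: "'a surface \<Rightarrow> 'a set \<Rightarrow> bool" where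
  "geodesic_lamination M \<Lambda> \<longleftrightarrow>
     \<Lambda> \<noteq> {} \<and> closedin (surf_top M) \<Lambda> \<and> (\<exists>\<L>. leaf_decomposition M \<Lambda> \<L>)"

text \<open>The decomposition of a lamination into leaves is unique, so the choice of
  \<open>\<L>\<close> is immaterial.\<close>

definition lamination_lift :: "'a surface \<Rightarrow> 'a set \<Rightarrow> ('a \<times> 'a tvec set) set" where
  "lamination_lift M \<Lambda> =
     {(\<gamma> t, line_of (velocity M \<gamma> t)) |\<gamma> t.
        simple_complete_geodesic M \<gamma> \<and> (\<exists>\<L>. leaf_decomposition M \<Lambda> \<L> \<and> range \<gamma> \<in> \<L>)}"

definition hausdorff_dist :: "'a surface \<Rightarrow> 'a set \<Rightarrow> 'a set \<Rightarrow> ennreal" where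
  "hausdorff_dist M \<Lambda> \<Lambda>' =
     Inf {ennreal \<epsilon> |\<epsilon>. \<epsilon> > 0 \<and>
       lamination_lift M \<Lambda> \<subseteq> PT_nbhd M \<epsilon> (lamination_lift M \<Lambda>') \<and>
       lamination_lift M \<Lambda>' \<subseteq> PT_nbhd M \<epsilon> (lamination_lift M \<Lambda>)}"

definition lamination_topology :: "'a surface \<Rightarrow> 'a set topology" where
  "lamination_topology M =
     topology (\<lambda>U. U \<subseteq> Collect (geodesic_lamination M) \<and>
       (\<forall>\<Lambda>\<in>U. \<exists>\<epsilon>>0. \<forall>\<Lambda>'. geodesic_lamination M \<Lambda>' \<and> hausdorff_dist M \<Lambda> \<Lambda>' < \<epsilon> \<longrightarrow> \<Lambda>' \<in> U))"

lemma openin_lamination_topology: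
  "openin (lamination_topology M) U \<longleftrightarrow>
     U \<subseteq> Collect (geodesic_lamination M) \<and>
     (\<forall>\<Lambda>\<in>U. \<exists>\<epsilon>>0. \<forall>\<Lambda>'. geodesic_lamination M \<Lambda>' \<and> hausdorff_dist M \<Lambda> \<Lambda>' < \<epsilon> \<longrightarrow> \<Lambda>' \<in> U)"
proof -
  define P where "P U \<longleftrightarrow> U \<subseteq> Collect (geodesic_lamination M) \<and>
     (\<forall>\<Lambda>\<in>U. \<exists>\<epsilon>>0. \<forall>\<Lambda>'. geodesic_lamination M \<Lambda>' \<and> hausdorff_dist M \<Lambda> \<Lambda>' < \<epsilon> \<longrightarrow> \<Lambda>' \<in> U)" for U
  have Int: "P (U \<inter> V)" if "P U" "P V" for U V
    unfolding P_def
  proof (intro conjI ballI)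
    show "U \<inter> V \<subseteq> Collect (geodesic_lamination M)" using that by (auto simp: P_def)
    fix \<Lambda> assume "\<Lambda> \<in> U \<inter> V"
    then have "\<Lambda> \<in> U" "\<Lambda> \<in> V" by auto
    obtain d where d: "d > 0"
        "\<forall>\<Lambda>'. geodesic_lamination M \<Lambda>' \<and> hausdorff_dist M \<Lambda> \<Lambda>' < d \<longrightarrow> \<Lambda>' \<in> U"
      using \<open>P U\<close> \<open>\<Lambda> \<in> U\<close> unfolding P_def by blast
    obtain e where e: "e > 0"
        "\<forall>\<Lambda>'. geodesic_lamination M \<Lambda>' \<and> hausdorff_dist M \<Lambda> \<Lambda>' < e \<longrightarrow> \<Lambda>' \<in> V"
      using \<open>P V\<close> \<open>\<Lambda> \<in> V\<close> unfolding P_def by blast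
    show "\<exists>\<epsilon>>0. \<forall>\<Lambda>'. geodesic_lamination M \<Lambda>' \<and> hausdorff_dist M \<Lambda> \<Lambda>' < \<epsilon> \<longrightarrow> \<Lambda>' \<in> U \<inter> V"
      using d e by (intro exI[of _ "min d e"]) auto
  qed
  have Union: "P (\<Union>\<U>)" if "\<forall>U\<in>\<U>. P U" for \<U>
    using that unfolding P_def by (smt (verit) Union_iff Sup_least)
  have "istopology P"
    unfolding istopology_def using Int Union by blast
  then have "openin (topology P) = P" by (rule topology_inverse')
  moreover have "lamination_topology M = topology P"
    unfolding lamination_topology_def P_def by simp
  ultimately show ?thesis by (simp add: P_def)
qed

lemma topspace_lamination_topology:
  "topspace (lamination_topology M) = Collect (geodesic_lamination M)"
proof -
  have "openin (lamination_topology M) (Collect (geodesic_lamination M))"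
    unfolding openin_lamination_topology by (auto intro: exI[of _ 1])
  then show ?thesis
    by (metis openin_lamination_topology openin_subset openin_topspace subset_antisym)
qed

definition totally_disconnected_space :: "'b topology \<Rightarrow> bool" where
  "totally_disconnected_space X \<longleftrightarrow> (\<forall>C. connectedin X C \<longrightarrow> (\<exists>x. C \<subseteq> {x}))"

end

theory Submission
 imports Defs
begin

text \<open>Let \<open>\<gamma>\<close> be a leaf of one lamination through a point outside another one. In a chart box around
\<open>\<gamma> 0\<close>, the simple geodesics near \<open>\<gamma>\<close>, shifted in time so that their offset from \<open>\<gamma>\<close> is orthogonal
to \<open>\<gamma>\<close>, are described by a set \<open>S\<close> of offsets (position and velocity), which is compact because limits of
simple geodesics are simple. If the component of \<open>0\<close> in \<open>S\<close> is a point, then by the Sura-Bura theorem there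
is an arbitrarily small clopen \<open>W \<subseteq> S\<close> around \<open>0\<close>; having a leaf with offset in \<open>W\<close> is a uniformly
clopen property for the Hausdorff distance and separates the two laminations.

So suppose that \<open>S\<close> contains a continuum with more than one point. Along two nearby geodesics the signed normal
distance \<open>J\<close> satisfies \<open>J'' = - K J\<close> up to terms of second order. Since \<open>K < 0\<close>, the absolute value of \<open>J\<close> grows
forwards or backwards, so geodesics that stay close for all time coincide, and subcontinua spread to a fixed size.
Choose nested subcontinua that reach this size at successive times with bounded gaps. At two of these times, by
pigeonhole, the base points are in almost the same position; as the innermost subcontinuum is still narrow at the earlier time
and wide at the later one, the intermediate value theorem yields a geodesic that meets its own past. It is simple, hence closed, and its
period is bounded. Such closed geodesics are therefore dense in the continuum and accumulate at a closed
geodesic of bounded period, which contradicts expansivity.\<close>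

section \<open>Calculus on the half-plane\<close>

text \<open>Two obstacles shape the development. A geodesic with given initial data may leave the
  surface through the boundary; hence no geodesic is constructed from initial data. Geodesics are
  only compared with each other or arise as limits of given ones, and derivatives are one-sided at
  the edge. Secondly, comparison over unbounded time passes through many charts and lets the clocks
  of two geodesics drift apart. Time is therefore cut into steps \<open>T\<close>, the second
  geodesic is resynchronized after every step, and the Jacobi equation survives as a convexity
  inequality for sequences, \<open>D j + c * m j <= max (D (j + 1)) (D (j - 1))\<close>, between
  normal distance \<open>D\<close> and full offset \<open>m\<close>. It bounds the sum of all
  offsets, and with it the clock drift, for as long as the two geodesics stay close. Simplicity acts
  through self-returns: there the tangent lines agree, and uniqueness makes the geodesic periodic.
  Since the lifted metric sees lines and not directions, the comparison of laminations always ends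
  with a geodesic or its reversal.\<close>

abbreviation relopen :: "(real^2) set => bool" where
 "relopen V \<equiv> openin (top_of_set half_plane) V"

lemma closed_half_plane: "closed half_plane"
 unfolding half_plane_def
 by (intro closed_Collect_le continuous_intros)

lemma convex_half_plane: "convex half_plane"
proof -
 have "half_plane = {p. axis 2 1 \<bullet> p >= 0}" by (simp add: half_plane_def inner_axis')
 thus ?thesis using convex_halfspace_ge[of 0 "axis 2 1 :: real^2"] by simp
qed

lemma relopen_subset: "relopen V ==> V <= half_plane"
 by (rule openin_imp_subset)

lemma relopen_ball:
 assumes "relopen V" "p \<in> V"
 obtains r where "r > 0" "ball p r \<inter> half_plane <= V"
 using assms unfolding openin_contains_ball by blast

lemma linear_vec2:
 fixes f :: "real^2 => 'b::real_vector"
 assumes "linear f" shows "f h = h$1 *\<^sub>R f (axis 1 1) + h$2 *\<^sub>R f (axis 2 1)"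
proof -
 have "h = h$1 *\<^sub>R axis 1 1 + h$2 *\<^sub>R axis 2 1"
  by (simp add: vec_eq_iff forall_2 axis_def)
 hence "f h = f (h$1 *\<^sub>R axis 1 1 + h$2 *\<^sub>R axis 2 1)" by (rule arg_cong)
 also have "... = h$1 *\<^sub>R f (axis 1 1) + h$2 *\<^sub>R f (axis 2 1)"
  using assms by (simp add: linear_add linear_cmul)
 finally show ?thesis .
qed

text \<open>At an edge point only one side is available in the second direction; short positive
  steps along both axes stay in \<open>V\<close> and already determine a derivative.\<close>

lemma frechet_unique_relopen:
 fixes f :: "real^2 => 'b::real_normed_vector"
 assumes V: "relopen V" "p \<in> V"
  and D: "(f has_derivative f') (at p within V)" "(f has_derivative f'') (at p within V)"
 shows "f' = f''"
proof (rule frechet_derivative_unique_within[OF D])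
 fix i :: "real^2" and e :: real
 assume i: "i \<in> Basis" and e: "0 < e"
 obtain r where r: "r > 0" "ball p r \<inter> half_plane <= V" using relopen_ball[OF V] .
 define d where "d = min e r/2"
 have d: "d > 0" "d < e" "d < r" using e r by (auto simp: d_def)
 obtain k where k: "i = axis k 1" using i by (auto simp: Basis_vec_def)
 have "p \<in> half_plane" using V relopen_subset by auto
 hence "p + d *\<^sub>R i \<in> half_plane"
  using d by (auto simp: half_plane_def k axis_def)
 moreover have "p + d *\<^sub>R i \<in> ball p r"
  using d i by (simp add: dist_norm)
 ultimately have "p + d *\<^sub>R i \<in> V" using r by auto
 thus "EX d. 0 < \<bar>d\<bar> & \<bar>d\<bar> < e & p + d *\<^sub>R i \<in> V" using d by (intro exI[of _ d]) auto
qed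

lemma partial_unique:
 assumes "relopen V" "p \<in> V" "(f has_derivative f') (at p within V)"
 shows "partial V i f p = f' (axis i 1)"
proof -
 have "(f has_derivative frechet_derivative f (at p within V)) (at p within V)"
  using assms(3) frechet_derivative_works differentiable_def by blast
 thus ?thesis unfolding partial_def
  using frechet_unique_relopen[OF assms(1,2) _ assms(3)] by metis
qed

lemma has_derivative_partial:
 assumes "f differentiable (at p within V)"
 shows "(f has_derivative (%h. h$1*partial V 1 f p + h$2*partial V 2 f p)) (at p within V)"
proof -
 let ?A = "frechet_derivative f (at p within V)"
 have D: "(f has_derivative ?A) (at p within V)"
  using assms frechet_derivative_works by blast
 hence "linear (?A)" by (rule has_derivative_linear)
 hence "frechet_derivative f (at p within V) h = h$1*partial V 1 f p + h$2*partial V 2 f p" for h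
  unfolding partial_def using linear_vec2[of "?A" h]
  unfolding real_scaleR_def by blast
 hence "?A = (%h. h$1*partial V 1 f p + h$2*partial V 2 f p)"
  by (rule ext)
 with D show ?thesis by metis
qed

lemma partial_cong:
 assumes "!!q. q \<in> V ==> f q = g q" "p \<in> V"
 shows "partial V i f p = partial V i g p"
proof -
 have "(f has_derivative D) (at p within V) \<longleftrightarrow> (g has_derivative D) (at p within V)" for D
  using has_derivative_transform[OF assms(2), of f g D] has_derivative_transform[OF assms(2), of g f D] assms(1) by auto
 thus ?thesis unfolding partial_def frechet_derivative_def by simp
qed

lemma partial_arith:
 assumes V: "relopen V" "p \<in> V"
  and f: "f differentiable (at p within V)" and g: "g differentiable (at p within V)"
 shows "partial V i (%q. f q + g q) p = partial V i f p + partial V i g p"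
  and "partial V i (%q. f q - g q) p = partial V i f p - partial V i g p"
  and "partial V i (%q. f q*g q) p = partial V i f p*g p + f p*partial V i g p"
  and "f p ~= 0 ==> partial V i (%q. inverse (f q)) p = - partial V i f p*(inverse (f p))^2"
proof -
 let ?A = "partial V i f p"
 note Df = has_derivative_partial[OF f] and Dg = has_derivative_partial[OF g]
 have e: "axis i 1 $ 1*a + axis i 1 $ 2*b = (if i = 1 then a else b)" for a b :: real
  using exhaust_2[of i] by (auto simp: axis_def)
 have e': "(if i = 1 then partial V 1 h p else partial V 2 h p) = partial V i h p" for h
  using exhaust_2[of i] by auto
 show "partial V i (%q. f q + g q) p = ?A + partial V i g p"
  using partial_unique[OF V has_derivative_add[OF Df Dg], of i] by (simp only: e e')
 show "partial V i (%q. f q - g q) p = ?A - partial V i g p"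
  using partial_unique[OF V has_derivative_diff[OF Df Dg], of i] by (simp only: e e')
 show "partial V i (%q. f q*g q) p = ?A*g p + f p*partial V i g p"
  using partial_unique[OF V has_derivative_mult[OF Df Dg], of i] by (simp only: e e' add.commute)
 show "partial V i (%q. inverse (f q)) p = - ?A*(inverse (f p))^2" if "f p ~= 0"
  using partial_unique[OF V Deriv.has_derivative_inverse[OF that Df], of i]
  by (simp only: e e') (simp add: power2_eq_square)
qed

lemma partial_const: "relopen V ==> p \<in> V ==> partial V i (%q. c) p = 0"
 using partial_unique[OF _ _ has_derivative_const] by simp

definition C1_on :: "(real^2) set => (real^2 => real) => bool" where
 "C1_on V f \<longleftrightarrow> f differentiable_on V & (ALL i. continuous_on V (partial V i f))"

lemma smooth_onD:
 assumes "smooth_on V f"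
 shows "C1_on V f" "C1_on V (partial V i f)" "C1_on V (partial V j (partial V i f))"
 using assms[unfolded smooth_on_def, rule_format, of "Suc 0"]
  assms[unfolded smooth_on_def, rule_format, of "Suc (Suc 0)"]
  assms[unfolded smooth_on_def, rule_format, of "Suc (Suc (Suc 0))"]
 by (simp_all add: C1_on_def)

lemma C1_onD:
 assumes "C1_on V f"
 shows "p \<in> V ==> f differentiable (at p within V)" "continuous_on V f" "continuous_on V (partial V i f)"
 using assms differentiable_imp_continuous_on by (auto simp: C1_on_def differentiable_on_def)

lemma C1_on_const: "relopen V ==> C1_on V (%_. c)"
 unfolding C1_on_def by (auto simp: partial_const cong: continuous_on_cong)

lemma C1_onI:
 assumes "!!p. p \<in> V ==> f differentiable (at p within V)"
  and "!!i. continuous_on V (F i)" and "!!i p. p \<in> V ==> partial V i f p = F i p"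
 shows "C1_on V f"
 unfolding C1_on_def differentiable_on_def
 using assms by (metis (no_types, lifting) continuous_on_cong)

lemma C1_on_arith:
 assumes V: "relopen V" and f: "C1_on V f" and g: "C1_on V g"
 shows "C1_on V (%q. f q + g q)" "C1_on V (%q. f q - g q)" "C1_on V (%q. f q*g q)"
  "(!!p. p \<in> V ==> f p ~= 0) ==> C1_on V (%q. inverse (f q))"
proof -
 note F = C1_onD[OF f] and G = C1_onD[OF g]
 show "C1_on V (%q. f q + g q)"
  by (rule C1_onI[OF _ _ partial_arith(1)[OF V]]) (use F G in \<open>auto intro!: continuous_intros differentiable_add\<close>)
 show "C1_on V (%q. f q - g q)"
  by (rule C1_onI[OF _ _ partial_arith(2)[OF V]]) (use F G in \<open>auto intro!: continuous_intros differentiable_diff\<close>)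
 show "C1_on V (%q. f q*g q)"
  by (rule C1_onI[OF _ _ partial_arith(3)[OF V]]) (use F G in \<open>auto intro!: continuous_intros differentiable_mult\<close>)
 show "C1_on V (%q. inverse (f q))" if "!!p. p \<in> V ==> f p ~= 0"
  by (rule C1_onI[OF _ _ partial_arith(4)[OF V]]) (use F that in \<open>auto intro!: continuous_intros differentiable_inverse\<close>)
qed

lemma C1_on_sum:
 assumes "relopen V" "finite I" "!!i. i \<in> I ==> C1_on V (f i)"
 shows "C1_on V (%q. \<Sum>i\<in>I. f i q)"
 using assms(2,3) by (induction I rule: finite_induct) (auto intro: C1_on_const C1_on_arith assms(1))

lemma C1_on_cong:
 assumes "!!q. q \<in> V ==> f q = g q" shows "C1_on V f \<longleftrightarrow> C1_on V g"
proof -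
 have "f differentiable_on V \<longleftrightarrow> g differentiable_on V"
  unfolding differentiable_on_def differentiable_def
  using has_derivative_transform[of _ V f g] has_derivative_transform[of _ V g f] assms
  by (metis (no_types, lifting))
 moreover have "continuous_on V (partial V i f) \<longleftrightarrow> continuous_on V (partial V i g)" for i
  using partial_cong[of V f g, OF assms] by (intro continuous_on_cong) auto
 ultimately show ?thesis unfolding C1_on_def by auto
qed

lemma has_vector_derivative_chain_within:
 fixes x :: "real => real^2" and f :: "real^2 => 'b::real_normed_vector"
 assumes x: "(x has_vector_derivative v) (at t)"
  and f: "(f has_derivative D) (at (x t) within V)"
  and ev: "eventually (%s. x s \<in> V) (at t)" and xt: "x t \<in> V"
 shows "((%s. f (x s)) has_vector_derivative D v) (at t)"
proof -
 obtain d where d0: "d > 0" "!!s. s ~= t ==> dist s t < d ==> x s \<in> V"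
  using ev unfolding eventually_at by auto
 hence d: "d > 0" "!!s. s \<in> ball t d ==> x s \<in> V"
  using xt by (simp, metis dist_commute mem_ball)
 have "(x has_vector_derivative v) (at t within ball t d)"
  using x has_vector_derivative_at_within by blast
 moreover have "(f has_derivative D) (at (x t) within x ` ball t d)"
  using d(2) by (intro has_derivative_subset[OF f]) auto
 ultimately have "((f \<circ> x) has_derivative (D \<circ> (%h. h *\<^sub>R v))) (at t within ball t d)"
  unfolding has_vector_derivative_def by (rule diff_chain_within)
 moreover have "D \<circ> (%h. h *\<^sub>R v) = (%h. h *\<^sub>R D v)"
  using has_derivative_linear[OF f] by (simp add: linear_cmul fun_eq_iff)
 moreover have "at t within ball t d = at t"
  using d(1) by (intro at_within_open) auto
 ultimately have "((f \<circ> x) has_derivative (%h. h *\<^sub>R D v)) (at t)" by simp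
 thus ?thesis unfolding has_vector_derivative_def comp_def .
qed

lemma axis_in_half_plane:
 assumes "p \<in> half_plane" "0 <= b" shows "p + axis 1 a + axis 2 b \<in> half_plane"
 using assms by (auto simp: half_plane_def axis_def)

lemma mvt_partial:
 assumes V: "!!s. 0 <= s ==> s <= h ==> q + axis i s \<in> V"
  and f: "!!p. p \<in> V ==> f differentiable (at p within V)" and h: "0 < h"
 obtains s where "0 < s" "s < h" "f (q + axis i h) - f q = h*partial V i f (q + axis i s)"
proof -
 have D: "((%s. f (q + axis i s)) has_derivative (%x. x*partial V i f (q + axis i s))) (at s within {0..h})"
  if "0 <= s" "s <= h" for s
 proof -
  have "linear (%s::real. axis i s)"
   by (rule linearI) (auto simp: axis_def vec_eq_iff)
  hence "bounded_linear (%s::real. axis i s)" by (simp add: linear_conv_bounded_linear)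
  hence 1: "((%s. q + axis i s) has_derivative (%x. axis i x)) (at s within {0..h})"
   by (auto intro!: derivative_eq_intros bounded_linear_imp_has_derivative)
  have "(%s. q + axis i s) ` {0..h} <= V" using V by auto
  hence 2: "(f has_derivative (%h. h$1*partial V 1 f (q + axis i s) + h$2*partial V 2 f (q + axis i s)))
   (at (q + axis i s) within (%s. q + axis i s) ` {0..h})"
   using has_derivative_subset[OF has_derivative_partial[OF f[OF V[OF that]]]] by blast
  have e: "(%h. h$1*partial V 1 f (q + axis i s) + h$2*partial V 2 f (q + axis i s)) \<circ> axis i
   = (%x. x*partial V i f (q + axis i s))"
   using exhaust_2[of i] by (auto simp: axis_def fun_eq_iff)
  show ?thesis using diff_chain_within[OF 1 2] unfolding e by (simp add: o_def)
 qed
 have "EX s:{0<..<h}. f (q + axis i h) - f (q + axis i 0) = (h - 0)*partial V i f (q + axis i s)"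
  using mvt_simple[OF h, of "%s. f (q + axis i s)" "%s x. x*partial V i f (q + axis i s)"] D by simp
 moreover have "axis i 0 = (0::real^2)" by (simp add: axis_def vec_eq_iff)
 ultimately show ?thesis using that by auto
qed

text \<open>Schwarz's theorem up to the edge: the second difference is taken over a square with
  lower left corner \<open>p\<close>, which stays in the half-plane.\<close>

lemma mixed_partials_commute:
 assumes V: "relopen V" "p \<in> V" and f: "C1_on V f" and f2: "!!i. C1_on V (partial V i f)"
 shows "partial V 1 (partial V 2 f) p = partial V 2 (partial V 1 f) p"
proof (rule ccontr)
 let ?A = "partial V 2 f" and ?B = "partial V 1 f"
 define a where "a = partial V 1 ?A p"
 define b where "b = partial V 2 ?B p"
 assume "\<not> ?thesis"
 hence e: "\<bar>a - b\<bar> / 2 > 0" by (simp add: a_def b_def)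
 obtain r where r: "r > 0" "ball p r \<inter> half_plane <= V" using relopen_ball[OF V] .
 have cont: "EX d>0. ALL q:V. dist q p < d --> \<bar>partial V i (partial V j f) q - partial V i (partial V j f) p\<bar> < \<bar>a - b\<bar> / 2" for i j
  using C1_onD(3)[OF f2, of i j] V(2) e unfolding continuous_on_iff dist_real_def by blast
 obtain d1 where d1: "d1 > 0" "!!q. q \<in> V ==> dist q p < d1 ==> \<bar>partial V 1 ?A q - a\<bar> < \<bar>a - b\<bar> / 2"
  using cont[of 1 2] unfolding a_def by blast
 obtain d2 where d2: "d2 > 0" "!!q. q \<in> V ==> dist q p < d2 ==> \<bar>partial V 2 ?B q - b\<bar> < \<bar>a - b\<bar> / 2"
  using cont[of 2 1] unfolding b_def by blast
 define h where "h = min r (min d1 d2)/3"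
 have h: "h > 0" "2*h < r" "2*h < d1" "2*h < d2" using r d1 d2 by (auto simp: h_def)
 have near: "dist (p + axis 1 s + axis 2 t) p <= 2*h" if "0 <= s" "s <= h" "0 <= t" "t <= h" for s t
 proof -
  have "dist (p + axis 1 s + axis 2 t) p = norm (axis 1 s + axis 2 t :: real^2)" by (simp add: dist_norm algebra_simps)
  also have "... <= norm (axis 1 s :: real^2) + norm (axis 2 t :: real^2)" by (rule norm_triangle_ineq)
  also have "... = s + t" using that by (simp add: axis_def norm_vec_def L2_set_def sum_2)
  finally show ?thesis using that by simp
 qed
 have inV: "p + axis 1 s + axis 2 t \<in> V" if "0 <= s" "s <= h" "0 <= t" "t <= h" for s t
 proof -
  have "p \<in> half_plane" using V relopen_subset by auto
  hence "p + axis 1 s + axis 2 t \<in> half_plane" using axis_in_half_plane that by auto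
  moreover have "p + axis 1 s + axis 2 t \<in> ball p r" using near[OF that] h by (simp add: dist_commute)
  ultimately show ?thesis using r by auto
 qed
 have z: "axis i 0 = (0::real^2)" for i by (simp add: axis_def vec_eq_iff)
 have c: "p + axis 1 s + axis 2 t = p + axis 2 t + axis 1 s" for s t by (simp add: algebra_simps)
 \<comment> \<open>\<open>D\<close> is the second difference of \<open>f\<close> over the square
   with side \<open>h\<close>. The mean value theorem, applied in either order of the variables,
   evaluates it as \<open>h^2\<close> times each of the two mixed partials at nearby points.\<close>
 define D where "D = f (p + axis 1 h + axis 2 h) - f (p + axis 1 h) - (f (p + axis 2 h) - f p)"
 note df = C1_onD(1)[OF f] and df2 = C1_onD(1)[OF f2]
 have lin: "bounded_linear (%s::real. axis i s :: real^2)" for i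
  unfolding linear_conv_bounded_linear[symmetric] by (rule linearI) (auto simp: axis_def vec_eq_iff)
 have line: "((%s. f (p + axis i s + axis j t)) has_real_derivative partial V i f (p + axis i s + axis j t)) (at s within {0..h})"
  if ij: "i = 1 & j = 2 \<or> i = 2 & j = 1" and s: "0 <= s" "s <= h" "0 <= t" "t <= h" for i j s t
 proof -
  have sub: "p + axis i u + axis j t \<in> V" if "0 <= u" "u <= h" for u
   using ij inV[OF that s(3,4)] inV[OF s(3,4) that] by (auto simp: algebra_simps)
  have 1: "((%s. p + axis i s + axis j t) has_derivative (%x. axis i x)) (at s within {0..h})"
   using bounded_linear_imp_has_derivative[OF lin] by (auto intro!: derivative_eq_intros)
  have "(%s. p + axis i s + axis j t) ` {0..h} <= V" using sub by auto
  hence 2: "(f has_derivative (%h. h$1*partial V 1 f (p + axis i s + axis j t) + h$2*partial V 2 f (p + axis i s + axis j t)))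
   (at (p + axis i s + axis j t) within (%s. p + axis i s + axis j t) ` {0..h})"
   using has_derivative_subset[OF has_derivative_partial[OF df[OF sub[OF s(1,2)]]]] by blast
  have e: "(%h. h$1*partial V 1 f (p + axis i s + axis j t) + h$2*partial V 2 f (p + axis i s + axis j t)) \<circ> axis i
   = (%x. partial V i f (p + axis i s + axis j t)*x)"
   using exhaust_2[of i] by (auto simp: axis_def fun_eq_iff)
  show ?thesis using diff_chain_within[OF 1 2] unfolding e has_field_derivative_def by (simp add: o_def)
 qed
 have mixed: "EX s t. 0 <= s & s <= h & 0 <= t & t <= h & D = h*(h*partial V j (partial V i f) (p + axis i s + axis j t))"
  if ij: "i = 1 & j = 2 \<or> i = 2 & j = 1" for i j
 proof -
  have "((%s. f (p + axis i s + axis j h) - f (p + axis i s)) has_real_derivative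
    (partial V i f (p + axis i s + axis j h) - partial V i f (p + axis i s))) (at s within {0..h})"
   if "0 <= s" "s <= h" for s
   using DERIV_diff[OF line[OF ij that, of h] line[OF ij that, of 0]] h by (simp add: z)
  hence "EX s:{0<..<h}. (f (p + axis i h + axis j h) - f (p + axis i h)) - (f (p + axis i 0 + axis j h) - f (p + axis i 0))
    = (h - 0)*(partial V i f (p + axis i s + axis j h) - partial V i f (p + axis i s))"
   using mvt_simple[OF h(1), of "%s. f (p + axis i s + axis j h) - f (p + axis i s)"
    "%s. (*) (partial V i f (p + axis i s + axis j h) - partial V i f (p + axis i s))"]
   by (simp add: has_field_derivative_def mult.commute[of h])
  moreover have "(f (p + axis i h + axis j h) - f (p + axis i h)) - (f (p + axis i 0 + axis j h) - f (p + axis i 0)) = D"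
   using ij by (auto simp: D_def z algebra_simps)
  ultimately obtain s where s: "0 < s" "s < h" "D = h*(partial V i f (p + axis i s + axis j h) - partial V i f (p + axis i s))" by auto
  obtain t where t: "0 < t" "t < h" "partial V i f (p + axis i s + axis j h) - partial V i f (p + axis i s)
    = h*partial V j (partial V i f) (p + axis i s + axis j t)"
  proof (rule mvt_partial[of h "p + axis i s" j V "partial V i f"])
   show "p + axis i s + axis j u \<in> V" if "0 <= u" "u <= h" for u
    using ij inV[of s u] inV[of u s] that s by (auto simp: algebra_simps)
  qed (use df2 h in auto)
  show ?thesis using s t by (intro exI[of _ s] exI[of _ t]) auto
 qed
 obtain s t where st: "0 <= s" "s <= h" "0 <= t" "t <= h" "D = h*(h*partial V 2 ?B (p + axis 1 s + axis 2 t))"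
  using mixed[of 1 2] by auto
 obtain s' t' where st': "0 <= s'" "s' <= h" "0 <= t'" "t' <= h" "D = h*(h*partial V 1 ?A (p + axis 1 s' + axis 2 t'))"
  using mixed[of 2 1] c by metis
 have "partial V 2 ?B (p + axis 1 s + axis 2 t) = partial V 1 ?A (p + axis 1 s' + axis 2 t')"
  using st(5) st'(5) h(1) by simp
 moreover have "\<bar>partial V 1 ?A (p + axis 1 s' + axis 2 t') - a\<bar> < \<bar>a - b\<bar> / 2"
  using d1(2)[OF inV[OF st'(1-4)]] near[OF st'(1-4)] h by linarith
 moreover have "\<bar>partial V 2 ?B (p + axis 1 s + axis 2 t) - b\<bar> < \<bar>a - b\<bar> / 2"
  using d2(2)[OF inV[OF st(1-4)]] near[OF st(1-4)] h by linarith
 ultimately show False by (smt (verit) field_sum_of_halves)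
qed

lemma partial_bound:
 assumes "\<bar>a\<bar> <= B" "\<bar>b\<bar> <= (B::real)" shows "\<bar>h$1*a + h$2*b\<bar> <= 2*B*norm (h::real^2)"
proof -
 have "\<bar>h$1*a + h$2*b\<bar> <= \<bar>h$1\<bar> * \<bar>a\<bar> + \<bar>h$2\<bar> * \<bar>b\<bar>"
  by (metis abs_mult abs_triangle_ineq)
 also have "... <= norm h*B + norm h*B"
  using component_le_norm_cart[of h] assms by (intro add_mono mult_mono) auto
 finally show ?thesis by (simp add: algebra_simps)
qed

lemma compact_thicken:
 assumes V: "relopen V" and P: "compact P" "P <= V"
 obtains r N where "r > 0" "compact N" "N <= V" "!!p. p \<in> P ==> cball p r \<inter> half_plane <= N"
proof -
 obtain T where T: "open T" "V = half_plane \<inter> T" using V by (auto simp: openin_open)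
 obtain r where r: "r > 0" "(\<Union>x\<in>P. cball x r) <= T"
  using compact_subset_open_imp_cball_epsilon_subset[OF P(1) T(1)] P T by auto
 define N where "N = {x + y |x y. x \<in> P & y \<in> cball 0 r} \<inter> half_plane"
 have e: "{x + y |x y. x \<in> P & y \<in> cball 0 r} = (\<Union>x\<in>P. cball x r)"
 proof -
  have "z \<in> cball x r \<longleftrightarrow> (EX y. z = x + y & y \<in> cball 0 r)" for x z :: "real^2"
   by (auto simp: dist_norm norm_minus_commute intro!: exI[of _ "z - x"])
  thus ?thesis by blast
 qed
 have "compact N" unfolding N_def
  by (intro compact_Int_closed compact_sums P closed_half_plane) auto
 moreover have "N <= V" using r(2) unfolding N_def e T(2) by auto
 moreover have "cball p r \<inter> half_plane <= N" if "p \<in> P" for p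
  using that unfolding N_def e by auto
 ultimately show ?thesis using that r(1) by blast
qed

text \<open>Uniformity in \<open>p\<close> comes from uniform continuity of the partials on a
  compact thickening of \<open>P\<close>; a ball cut by the half-plane is convex, so the segment
  from \<open>p\<close> to \<open>q\<close> stays where the estimate holds.\<close>

lemma C1_uniform_linearization:
 assumes V: "relopen V" and f: "C1_on V f" and P: "compact P" "P <= V" and e: "e > 0"
 shows "EX d>0. ALL p:P. ALL q:half_plane. dist q p <= d --> q \<in> V &
  \<bar>f q - f p - ((q - p)$1*partial V 1 f p + (q - p)$2*partial V 2 f p)\<bar> <= e*dist q p"
proof -
 obtain r N where r: "r > 0" "compact N" "N <= V" "!!p. p \<in> P ==> cball p r \<inter> half_plane <= N"
  by (rule compact_thicken[OF V P]) blast
 have uc: "EX d>0. ALL p:N. ALL q:N. dist q p < d --> \<bar>partial V i f q - partial V i f p\<bar> < e/2" for i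
  using compact_uniformly_continuous[OF continuous_on_subset[OF C1_onD(3)[OF f] r(3)] r(2), of i] e
  unfolding uniformly_continuous_on_def dist_real_def by (meson half_gt_zero)
 obtain d1 where d1: "d1 > 0" "!!p q. p \<in> N ==> q \<in> N ==> dist q p < d1 ==> \<bar>partial V 1 f q - partial V 1 f p\<bar> < e/2"
  using uc[of 1] by blast
 obtain d2 where d2: "d2 > 0" "!!p q. p \<in> N ==> q \<in> N ==> dist q p < d2 ==> \<bar>partial V 2 f q - partial V 2 f p\<bar> < e/2"
  using uc[of 2] by blast
 define d where "d = min r (min d1 d2)/2"
 have d: "d > 0" "d < r" "d < d1" "d < d2" using r d1 d2 by (auto simp: d_def)
 show ?thesis
 proof (intro exI[of _ d] conjI ballI impI)
  fix p q assume p: "p \<in> P" and q: "q \<in> half_plane" "dist q p <= d"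
  define S where "S = cball p d \<inter> half_plane"
  have S: "S <= N" using r(4)[OF p] d by (auto simp: S_def)
  have pS: "p \<in> S" "q \<in> S" using p P(2) relopen_subset[OF V] q d by (auto simp: S_def dist_commute)
  have "convex S" unfolding S_def by (intro convex_Int convex_half_plane) auto
  hence seg: "p + t *\<^sub>R (q - p) \<in> S" if "t \<in> {0..1}" for t
   using that pS convexD_alt[of S p q t] by (simp add: algebra_simps)
  show "q \<in> V" using pS S r by auto
  let ?D = "%x (h::real^2). h$1*partial V 1 f x + h$2*partial V 2 f x"
  have der: "(f has_derivative ?D x) (at x within S)" if "x \<in> S" for x
   using has_derivative_subset[OF has_derivative_partial[OF C1_onD(1)[OF f]]] that S r(3) by blast
  have bd: "onorm (?D x - ?D p) <= e" if "x \<in> S" for x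
  proof (rule onorm_bound)
   fix h :: "real^2"
   have "dist x p < d1" "dist x p < d2" using that d by (auto simp: S_def dist_commute)
   hence "\<bar>h$1*(partial V 1 f x - partial V 1 f p) + h$2*(partial V 2 f x - partial V 2 f p)\<bar> <= 2*(e/2)*norm h"
    using d1(2)[of p x] d2(2)[of p x] that S pS by (intro partial_bound less_imp_le) auto
   thus "norm ((?D x - ?D p) h) <= e*norm h" by (simp add: algebra_simps)
  qed (use e in auto)
  have "norm (f q - f p - ?D p (q - p)) <= norm (q - p)*e"
   by (rule differentiable_bound_linearization[OF seg der bd pS(1)])
  thus "\<bar>f q - f p - ?D p (q - p)\<bar> <= e*dist q p" by (simp add: dist_norm mult.commute)
 qed (rule d)
qed

lemma C1_lipschitz_convex:
 assumes f: "C1_on V f" and C: "compact C" "convex C" "C <= V"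
 shows "EX L>=0. ALL p:C. ALL q:C. \<bar>f q - f p\<bar> <= L*dist q p"
proof -
 have "EX B. ALL p:C. \<bar>partial V i f p\<bar> <= B" for i
 proof -
  have "bounded (partial V i f ` C)"
   using compact_continuous_image[OF continuous_on_subset[OF C1_onD(3)[OF f] C(3)] C(1)] by (rule compact_imp_bounded)
  thus ?thesis by (auto simp: bounded_iff)
 qed
 then obtain B1 B2 where B: "!!p. p \<in> C ==> \<bar>partial V 1 f p\<bar> <= B1" "!!p. p \<in> C ==> \<bar>partial V 2 f p\<bar> <= B2"
  by metis
 define B where "B = max 0 (max B1 B2)"
 let ?D = "%x (h::real^2). h$1*partial V 1 f x + h$2*partial V 2 f x"
 have "norm (f q - f p) <= 2*B*norm (q - p)" if "p \<in> C" "q \<in> C" for p q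
 proof (rule differentiable_bound[OF C(2) _ _ that(2,1), of f ?D])
  show "(f has_derivative ?D x) (at x within C)" if "x \<in> C" for x
   using has_derivative_subset[OF has_derivative_partial[OF C1_onD(1)[OF f]]] that C by blast
  show "onorm (?D x) <= 2*B" if "x \<in> C" for x
   using partial_bound[of "partial V 1 f x" B "partial V 2 f x"] B(1)[OF that] B(2)[OF that]
   by (intro onorm_bound) (auto simp: B_def)
 qed
 thus ?thesis by (intro exI[of _ "2*B"]) (auto simp: dist_norm B_def)
qed

lemma C1_lipschitz_near:
 assumes V: "relopen V" and f: "C1_on V f" and P: "compact P" "P <= V"
 shows "EX L>=0. EX d>0. ALL p:P. ALL q:half_plane. dist q p <= d --> q \<in> V & \<bar>f q - f p\<bar> <= L*dist q p"
proof -
 obtain d where d: "d > 0" "!!p q. p \<in> P ==> q \<in> half_plane ==> dist q p <= d ==> q \<in> V &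
  \<bar>f q - f p - ((q - p)$1*partial V 1 f p + (q - p)$2*partial V 2 f p)\<bar> <= 1*dist q p"
  using C1_uniform_linearization[OF V f P zero_less_one] by blast
 have "EX B. ALL p:P. \<bar>partial V i f p\<bar> <= B" for i
 proof -
  have "bounded (partial V i f ` P)"
   using compact_continuous_image[OF continuous_on_subset[OF C1_onD(3)[OF f] P(2)] P(1)] by (rule compact_imp_bounded)
  thus ?thesis by (auto simp: bounded_iff)
 qed
 then obtain B1 B2 where B: "!!p. p \<in> P ==> \<bar>partial V 1 f p\<bar> <= B1" "!!p. p \<in> P ==> \<bar>partial V 2 f p\<bar> <= B2"
  by metis
 define B where "B = max 0 (max B1 B2)"
 have "\<bar>f q - f p\<bar> <= (2*B + 1)*dist q p" if "p \<in> P" "q \<in> half_plane" "dist q p <= d" for p q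
 proof -
  have "\<bar>(q - p)$1*partial V 1 f p + (q - p)$2*partial V 2 f p\<bar> <= 2*B*norm (q - p)"
   using B(1)[OF that(1)] B(2)[OF that(1)] by (intro partial_bound) (auto simp: B_def)
  moreover have "\<bar>f q - f p - ((q - p)$1*partial V 1 f p + (q - p)$2*partial V 2 f p)\<bar> <= norm (q - p)"
   using d(2)[OF that] by (simp add: dist_norm)
  ultimately have "\<bar>f q - f p\<bar> <= 2*B*norm (q - p) + norm (q - p)" by linarith
  thus ?thesis by (simp add: dist_norm algebra_simps)
 qed
 thus ?thesis using d by (intro exI[of _ "2*B + 1"] conjI exI[of _ d]) (auto simp: B_def)
qed

lemma matrix_inv_unique:
 fixes A :: "real^'n^'n"
 assumes "A ** B = mat 1" "B ** A = mat 1"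
 shows "matrix_inv A = B"
proof -
 have "A ** matrix_inv A = mat 1 & matrix_inv A ** A = mat 1"
  unfolding matrix_inv_def by (rule someI[of _ B]) (use assms in auto)
 hence "B ** (A ** matrix_inv A) = B" by simp
 thus ?thesis by (simp add: matrix_mul_assoc assms)
qed

section \<open>Metric, connection and curvature\<close>

locale riem =
 fixes M :: "'a surface"
 assumes riemannian: "riemannian_surface M"
begin

abbreviation "X \<equiv> surf_top M"
abbreviation "\<A> \<equiv> surf_atlas M"
abbreviation "vel \<equiv> velocity M"
abbreviation "chr \<equiv> christoffel M"
abbreviation "gm \<equiv> surf_metric M"
abbreviation "tnm \<equiv> tangent_norm M"
abbreviation "cvd \<equiv> cov_deriv M"
abbreviation "gK \<equiv> gauss_curvature M"

definition ip :: "'a chart => real^2 => real^2 => real^2 => real" where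
 "ip c p u w = u \<bullet> (gm c p *v w)"

text \<open>The Christoffel symbols as a bilinear map of coordinate vectors: the geodesic equation
  reads \<open>v' = - Gam v v\<close>, and the covariant derivative along a curve is
  \<open>d' + Gam v d\<close>.\<close>

definition Gam :: "'a chart => real^2 => real^2 => real^2 => real^2" where
 "Gam c p u w = (\<chi> k. \<Sum>i\<in>UNIV. \<Sum>j\<in>UNIV. chr c k i j p*u$i*w$j)"

text \<open>Derivative of the metric in direction \<open>h\<close>, with the coordinates of
  \<open>u\<close> and \<open>w\<close> held constant; \<open>dGam\<close> is the same for the
  connection.\<close>

definition dip :: "'a chart => real^2 => real^2 => real^2 => real^2 => real" where
 "dip c p h u w = (\<Sum>i\<in>UNIV. \<Sum>j\<in>UNIV.
  (\<Sum>l\<in>UNIV. h$l*partial (cimg c) l (%q. gm c q $ i $ j) p)*u$i*w$j)"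

definition dGam :: "'a chart => real^2 => real^2 => real^2 => real^2 => real^2" where
 "dGam c p h u w = (\<chi> k. \<Sum>i\<in>UNIV. \<Sum>j\<in>UNIV.
  (\<Sum>l\<in>UNIV. h$l*partial (cimg c) l (chr c k i j) p)*u$i*w$j)"

text \<open>R(u, w)z for vector fields with constant coordinates, so that no bracket term
  appears.\<close>

definition Rm :: "'a chart => real^2 => real^2 => real^2 => real^2 => real^2" where
 "Rm c p u w z = dGam c p u w z - dGam c p w u z + Gam c p u (Gam c p w z) - Gam c p w (Gam c p u z)"

lemma Hausdorff: "Hausdorff_space X"
 and charts: "c \<in> \<A> ==> is_chart X c"
 and charts_cover: "(\<Union>c\<in>\<A>. cdom c) = topspace X"
 and transition_smooth: "c \<in> \<A> ==> d \<in> \<A> ==> smooth_on (overlap c d) (%p. transition c d p $ i)"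
 and metric_smooth: "c \<in> \<A> ==> smooth_on (cimg c) (%p. gm c p $ i $ j)"
 and metric_sym: "c \<in> \<A> ==> p \<in> cimg c ==> transpose (gm c p) = gm c p"
 and metric_pos: "c \<in> \<A> ==> p \<in> cimg c ==> v ~= 0 ==> ip c p v v > 0"
 and metric_transition: "c \<in> \<A> ==> d \<in> \<A> ==> p \<in> overlap c d ==>
  ip c p v w = ip d (transition c d p) (frechet_derivative (transition c d) (at p within overlap c d) v)
    (frechet_derivative (transition c d) (at p within overlap c d) w)"
 using riemannian unfolding riemannian_surface_def smooth_atlas_def ip_def Let_def by auto

lemma relopen_cimg: "c \<in> \<A> ==> relopen (cimg c)"
 using charts unfolding is_chart_def by auto

lemma metric_sym': "c \<in> \<A> ==> p \<in> cimg c ==> gm c p $ i $ j = gm c p $ j $ i"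
 using arg_cong[OF metric_sym[of c p], of "%A. A $ j $ i"] by (simp add: transpose_def)

lemma metric_sym_partial: "c \<in> \<A> ==> p \<in> cimg c ==>
 partial (cimg c) l (%q. gm c q $ i $ j) p = partial (cimg c) l (%q. gm c q $ j $ i) p"
 by (rule partial_cong) (auto intro: metric_sym')

lemma ip_expand: "ip c p u w = (\<Sum>i\<in>UNIV. \<Sum>j\<in>UNIV. gm c p $ i $ j*u$i*w$j)"
 by (simp add: ip_def inner_vec_def matrix_vector_mult_def sum_2 algebra_simps)

lemma ip_lin [simp]:
 "ip c p (u + v) w = ip c p u w + ip c p v w" "ip c p w (u + v) = ip c p w u + ip c p w v"
 "ip c p (u - v) w = ip c p u w - ip c p v w" "ip c p w (u - v) = ip c p w u - ip c p w v"
 "ip c p (a *\<^sub>R u) w = a*ip c p u w" "ip c p w (a *\<^sub>R u) = a*ip c p w u"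
 "ip c p (- u) w = - ip c p u w" "ip c p w (- u) = - ip c p w u"
 "ip c p 0 w = 0" "ip c p w 0 = 0"
 by (simp_all add: ip_expand sum_2 algebra_simps)

lemma Gam_lin [simp]:
 "Gam c p (u + v) w = Gam c p u w + Gam c p v w" "Gam c p w (u + v) = Gam c p w u + Gam c p w v"
 "Gam c p (u - v) w = Gam c p u w - Gam c p v w" "Gam c p w (u - v) = Gam c p w u - Gam c p w v"
 "Gam c p (a *\<^sub>R u) w = a *\<^sub>R Gam c p u w" "Gam c p w (a *\<^sub>R u) = a *\<^sub>R Gam c p w u"
 "Gam c p (- u) w = - Gam c p u w" "Gam c p w (- u) = - Gam c p w u"
 "Gam c p 0 w = 0" "Gam c p w 0 = 0"
 by (simp_all add: Gam_def sum_2 vec_eq_iff algebra_simps)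

lemma ip_sym: "c \<in> \<A> ==> p \<in> cimg c ==> ip c p u w = ip c p w u"
 using metric_sym'[of c p 1 2] by (simp add: ip_expand sum_2)

lemma dip_sym: "c \<in> \<A> ==> p \<in> cimg c ==> dip c p h u w = dip c p h w u"
 using metric_sym_partial[of c p _ 1 2] by (simp add: dip_def sum_2 algebra_simps)

lemma christoffel_sym:
 assumes "c \<in> \<A>" "p \<in> cimg c" shows "chr c k i j p = chr c k j i p"
 unfolding christoffel_def metric_sym_partial[OF assms, of _ i j] by (simp add: add.commute)

lemma Gam_sym: "c \<in> \<A> ==> p \<in> cimg c ==> Gam c p u w = Gam c p w u"
 using christoffel_sym[of c p _ 1 2] by (simp add: Gam_def sum_2 vec_eq_iff algebra_simps)

definition gdet :: "'a chart => real^2 => real" where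
 "gdet c p = gm c p $ 1 $ 1 * gm c p $ 2 $ 2 - gm c p $ 1 $ 2 * gm c p $ 2 $ 1"

lemma gdet_pos:
 assumes "c \<in> \<A>" "p \<in> cimg c" shows "gdet c p > 0"
proof -
 let ?g = "%i j. gm c p $ i $ j"
 have "ip c p (axis 1 1) (axis 1 1) > 0" by (rule metric_pos[OF assms]) simp
 hence g11: "?g 1 1 > 0" by (simp add: ip_expand sum_2 axis_def)
 \<comment> \<open>This vector is metrically orthogonal to \<open>axis 1 1\<close>, and its squared
   length is the entry \<open>?g 1 1\<close> times the determinant.\<close>
 define v :: "real^2" where "v = (\<chi> i. if i = 1 then - ?g 1 2 else ?g 1 1)"
 have "v ~= 0" using g11 by (auto simp: v_def vec_eq_iff forall_2)
 hence "ip c p v v > 0" by (rule metric_pos[OF assms])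
 moreover have "ip c p v v = ?g 1 1*gdet c p"
  using metric_sym'[OF assms, of 1 2] by (simp add: ip_expand sum_2 v_def gdet_def algebra_simps)
 ultimately show ?thesis using g11 by (simp add: zero_less_mult_iff)
qed

text \<open>Cramer's formula; in the index type \<open>2\<close> the term \<open>3 - i\<close> is
  the index other than \<open>i\<close>.\<close>

lemma matrix_inv_metric:
 assumes "c \<in> \<A>" "p \<in> cimg c"
 shows "matrix_inv (gm c p) =
  (\<chi> i j. (if i = j then gm c p $ (3 - i) $ (3 - j) else - gm c p $ i $ j)*inverse (gdet c p))"
  (is "_ = ?B")
proof (rule matrix_inv_unique)
 have 3: "(3::2) - 1 = 2" "(3::2) - 2 = 1" by simp_all
 have g: "gdet c p ~= 0" using gdet_pos[OF assms] by simp
 show "gm c p ** ?B = mat 1"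
  using g by (simp add: matrix_matrix_mult_def mat_def vec_eq_iff forall_2 sum_2 3 field_simps)
   (simp add: gdet_def algebra_simps)
 show "?B ** gm c p = mat 1"
  using g by (simp add: matrix_matrix_mult_def mat_def vec_eq_iff forall_2 sum_2 3 field_simps)
   (simp add: gdet_def algebra_simps)
qed

lemma metric_C1: "c \<in> \<A> ==> C1_on (cimg c) (%p. gm c p $ i $ j)"
 "c \<in> \<A> ==> C1_on (cimg c) (partial (cimg c) l (%p. gm c p $ i $ j))"
 using smooth_onD[OF metric_smooth] by auto

lemma gdet_C1: "c \<in> \<A> ==> C1_on (cimg c) (gdet c)"
 unfolding gdet_def[abs_def] by (intro C1_on_arith relopen_cimg metric_C1)

lemma metric_inv_C1:
 assumes "c \<in> \<A>" shows "C1_on (cimg c) (%p. matrix_inv (gm c p) $ i $ j)"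
proof -
 have inv: "C1_on (cimg c) (%p. inverse (gdet c p))"
 proof (rule C1_on_arith(4)[OF relopen_cimg[OF assms] gdet_C1[OF assms] gdet_C1[OF assms]])
  show "gdet c p ~= 0" if "p \<in> cimg c" for p using gdet_pos[OF assms that] by simp
 qed
 have 1: "C1_on (cimg c) (%p. gm c p $ (3 - i) $ (3 - j)*inverse (gdet c p))"
  "C1_on (cimg c) (%p. (0 - gm c p $ i $ j)*inverse (gdet c p))"
  by (intro C1_on_arith inv C1_on_const relopen_cimg metric_C1 assms)+
 show ?thesis
 proof (cases "i = j")
  case True
  thus ?thesis by (intro C1_on_cong[THEN iffD1, OF _ 1(1)]) (simp add: matrix_inv_metric[OF assms])
 next
  case False
  thus ?thesis by (intro C1_on_cong[THEN iffD1, OF _ 1(2)]) (simp add: matrix_inv_metric[OF assms])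
 qed
qed

lemma christoffel_C1: "c \<in> \<A> ==> C1_on (cimg c) (chr c k i j)"
 unfolding christoffel_def[abs_def] divide_inverse
 by (intro C1_on_arith C1_on_sum C1_on_const relopen_cimg metric_C1 metric_inv_C1) auto

lemma christoffel_lower:
 assumes "c \<in> \<A>" "p \<in> cimg c"
 shows "(\<Sum>k\<in>UNIV. gm c p $ m $ k * chr c k i j p) =
  (partial (cimg c) i (%q. gm c q $ j $ m) p
    + partial (cimg c) j (%q. gm c q $ i $ m) p
    - partial (cimg c) m (%q. gm c q $ i $ j) p)/2"
proof -
 define G where "G = gm c p"
 define B where "B = matrix_inv G"
 have 3: "(3::2) - 1 = 2" "(3::2) - 2 = 1" by simp_all
 have g: "gdet c p ~= 0" using gdet_pos[OF assms] by simp
 have "G ** B = mat 1" unfolding G_def B_def matrix_inv_metric[OF assms]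
  using g by (simp add: matrix_matrix_mult_def mat_def vec_eq_iff forall_2 sum_2 3 field_simps)
   (simp add: gdet_def algebra_simps)
 hence GB: "G $ m $ 1*B $ 1 $ l + G $ m $ 2*B $ 2 $ l = (if m = l then 1 else 0)" for m l
  by (simp add: matrix_matrix_mult_def mat_def vec_eq_iff sum_2)
 define E where "E l = partial (cimg c) i (%q. gm c q $ j $ l) p
    + partial (cimg c) j (%q. gm c q $ i $ l) p
    - partial (cimg c) l (%q. gm c q $ i $ j) p" for l
 have "(\<Sum>k\<in>UNIV. gm c p $ m $ k * chr c k i j p) =
  ((G $ m $ 1*B $ 1 $ 1 + G $ m $ 2*B $ 2 $ 1)*E 1 + (G $ m $ 1*B $ 1 $ 2 + G $ m $ 2*B $ 2 $ 2)*E 2)/2"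
  unfolding christoffel_def E_def[symmetric] G_def[symmetric] B_def[symmetric]
  by (simp add: sum_2 algebra_simps add_divide_distrib)
 also have "... = E m/2" unfolding GB using exhaust_2[of m] by auto
 finally show ?thesis unfolding E_def .
qed

text \<open>Koszul's formula for fields with constant coordinates. As the metric is nondegenerate it
  determines \<open>Gam\<close>, which is how \<open>Gam_DT\<close> finds the behaviour of
  \<open>Gam\<close> under a change of charts.\<close>

lemma koszul:
 assumes "c \<in> \<A>" "p \<in> cimg c"
 shows "2*ip c p (Gam c p u w) z = dip c p u w z + dip c p w u z - dip c p z u w"
proof -
 have "ip c p (Gam c p u w) z = (\<Sum>m\<in>UNIV. \<Sum>i\<in>UNIV. \<Sum>j\<in>UNIV. z$m*u$i*w$j *
   (\<Sum>k\<in>UNIV. gm c p $ m $ k * chr c k i j p))"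
  using metric_sym'[OF assms, of 1 2]
  by (simp add: ip_expand Gam_def sum_2 algebra_simps)
 also have "... = (dip c p u w z + dip c p w u z - dip c p z u w)/2"
  unfolding christoffel_lower[OF assms] dip_def sum_2
  by (simp add: algebra_simps add_divide_distrib diff_divide_distrib)
 finally show ?thesis by simp
qed

lemma compat:
 assumes "c \<in> \<A>" "p \<in> cimg c"
 shows "dip c p h u w = ip c p (Gam c p h u) w + ip c p u (Gam c p h w)"
 using koszul[OF assms, of h u w] koszul[OF assms, of h w u] ip_sym[OF assms, of u "Gam c p h w"]
  dip_sym[OF assms, of h w u] by linarith

lemma christoffel_compat:
 assumes "c \<in> \<A>" "p \<in> cimg c"
 shows "partial (cimg c) k (%q. gm c q $ i $ j) p =
  (\<Sum>l\<in>UNIV. gm c p $ l $ j * chr c l k i p + gm c p $ i $ l * chr c l k j p)"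
proof -
 have "partial (cimg c) k (%q. gm c q $ i $ j) p =
   (\<Sum>l\<in>UNIV. gm c p $ j $ l * chr c l k i p) + (\<Sum>l\<in>UNIV. gm c p $ i $ l * chr c l k j p)"
  unfolding christoffel_lower[OF assms] using metric_sym_partial[OF assms, of k i j] metric_sym_partial[OF assms, of i k j]
   metric_sym_partial[OF assms, of j k i] by (simp add: field_simps)
 thus ?thesis using metric_sym'[OF assms, of j] by (simp add: sum.distrib)
qed

text \<open>Metric compatibility differentiated once more. Written in both orders, it turns the
  equality of mixed partials of the metric into the skew symmetry of the curvature in
  \<open>Rm_skew_axis\<close>.\<close>

lemma metric_second_partial:
 assumes c: "c \<in> \<A>" and p: "p \<in> cimg c"
 shows "partial (cimg c) m (partial (cimg c) k (%q. gm c q $ i $ j)) p =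
  (\<Sum>l\<in>UNIV. partial (cimg c) m (%q. gm c q $ l $ j) p * chr c l k i p
   + gm c p $ l $ j*partial (cimg c) m (chr c l k i) p
   + partial (cimg c) m (%q. gm c q $ i $ l) p * chr c l k j p
   + gm c p $ i $ l*partial (cimg c) m (chr c l k j) p)"
proof -
 note V = relopen_cimg[OF c] and g = C1_onD(1)[OF metric_C1(1)[OF c] p] and G = C1_onD(1)[OF christoffel_C1[OF c] p]
 have "partial (cimg c) m (partial (cimg c) k (%q. gm c q $ i $ j)) p =
  partial (cimg c) m (%p. (gm c p $ 1 $ j * chr c 1 k i p + gm c p $ i $ 1 * chr c 1 k j p)
   + (gm c p $ 2 $ j * chr c 2 k i p + gm c p $ i $ 2 * chr c 2 k j p)) p"
  by (rule partial_cong[OF _ p]) (simp add: christoffel_compat[OF c] sum_2)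
 also have "... = ((partial (cimg c) m (%q. gm c q $ 1 $ j) p * chr c 1 k i p
   + gm c p $ 1 $ j*partial (cimg c) m (chr c 1 k i) p)
   + (partial (cimg c) m (%q. gm c q $ i $ 1) p * chr c 1 k j p
   + gm c p $ i $ 1*partial (cimg c) m (chr c 1 k j) p))
  + ((partial (cimg c) m (%q. gm c q $ 2 $ j) p * chr c 2 k i p
   + gm c p $ 2 $ j*partial (cimg c) m (chr c 2 k i) p)
   + (partial (cimg c) m (%q. gm c q $ i $ 2) p * chr c 2 k j p
   + gm c p $ i $ 2*partial (cimg c) m (chr c 2 k j) p))"
  using partial_arith(1,3)[OF V p] g G by (auto intro!: differentiable_add differentiable_mult)
 finally show ?thesis by (simp add: sum_2 algebra_simps)
qed

lemma Rm_lin [simp]: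
 "Rm c p (u + v) w z = Rm c p u w z + Rm c p v w z" "Rm c p w (u + v) z = Rm c p w u z + Rm c p w v z"
 "Rm c p u w (z + v) = Rm c p u w z + Rm c p u w v"
 "Rm c p (a *\<^sub>R u) w z = a *\<^sub>R Rm c p u w z" "Rm c p u (a *\<^sub>R w) z = a *\<^sub>R Rm c p u w z"
 "Rm c p u w (a *\<^sub>R z) = a *\<^sub>R Rm c p u w z"
 by (simp_all add: Rm_def dGam_def Gam_def sum_2 vec_eq_iff algebra_simps)

definition cross :: "real^2 => real^2 => real" where "cross u w = u$1*w$2 - u$2*w$1"

text \<open>The curvature is alternating in \<open>u\<close> and \<open>w\<close>, and in dimension
  two alternating forms are multiples of \<open>cross\<close>; a single operator carries all the
  curvature.\<close>

lemma Rm_cross: "Rm c p u w z = cross u w *\<^sub>R Rm c p (axis 1 1) (axis 2 1) z"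
proof -
 have a: "x = x$1 *\<^sub>R axis 1 1 + x$2 *\<^sub>R axis 2 1" for x :: "real^2"
  by (simp add: vec_eq_iff forall_2 axis_def)
 have s: "Rm c p x x z = 0" "Rm c p x y z = - Rm c p y x z" for x y
  by (simp_all add: Rm_def)
 have "Rm c p u w z = Rm c p (u$1 *\<^sub>R axis 1 1 + u$2 *\<^sub>R axis 2 1) (w$1 *\<^sub>R axis 1 1 + w$2 *\<^sub>R axis 2 1) z"
  by (rule arg_cong2[where f="%u w. Rm c p u w z", OF a[of u] a[of w]])
 thus ?thesis using s(2)[of "axis 2 1" "axis 1 1"]
  by (simp add: s(1) cross_def algebra_simps)
qed

lemma Rm_axis: "Rm c p (axis 1 1) (axis 2 1) (axis k 1) $ l = riemann M c l 1 2 k p"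
 using exhaust_2[of k] by (auto simp: Rm_def dGam_def Gam_def riemann_def sum_2 axis_def algebra_simps)

lemma Rm_skew_axis:
 assumes c: "c \<in> \<A>" and p: "p \<in> cimg c"
 shows "ip c p (Rm c p (axis 1 1) (axis 2 1) (axis i 1)) (axis j 1)
  + ip c p (axis i 1) (Rm c p (axis 1 1) (axis 2 1) (axis j 1)) = 0"
proof -
 have ax: "ip c p w (axis j 1) = (\<Sum>l\<in>UNIV. gm c p $ l $ j*w $ l)"
  "ip c p (axis j 1) w = (\<Sum>l\<in>UNIV. gm c p $ j $ l*w $ l)" for w j
  using exhaust_2[of j] by (auto simp: ip_expand sum_2 axis_def)
 have "partial (cimg c) 1 (partial (cimg c) 2 (%q. gm c q $ i $ j)) p =
  partial (cimg c) 2 (partial (cimg c) 1 (%q. gm c q $ i $ j)) p"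
  by (intro mixed_partials_commute relopen_cimg metric_C1 c p)
 thus ?thesis
  unfolding metric_second_partial[OF c p] christoffel_compat[OF c p] ax Rm_axis riemann_def sum_2
  by (simp add: algebra_simps)
qed

lemma Rm_skew:
 assumes c: "c \<in> \<A>" and p: "p \<in> cimg c"
 shows "ip c p (Rm c p u w z) y + ip c p z (Rm c p u w y) = 0"
proof -
 have a: "x = x$1 *\<^sub>R axis 1 1 + x$2 *\<^sub>R axis 2 1" for x :: "real^2"
  by (simp add: vec_eq_iff forall_2 axis_def)
 let ?R = "Rm c p (axis 1 1) (axis 2 1)"
 let ?B = "%z y. ip c p (?R z) y + ip c p z (?R y)"
 note s = Rm_skew_axis[OF c p]
 have "?B z y = ?B (z$1 *\<^sub>R axis 1 1 + z$2 *\<^sub>R axis 2 1) (y$1 *\<^sub>R axis 1 1 + y$2 *\<^sub>R axis 2 1)"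
  by (rule arg_cong2[where f="?B", OF a[of z] a[of y]])
 also have "... = z$1*y$1*?B (axis 1 1) (axis 1 1) + z$1*y$2*?B (axis 1 1) (axis 2 1)
  + z$2*y$1*?B (axis 2 1) (axis 1 1) + z$2*y$2*?B (axis 2 1) (axis 2 1)"
  by (simp only: Rm_lin ip_lin distrib_left distrib_right) (simp only: ac_simps)
 finally have B: "?B z y = 0" unfolding s by (simp only: mult_zero_right add_0)
 have "ip c p (Rm c p u w z) y + ip c p z (Rm c p u w y) = cross u w*?B z y"
  by (simp only: Rm_cross[of c p u w z] Rm_cross[of c p u w y] ip_lin distrib_left)
 thus ?thesis unfolding B by simp
qed

lemma gauss_Rm:
 assumes c: "c \<in> \<A>" and p: "p \<in> cimg c"
 shows "ip c p (Rm c p (axis 1 1) (axis 2 1) (axis 2 1)) (axis 1 1) = gK c p*gdet c p"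
proof -
 have "det (gm c p) = gdet c p" by (simp add: det_2 gdet_def)
 thus ?thesis using gdet_pos[OF c p] metric_sym'[OF c p, of 1 2]
  by (simp add: gauss_curvature_def ip_expand sum_2 Rm_axis) (simp add: axis_def algebra_simps)
qed

text \<open>Lagrange's identity: the Gram determinant of two pairs of vectors is the product of
  their areas.\<close>

lemma gdet_cross:
 assumes c: "c \<in> \<A>" and p: "p \<in> cimg c"
 shows "gdet c p * cross v w * cross a b = ip c p v a*ip c p w b - ip c p v b*ip c p w a"
 using metric_sym'[OF c p, of 1 2] by (simp add: gdet_def cross_def ip_expand sum_2 algebra_simps)

text \<open>The operator \<open>Rm c p (axis 1 1) (axis 2 1)\<close> is skew for the metric, so in
  the plane it is a multiple of the rotation by a right angle, with a factor given by the Gauss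
  curvature. This is what makes the Jacobi equation scalar: for a unit vector \<open>v\<close> the
  normal part of R(v, d)v is -K times that of \<open>d\<close>.\<close>

lemma cross_Rm:
 assumes c: "c \<in> \<A>" and p: "p \<in> cimg c"
 shows "cross v (Rm c p v d v) = - gK c p*ip c p v v * cross v d"
proof (cases "v = 0")
 case False
 let ?R = "Rm c p (axis 1 1) (axis 2 1)"
 \<comment> \<open>\<open>b\<close> is \<open>v\<close> turned by a right angle for the Euclidean
   product, so \<open>cross v b\<close> is the squared Euclidean length of \<open>v\<close> and may
   be cancelled.\<close>
 define b :: "real^2" where "b = (\<chi> i. if i = 1 then - v$2 else v$1)"
 have cb: "cross v b ~= 0"
 proof -
  have "b$1 = - v$2" "b$2 = v$1" unfolding b_def by simp_all
  hence "cross v b = (v$1)^2 + (v$2)^2" unfolding cross_def power2_eq_square by simp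
  moreover have "v$1 ~= 0 \<or> v$2 ~= 0" using False by (auto simp: vec_eq_iff forall_2)
  ultimately show ?thesis by (simp add: sum_power2_eq_zero_iff)
 qed
 have sk: "ip c p (?R z) y = - ip c p (?R y) z" for z y
  using Rm_skew[OF c p, of "axis 1 1" "axis 2 1" z y] ip_sym[OF c p, of z] by simp
 have vv: "ip c p (?R z) z = 0" for z using sk[of z z] by simp
 have a: "x = x$1 *\<^sub>R axis 1 1 + x$2 *\<^sub>R axis 2 1" for x :: "real^2"
  by (simp add: vec_eq_iff forall_2 axis_def)
 have "ip c p (?R v) b = ip c p (?R (v$1 *\<^sub>R axis 1 1 + v$2 *\<^sub>R axis 2 1)) (b$1 *\<^sub>R axis 1 1 + b$2 *\<^sub>R axis 2 1)"
  by (rule arg_cong2[where f="%x y. ip c p (?R x) y", OF a[of v] a[of b]])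
 also have "... = v$1*b$1*ip c p (?R (axis 1 1)) (axis 1 1) + v$1*b$2*ip c p (?R (axis 1 1)) (axis 2 1)
  + v$2*b$1*ip c p (?R (axis 2 1)) (axis 1 1) + v$2*b$2*ip c p (?R (axis 2 1)) (axis 2 1)"
  by (simp add: algebra_simps)
 also have "... = - cross v b*ip c p (?R (axis 2 1)) (axis 1 1)"
  unfolding vv sk[of "axis 1 1" "axis 2 1"] by (simp add: cross_def algebra_simps)
 also have "... = - cross v b*gK c p*gdet c p" unfolding gauss_Rm[OF c p] by simp
 finally have wb: "ip c p (?R v) b = - cross v b*gK c p*gdet c p" .
 have "gdet c p * cross v (?R v) * cross v b = ip c p v v * (- cross v b*gK c p*gdet c p) - ip c p v b*0"
  using gdet_cross[OF c p, of v "?R v" v b] unfolding vv wb .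
 hence 1: "(gdet c p * cross v b) * cross v (?R v) = (gdet c p * cross v b)*(- gK c p*ip c p v v)"
  by (simp add: algebra_simps)
 have 2: "gdet c p * cross v b ~= 0" using gdet_pos[OF c p] cb by simp
 have "cross v (?R v) = - gK c p*ip c p v v"
  by (rule mult_left_cancel[OF 2, THEN iffD1, OF 1])
 moreover have "cross v (a *\<^sub>R w) = a * cross v w" for a w by (simp add: cross_def right_diff_distrib)
 hence "cross v (Rm c p v d v) = cross v d * cross v (?R v)"
  by (subst Rm_cross[of c p v d v]) (rule \<open>!!w a. cross v (a *\<^sub>R w) = a * cross v w\<close>)
 ultimately show ?thesis by (metis mult.commute)
next
 case True
 thus ?thesis by (simp only: cross_def zero_index mult_zero_left mult_zero_right diff_zero ip_lin)
qed

end

lemma has_derivative_cart: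
 fixes f :: "'b::real_normed_vector => real^'n"
 shows "(f has_derivative f') (at t within S) \<longleftrightarrow> (ALL k. ((%x. f x $ k) has_derivative (%h. f' h $ k)) (at t within S))"
 unfolding has_derivative_componentwise_within[of f] by (auto simp: Basis_vec_def inner_axis)

lemma has_derivative_triple:
 fixes f g k :: "'b::real_normed_vector => real"
 assumes "(f has_derivative f') (at t within S)" "(g has_derivative g') (at t within S)" "(k has_derivative k') (at t within S)"
 shows "((%s. f s*g s*k s) has_derivative (%d. f' d*g t*k t + f t*g' d*k t + f t*g t*k' d)) (at t within S)"
 by (rule has_derivative_eq_rhs[OF has_derivative_mult[OF has_derivative_mult[OF assms(1,2)] assms(3)]])
  (simp add: fun_eq_iff algebra_simps)

lemma C1_on_comp:
 assumes f: "C1_on V f" and x: "(x has_derivative x') (at t within S)" and S: "x ` S <= V" "t \<in> S"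
 shows "((%s. f (x s)) has_derivative (%h. \<Sum>l\<in>UNIV. x' h $ l*partial V l f (x t))) (at t within S)"
proof -
 have "(f has_derivative (%h. h$1*partial V 1 f (x t) + h$2*partial V 2 f (x t))) (at (x t) within x ` S)"
  using S has_derivative_subset[OF has_derivative_partial[OF C1_onD(1)[OF f]]] by blast
 from diff_chain_within[OF x this] show ?thesis by (simp add: o_def sum_2)
qed

context riem begin

lemma ip_has_derivative:
 assumes c: "c \<in> \<A>" and x: "(x has_derivative x') (at t within S)" and S: "x ` S <= cimg c" "t \<in> S"
  and u: "(u has_derivative u') (at t within S)" and w: "(w has_derivative w') (at t within S)"
 shows "((%s. ip c (x s) (u s) (w s)) has_derivative
  (%h. dip c (x t) (x' h) (u t) (w t) + ip c (x t) (u' h) (w t) + ip c (x t) (u t) (w' h))) (at t within S)"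
proof -
 note g = C1_on_comp[OF metric_C1(1)[OF c] x S]
 show ?thesis unfolding ip_expand
  by (rule has_derivative_eq_rhs[OF has_derivative_sum[OF has_derivative_sum[OF has_derivative_triple[OF g
     u[unfolded has_derivative_cart, rule_format] w[unfolded has_derivative_cart, rule_format]]]]])
   (simp add: fun_eq_iff dip_def ip_expand sum_2 algebra_simps)
qed

lemma Gam_has_derivative:
 assumes c: "c \<in> \<A>" and x: "(x has_derivative x') (at t within S)" and S: "x ` S <= cimg c" "t \<in> S"
  and u: "(u has_derivative u') (at t within S)" and w: "(w has_derivative w') (at t within S)"
 shows "((%s. Gam c (x s) (u s) (w s)) has_derivative
  (%h. dGam c (x t) (x' h) (u t) (w t) + Gam c (x t) (u' h) (w t) + Gam c (x t) (u t) (w' h))) (at t within S)"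
 unfolding has_derivative_cart
proof
 fix k
 note g = C1_on_comp[OF christoffel_C1[OF c] x S]
 show "((%s. Gam c (x s) (u s) (w s) $ k) has_derivative
  (%h. (dGam c (x t) (x' h) (u t) (w t) + Gam c (x t) (u' h) (w t) + Gam c (x t) (u t) (w' h)) $ k)) (at t within S)"
  unfolding Gam_def vec_lambda_beta
  by (rule has_derivative_eq_rhs[OF has_derivative_sum[OF has_derivative_sum[OF has_derivative_triple[OF g
     u[unfolded has_derivative_cart, rule_format] w[unfolded has_derivative_cart, rule_format]]]]])
   (simp add: fun_eq_iff dGam_def sum_2 algebra_simps)
qed

text \<open>The area density: \<open>vol c p * cross u w\<close> is the Riemannian area form, with
  the orientation of the chart \<open>c\<close>.\<close>

definition vol :: "'a chart => real^2 => real" where "vol c p = sqrt (gdet c p)"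

lemma vol_sq: "c \<in> \<A> ==> p \<in> cimg c ==> (vol c p)^2 = gdet c p"
 using gdet_pos[of c p] by (simp add: vol_def)

text \<open>Jacobi's formula: the logarithmic derivative of the determinant is twice the trace of
  the connection.\<close>

lemma gdet_partial:
 assumes c: "c \<in> \<A>" and p: "p \<in> cimg c"
 shows "partial (cimg c) k (gdet c) p = 2*gdet c p*(chr c 1 k 1 p + chr c 2 k 2 p)"
proof -
 let ?A = "gm c p"
 note V = relopen_cimg[OF c] and g = C1_onD(1)[OF metric_C1(1)[OF c] p]
 have "partial (cimg c) k (gdet c) p =
  (partial (cimg c) k (%q. gm c q $ 1 $ 1) p * ?A $ 2 $ 2
  + ?A $ 1 $ 1*partial (cimg c) k (%q. gm c q $ 2 $ 2) p)
  - (partial (cimg c) k (%q. gm c q $ 1 $ 2) p * ?A $ 2 $ 1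
  + ?A $ 1 $ 2*partial (cimg c) k (%q. gm c q $ 2 $ 1) p)"
  unfolding gdet_def[abs_def] using partial_arith(2,3)[OF V p] g by (auto intro!: differentiable_mult)
 also have "... = 2*gdet c p*(chr c 1 k 1 p + chr c 2 k 2 p)"
  unfolding christoffel_compat[OF c p] gdet_def using metric_sym'[OF c p, of 2 1]
  by (simp add: sum_2 algebra_simps)
 finally show ?thesis .
qed

lemma vol_has_derivative:
 assumes c: "c \<in> \<A>" and x: "(x has_derivative x') (at t within S)" and S: "x ` S <= cimg c" "t \<in> S"
 shows "((%s. vol c (x s)) has_derivative
  (%h. vol c (x t)*(Gam c (x t) (x' h) (axis 1 1) $ 1 + Gam c (x t) (x' h) (axis 2 1) $ 2))) (at t within S)"
proof -
 let ?A = "inverse (sqrt (gdet c (x t)))" and ?B = "gdet c (x t)"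
 have p: "x t \<in> cimg c" using S by auto
 have d: "?B > 0" by (rule gdet_pos[OF c p])
 have s: "sqrt (?B) * sqrt (?B) = ?B" using d by simp
 have r: "(sqrt has_derivative (%h. h*(?A/2))) (at (?B))"
  by (rule has_derivative_eq_rhs[OF DERIV_real_sqrt[OF d, unfolded has_field_derivative_def]]) (simp add: fun_eq_iff)
 have "((%s. sqrt (gdet c (x s))) has_derivative (%h. (\<Sum>l\<in>UNIV. x' h $ l*partial (cimg c) l (gdet c) (x t))
   * (?A/2))) (at t within S)"
  using has_derivative_compose[OF C1_on_comp[OF gdet_C1[OF c] x S] r] .
 moreover have "(%h. (\<Sum>l\<in>UNIV. x' h $ l*partial (cimg c) l (gdet c) (x t))*(?A/2))
  = (%h. vol c (x t)*(Gam c (x t) (x' h) (axis 1 1) $ 1 + Gam c (x t) (x' h) (axis 2 1) $ 2))"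
 proof
  fix h
  have e: "?B*?A = sqrt (?B)"
   using d by (metis divide_inverse less_imp_le real_div_sqrt)
  have "(\<Sum>l\<in>UNIV. x' h $ l*partial (cimg c) l (gdet c) (x t))*(?A/2)
   = (?B*?A) *
    (x' h $ 1*(chr c 1 1 1 (x t) + chr c 2 1 2 (x t)) + x' h $ 2*(chr c 1 2 1 (x t) + chr c 2 2 2 (x t)))"
   unfolding gdet_partial[OF c p] by (simp add: sum_2 algebra_simps)
  also have "... = vol c (x t)*(Gam c (x t) (x' h) (axis 1 1) $ 1 + Gam c (x t) (x' h) (axis 2 1) $ 2)"
   unfolding e vol_def by (simp add: Gam_def sum_2 axis_def algebra_simps)
  finally show "(\<Sum>l\<in>UNIV. x' h $ l*partial (cimg c) l (gdet c) (x t))*(?A/2)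
   = vol c (x t)*(Gam c (x t) (x' h) (axis 1 1) $ 1 + Gam c (x t) (x' h) (axis 2 1) $ 2)" .
 qed
 ultimately show ?thesis by (simp add: vol_def)
qed

section \<open>Changes of charts\<close>

definition DT :: "'a chart => 'a chart => real^2 => real^2 => real^2" where
 "DT c d p = frechet_derivative (transition c d) (at p within overlap c d)"

text \<open>The second derivative of the transition map, which is the inhomogeneous term when
  Christoffel symbols change charts.\<close>

definition D2T :: "'a chart => 'a chart => real^2 => real^2 => real^2 => real^2" where
 "D2T c d p u w = (\<chi> k. \<Sum>i\<in>UNIV. \<Sum>j\<in>UNIV. u$i*w$j *
  partial (overlap c d) i (partial (overlap c d) j (%p. transition c d p $ k)) p)"

lemma chart_inj: "c \<in> \<A> ==> inj_on (cmap c) (cdom c)"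
 and chart_open: "c \<in> \<A> ==> openin X (cdom c)"
 and chart_homeo: "c \<in> \<A> ==> homeomorphic_map (subtopology X (cdom c)) (top_of_set (cimg c)) (cmap c)"
proof -
 assume c: "c \<in> \<A>"
 thus o: "openin X (cdom c)" and h: "homeomorphic_map (subtopology X (cdom c)) (top_of_set (cimg c)) (cmap c)"
  using charts unfolding is_chart_def by auto
 have "topspace (subtopology X (cdom c)) = cdom c" using openin_subset[OF o] by (auto simp: topspace_subtopology)
 thus "inj_on (cmap c) (cdom c)" using homeomorphic_imp_injective_map[OF h] by simp
qed

lemma transition_cmap:
 assumes "c \<in> \<A>" "y \<in> cdom c" shows "transition c d (cmap c y) = cmap d y"
 using inv_into_f_f[OF chart_inj[OF assms(1)] assms(2)] by (simp add: transition_def)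

lemma overlap_relopen:
 assumes c: "c \<in> \<A>" and d: "d \<in> \<A>" shows "relopen (overlap c d)" "overlap c d <= cimg c"
proof -
 have ts: "topspace (subtopology X (cdom c)) = cdom c"
  using openin_subset[OF chart_open[OF c]] by (auto simp: topspace_subtopology)
 have "openin (subtopology X (cdom c)) (cdom c \<inter> cdom d)"
  using chart_open[OF c] chart_open[OF d] by (simp add: openin_open_subtopology openin_Int)
 hence "openin (top_of_set (cimg c)) (cmap c ` (cdom c \<inter> cdom d))"
  using homeomorphic_map_openness_eq[OF chart_homeo[OF c]] by blast
 thus "relopen (overlap c d)" unfolding overlap_def
  using relopen_cimg[OF c] openin_trans by blast
 show "overlap c d <= cimg c" by (auto simp: overlap_def)
qed

lemma transition_C1:
 assumes "c \<in> \<A>" "d \<in> \<A>"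
 shows "C1_on (overlap c d) (%p. transition c d p $ k)"
  "C1_on (overlap c d) (partial (overlap c d) i (%p. transition c d p $ k))"
 using smooth_onD[OF transition_smooth[OF assms]] by auto

lemma DT_has_derivative:
 assumes c: "c \<in> \<A>" and d: "d \<in> \<A>" and p: "p \<in> overlap c d"
 shows "(transition c d has_derivative DT c d p) (at p within overlap c d)"
  and "DT c d p h $ k = (\<Sum>i\<in>UNIV. h$i*partial (overlap c d) i (%p. transition c d p $ k) p)"
  and "linear (DT c d p)"
proof -
 let ?D = "%h. \<chi> k. h$1*partial (overlap c d) 1 (%p. transition c d p $ k) p + h$2*partial (overlap c d) 2 (%p. transition c d p $ k) p"
 have D: "(transition c d has_derivative ?D) (at p within overlap c d)"
  unfolding has_derivative_cart
  using has_derivative_partial[OF C1_onD(1)[OF transition_C1(1)[OF c d] p]] by simp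
 thus 1: "(transition c d has_derivative DT c d p) (at p within overlap c d)"
  unfolding DT_def using frechet_derivative_works differentiable_def by blast
 have "DT c d p = ?D" by (rule frechet_unique_relopen[OF overlap_relopen(1)[OF c d] p 1 D])
 thus "DT c d p h $ k = (\<Sum>i\<in>UNIV. h$i*partial (overlap c d) i (%p. transition c d p $ k) p)"
  by (simp add: sum_2)
 show "linear (DT c d p)" by (rule has_derivative_linear[OF 1])
qed

lemma metric_DT:
 assumes "c \<in> \<A>" "d \<in> \<A>" "p \<in> overlap c d"
 shows "ip c p v w = ip d (transition c d p) (DT c d p v) (DT c d p w)"
 using metric_transition[OF assms] unfolding DT_def .

lemma transition_in: "c \<in> \<A> ==> p \<in> overlap c d ==> transition c d p \<in> cimg d"
 "c \<in> \<A> ==> p \<in> overlap c d ==> p \<in> cimg c"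
 by (auto simp: overlap_def transition_cmap)

lemma DT_surj:
 assumes c: "c \<in> \<A>" and d: "d \<in> \<A>" and p: "p \<in> overlap c d"
 shows "surj (DT c d p)" "inj (DT c d p)"
proof -
 note lin = DT_has_derivative(3)[OF c d p]
 have "u = 0" if "DT c d p u = 0" for u
 proof (rule ccontr)
  assume "u ~= 0"
  hence "ip c p u u > 0" using metric_pos[OF c] transition_in(2)[OF c p] by blast
  thus False unfolding metric_DT[OF c d p] that by simp
 qed
 thus i: "inj (DT c d p)" using linear_injective_0[OF lin] by blast
 show "surj (DT c d p)" by (rule linear_injective_imp_surjective[OF lin i]) simp
qed

lemma DT_has_derivative_along:
 assumes c: "c \<in> \<A>" and d: "d \<in> \<A>" and x: "(x has_derivative x') (at t within S)"
  and S: "x ` S <= overlap c d" "t \<in> S" and u: "(u has_derivative u') (at t within S)"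
 shows "((%s. DT c d (x s) (u s)) has_derivative (%h. D2T c d (x t) (x' h) (u t) + DT c d (x t) (u' h))) (at t within S)"
 unfolding has_derivative_cart
proof
 fix k
 have xs: "x s \<in> overlap c d" if "s \<in> S" for s using S that by auto
 have "((%s. \<Sum>i\<in>UNIV. u s $ i*partial (overlap c d) i (%p. transition c d p $ k) (x s)) has_derivative
  (%h. (D2T c d (x t) (x' h) (u t) + DT c d (x t) (u' h)) $ k)) (at t within S)"
  by (rule has_derivative_eq_rhs[OF has_derivative_sum[OF has_derivative_mult[OF u[unfolded has_derivative_cart, rule_format]
    C1_on_comp[OF transition_C1(2)[OF c d] x S]]]])
   (simp add: fun_eq_iff DT_has_derivative(2)[OF c d xs[OF S(2)]] D2T_def sum_2 algebra_simps)
 thus "((%s. DT c d (x s) (u s) $ k) has_derivative (%h. (D2T c d (x t) (x' h) (u t) + DT c d (x t) (u' h)) $ k)) (at t within S)"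
  by (rule has_derivative_transform[OF S(2), rotated]) (simp add: DT_has_derivative(2)[OF c d xs])
qed

lemma D2T_sym:
 assumes c: "c \<in> \<A>" and d: "d \<in> \<A>" and p: "p \<in> overlap c d"
 shows "D2T c d p u w = D2T c d p w u"
proof -
 let ?A = "overlap c d"
 have "partial ?A 1 (partial ?A 2 (%p. transition c d p $ k)) p
   = partial ?A 2 (partial ?A 1 (%p. transition c d p $ k)) p" for k
  by (intro mixed_partials_commute overlap_relopen transition_C1 c d p)
 thus ?thesis by (simp add: D2T_def vec_eq_iff sum_2)
qed

lemma dip_DT:
 assumes c: "c \<in> \<A>" and d: "d \<in> \<A>" and p: "p \<in> overlap c d"
 shows "dip c p u w z = dip d (transition c d p) (DT c d p u) (DT c d p w) (DT c d p z)
  + ip d (transition c d p) (D2T c d p u w) (DT c d p z) + ip d (transition c d p) (DT c d p w) (D2T c d p u z)"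
proof -
 let ?O = "overlap c d"
 let ?A = "transition c d p" and ?B = "at p within ?O" and ?D = "DT c d p w" and ?E = "DT c d p z"
 have id: "((%q. q) has_derivative (%h. h)) ?B" by (rule has_derivative_ident)
 have "((%q. ip c q w z) has_derivative (%h. dip c p h w z + ip c p 0 z + ip c p w 0)) ?B"
  using overlap_relopen(2)[OF c d] p by (intro ip_has_derivative[OF c id] has_derivative_const) auto
 hence 1: "((%q. ip c q w z) has_derivative (%h. dip c p h w z)) ?B" by simp
 have 2: "((%q. DT c d q y) has_derivative (%h. D2T c d p h y + DT c d p 0)) ?B" for y
  using p by (intro DT_has_derivative_along[OF c d id] has_derivative_const) auto
 have z: "DT c d p 0 = 0" by (rule linear_0[OF DT_has_derivative(3)[OF c d p]])
 have "((%q. ip d (transition c d q) (DT c d q w) (DT c d q z)) has_derivative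
  (%h. dip d ?A (DT c d p h) ?D ?E
   + ip d ?A (D2T c d p h w + DT c d p 0) ?E
   + ip d ?A ?D (D2T c d p h z + DT c d p 0))) ?B"
  using p image_subsetI[of ?O, OF transition_in(1)[OF c]] by (intro ip_has_derivative[OF d DT_has_derivative(1)[OF c d p]] 2)
 hence 3: "((%q. ip c q w z) has_derivative
  (%h. dip d ?A (DT c d p h) ?D ?E
   + ip d ?A (D2T c d p h w) ?E
   + ip d ?A ?D (D2T c d p h z))) ?B"
  unfolding z add_0_right by (rule has_derivative_transform[OF p, rotated]) (rule metric_DT[OF c d])
 show ?thesis using fun_cong[OF frechet_unique_relopen[OF overlap_relopen(1)[OF c d] p 1 3], of u] .
qed

text \<open>The transition is an isometry, so Koszul's formula in one chart is that of the other
  plus terms in \<open>D2T\<close>; since \<open>D2T\<close> is symmetric these combine into a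
  single one.\<close>

lemma Gam_DT:
 assumes c: "c \<in> \<A>" and d: "d \<in> \<A>" and p: "p \<in> overlap c d"
 shows "DT c d p (Gam c p u w) = Gam d (transition c d p) (DT c d p u) (DT c d p w) + D2T c d p u w"
proof -
 let ?q = "transition c d p" and ?D = "DT c d p"
 have pc: "p \<in> cimg c" and qd: "?q \<in> cimg d" using transition_in[OF c p] by auto
 \<comment> \<open>The difference of the two sides is tested against itself: by surjectivity it is
   \<open>DT\<close> of some \<open>z\<close>, and positivity of the metric forces it to
   vanish.\<close>
 define y where "y = ?D (Gam c p u w) - (Gam d ?q (?D u) (?D w) + D2T c d p u w)"
 obtain z where z: "?D z = y" using DT_surj(1)[OF c d p] by (metis surjD)
 have "2*ip d ?q (?D (Gam c p u w)) (?D z) = dip c p u w z + dip c p w u z - dip c p z u w"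
  using koszul[OF c pc, of u w z] unfolding metric_DT[OF c d p, symmetric] .
 also have "... = (dip d ?q (?D u) (?D w) (?D z) + dip d ?q (?D w) (?D u) (?D z) - dip d ?q (?D z) (?D u) (?D w))
  + 2*ip d ?q (D2T c d p u w) (?D z)"
  unfolding dip_DT[OF c d p, of u] dip_DT[OF c d p, of w] dip_DT[OF c d p, of z]
  using D2T_sym[OF c d p, of w u] D2T_sym[OF c d p, of z u] D2T_sym[OF c d p, of z w]
   ip_sym[OF d qd, of "D2T c d p u z" "?D w"] by simp
 also have "... = 2*ip d ?q (Gam d ?q (?D u) (?D w)) (?D z) + 2*ip d ?q (D2T c d p u w) (?D z)"
  unfolding koszul[OF d qd] by simp
 finally have "ip d ?q y y = 0" unfolding z by (simp add: y_def)
 hence "y = 0" using metric_pos[OF d qd, of y] by fastforce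
 thus ?thesis by (simp add: y_def)
qed

lemma dGam_lin [simp]: "dGam c p (a *\<^sub>R h) u w = a *\<^sub>R dGam c p h u w" "dip c p (a *\<^sub>R h) u w = a*dip c p h u w"
 "D2T c d p (a *\<^sub>R h) u = a *\<^sub>R D2T c d p h u"
 by (simp_all add: dGam_def dip_def D2T_def sum_2 vec_eq_iff algebra_simps)

context
 fixes c :: "'a chart" and x :: "real => real^2" and S :: "real set" and t :: real and x' :: "real^2"
 assumes c: "c \<in> \<A>" and S: "open S" "t \<in> S"
  and x: "(x has_vector_derivative x') (at t)"
begin

lemma at_S: "at t within S = at t"
 by (rule at_within_open[OF S(2,1)])

lemma vd_within: "(u has_vector_derivative u') (at t) ==> (u has_derivative (%h. h *\<^sub>R u')) (at t within S)"
 unfolding at_S has_vector_derivative_def .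

lemma Gam_vd:
 assumes "x ` S <= cimg c" "(u has_vector_derivative u') (at t)" "(w has_vector_derivative w') (at t)"
 shows "((%s. Gam c (x s) (u s) (w s)) has_vector_derivative
  (dGam c (x t) x' (u t) (w t) + Gam c (x t) u' (w t) + Gam c (x t) (u t) w')) (at t)"
 unfolding has_vector_derivative_def at_S[symmetric]
 by (rule has_derivative_eq_rhs[OF Gam_has_derivative[OF c vd_within[OF x] assms(1) S(2) vd_within[OF assms(2)] vd_within[OF assms(3)]]])
  (simp add: fun_eq_iff algebra_simps)

lemma vol_vd:
 assumes "x ` S <= cimg c"
 shows "((%s. vol c (x s)) has_real_derivative
  (vol c (x t)*(Gam c (x t) x' (axis 1 1) $ 1 + Gam c (x t) x' (axis 2 1) $ 2))) (at t)"
 unfolding has_field_derivative_def at_S[symmetric]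
 by (rule has_derivative_eq_rhs[OF vol_has_derivative[OF c vd_within[OF x] assms S(2)]])
  (simp add: fun_eq_iff algebra_simps)

lemma DT_vd:
 assumes d: "d \<in> \<A>" and xS: "x ` S <= overlap c d" and u: "(u has_vector_derivative u') (at t)"
 shows "((%s. DT c d (x s) (u s)) has_vector_derivative (D2T c d (x t) x' (u t) + DT c d (x t) u')) (at t)"
  "((%s. transition c d (x s)) has_vector_derivative DT c d (x t) x') (at t)"
proof -
 have p: "x t \<in> overlap c d" using xS S by auto
 show "((%s. DT c d (x s) (u s)) has_vector_derivative (D2T c d (x t) x' (u t) + DT c d (x t) u')) (at t)"
  unfolding has_vector_derivative_def at_S[symmetric]
  by (rule has_derivative_eq_rhs[OF DT_has_derivative_along[OF c d vd_within[OF x] xS S(2) vd_within[OF u]]])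
   (simp add: fun_eq_iff algebra_simps linear_cmul[OF DT_has_derivative(3)[OF c d p]])
 have "eventually (%s. x s \<in> overlap c d) (at t)"
  unfolding eventually_at_topological using S xS by (intro exI[of _ S]) auto
 thus "((%s. transition c d (x s)) has_vector_derivative DT c d (x t) x') (at t)"
  by (rule has_vector_derivative_chain_within[OF x DT_has_derivative(1)[OF c d p] _ p])
qed

end

lemma cont_open:
 assumes "continuous_map euclideanreal X g" "c \<in> \<A>" shows "open {t. g t \<in> cdom c}"
 using assms chart_open[OF assms(2)] by (auto simp: continuous_map_def)

text \<open>\<open>tangent_norm\<close> picks a chart by choice; for a vector whose coordinates
  transform by \<open>DT\<close> every chart gives the same value, because transitions are
  isometries.\<close>

lemma tangent_norm_chart:
 assumes c: "c \<in> \<A>" "y \<in> cdom c"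
  and T: "!!d. d \<in> \<A> ==> y \<in> cdom d ==> \<xi> d = DT c d (cmap c y) (\<xi> c)"
 shows "tnm y \<xi> = sqrt (ip c (cmap c y) (\<xi> c) (\<xi> c))"
proof -
 define d where "d = (SOME d. d \<in> \<A> & y \<in> cdom d)"
 have d: "d \<in> \<A> & y \<in> cdom d" unfolding d_def by (rule someI[of _ c]) (use c in auto)
 have p: "cmap c y \<in> overlap c d" using c d by (auto simp: overlap_def)
 have "ip c (cmap c y) (\<xi> c) (\<xi> c) = ip d (cmap d y) (\<xi> d) (\<xi> d)"
  using metric_DT[OF c(1) conjunct1[OF d] p, of "\<xi> c" "\<xi> c"]
  unfolding T[OF conjunct1[OF d] conjunct2[OF d]] transition_cmap[OF c] .
 thus ?thesis unfolding tangent_norm_def Let_def d_def[symmetric] ip_def[symmetric] by (rule arg_cong[where f=sqrt, OF sym])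
qed

lemma tangent_space_chart:
 assumes "\<xi> \<in> tangent_space M y" "c \<in> \<A>" "y \<in> cdom c" "d \<in> \<A>" "y \<in> cdom d"
 shows "\<xi> d = DT c d (cmap c y) (\<xi> c)"
proof -
 have "ALL c:\<A>. ALL d:\<A>. y \<in> cdom c \<inter> cdom d --> \<xi> d = DT c d (cmap c y) (\<xi> c)"
  using assms(1) unfolding tangent_space_def DT_def mem_Collect_eq by (rule conjunct1)
 thus ?thesis using assms(2-5) by blast
qed

lemma velocity_chart:
 assumes S: "open S" "t \<in> S" "!!s. s \<in> S ==> g s \<in> cdom c \<inter> cdom d" and c: "c \<in> \<A>" "d \<in> \<A>"
  and x: "((%s. cmap c (g s)) has_vector_derivative v) (at t)"
 shows "((%s. cmap d (g s)) has_vector_derivative DT c d (cmap c (g t)) v) (at t)"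
proof -
 have sub: "(%s. cmap c (g s)) ` S <= overlap c d" using S(3) by (auto simp: overlap_def)
 have "((%s. transition c d (cmap c (g s))) has_vector_derivative DT c d (cmap c (g t)) v) (at t)"
  using DT_vd(2)[OF c(1) S(1,2) x c(2) sub has_vector_derivative_const] .
 thus ?thesis
  by (rule has_vector_derivative_transform_within_open[OF _ S(1,2)])
   (use S(3) in \<open>auto simp: transition_cmap[OF c(1)]\<close>)
qed

lemma velocity_eq:
 assumes "c \<in> \<A>" "g t \<in> cdom c" "((%s. cmap c (g s)) has_vector_derivative v) (at t)"
 shows "vel g t c = v"
 using assms vector_derivative_at[OF assms(3)] by (simp add: velocity_def o_def)

lemma cov_deriv_eq:
 assumes "c \<in> \<A>" "g t \<in> cdom c" "((%s. V s c) has_vector_derivative w) (at t)"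
 shows "cvd g V t c = w + Gam c (cmap c (g t)) (vel g t c) (V t c)"
 using assms vector_derivative_at[OF assms(3)] by (simp add: cov_deriv_def Gam_def vec_eq_iff)

lemma cov_deriv_chart:
 assumes S: "open S" "t \<in> S" "!!s. s \<in> S ==> g s \<in> cdom c \<inter> cdom d" and c: "c \<in> \<A>" "d \<in> \<A>"
  and x: "((%s. cmap c (g s)) has_vector_derivative v) (at t)"
  and V: "((%s. V s c) has_vector_derivative w) (at t)"
  and Vd: "!!s. s \<in> S ==> V s d = DT c d (cmap c (g s)) (V s c)"
 shows "((%s. V s d) has_vector_derivative (D2T c d (cmap c (g t)) v (V t c) + DT c d (cmap c (g t)) w)) (at t)"
  and "cvd g V t d = DT c d (cmap c (g t)) (cvd g V t c)"
proof -
 let ?A = "cmap c (g t)"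
 let ?B = "D2T c d ?A v (V t c) + DT c d ?A w"
 have sub: "(%s. cmap c (g s)) ` S <= overlap c d" using S(3) by (auto simp: overlap_def)
 have p: "cmap c (g t) \<in> overlap c d" using sub S(2) by auto
 have td: "g t \<in> cdom c" "g t \<in> cdom d" using S by auto
 have "((%s. DT c d (cmap c (g s)) (V s c)) has_vector_derivative ?B) (at t)"
  using DT_vd(1)[OF c(1) S(1,2) x c(2) sub V] .
 thus 1: "((%s. V s d) has_vector_derivative ?B) (at t)"
  by (rule has_vector_derivative_transform_within_open[OF _ S(1,2)]) (simp add: Vd)
 have vc: "vel g t c = v" by (rule velocity_eq[where c=c and g=g and t=t]) (use c td x in auto)
 have vd: "vel g t d = DT c d ?A v"
  by (rule velocity_eq[where c=d and g=g and t=t, OF c(2) td(2) velocity_chart[OF S c x]])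
 have T: "transition c d ?A = cmap d (g t)" by (rule transition_cmap[OF c(1) td(1)])
 show "cvd g V t d = DT c d ?A (cvd g V t c)"
  unfolding cov_deriv_eq[where c=d and g=g and t=t and V=V, OF c(2) td(2) 1] cov_deriv_eq[where c=c and g=g and t=t and V=V, OF c(1) td(1) V] vc vd
   linear_add[OF DT_has_derivative(3)[OF c p]] Gam_DT[OF c p] T Vd[OF S(2)] by simp
qed

section \<open>Geodesics in charts\<close>

lemma geodesic_continuous: "complete_geodesic M g ==> continuous_map euclideanreal X g"
 by (simp add: complete_geodesic_def)

lemma geodesic_chart:
 assumes g: "complete_geodesic M g" and c: "c \<in> \<A>" and t: "g t \<in> cdom c"
 shows "((%s. cmap c (g s)) has_vector_derivative vel g t c) (at t)"
  and "((%s. vel g s c) has_vector_derivative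
    - Gam c (cmap c (g t)) (vel g t c) (vel g t c)) (at t)"
  and "ip c (cmap c (g t)) (vel g t c) (vel g t c) = 1"
  and "d \<in> \<A> ==> g t \<in> cdom d ==> vel g t d = DT c d (cmap c (g t)) (vel g t c)"
proof -
 let ?A = "tnm (g t) (vel g t)"
 have C: "C1_along M UNIV g (vel g)" using g by (simp add: complete_geodesic_def)
 have x: "((%s. cmap c (g s)) has_vector_derivative vel g t c) (at t)"
  if "c \<in> \<A>" "g t \<in> cdom c" for c
 proof -
  have "(cmap c \<circ> g) differentiable (at t)"
   using C that unfolding C1_along_def C1_differentiable_on_eq by auto
  thus ?thesis using that vector_derivative_works by (auto simp: velocity_def o_def)
 qed
 show "((%s. cmap c (g s)) has_vector_derivative vel g t c) (at t)" by (rule x[OF c t])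
 have "(%s. vel g s c) differentiable (at t)"
  using C c t unfolding C1_along_def C1_differentiable_on_eq by auto
 hence v: "((%s. vel g s c) has_vector_derivative vector_derivative (%s. vel g s c) (at t)) (at t)"
  using vector_derivative_works by blast
 have "cvd g (vel g) t c = 0" using g by (simp add: complete_geodesic_def)
 hence "vector_derivative (%s. vel g s c) (at t) = - Gam c (cmap c (g t)) (vel g t c) (vel g t c)"
  unfolding cov_deriv_eq[where c=c and g=g and t=t and V="vel g", OF c t v] by (simp add: eq_neg_iff_add_eq_0)
 thus "((%s. vel g s c) has_vector_derivative
    - Gam c (cmap c (g t)) (vel g t c) (vel g t c)) (at t)" using v by simp
 have tr: "vel g t d = DT c d (cmap c (g t)) (vel g t c)" if d: "d \<in> \<A>" "g t \<in> cdom d" for d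
 proof -
  have "open ({s. g s \<in> cdom c} \<inter> {s. g s \<in> cdom d})"
   using cont_open[OF geodesic_continuous[OF g] c] cont_open[OF geodesic_continuous[OF g] d(1)] by (rule open_Int)
  hence "((%s. cmap d (g s)) has_vector_derivative DT c d (cmap c (g t)) (vel g t c)) (at t)"
   using c t d by (intro velocity_chart[OF _ _ _ _ _ x]) auto
  thus ?thesis by (rule velocity_eq[where c=d and g=g and t=t, OF d])
 qed
 thus "d \<in> \<A> ==> g t \<in> cdom d ==> vel g t d = DT c d (cmap c (g t)) (vel g t c)" .
 have "?A = sqrt (ip c (cmap c (g t)) (vel g t c) (vel g t c))"
  by (rule tangent_norm_chart[OF c t]) (rule tr)
 moreover have "?A = 1" using g by (simp add: complete_geodesic_def)
 ultimately show "ip c (cmap c (g t)) (vel g t c) (vel g t c) = 1" by simp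
qed

text \<open>One chart around each time is enough: \<open>Gam_DT\<close> carries the geodesic
  equation to all others. Shifts, reversals and limits of geodesics are recognized as geodesics in
  this way.\<close>

lemma complete_geodesicI:
 assumes cont: "continuous_map euclideanreal X g"
  and loc: "!!t. EX c S v. c \<in> \<A> & open S & t \<in> S & (ALL s:S. g s \<in> cdom c &
   ((%s. cmap c (g s)) has_vector_derivative v s) (at s) &
   (v has_vector_derivative - Gam c (cmap c (g s)) (v s) (v s)) (at s) &
   ip c (cmap c (g s)) (v s) (v s) = 1)"
 shows "complete_geodesic M g"
proof -
 let ?V = "vel g"
 have main: "((%s. cmap d (g s)) has_vector_derivative ?V t d) (at t) &
   ((%s. ?V s d) has_vector_derivative - Gam d (cmap d (g t)) (?V t d) (?V t d)) (at t) &
   ip d (cmap d (g t)) (?V t d) (?V t d) = 1" if d: "d \<in> \<A>" "g t \<in> cdom d" for d t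
 proof -
  obtain c S v where L: "c \<in> \<A>" "open S" "t \<in> S" and L': "ALL s:S. g s \<in> cdom c &
   ((%s. cmap c (g s)) has_vector_derivative v s) (at s) &
   (v has_vector_derivative - Gam c (cmap c (g s)) (v s) (v s)) (at s) &
   ip c (cmap c (g s)) (v s) (v s) = 1"
   using loc[of t] by (elim exE conjE) (rule that)
  note S = L L'[rule_format, THEN conjunct1] L'[rule_format, THEN conjunct2, THEN conjunct1]
   L'[rule_format, THEN conjunct2, THEN conjunct2, THEN conjunct1]
   L'[rule_format, THEN conjunct2, THEN conjunct2, THEN conjunct2]
  define R where "R = S \<inter> {s. g s \<in> cdom d}"
  have R: "open R" "t \<in> R" "!!s. s \<in> R ==> g s \<in> cdom c \<inter> cdom d" "R <= S"
   using S d cont_open[OF cont d(1)] by (auto simp: R_def)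
  have vc: "?V s c = v s" if "s \<in> R" for s
   using that R(3)[of s] R(4) S(1,5) by (intro velocity_eq) auto
  have D: "((%s. cmap d (g s)) has_vector_derivative DT c d (cmap c (g s)) (v s)) (at s)" if "s \<in> R" for s
   using that R S(5) by (intro velocity_chart[OF R(1) that R(3) S(1) d(1)]) auto
  have vd: "?V s d = DT c d (cmap c (g s)) (?V s c)" if "s \<in> R" for s
   unfolding vc[OF that] using that R(3)[of s] D[OF that] d by (intro velocity_eq) auto
  have tS: "t \<in> S" using R by auto
  have Vc: "((%s. ?V s c) has_vector_derivative - Gam c (cmap c (g t)) (v t) (v t)) (at t)"
   by (rule has_vector_derivative_transform_within_open[OF S(6)[OF tS] R(1,2)]) (simp add: vc)
  note cd = cov_deriv_chart[OF R(1-3) S(1) d(1) S(5)[OF tS] Vc vd]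
  have p: "cmap c (g t) \<in> overlap c d" using R by (auto simp: overlap_def)
  have T: "transition c d (cmap c (g t)) = cmap d (g t)" using transition_cmap[OF S(1)] R by auto
  have "D2T c d (cmap c (g t)) (v t) (?V t c) + DT c d (cmap c (g t)) (- Gam c (cmap c (g t)) (v t) (v t))
   = - Gam d (cmap d (g t)) (?V t d) (?V t d)"
   unfolding linear_neg[OF DT_has_derivative(3)[OF S(1) d(1) p]] Gam_DT[OF S(1) d(1) p] T vd[OF R(2)] vc[OF R(2)] by simp
  hence "((%s. ?V s d) has_vector_derivative - Gam d (cmap d (g t)) (?V t d) (?V t d)) (at t)"
   using cd(1) by simp
  moreover have "((%s. cmap d (g s)) has_vector_derivative ?V t d) (at t)"
   using D[OF R(2)] vd[OF R(2)] vc[OF R(2)] by simp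
  moreover have "ip d (cmap d (g t)) (?V t d) (?V t d) = 1"
   using metric_DT[OF S(1) d(1) p, of "v t" "v t"] S(7)[OF tS] unfolding T vd[OF R(2)] vc[OF R(2)] by simp
  ultimately show ?thesis by blast
 qed
 have contV: "continuous_on {t. g t \<in> cdom c} (%s. ?V s c)" if "c \<in> \<A>" for c
  using main[OF that] has_vector_derivative_continuous by (intro continuous_at_imp_continuous_on) blast
 have contG: "continuous_on {t. g t \<in> cdom c} (%t. - Gam c (cmap c (g t)) (?V t c) (?V t c))" if c: "c \<in> \<A>" for c
 proof (intro continuous_at_imp_continuous_on ballI continuous_minus)
  fix t assume t: "t \<in> {t. g t \<in> cdom c}"
  have "((%s. Gam c (cmap c (g s)) (?V s c) (?V s c)) has_vector_derivative
   (dGam c (cmap c (g t)) (?V t c) (?V t c) (?V t c) + Gam c (cmap c (g t)) (- Gam c (cmap c (g t)) (?V t c) (?V t c)) (?V t c)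
    + Gam c (cmap c (g t)) (?V t c) (- Gam c (cmap c (g t)) (?V t c) (?V t c)))) (at t)"
   using main[OF c] t by (intro Gam_vd[OF c cont_open[OF cont c] t]) auto
  thus "isCont (%t. Gam c (cmap c (g t)) (?V t c) (?V t c)) t" by (rule has_vector_derivative_continuous)
 qed
 have "C1_along M UNIV g ?V"
  unfolding C1_along_def C1_differentiable_on_def
 proof (intro ballI conjI exI)
  fix c assume c: "c \<in> \<A>"
  show "(cmap c \<circ> g has_vector_derivative ?V t c) (at t)" if "t \<in> {t \<in> UNIV. g t \<in> cdom c}" for t
   using main[OF c] that by (simp add: o_def)
  show "continuous_on {t \<in> UNIV. g t \<in> cdom c} (%t. ?V t c)" using contV[OF c] by simp
  show "((%t. ?V t c) has_vector_derivative - Gam c (cmap c (g t)) (?V t c) (?V t c)) (at t)" if "t \<in> {t \<in> UNIV. g t \<in> cdom c}" for t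
   using main[OF c] that by simp
  show "continuous_on {t \<in> UNIV. g t \<in> cdom c} (%t. - Gam c (cmap c (g t)) (?V t c) (?V t c))" using contG[OF c] by simp
 qed
 moreover have "tnm (g t) (?V t) = 1" for t
 proof -
  define d where "d = (SOME d. d \<in> \<A> & g t \<in> cdom d)"
  obtain c where c: "c \<in> \<A>" "g t \<in> cdom c" using loc[of t] by (elim exE conjE) (rule that, auto)
  have d: "d \<in> \<A> & g t \<in> cdom d" unfolding d_def by (rule someI[of _ c]) (use c in auto)
  thus ?thesis unfolding tangent_norm_def Let_def d_def[symmetric] ip_def[symmetric] using main by simp
 qed
 moreover have "cvd g ?V t = (%_. 0)" for t
 proof
  fix c show "cvd g ?V t c = 0"
  proof (cases "c \<in> \<A> & g t \<in> cdom c")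
   case True
   hence "((%s. ?V s c) has_vector_derivative - Gam c (cmap c (g t)) (?V t c) (?V t c)) (at t)" using main by blast
   thus ?thesis using True by (simp add: cov_deriv_eq[where c=c and V="?V"])
  qed (auto simp: cov_deriv_def)
 qed
 ultimately show ?thesis using cont by (simp add: complete_geodesic_def)
qed

end

section \<open>Uniform constants over finite families and compact sets\<close>

lemma finite_uniform_small:
 assumes "finite I" "!!i. i \<in> I ==> EX d>0. P i d" "!!i d d'. i \<in> I ==> P i d ==> 0 < d' ==> d' <= d ==> P i d'"
 shows "EX d>0::real. ALL i:I. P i d"
 using assms
proof (induction I rule: finite_induct)
 case (insert i I)
 have "EX d>0. ALL i:I. P i d" by (rule insert.IH) (use insert.prems in auto)
 then obtain d1 where d1: "d1 > 0" "ALL i:I. P i d1" by auto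
 obtain d2 where d2: "d2 > 0" "P i d2" using insert.prems(1)[of i] by auto
 have "P j (min d1 d2)" if "j \<in> insert i I" for j
 proof (cases "j = i")
  case True thus ?thesis using insert.prems(2)[of i d2 "min d1 d2"] d1 d2 by simp
 next
  case False thus ?thesis using insert.prems(2)[of j d1 "min d1 d2"] d1 d2 that by simp
 qed
 thus ?case using d1 d2 by (intro exI[of _ "min d1 d2"]) simp
qed (auto intro: exI[of _ 1])

lemma finite_uniform_large:
 assumes "finite I" "!!i. i \<in> I ==> EX B. P i B" "!!i B B'. i \<in> I ==> P i B ==> B <= B' ==> P i B'"
 shows "EX B::real. B >= b & (ALL i:I. P i B)"
 using assms
proof (induction I rule: finite_induct)
 case (insert i I)
 have "EX B>=b. ALL i:I. P i B" by (rule insert.IH) (use insert.prems in auto)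
 then obtain d1 where d1: "d1 >= b" "ALL i:I. P i d1" by auto
 obtain d2 where d2: "P i d2" using insert.prems(1)[of i] by auto
 have "P j (max d1 d2)" if "j \<in> insert i I" for j
 proof (cases "j = i")
  case True thus ?thesis using insert.prems(2)[of i d2 "max d1 d2"] d1 d2 by simp
 next
  case False thus ?thesis using insert.prems(2)[of j d1 "max d1 d2"] d1 d2 that by simp
 qed
 thus ?case using d1 d2 by (intro exI[of _ "max d1 d2"]) auto
qed auto

lemma continuous_compact_bound:
 fixes f :: "'b::topological_space => real"
 assumes "continuous_on S f" "compact S" shows "EX B. ALL x:S. \<bar>f x\<bar> <= B"
 using compact_imp_bounded[OF compact_continuous_image[OF assms]] by (auto simp: bounded_iff)

lemma norm_bilinear_bound:
 fixes a :: "2 => 2 => 2 => real"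
 assumes "!!k i j. \<bar>a k i j\<bar> <= B"
 shows "norm (\<chi> k. \<Sum>i\<in>UNIV. \<Sum>j\<in>UNIV. a k i j*u$i*w$j) <= 8*B*norm (u::real^2)*norm (w::real^2)"
proof -
 have B: "B >= 0" using assms[of 1 1 1] by linarith
 have 1: "\<bar>a k i j*u$i*w$j\<bar> <= B*norm u*norm w" for k i j
  using assms[of k i j] component_le_norm_cart[of u i] component_le_norm_cart[of w j] B
  unfolding abs_mult by (intro mult_mono mult_nonneg_nonneg) auto
 have 2: "\<bar>\<Sum>i\<in>UNIV. \<Sum>j\<in>UNIV. a k i j*u$i*w$j\<bar> <= 4*(B*norm u*norm w)" for k
  using 1[of k 1 1] 1[of k 1 2] 1[of k 2 1] 1[of k 2 2] unfolding sum_2 by linarith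
 have "norm (\<chi> k. \<Sum>i\<in>UNIV. \<Sum>j\<in>UNIV. a k i j*u$i*w$j) <= (\<Sum>k\<in>UNIV. \<bar>\<Sum>i\<in>UNIV. \<Sum>j\<in>UNIV. a k i j*u$i*w$j\<bar>)"
  using norm_le_l1_cart[of "\<chi> k. \<Sum>i\<in>UNIV. \<Sum>j\<in>UNIV. a k i j*u$i*w$j"] by simp
 also have "... <= 8*(B*norm u*norm w)" using 2[of 1] 2[of 2] by (simp add: sum_2)
 finally show ?thesis by (simp add: mult.assoc)
qed

section \<open>Boxes\<close>

text \<open>A box \<open>(c, p, r)\<close> is a chart \<open>c\<close> whose image contains the part of the closed disc of radius \<open>3 r\<close>
around \<open>p\<close> that lies in the half-plane.\<close>

type_synonym 'b box = "'b chart \<times> (real^2) \<times> real"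

abbreviation bch :: "'b box => 'b chart" where "bch b \<equiv> fst b"
abbreviation bpt :: "'b box => real^2" where "bpt b \<equiv> fst (snd b)"
abbreviation brad :: "'b box => real" where "brad b \<equiv> snd (snd b)"

definition Kb :: "'b box => (real^2) set" where "Kb b = cball (bpt b) (3*brad b) \<inter> half_plane"

text \<open>Three sizes are used: the sets \<open>inn 1 b\<close> cover the surface, geodesics start
  in \<open>inn 2 b\<close>, and within time \<open>4 * T\<close> they stay in
  \<open>inn 3 b\<close>, whose image lies in the compact set \<open>Kb b\<close>.\<close>

definition inn :: "real => 'b box => 'b set" where
 "inn k b = {y \<in> cdom (bch b). dist (cmap (bch b) y) (bpt b) <= k*brad b}"

lemma Kb_compact: "compact (Kb b)" "convex (Kb b)"
 unfolding Kb_def by (auto intro!: compact_Int_closed closed_half_plane convex_Int convex_half_plane)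

context riem begin

definition valid_box :: "'a box => bool" where
 "valid_box b \<longleftrightarrow> bch b \<in> \<A> & brad b > 0 & Kb b <= cimg (bch b)"

lemma ip_bounds:
 assumes b: "valid_box b"
 shows "EX C. ALL q:Kb b. ALL u. (norm u)^2 <= C*ip (bch b) q u u & ip (bch b) q u u <= C*(norm u)^2"
proof -
 let ?c = "bch b"
 have c: "?c \<in> \<A>" and K: "Kb b <= cimg ?c" using b by (auto simp: valid_box_def)
 define S where "S = Kb b \<times> sphere (0::real^2) 1"
 have S: "compact S" unfolding S_def by (intro compact_Times Kb_compact) simp
 have gc: "continuous_on S (%z. gm ?c (fst z) $ i $ j)" for i j
  by (rule continuous_on_compose2[OF C1_onD(2)[OF metric_C1(1)[OF c]]]) (use K in \<open>auto simp: S_def intro!: continuous_intros\<close>)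
 have cont: "continuous_on S (%z. ip ?c (fst z) (snd z) (snd z))"
  unfolding ip_expand by (intro continuous_intros gc)
 obtain B where B: "!!z. z \<in> S ==> \<bar>ip ?c (fst z) (snd z) (snd z)\<bar> <= B"
  using continuous_compact_bound[OF cont S] by blast
 have pos: "ip ?c (fst z) (snd z) (snd z) > 0" if "z \<in> S" for z
  by (rule metric_pos[OF c]) (use that K in \<open>auto simp: S_def\<close>)
 have "continuous_on S (%z. inverse (ip ?c (fst z) (snd z) (snd z)))"
  by (intro continuous_on_inverse cont) (use pos in fastforce)
 then obtain B' where B': "!!z. z \<in> S ==> \<bar>inverse (ip ?c (fst z) (snd z) (snd z))\<bar> <= B'"
  using continuous_compact_bound[OF _ S] by blast
 define C where "C = max B B'"
 have "(norm u)^2 <= C*ip ?c q u u & ip ?c q u u <= C*(norm u)^2" if q: "q \<in> Kb b" for q u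
 proof (cases "u = 0")
  case False
  define e where "e = u /\<^sub>R norm u"
  have u: "u = norm u *\<^sub>R e" using False by (simp add: e_def)
  have z: "(q, e) \<in> S" using False q by (auto simp: S_def e_def)
  have i: "ip ?c q u u = (norm u)^2*ip ?c q e e" by (subst (1 2) u) (simp add: power2_eq_square)
  have 1: "ip ?c q e e <= C" using B[OF z] by (simp add: C_def)
  have p: "ip ?c q e e > 0" using pos[OF z] by simp
  have "inverse (ip ?c q e e) <= C" using abs_le_D1[OF B'[OF z]] by (simp add: C_def)
  hence 2: "1 <= C*ip ?c q e e" using p by (simp add: field_simps)
  show ?thesis unfolding i using mult_left_mono[OF 1, of "(norm u)^2"] mult_left_mono[OF 2, of "(norm u)^2"]
   by (simp add: mult.commute mult.left_commute)
 qed simp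
 thus ?thesis by blast
qed

lemma christoffel_bound:
 assumes b: "valid_box b"
 shows "EX B. ALL q:Kb b. ALL k i j. \<bar>chr (bch b) k i j q\<bar> <= B"
  and "EX B. ALL q:Kb b. ALL q':Kb b. ALL k i j. \<bar>chr (bch b) k i j q' - chr (bch b) k i j q\<bar> <= B*dist q' q"
proof -
 have c: "bch b \<in> \<A>" and K: "Kb b <= cimg (bch b)" using b by (auto simp: valid_box_def)
 let ?P = "%k i j B. ALL q:Kb b. ALL q':Kb b. \<bar>chr (bch b) k i j q' - chr (bch b) k i j q\<bar> <= B*dist q' q"
 have "EX B>=0. ALL (k, i, j):UNIV. ALL q:Kb b. \<bar>chr (bch b) k i j q\<bar> <= B"
 proof (rule finite_uniform_large)
  show "EX B. case x of (k, i, j) => ALL q:Kb b. \<bar>chr (bch b) k i j q\<bar> <= B" for x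
   by (cases x) (use continuous_compact_bound[OF continuous_on_subset[OF C1_onD(2)[OF christoffel_C1[OF c]] K] Kb_compact(1)] in simp)
 qed (auto dest: order_trans)
 then obtain B where "ALL k i j. ALL q:Kb b. \<bar>chr (bch b) k i j q\<bar> <= B" by auto
 thus "EX B. ALL q:Kb b. ALL k i j. \<bar>chr (bch b) k i j q\<bar> <= B" by blast
 have "EX B>=0. ALL (k, i, j):UNIV. ?P k i j B"
 proof (rule finite_uniform_large)
  show "EX B. case x of (k, i, j) => ?P k i j B" for x
  proof (cases x)
   case (fields k i j)
   show ?thesis unfolding fields prod.case
    using C1_lipschitz_convex[OF christoffel_C1[OF c, of k i j] Kb_compact K] by blast
  qed
 next
  fix x B B' assume 1: "case x of (k, i, j) => ?P k i j B"
   and 2: "B <= (B'::real)"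
  have "B*dist q' q <= B' * dist q' q" for q q' :: "real^2" using 2 by (rule mult_right_mono) simp
  thus "case x of (k, i, j) => ?P k i j B'"
   using 1 order_trans by (cases x) (simp, blast)
 qed auto
 then obtain B where "ALL k i j. ?P k i j B" by auto
 thus "EX B. ALL q:Kb b. ALL q':Kb b. ALL k i j. \<bar>chr (bch b) k i j q' - chr (bch b) k i j q\<bar> <= B*dist q' q" by blast
qed

lemma Gam_bounds:
 assumes b: "valid_box b"
 shows "EX G. ALL q:Kb b. ALL u w. norm (Gam (bch b) q u w) <= G*norm u*norm w"
  and "EX G. ALL q:Kb b. ALL q':Kb b. ALL u w. norm (Gam (bch b) q' u w - Gam (bch b) q u w) <= G*dist q' q*norm u*norm w"
proof -
 let ?c = "bch b"
 obtain B where B: "!!q k i j. q \<in> Kb b ==> \<bar>chr ?c k i j q\<bar> <= B" using christoffel_bound(1)[OF b] by blast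
 have "norm (Gam ?c q u w) <= 8*B*norm u*norm w" if "q \<in> Kb b" for q u w
  unfolding Gam_def by (rule norm_bilinear_bound) (rule B[OF that])
 thus "EX G. ALL q:Kb b. ALL u w. norm (Gam ?c q u w) <= G*norm u*norm w" by blast
 obtain B where B: "!!q q' k i j. q \<in> Kb b ==> q' \<in> Kb b ==> \<bar>chr ?c k i j q' - chr ?c k i j q\<bar> <= B*dist q' q"
  using christoffel_bound(2)[OF b] by blast
 have "norm (Gam ?c q' u w - Gam ?c q u w) <= 8*(B*dist q' q)*norm u*norm w" if "q \<in> Kb b" "q' \<in> Kb b" for q q' u w
 proof -
  have "Gam ?c q' u w - Gam ?c q u w = (\<chi> k. \<Sum>i\<in>UNIV. \<Sum>j\<in>UNIV. (chr ?c k i j q' - chr ?c k i j q)*u$i*w$j)"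
   by (simp add: Gam_def vec_eq_iff sum_2 algebra_simps)
  thus ?thesis by (simp only:) (rule norm_bilinear_bound, rule B[OF that])
 qed
 thus "EX G. ALL q:Kb b. ALL q':Kb b. ALL u w. norm (Gam ?c q' u w - Gam ?c q u w) <= G*dist q' q*norm u*norm w"
  by (intro exI[of _ "8*B"]) (simp add: mult.assoc)
qed

lemma Gam_linearization:
 assumes b: "valid_box b" and e: "e > 0"
 shows "EX d>0. ALL q:Kb b. ALL q':half_plane. dist q' q <= d -->
  (ALL u w. norm (Gam (bch b) q' u w - Gam (bch b) q u w - dGam (bch b) q (q' - q) u w) <= e*dist q' q*norm u*norm w)"
proof -
 let ?c = "bch b"
 have c: "?c \<in> \<A>" and K: "Kb b <= cimg ?c" using b by (auto simp: valid_box_def)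
 let ?E = "%k i j q q'. chr ?c k i j q' - chr ?c k i j q - ((q' - q)$1*partial (cimg ?c) 1 (chr ?c k i j) q
   + (q' - q)$2*partial (cimg ?c) 2 (chr ?c k i j) q)"
 let ?P = "%k i j d. ALL q:Kb b. ALL q':half_plane. dist q' q <= d --> \<bar>?E k i j q q'\<bar> <= e/8*dist q' q"
 have "EX d>0. ALL (k, i, j):UNIV. ?P k i j d"
 proof (rule finite_uniform_small)
  fix x :: "2 \<times> 2 \<times> 2"
  show "EX d>0. case x of (k, i, j) => ?P k i j d"
  proof (cases x)
   case (fields k i j)
   have "e/8 > 0" using e by simp
   from C1_uniform_linearization[OF relopen_cimg[OF c] christoffel_C1[OF c] Kb_compact(1) K this]
   show ?thesis unfolding fields prod.case by blast
  qed
 next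
  fix x d d' assume 1: "case x of (k, i, j) => ?P k i j d" and 2: "d' <= (d::real)"
  have "dist q' q <= d' ==> dist q' q <= d" for q q' :: "real^2" using 2 by simp
  show "case x of (k, i, j) => ?P k i j d'"
  proof (cases x)
   case (fields k i j)
   show ?thesis using 1 unfolding fields prod.case using \<open>!!q' q :: real^2. dist q' q <= d' ==> dist q' q <= d\<close> by blast
  qed
 qed simp
 then obtain d where "d > 0" "ALL k i j. ?P k i j d" by auto
 hence d: "d > 0" "!!k i j q q'. q \<in> Kb b ==> q' \<in> half_plane ==> dist q' q <= d ==> \<bar>?E k i j q q'\<bar> <= e/8*dist q' q"
  by blast+
 have "norm (Gam ?c q' u w - Gam ?c q u w - dGam ?c q (q' - q) u w) <= e*dist q' q*norm u*norm w"
  if "q \<in> Kb b" "q' \<in> half_plane" "dist q' q <= d" for q q' u w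
 proof -
  have "Gam ?c q' u w - Gam ?c q u w - dGam ?c q (q' - q) u w = (\<chi> k. \<Sum>i\<in>UNIV. \<Sum>j\<in>UNIV. ?E k i j q q' * u$i*w$j)"
   by (simp add: Gam_def dGam_def vec_eq_iff sum_2 algebra_simps)
  hence "norm (Gam ?c q' u w - Gam ?c q u w - dGam ?c q (q' - q) u w) <= 8*(e/8*dist q' q)*norm u*norm w"
   by (simp only:) (rule norm_bilinear_bound, rule d(2)[OF that])
  thus ?thesis by simp
 qed
 thus ?thesis using d(1) by blast
qed

lemma ip_linearization:
 assumes b: "valid_box b" and e: "e > 0"
 shows "EX d>0. ALL q:Kb b. ALL q':half_plane. dist q' q <= d -->
  (ALL u w. \<bar>ip (bch b) q' u w - ip (bch b) q u w - dip (bch b) q (q' - q) u w\<bar> <= e*dist q' q*norm u*norm w)"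
proof -
 let ?c = "bch b"
 have c: "?c \<in> \<A>" and K: "Kb b <= cimg ?c" using b by (auto simp: valid_box_def)
 let ?E = "%i j q q'. gm ?c q' $ i $ j - gm ?c q $ i $ j - ((q' - q)$1*partial (cimg ?c) 1 (%q. gm ?c q $ i $ j) q
   + (q' - q)$2*partial (cimg ?c) 2 (%q. gm ?c q $ i $ j) q)"
 let ?P = "%i j d. ALL q:Kb b. ALL q':half_plane. dist q' q <= d --> \<bar>?E i j q q'\<bar> <= e/4*dist q' q"
 have "EX d>0. ALL (i, j):UNIV. ?P i j d"
 proof (rule finite_uniform_small)
  fix x :: "2 \<times> 2"
  show "EX d>0. case x of (i, j) => ?P i j d"
  proof (cases x)
   case (Pair i j)
   have "e/4 > 0" using e by simp
   from C1_uniform_linearization[OF relopen_cimg[OF c] metric_C1(1)[OF c] Kb_compact(1) K this]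
   show ?thesis unfolding Pair prod.case by blast
  qed
 next
  fix x d d' assume 1: "case x of (i, j) => ?P i j d" and 2: "d' <= (d::real)"
  have "dist q' q <= d' ==> dist q' q <= d" for q q' :: "real^2" using 2 by simp
  show "case x of (i, j) => ?P i j d'"
  proof (cases x)
   case (Pair i j)
   show ?thesis using 1 unfolding Pair prod.case using \<open>!!q' q :: real^2. dist q' q <= d' ==> dist q' q <= d\<close> by blast
  qed
 qed simp
 then obtain d where "d > 0" "ALL i j. ?P i j d" by auto
 hence d: "d > 0" "!!i j q q'. q \<in> Kb b ==> q' \<in> half_plane ==> dist q' q <= d ==> \<bar>?E i j q q'\<bar> <= e/4*dist q' q"
  by blast+
 have "\<bar>ip ?c q' u w - ip ?c q u w - dip ?c q (q' - q) u w\<bar> <= e*dist q' q*norm u*norm w"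
  if q: "q \<in> Kb b" "q' \<in> half_plane" "dist q' q <= d" for q q' u w
 proof -
  have 1: "\<bar>?E i j q q' * u$i*w$j\<bar> <= e/4*dist q' q*norm u*norm w" for i j
   using d(2)[OF q, of i j] component_le_norm_cart[of u i] component_le_norm_cart[of w j] e
   unfolding abs_mult by (intro mult_mono mult_nonneg_nonneg) auto
  have "ip ?c q' u w - ip ?c q u w - dip ?c q (q' - q) u w = (\<Sum>i\<in>UNIV. \<Sum>j\<in>UNIV. ?E i j q q' * u$i*w$j)"
   by (simp add: ip_expand dip_def sum_2 algebra_simps)
  hence "\<bar>ip ?c q' u w - ip ?c q u w - dip ?c q (q' - q) u w\<bar> <= 4*(e/4*dist q' q*norm u*norm w)"
   unfolding sum_2 using 1[of 1 1] 1[of 1 2] 1[of 2 1] 1[of 2 2] by linarith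
  thus ?thesis by simp
 qed
 thus ?thesis using d(1) by blast
qed

lemma curvature_bounds:
 assumes b: "valid_box b" and neg: "negatively_curved M"
 shows "EX k>0. ALL q:Kb b. k <= - gK (bch b) q & - gK (bch b) q <= 1/k"
proof -
 let ?c = "bch b"
 have c: "?c \<in> \<A>" and K: "Kb b <= cimg ?c" using b by (auto simp: valid_box_def)
 have ch: "continuous_on (Kb b) (chr ?c k i j)" "continuous_on (Kb b) (partial (cimg ?c) l (chr ?c k i j))" for k i j l
  using C1_onD(2,3)[OF christoffel_C1[OF c]] continuous_on_subset K by blast+
 have g: "continuous_on (Kb b) (%q. gm ?c q $ i $ j)" for i j
  using C1_onD(2)[OF metric_C1(1)[OF c]] continuous_on_subset K by blast
 have det: "det (gm ?c q) = gdet ?c q" for q by (simp add: det_2 gdet_def)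
 have 1: "continuous_on (Kb b) (%q. - gK ?c q)"
  unfolding gauss_curvature_def riemann_def det
 proof (intro continuous_on_divide continuous_on_minus)
  show "continuous_on (Kb b) (gdet ?c)" unfolding gdet_def[abs_def]
   by (intro continuous_on_diff continuous_on_mult g)
  show "ALL q:Kb b. gdet ?c q ~= 0" using gdet_pos[OF c] K by fastforce
  show "continuous_on (Kb b) (%q. \<Sum>l\<in>UNIV. gm ?c q $ 1 $ l *
   (partial (cimg ?c) 1 (chr ?c l 2 2) q - partial (cimg ?c) 2 (chr ?c l 1 2) q +
    (\<Sum>m\<in>UNIV. chr ?c l 1 m q * chr ?c m 2 2 q - chr ?c l 2 m q * chr ?c m 1 2 q)))"
   by (intro continuous_on_sum continuous_on_add continuous_on_diff continuous_on_mult g ch)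
 qed
 have pos: "- gK ?c q > 0" if "q \<in> Kb b" for q
  using neg that K c unfolding negatively_curved_def by auto
 have "continuous_on (Kb b) (%q. inverse (- gK ?c q))"
  by (rule continuous_on_inverse[OF 1]) (use pos in fastforce)
 with 1 obtain B1 B2 where B: "!!q. q \<in> Kb b ==> \<bar>inverse (- gK ?c q)\<bar> <= B1" "!!q. q \<in> Kb b ==> \<bar>- gK ?c q\<bar> <= B2"
  using continuous_compact_bound[OF _ Kb_compact(1)] by metis
 define k where "k = 1/max 1 (max B1 B2)"
 have "k <= - gK ?c q & - gK ?c q <= 1/k" if q: "q \<in> Kb b" for q
 proof
  show "- gK ?c q <= 1/k" using B(2)[OF q] by (simp add: k_def)
  have "inverse (- gK ?c q) <= max 1 (max B1 B2)" using abs_le_D1[OF B(1)[OF q]] by linarith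
  thus "k <= - gK ?c q" unfolding k_def using pos[OF q]
   by (simp add: field_simps)
 qed
 moreover have "k > 0" by (simp add: k_def)
 ultimately show ?thesis by blast
qed

end

section \<open>Gronwall's inequality, time shifts and reversals\<close>

lemma gronwall_pos:
 fixes z :: "real => 'e::real_inner"
 assumes D: "!!t. 0 <= t ==> t <= T ==> (z has_vector_derivative z' t) (at t)"
  and L: "!!t. 0 <= t ==> t <= T ==> norm (z' t) <= L*norm (z t)" and T: "0 <= T"
 shows "norm (z T) <= exp (L*T)*norm (z 0)"
proof -
 define f where "f t = exp (- 2*L*t)*(z t \<bullet> z t)" for t
 have "f T <= f 0"
 proof (rule DERIV_nonpos_imp_nonincreasing[OF T])
  fix t assume t: "0 <= t" "t <= T"
  have zz: "((%t. z t \<bullet> z t) has_real_derivative (z t \<bullet> z' t + z' t \<bullet> z t)) (at t)"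
   using has_derivative_inner[OF D[OF t, unfolded has_vector_derivative_def] D[OF t, unfolded has_vector_derivative_def]]
   unfolding has_field_derivative_def by (rule has_derivative_eq_rhs) (simp add: fun_eq_iff algebra_simps)
  have "(f has_real_derivative (exp (- 2*L*t)*(- 2*L)*(z t \<bullet> z t) + exp (- 2*L*t)*(z t \<bullet> z' t + z' t \<bullet> z t))) (at t)"
   unfolding f_def by (rule derivative_eq_intros zz refl | simp)+
  moreover have "exp (- 2*L*t)*(- 2*L)*(z t \<bullet> z t) + exp (- 2*L*t)*(z t \<bullet> z' t + z' t \<bullet> z t) <= 0"
  proof -
   have "z t \<bullet> z' t <= norm (z t)*norm (z' t)" by (rule norm_cauchy_schwarz)
   also have "... <= norm (z t)*(L*norm (z t))" by (intro mult_left_mono L t) simp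
   also have "... = L*(z t \<bullet> z t)" by (simp add: power2_norm_eq_inner[symmetric] power2_eq_square)
   finally have "- 2*L*(z t \<bullet> z t) + (z t \<bullet> z' t + z' t \<bullet> z t) <= 0" by (simp add: inner_commute)
   hence "exp (- 2*L*t)*(- 2*L*(z t \<bullet> z t) + (z t \<bullet> z' t + z' t \<bullet> z t)) <= 0"
    by (intro mult_nonneg_nonpos) auto
   thus ?thesis by (simp add: algebra_simps)
  qed
  ultimately show "EX y. (f has_real_derivative y) (at t) & y <= 0" by blast
 qed
 hence "exp (- (2*L*T))*(norm (z T))^2 <= (norm (z 0))^2" by (simp add: f_def power2_norm_eq_inner)
 hence "exp (2*L*T)*(exp (- (2*L*T))*(norm (z T))^2) <= exp (2*L*T)*(norm (z 0))^2"
  by (rule mult_left_mono) simp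
 hence "(norm (z T))^2 <= exp (2*L*T)*(norm (z 0))^2" by (simp add: mult.assoc[symmetric] exp_add[symmetric])
 also have "... = (exp (L*T)*norm (z 0))^2"
  by (simp add: power_mult_distrib power2_eq_square exp_add[symmetric])
 finally show ?thesis by (rule power2_le_imp_le) simp
qed

lemma has_vector_derivative_affine:
 fixes x :: "real => 'b::real_normed_vector"
 assumes "(x has_vector_derivative v) (at (s*t + a))"
 shows "((%t. x (s*t + a)) has_vector_derivative s *\<^sub>R v) (at t)"
proof -
 have "((%t. s*t + a) has_vector_derivative s) (at t)"
  by (auto intro!: derivative_eq_intros simp: has_real_derivative_iff_has_vector_derivative[symmetric])
 from vector_diff_chain_at[OF this assms] show ?thesis by (simp add: o_def)
qed

lemma gronwall:
 fixes z :: "real => 'e::real_inner"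
 assumes D: "!!t. \<bar>t\<bar> <= T ==> (z has_vector_derivative z' t) (at t)"
  and L: "!!t. \<bar>t\<bar> <= T ==> norm (z' t) <= L*norm (z t)" and t: "\<bar>t\<bar> <= T"
 shows "norm (z t) <= exp (L*\<bar>t\<bar>)*norm (z 0)"
proof (cases "0 <= t")
 case True
 thus ?thesis using gronwall_pos[of t z z' L] D L t by auto
next
 case False
 have "norm (z (- 1*(- t) + 0)) <= exp (L * - t)*norm (z (- 1*0 + 0))"
 proof (rule gronwall_pos[where z="%t. z (- 1*t + 0)" and z'="%t. - 1 *\<^sub>R z' (- 1*t + 0)"])
  show "((%t. z (- 1*t + 0)) has_vector_derivative - 1 *\<^sub>R z' (- 1 * s + 0)) (at s)" if "0 <= s" "s <= - t" for s
   by (rule has_vector_derivative_affine) (rule D, use that t in auto)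
  show "norm (- 1 *\<^sub>R z' (- 1 * s + 0)) <= L*norm (z (- 1 * s + 0))" if "0 <= s" "s <= - t" for s
   using L[of "-s"] that t by auto
 qed (use False in auto)
 thus ?thesis using False by simp
qed

definition sh :: "(real => 'b) => real => real => 'b" where "sh g a = (%t. g (t + a))"
definition rv :: "(real => 'b) => real => 'b" where "rv g = (%t. g (- t))"

lemma sh_sh [simp]: "sh (sh g a) b = sh g (a + b)" "sh g 0 = g"
 by (simp_all add: sh_def fun_eq_iff algebra_simps)

lemma sh_rv: "sh (rv g) a = rv (sh g (- a))" "rv (rv g) = g"
 by (simp_all add: sh_def rv_def fun_eq_iff algebra_simps)

lemma sh_apply: "sh g a t = g (t + a)" "rv g t = g (- t)"
 by (simp_all add: sh_def rv_def)

context riem begin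

lemma geodesic_affine:
 assumes g: "complete_geodesic M g" and s: "s = 1 \<or> s = - 1"
 shows "complete_geodesic M (%t. g (s*t + a))"
  and "vel (%t. g (s*t + a)) t c = s *\<^sub>R vel g (s*t + a) c"
proof -
 let ?g = "%t. g (s*t + a)"
 have cont: "continuous_map euclideanreal X ?g"
  using continuous_map_compose[of euclideanreal euclideanreal "%t. s*t + a" X g] geodesic_continuous[OF g]
  by (simp add: o_def continuous_intros)
 have x: "((%t. cmap c (?g t)) has_vector_derivative s *\<^sub>R vel g (s*t + a) c) (at t)"
  if "c \<in> \<A>" "?g t \<in> cdom c" for c t
  by (rule has_vector_derivative_affine[OF geodesic_chart(1)[OF g that]])
 have v: "((%t. s *\<^sub>R vel g (s*t + a) c) has_vector_derivative
  - Gam c (cmap c (?g t)) (s *\<^sub>R vel g (s*t + a) c) (s *\<^sub>R vel g (s*t + a) c)) (at t)"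
  if "c \<in> \<A>" "?g t \<in> cdom c" for c t
 proof -
  have "((%t. s *\<^sub>R vel g (s*t + a) c) has_vector_derivative
   s *\<^sub>R (s *\<^sub>R - Gam c (cmap c (?g t)) (vel g (s*t + a) c) (vel g (s*t + a) c))) (at t)"
   by (intro bounded_linear.has_vector_derivative[OF bounded_linear_scaleR_right] has_vector_derivative_affine geodesic_chart(2)[OF g that])
  thus ?thesis using s by auto
 qed
 show "complete_geodesic M ?g"
 proof (rule complete_geodesicI[OF cont])
  fix t
  have "?g t \<in> topspace X" using cont by (auto simp: continuous_map_def)
  then obtain c where c: "c \<in> \<A>" "?g t \<in> cdom c" using charts_cover by blast
  let ?S = "{t. ?g t \<in> cdom c}"
  have "ALL r:?S. ?g r \<in> cdom c & ((%s. cmap c (?g s)) has_vector_derivative s *\<^sub>R vel g (s*r + a) c) (at r) &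
   ((%t. s *\<^sub>R vel g (s*t + a) c) has_vector_derivative
    - Gam c (cmap c (?g r)) (s *\<^sub>R vel g (s*r + a) c) (s *\<^sub>R vel g (s*r + a) c)) (at r) &
   ip c (cmap c (?g r)) (s *\<^sub>R vel g (s*r + a) c) (s *\<^sub>R vel g (s*r + a) c) = 1"
   using x v geodesic_chart(3)[OF g] c(1) s by auto
  thus "EX c S v. c \<in> \<A> & open S & t \<in> S & (ALL s:S. ?g s \<in> cdom c &
   ((%s. cmap c (?g s)) has_vector_derivative v s) (at s) &
   (v has_vector_derivative - Gam c (cmap c (?g s)) (v s) (v s)) (at s) &
   ip c (cmap c (?g s)) (v s) (v s) = 1)"
   using c cont_open[OF cont c(1)] by (intro exI[of _ c] exI[of _ ?S] exI[of _ "%t. s *\<^sub>R vel g (s*t + a) c"]) simp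
 qed
 show "vel ?g t c = s *\<^sub>R vel g (s*t + a) c"
 proof (cases "c \<in> \<A> & ?g t \<in> cdom c")
  case True
  thus ?thesis by (intro velocity_eq[where c=c and g="?g" and t=t] x) auto
 next
  case False
  thus ?thesis unfolding velocity_def if_not_P[OF False] by simp
 qed
qed

lemma geodesic_sh:
 assumes "complete_geodesic M g"
 shows "complete_geodesic M (sh g a)" "vel (sh g a) t = vel g (t + a)"
 using geodesic_affine[OF assms, of 1 a] by (auto simp: sh_def fun_eq_iff)

lemma geodesic_rv:
 assumes "complete_geodesic M g"
 shows "complete_geodesic M (rv g)" "vel (rv g) t c = - vel g (- t) c"
 using geodesic_affine[OF assms, of "- 1" 0] by (auto simp: rv_def)

lemma line_of_neg: "line_of (%c. - \<xi> c) = line_of (\<xi> :: 'a tvec)"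
proof -
 have "(%c. r *\<^sub>R - \<xi> c) = (%c. (- r) *\<^sub>R \<xi> c)" "(%c. r *\<^sub>R \<xi> c) = (%c. (- r) *\<^sub>R - \<xi> c)" for r by auto
 thus ?thesis unfolding line_of_def by blast
qed

lemma simple_sh:
 assumes "simple_complete_geodesic M g"
 shows "simple_complete_geodesic M (sh g a)" "range (sh g a) = range g"
proof -
 have g: "complete_geodesic M g"
  and s: "g s = g t ==> line_of (vel g s) = line_of (vel g t)" for s t
  using assms unfolding simple_complete_geodesic_def by blast+
 show "simple_complete_geodesic M (sh g a)"
  unfolding simple_complete_geodesic_def geodesic_sh(2)[OF g] sh_apply
  using geodesic_sh(1)[OF g, unfolded sh_def] s by blast
 have "surj (%t::real. t + a)" by (rule surjI[of _ "%t. t - a"]) simp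
 moreover have "range (sh g a) = g ` range (%t. t + a)" unfolding sh_def by (simp only: image_image)
 ultimately show "range (sh g a) = range g" by (simp only:)
qed

lemma simple_rv:
 assumes "simple_complete_geodesic M g"
 shows "simple_complete_geodesic M (rv g)" "range (rv g) = range g"
proof -
 have g: "complete_geodesic M g"
  and s: "g s = g t ==> line_of (vel g s) = line_of (vel g t)" for s t
  using assms unfolding simple_complete_geodesic_def by blast+
 have v: "vel (rv g) t = (%c. - vel g (- t) c)" for t
  using geodesic_rv(2)[OF g] by (rule ext)
 show "simple_complete_geodesic M (rv g)"
  unfolding simple_complete_geodesic_def v line_of_neg sh_apply
  using geodesic_rv(1)[OF g, unfolded rv_def] s by blast
 have "surj (%t::real. - t)" by (rule surjI[of _ "%t. - t"]) simp
 moreover have "range (rv g) = g ` range (%t. - t)" unfolding rv_def by (simp only: image_image)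
 ultimately show "range (rv g) = range g" by (simp only:)
qed

lemma inn_mono: "valid_box b ==> k <= k' ==> inn k b <= inn k' b"
 unfolding inn_def valid_box_def by (auto intro: order_trans mult_right_mono)

lemma inn_Kb: "valid_box b ==> y \<in> inn k b ==> k <= 3 ==> cmap (bch b) y \<in> Kb b"
proof -
 assume b: "valid_box b" and y: "y \<in> inn k b" and k: "k <= 3"
 have "y \<in> inn 3 b" using inn_mono[OF b k] y by auto
 moreover have "cmap (bch b) y \<in> half_plane"
  using y b relopen_subset[OF relopen_cimg[of "bch b"]] by (auto simp: inn_def valid_box_def)
 ultimately show ?thesis by (auto simp: inn_def Kb_def dist_commute)
qed

lemma inn_closed:
 assumes b: "valid_box b" and k: "k <= 3" shows "compactin X (inn k b)" "closedin X (inn k b)"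
proof -
 let ?c = "bch b" and ?D = "cball (bpt b) (k*brad b) \<inter> half_plane"
 let ?A = "subtopology X (cdom ?c)"
 have c: "?c \<in> \<A>" using b by (simp add: valid_box_def)
 have sub: "?D <= cimg ?c"
 proof -
  have "k*brad b <= 3*brad b" using b k by (intro mult_right_mono) (auto simp: valid_box_def)
  hence "?D <= Kb b" unfolding Kb_def by (intro Int_mono subset_cball) auto
  thus ?thesis using b unfolding valid_box_def by blast
 qed
 have hD: "compact ?D" by (intro compact_Int_closed closed_half_plane) auto
 obtain g where g: "homeomorphic_maps ?A (top_of_set (cimg ?c)) (cmap ?c) g"
  using chart_homeo[OF c] homeomorphic_map_maps by blast
 have ts: "topspace ?A = cdom ?c"
  using openin_subset[OF chart_open[OF c]] by (auto simp: topspace_subtopology)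
 have "compactin (top_of_set (cimg ?c)) ?D" using hD sub by (simp add: compactin_subtopology)
 hence "compactin ?A (g ` ?D)"
  using g by (meson homeomorphic_maps_def image_compactin)
 hence "compactin X (g ` ?D)" by (simp add: compactin_subtopology)
 moreover have "g ` ?D = inn k b"
 proof -
  have gc: "!!y. y \<in> cdom ?c ==> g (cmap ?c y) = y" "!!q. q \<in> cimg ?c ==> cmap ?c (g q) = q" "!!q. q \<in> cimg ?c ==> g q \<in> cdom ?c"
   using g ts unfolding homeomorphic_maps_def continuous_map_def by auto
  have "g q \<in> inn k b" if "q \<in> ?D" for q
   using that sub gc(2)[of q] gc(3)[of q] by (auto simp: inn_def dist_commute)
  moreover have "y \<in> g ` ?D" if y: "y \<in> inn k b" for y
  proof -
   have "y \<in> cdom ?c" using y by (simp add: inn_def)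
   moreover have "cmap ?c y \<in> ?D" using y inn_Kb[OF b y k] by (auto simp: inn_def Kb_def dist_commute)
   ultimately show ?thesis using gc(1)[of y] by (metis imageI)
  qed
  ultimately show ?thesis by auto
 qed
 ultimately show "compactin X (inn k b)" by simp
 thus "closedin X (inn k b)" by (rule compactin_imp_closedin[OF Hausdorff])
qed

lemma chart_preimage_open:
 assumes c: "c \<in> \<A>" and U: "open U" shows "openin X {y \<in> cdom c. cmap c y \<in> U}"
proof -
 let ?A = "subtopology X (cdom c)"
 have ts: "topspace ?A = cdom c"
  using openin_subset[OF chart_open[OF c]] by (auto simp: topspace_subtopology)
 have "continuous_map ?A (top_of_set (cimg c)) (cmap c)"
  using chart_homeo[OF c] homeomorphic_imp_continuous_map by blast
 moreover have "openin (top_of_set (cimg c)) (cimg c \<inter> U)" using U by (simp add: openin_open_Int)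
 ultimately have "openin ?A {y \<in> cdom c. cmap c y \<in> cimg c \<inter> U}"
  unfolding continuous_map_def ts by blast
 moreover have "{y \<in> cdom c. cmap c y \<in> cimg c \<inter> U} = {y \<in> cdom c. cmap c y \<in> U}" by auto
 ultimately show ?thesis using openin_trans_full[OF _ chart_open[OF c]] by simp
qed

text \<open>A continuity argument that lets a speed bound valid only inside the box prove that the
  box is never left: up to a first exit the displacement is less than \<open>brad b\<close>, so the
  point is still in the interior of the largest disc.\<close>

lemma stay_in_box:
 fixes f :: "real => 'a"
 assumes b: "valid_box b" and f: "continuous_map (top_of_set {0..T}) X f" and T: "0 <= T"
  and f0: "f 0 \<in> inn k b" "k <= 2"
  and mv: "!!t. 0 <= t ==> t <= T ==> (!!s. 0 <= s ==> s <= t ==> f s \<in> inn 3 b) ==>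
   dist (cmap (bch b) (f t)) (cmap (bch b) (f 0)) < brad b"
 shows "t \<in> {0..T} ==> f t \<in> inn 3 b"
proof (rule ccontr)
 let ?A = "ball (bpt b) (3*brad b)"
 assume t: "t \<in> {0..T}" and n: "f t \<notin> inn 3 b"
 have c: "bch b \<in> \<A>" using b by (simp add: valid_box_def)
 define U where "U = {s \<in> {0..T}. f s \<notin> inn 3 b}"
 have pre: "openin (top_of_set {0..T}) {s \<in> {0..T}. f s \<in> V}" if "openin X V" for V
  using f that unfolding continuous_map_def by simp
 have "f s \<in> topspace X" if "s \<in> {0..T}" for s using f that by (auto simp: continuous_map_def)
 hence Ueq: "U = {s \<in> {0..T}. f s \<in> topspace X - inn 3 b}" by (auto simp: U_def)
 have Uo: "openin (top_of_set {0..T}) U"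
  unfolding Ueq by (rule pre) (use inn_closed(2)[OF b, of 3] in \<open>simp add: closedin_def\<close>)
 have tU: "t \<in> U" using t n by (simp add: U_def)
 \<comment> \<open>\<open>a\<close> is the infimum of the exit times. As \<open>inn 3 b\<close> is
   closed the path is still inside at time \<open>a\<close>, by \<open>mv\<close> even strictly
   inside, so exit times cannot accumulate at \<open>a\<close>.\<close>
 define a where "a = Inf U"
 have bdd: "bdd_below U" by (rule bdd_belowI[of _ 0]) (simp add: U_def)
 have a: "0 <= a" "a <= t" unfolding a_def using tU bdd
  by (auto intro!: cInf_greatest cInf_lower simp: U_def)
 hence aT: "a \<in> {0..T}" using t by auto
 have less: "f s \<in> inn 3 b" if "0 <= s" "s < a" for s
  using cInf_lower[OF _ bdd, of s] that aT unfolding a_def[symmetric] by (auto simp: U_def)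
 have fa: "f a \<in> inn 3 b"
 proof (rule ccontr)
  assume "f a \<notin> inn 3 b"
  hence "a \<in> U" using aT by (simp add: U_def)
  then obtain e where e: "e > 0" "!!s. s \<in> {0..T} ==> dist s a < e ==> s \<in> U"
   using Uo unfolding openin_euclidean_subtopology_iff by blast
  have "a ~= 0"
  proof
   assume "a = 0" thus False using f0 inn_mono[OF b, of k 3] \<open>f a \<notin> inn 3 b\<close> by auto
  qed
  define s where "s = max 0 (a - e/2)"
  have s: "0 <= s" "s < a" "dist s a < e" using a(1) \<open>a ~= 0\<close> e(1) by (auto simp: s_def dist_real_def)
  hence "s \<in> U" using aT by (intro e(2)) auto
  thus False using less[OF s(1,2)] by (simp add: U_def)
 qed
 have "f s \<in> inn 3 b" if "0 <= s" "s <= a" for s using less[OF that(1)] fa that by (cases "s = a") auto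
 hence d: "dist (cmap (bch b) (f a)) (cmap (bch b) (f 0)) < brad b" using mv aT by auto
 have d0: "dist (cmap (bch b) (f 0)) (bpt b) <= 2*brad b"
  using inn_mono[OF b f0(2)] f0(1) by (auto simp: inn_def)
 have "dist (cmap (bch b) (f a)) (bpt b) < 3*brad b"
  using d d0 dist_triangle[of "cmap (bch b) (f a)" "bpt b" "cmap (bch b) (f 0)"] by linarith
 hence aW: "f a \<in> {y \<in> cdom (bch b). cmap (bch b) y \<in> ?A}"
  using fa by (auto simp: inn_def dist_commute)
 obtain e where e: "e > 0" "!!s. s \<in> {0..T} ==> dist s a < e ==> f s \<in> {y \<in> cdom (bch b). cmap (bch b) y \<in> ?A}"
  using pre[OF chart_preimage_open[OF c, of "?A"]] aW aT
  unfolding openin_euclidean_subtopology_iff by auto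
 have "a + e <= s" if "s \<in> U" for s
 proof (rule ccontr)
  assume s: "\<not> a + e <= s"
  have "a <= s" unfolding a_def by (rule cInf_lower[OF that bdd])
  hence "f s \<in> {y \<in> cdom (bch b). cmap (bch b) y \<in> ?A}"
   using that s by (intro e(2)) (auto simp: U_def dist_real_def)
  hence "f s \<in> inn 3 b" by (auto simp: inn_def dist_commute)
  thus False using that by (simp add: U_def)
 qed
 hence "a + e <= a" unfolding a_def using tU by (intro cInf_greatest) auto
 thus False using e(1) by simp
qed

lemma vol_cross_sq:
 assumes c: "c \<in> \<A>" and p: "p \<in> cimg c"
 shows "(vol c p * cross u w)^2 + (ip c p u w)^2 = ip c p u u*ip c p w w"
proof -
 have "(vol c p * cross u w)^2 = gdet c p * cross u w * cross u w"
  unfolding power_mult_distrib vol_sq[OF c p] by (simp add: power2_eq_square)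
 thus ?thesis unfolding gdet_cross[OF c p] using ip_sym[OF c p, of w u] by (simp add: power2_eq_square)
qed

lemma ip_nonneg: "c \<in> \<A> ==> p \<in> cimg c ==> 0 <= ip c p u u"
 using metric_pos[of c p u] by (cases "u = 0") auto

end

section \<open>Pairs of nearby geodesics\<close>

text \<open>\<open>C\<close> collects the comparison constants of all boxes and \<open>T\<close> is
  the basic time step. \<open>tau_rad\<close> keeps motion for time \<open>4 * T\<close> inside a
  box, \<open>tau1\<close> lets offsets at most double during this time, and \<open>tau2\<close>
  makes the curvature term beat the Taylor error in \<open>local_growth\<close>.\<close>

locale boxes = riem M for M :: "'a surface" +
 fixes B :: "'a box set" and C T k :: real
 assumes finB: "finite B" and validB: "!!b. b \<in> B ==> valid_box b"
  and cover: "topspace (surf_top M) = (\<Union>b\<in>B. inn 1 b)"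
  and C1: "1 <= C"
  and ipC: "!!b q u. b \<in> B ==> q \<in> Kb b ==> (norm u)^2 <= C^2*ip (bch b) q u u & ip (bch b) q u u <= C^2*(norm u)^2"
  and GamC: "!!b q u w. b \<in> B ==> q \<in> Kb b ==> norm (Gam (bch b) q u w) <= C*norm u*norm w"
  and GamL: "!!b q q' u w. b \<in> B ==> q \<in> Kb b ==> q' \<in> Kb b ==>
   norm (Gam (bch b) q' u w - Gam (bch b) q u w) <= C*dist q' q*norm u*norm w"
  and curv: "!!b q. b \<in> B ==> q \<in> Kb b ==> k <= - gK (bch b) q & - gK (bch b) q <= 1/k"
  and kpos: "0 < k" "k <= 1"
  and tau_pos: "0 < T" and tau_rad: "!!b. b \<in> B ==> 4*C*T < brad b"
  and tau1: "40*C^4*T <= 1" and tau2: "32*C^4*T^2 <= k^3"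
begin

abbreviation "SG \<equiv> simple_complete_geodesic M"
abbreviation "G \<equiv> complete_geodesic M"
abbreviation "xx b g t \<equiv> cmap (bch b) (g t)"
abbreviation "vv b g t \<equiv> vel g t (bch b)"

definition Dz :: "'a box => (real => 'a) => (real => 'a) => (real^2) \<times> (real^2)" where
 "Dz b g h = (xx b h 0 - xx b g 0, vv b h 0 - vv b g 0)"

abbreviation "nz b g h \<equiv> norm (Dz b g h)"

text \<open>If \<open>Th\<close> vanishes, the offset is orthogonal to the first geodesic, and \<open>J\<close> is its signed length.\<close>

definition Th :: "'a box => (real => 'a) => (real => 'a) => real" where
 "Th b g h = ip (bch b) (xx b g 0) (vv b g 0) (xx b h 0 - xx b g 0)"

definition J :: "'a box => (real => 'a) => (real => 'a) => real" where
 "J b g h = vol (bch b) (xx b g 0) * cross (vv b g 0) (xx b h 0 - xx b g 0)"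

lemma bA: "b \<in> B ==> bch b \<in> \<A>" and brad_pos: "b \<in> B ==> brad b > 0" and KbA: "b \<in> B ==> Kb b <= cimg (bch b)"
 using validB by (auto simp: valid_box_def)

lemma Cpow: "1 <= C ^ n" "i <= j ==> C ^ i <= C ^ j"
 using C1 by (auto intro: one_le_power power_increasing)

lemma inn_dom: "y \<in> inn n b ==> y \<in> cdom (bch b)"
 by (simp add: inn_def)

lemma inn_K: "b \<in> B ==> y \<in> inn n b ==> n <= 3 ==> cmap (bch b) y \<in> Kb b"
 using inn_Kb validB by blast

lemma norm_le_ip:
 assumes "b \<in> B" "q \<in> Kb b" shows "norm u <= C * sqrt (ip (bch b) q u u)"
proof -
 have "norm u = sqrt ((norm u)^2)" by simp
 also have "... <= sqrt (C^2*ip (bch b) q u u)" using ipC[OF assms] by (intro real_sqrt_le_mono) blast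
 also have "... = C * sqrt (ip (bch b) q u u)" using C1 by (simp add: real_sqrt_mult)
 finally show ?thesis .
qed

text \<open>For a unit vector \<open>u\<close> the area form and the inner product with
  \<open>u\<close> are the coordinates of \<open>w\<close> in an orthonormal frame, by
  \<open>vol_cross_sq\<close>; \<open>C\<close> compares this with the Euclidean norm.\<close>

lemma unit_bounds:
 assumes b: "b \<in> B" and q: "q \<in> Kb b" and u: "ip (bch b) q u u = 1"
 shows "\<bar>vol (bch b) q * cross u w\<bar> <= C*norm w" "\<bar>ip (bch b) q u w\<bar> <= C*norm w"
  "norm u <= C" "norm w <= C*(\<bar>vol (bch b) q * cross u w\<bar> + \<bar>ip (bch b) q u w\<bar>)"
proof -
 let ?c = "bch b"
 let ?A = "\<bar>vol ?c q * cross u w\<bar> + \<bar>ip ?c q u w\<bar>" and ?B = "vol ?c q * cross u w" and ?D = "ip ?c q u w"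
 have qc: "q \<in> cimg ?c" using q KbA[OF b] by auto
 have e: "?B^2 + (?D)^2 = ip ?c q w w"
  using vol_cross_sq[OF bA[OF b] qc, of u w] u by simp
 have i: "ip ?c q w w <= (C*norm w)^2" using ipC[OF b q, of w] by (simp add: power_mult_distrib)
 have n: "0 <= C*norm w" using C1 by simp
 have "?B^2 <= (C*norm w)^2" using e i zero_le_power2[of "?D"] by linarith
 thus "\<bar>vol ?c q * cross u w\<bar> <= C*norm w" using n by (simp add: abs_le_square_iff[symmetric])
 have "(?D)^2 <= (C*norm w)^2" using e i zero_le_power2[of "vol ?c q * cross u w"] by linarith
 thus "\<bar>?D\<bar> <= C*norm w" using n by (simp add: abs_le_square_iff[symmetric])
 show "norm u <= C" using norm_le_ip[OF b q, of u] u by simp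
 have "norm w <= C * sqrt (?B^2 + (?D)^2)" unfolding e by (rule norm_le_ip[OF b q])
 also have "... <= C*?A"
  using C1 by (intro mult_left_mono sqrt_sum_squares_le_sum_abs) auto
 finally show "norm w <= C*?A" .
qed

lemma geo_unit: "G g ==> b \<in> B ==> g t \<in> inn n b ==> ip (bch b) (xx b g t) (vv b g t) (vv b g t) = 1"
 using geodesic_chart(3)[OF _ bA inn_dom] by blast

lemma speed: "G g ==> b \<in> B ==> g t \<in> inn n b ==> n <= 3 ==> norm (vv b g t) <= C"
 using unit_bounds(3)[OF _ inn_K geo_unit] by blast

lemma geo_deriv:
 assumes "G g" "b \<in> B" "g t \<in> inn n b"
 shows "((%s. xx b g s) has_vector_derivative vv b g t) (at t)"
  "((%s. vv b g s) has_vector_derivative - Gam (bch b) (xx b g t) (vv b g t) (vv b g t)) (at t)"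
 using geodesic_chart(1,2)[OF assms(1) bA[OF assms(2)] inn_dom[OF assms(3)]] by auto

lemma accel: "G g ==> b \<in> B ==> g t \<in> inn n b ==> n <= 3 ==>
 norm (Gam (bch b) (xx b g t) (vv b g t) (vv b g t)) <= C^3"
proof -
 assume a: "G g" "b \<in> B" "g t \<in> inn n b" "n <= 3"
 have "norm (Gam (bch b) (xx b g t) (vv b g t) (vv b g t)) <= C*norm (vv b g t)*norm (vv b g t)"
  by (rule GamC[OF a(2) inn_K[OF a(2-4)]])
 also have "... <= C*C*C" using speed[OF a] C1 by (intro mult_mono) auto
 finally show ?thesis by (simp add: power3_eq_cube)
qed

lemma mvt_norm:
 fixes x :: "real => 'e::real_normed_vector"
 assumes "a <= t" "!!s. a <= s ==> s <= t ==> (x has_vector_derivative x' s) (at s)"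
  and "!!s. a <= s ==> s <= t ==> norm (x' s) <= D" "0 <= D"
 shows "norm (x t - x a) <= D*(t - a)"
proof -
 have "norm (x t - x a) <= D*norm (t - a)"
 proof (rule differentiable_bound[of "{a..t}" x "%s h. h *\<^sub>R x' s"])
  show "(x has_derivative (%h. h *\<^sub>R x' s)) (at s within {a..t})" if "s \<in> {a..t}" for s
   using assms(2)[of s] that has_derivative_at_withinI unfolding has_vector_derivative_def by auto
  show "onorm (%h. h *\<^sub>R x' s) <= D" if "s \<in> {a..t}" for s
   using assms(3)[of s] that assms(4) by (intro onorm_bound) (auto simp: mult.commute[of D] intro!: mult_left_mono)
 qed (use assms(1) in auto)
 thus ?thesis using assms(1) by simp
qed

lemma geo_stay_pos:
 assumes g: "G g" and b: "b \<in> B" and 0: "g 0 \<in> inn n b" "n <= 2" and t: "0 <= t" "t <= 4*T"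
 shows "g t \<in> inn 3 b"
proof (rule stay_in_box[where T="4*T" and f=g, OF validB[OF b] _ _ 0])
 show "continuous_map (top_of_set {0..4*T}) X g"
  using geodesic_continuous[OF g] by (rule continuous_map_from_subtopology)
 show "t \<in> {0..4*T}" "0 <= 4*T" using t by auto
 fix s assume s: "0 <= s" "s <= 4*T" "!!r. 0 <= r ==> r <= s ==> g r \<in> inn 3 b"
 have "norm (xx b g s - xx b g 0) <= C*(s - 0)"
  using s(1,3) geo_deriv(1)[OF g b] speed[OF g b, of _ 3] C1 by (intro mvt_norm) auto
 also have "... <= C*(4*T)" using s C1 by (intro mult_left_mono) auto
 also have "... < brad b" using tau_rad[OF b] by simp
 finally show "dist (xx b g s) (xx b g 0) < brad b" by (simp add: dist_norm)
qed

lemma geo_stay: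
 assumes g: "G g" and b: "b \<in> B" and 0: "g 0 \<in> inn n b" "n <= 2" and t: "\<bar>t\<bar> <= 4*T"
 shows "g t \<in> inn 3 b"
proof (cases "0 <= t")
 case True thus ?thesis using geo_stay_pos[OF g b 0] t by auto
next
 case False
 have "rv g (- t) \<in> inn 3 b"
  using geo_stay_pos[OF geodesic_rv(1)[OF g] b, of n "-t"] 0 t False by (simp add: sh_apply)
 thus ?thesis by (simp add: sh_apply)
qed

lemma geo_move:
 assumes g: "G g" and b: "b \<in> B" and st: "!!r. min s t <= r ==> r <= max s t ==> g r \<in> inn 3 b"
 shows "norm (xx b g t - xx b g s) <= C*\<bar>t - s\<bar>" "norm (vv b g t - vv b g s) <= C^3*\<bar>t - s\<bar>"
proof -
 have 1: "norm (xx b g (max s t) - xx b g (min s t)) <= C*(max s t - min s t)"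
  using st geo_deriv(1)[OF g b] speed[OF g b, of _ 3] C1 by (intro mvt_norm) auto
 have 2: "norm (vv b g (max s t) - vv b g (min s t)) <= C^3*(max s t - min s t)"
  using st geo_deriv(2)[OF g b] accel[OF g b, of _ 3] C1 by (intro mvt_norm) auto
 show "norm (xx b g t - xx b g s) <= C*\<bar>t - s\<bar>" "norm (vv b g t - vv b g s) <= C^3*\<bar>t - s\<bar>"
  using 1 2 by (cases "s <= t"; simp add: max_def min_def norm_minus_commute)+
qed

lemma norm_fst_snd: "norm (fst z) <= norm z" "norm (snd z) <= norm z" "norm z <= norm (fst z) + norm (snd z)"
 using norm_fst_le[of "fst z" "snd z"] norm_snd_le[of "snd z" "fst z"] norm_Pair_le[of "fst z" "snd z"] by auto

text \<open>Gronwall's inequality for position and velocity together, with the Lipschitz constant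
  \<open>4 * C^3\<close> of the geodesic equation in a box.\<close>

lemma flow_diff:
 assumes g: "G g" "G h" and b: "b \<in> B" and 0: "g 0 \<in> inn n b" "h 0 \<in> inn n b" "n <= 2" and t: "\<bar>t\<bar> <= 4*T"
 shows "nz b (sh g t) (sh h t) <= 2*nz b g h"
proof -
 let ?c = "bch b"
 let ?A = "exp (4*C^3*\<bar>t\<bar>)"
 define z where "z s = (xx b h s - xx b g s, vv b h s - vv b g s)" for s
 define z' where "z' s = (vv b h s - vv b g s, - Gam ?c (xx b h s) (vv b h s) (vv b h s) - (- Gam ?c (xx b g s) (vv b g s) (vv b g s)))" for s
 have st: "g s \<in> inn 3 b" "h s \<in> inn 3 b" if "\<bar>s\<bar> <= 4*T" for s
  using geo_stay[OF g(1) b 0(1,3) that] geo_stay[OF g(2) b 0(2,3) that] .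
 have C2: "1 <= C^2" "C^2 <= C^3" using Cpow[of 2] by auto
 have "norm (z t) <= ?A*norm (z 0)"
 proof (rule gronwall[OF _ _ t])
  fix s assume s: "\<bar>s\<bar> <= 4*T"
  note S = st[OF s]
  show "(z has_vector_derivative z' s) (at s)" unfolding z_def z'_def
   by (intro has_vector_derivative_Pair has_vector_derivative_diff geo_deriv[OF g(1) b S(1)] geo_deriv[OF g(2) b S(2)])
  let ?x = "xx b g s" and ?y = "xx b h s" and ?u = "vv b g s" and ?w = "vv b h s"
  have K: "?x \<in> Kb b" "?y \<in> Kb b" using S inn_K[OF b] by auto
  have u: "norm ?u <= C" "norm ?w <= C" using S speed[OF g(1) b] speed[OF g(2) b] by auto
  have dx: "norm (?y - ?x) <= norm (z s)" "norm (?w - ?u) <= norm (z s)"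
   using norm_fst_snd[of "z s"] by (auto simp: z_def)
  have e: "- Gam ?c ?y ?w ?w - (- Gam ?c ?x ?u ?u) = - ((Gam ?c ?y ?w ?w - Gam ?c ?x ?w ?w) + Gam ?c ?x ?w (?w - ?u) + Gam ?c ?x (?w - ?u) ?u)"
   by simp
  have "norm (Gam ?c ?y ?w ?w - Gam ?c ?x ?w ?w) <= C*dist ?y ?x*norm ?w*norm ?w" by (rule GamL[OF b K])
  also have "... <= C*norm (z s)*C*C" using dx u C1 by (intro mult_mono) (auto simp: dist_norm)
  finally have 1: "norm (Gam ?c ?y ?w ?w - Gam ?c ?x ?w ?w) <= C^3*norm (z s)" by (simp add: power3_eq_cube algebra_simps)
  have "norm (Gam ?c ?x ?w (?w - ?u)) <= C*norm ?w*norm (?w - ?u)" by (rule GamC[OF b K(1)])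
  also have "... <= C*C*norm (z s)" using dx u C1 by (intro mult_mono) auto
  finally have 2: "norm (Gam ?c ?x ?w (?w - ?u)) <= C^2*norm (z s)" by (simp add: power2_eq_square)
  have "norm (Gam ?c ?x (?w - ?u) ?u) <= C*norm (?w - ?u)*norm ?u" by (rule GamC[OF b K(1)])
  also have "... <= C*norm (z s)*C" using dx u C1 by (intro mult_mono) auto
  finally have 3: "norm (Gam ?c ?x (?w - ?u) ?u) <= C^2*norm (z s)" by (simp add: power2_eq_square algebra_simps)
  have "norm (z' s) <= norm (?w - ?u) + norm (- Gam ?c ?y ?w ?w - (- Gam ?c ?x ?u ?u))"
   unfolding z'_def by (rule norm_Pair_le)
  also have "... <= norm (z s) + (C^3*norm (z s) + C^2*norm (z s) + C^2*norm (z s))"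
   unfolding e norm_minus_cancel using dx(2) 1 2 3 by (intro add_mono norm_triangle_le) auto
  also have "... = (1 + C^3 + C^2 + C^2)*norm (z s)" by (simp add: algebra_simps)
  also have "... <= (4*C^3)*norm (z s)" using C2 by (intro mult_right_mono) auto
  finally show "norm (z' s) <= 4*C^3*norm (z s)" .
 qed
 \<comment> \<open>By \<open>tau1\<close> the exponent is at most 2/5, and \<open>exp (2/5)\<close>
   is less than 2.\<close>
 also have "... <= 2*norm (z 0)"
 proof (rule mult_right_mono)
  have "C^3*T <= C^4*T" using Cpow(2)[of 3 4] tau_pos by (intro mult_right_mono) auto
  moreover have "C^3*\<bar>t\<bar> <= C^3*(4*T)" using t C1 by (intro mult_left_mono) auto
  ultimately have "4*C^3*\<bar>t\<bar> <= 2/5" using tau1 by linarith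
  hence "?A <= exp (2/5)" by simp
  also have "exp (2/5 :: real) <= 1 + 2/5 + (2/5)^2" by (rule exp_bound) auto
  also have "... <= (2::real)" by (simp add: power2_eq_square)
  finally show "?A <= 2" .
 qed simp
 finally show ?thesis by (simp add: z_def Dz_def sh_apply geodesic_sh(2)[OF g(1)] geodesic_sh(2)[OF g(2)])
qed

text \<open>Velocities of nearby geodesics have inner product at least 1/2, so the tangential offset
  increases strictly with the time shift. This yields both uniqueness (\<open>sync_unique\<close>)
  and existence (\<open>resync\<close>) of a synchronizing shift.\<close>

lemma Th_deriv:
 assumes g: "G g" "G h" and b: "b \<in> B" and 0: "g 0 \<in> inn 3 b" "h 0 \<in> inn n b" "n <= 2"
  and m: "nz b g h <= 1/(8*C)" and t: "\<bar>t\<bar> <= 4*T"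
 shows "((%s. Th b g (sh h s)) has_real_derivative ip (bch b) (xx b g 0) (vv b g 0) (vv b h t)) (at t)"
  "1/2 <= ip (bch b) (xx b g 0) (vv b g 0) (vv b h t)"
proof -
 let ?i = "ip (bch b) (xx b g 0) (vv b g 0)"
 have "linear ?i" by (rule linearI) simp_all
 hence bl: "bounded_linear ?i" by (simp add: linear_conv_bounded_linear)
 have st: "h s \<in> inn 3 b" if "\<bar>s\<bar> <= 4*T" for s using geo_stay[OF g(2) b 0(2,3) that] .
 have "((%s. xx b h s - xx b g 0) has_vector_derivative vv b h t) (at t)"
  using geo_deriv(1)[OF g(2) b st[OF t]] by (auto intro!: derivative_eq_intros)
 from bounded_linear.has_vector_derivative[OF bl this]
 show "((%s. Th b g (sh h s)) has_real_derivative ?i (vv b h t)) (at t)"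
  unfolding has_real_derivative_iff_has_vector_derivative by (simp add: Th_def sh_apply)
 have "norm (vv b h t - vv b h 0) <= C^3*\<bar>t - 0\<bar>"
  by (rule geo_move(2)[OF g(2) b]) (rule st, use t in auto)
 also have "... <= C^3*(4*T)" using t C1 by (intro mult_left_mono) auto
 finally have 1: "norm (vv b h t - vv b h 0) <= 4*(C^3*T)" by simp
 have 2: "norm (vv b h 0 - vv b g 0) <= 1/(8*C)" using m norm_fst_snd(2)[of "Dz b g h"] by (simp add: Dz_def)
 have "norm (vv b h t - vv b g 0) <= 4*(C^3*T) + 1/(8*C)"
  using norm_triangle_ineq[of "vv b h t - vv b h 0" "vv b h 0 - vv b g 0"] 1 2 by simp
 hence "C*norm (vv b h t - vv b g 0) <= C*(4*(C^3*T) + 1/(8*C))"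
  using C1 by (intro mult_left_mono) auto
 also have "... = 4*(C^4*T) + 1/8" using C1 by (simp add: algebra_simps power_eq_if)
 also have "... <= 1/2" using tau1 by simp
 finally have "\<bar>?i (vv b h t - vv b g 0)\<bar> <= 1/2"
  using unit_bounds(2)[OF b inn_K[OF b 0(1)] geo_unit[OF g(1) b 0(1)], of "vv b h t - vv b g 0"] by linarith
 moreover have "?i (vv b h t - vv b g 0) = ?i (vv b h t) - 1" using geo_unit[OF g(1) b 0(1)] by simp
 ultimately show "1/2 <= ?i (vv b h t)" by linarith
qed

lemma sync_unique:
 assumes g: "G g" "G h" and b: "b \<in> B" and 0: "g 0 \<in> inn 3 b" "h 0 \<in> inn n b" "n <= 2"
  and m: "nz b g h <= 1/(8*C)" and t: "\<bar>t\<bar> <= 4*T" and eq: "Th b g h = 0" "Th b g (sh h t) = 0"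
 shows "t = 0"
proof (rule ccontr)
 assume "t ~= 0"
 note D = Th_deriv[OF g b 0 m]
 have "Th b g (sh h (min 0 t)) < Th b g (sh h (max 0 t))"
 proof (rule DERIV_pos_imp_increasing[where f="%s. Th b g (sh h s)"])
  show "min 0 t < max 0 t" using \<open>t ~= 0\<close> by auto
  show "EX y. ((%s. Th b g (sh h s)) has_real_derivative y) (at s) & 0 < y" if "min 0 t <= s" "s <= max 0 t" for s
  proof -
   have "\<bar>s\<bar> <= 4*T" using that t by auto
   from D(1)[OF this] D(2)[OF this] show ?thesis
    by (intro exI[of _ "ip (bch b) (xx b g 0) (vv b g 0) (vv b h s)"]) auto
  qed
 qed
 thus False using eq \<open>t ~= 0\<close> by (cases "0 <= t") (auto simp: min_def max_def)
qed

text \<open>\<open>Th\<close> has slope at least 1/2 in the time shift and is at most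
  \<open>C * nz b g \<eta>\<close> to begin with, so it vanishes within time
  \<open>2 * C * nz b g \<eta>\<close>. The normal distance changes only to second order, since the
  shift is small and the motion during it is nearly parallel to \<open>g\<close>.\<close>

lemma resync:
 assumes g: "G g" "G \<eta>" and b: "b \<in> B" and 0: "g 0 \<in> inn 3 b" "\<eta> 0 \<in> inn n b" "n <= 2"
  and m: "nz b g \<eta> <= 1/(8*C)" "nz b g \<eta>*C <= T"
 obtains t where "\<bar>t\<bar> <= 2*C*nz b g \<eta>" "Th b g (sh \<eta> t) = 0" "\<eta> t \<in> inn 3 b"
  "nz b g (sh \<eta> t) <= 6*C^4*nz b g \<eta>"
  "\<bar>J b g (sh \<eta> t) - J b g \<eta>\<bar> <= 6*C^6*(nz b g \<eta>)^2" "\<bar>t\<bar> <= 2*\<bar>Th b g \<eta>\<bar>"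
proof -
 let ?m = "nz b g \<eta>" and ?c = "bch b"
 define a where "a = 2*C*?m"
 have a: "0 <= a" "a <= 4*T" using C1 m(2) tau_pos by (auto simp: a_def algebra_simps)
 note D = Th_deriv[OF g b 0 m(1)]
 have K: "xx b g 0 \<in> Kb b" using inn_K[OF b 0(1)] by simp
 note un = geo_unit[OF g(1) b 0(1)]
 have dx: "norm (xx b \<eta> 0 - xx b g 0) <= ?m" "norm (vv b \<eta> 0 - vv b g 0) <= ?m"
  using norm_fst_snd[of "Dz b g \<eta>"] by (auto simp: Dz_def)
 have Th0: "\<bar>Th b g \<eta>\<bar> <= a/2"
  using unit_bounds(2)[OF b K un, of "xx b \<eta> 0 - xx b g 0"] mult_left_mono[OF dx(1), of C] C1
  unfolding Th_def a_def by linarith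
 have mono: "Th b g (sh \<eta> t) - Th b g (sh \<eta> s) >= (t - s)/2" if "s <= t" "- a <= s" "t <= a" for s t
 proof -
  define h where "h r = Th b g (sh \<eta> r) - r/2" for r
  have "h s <= h t"
  proof (rule DERIV_nonneg_imp_nondecreasing[OF that(1)])
   fix r assume "s <= r" "r <= t"
   hence r: "\<bar>r\<bar> <= 4*T" using that a by auto
   have "(h has_real_derivative ip ?c (xx b g 0) (vv b g 0) (vv b \<eta> r) - 1/2) (at r)"
    unfolding h_def using DERIV_diff[OF D(1)[OF r] DERIV_cdivide[OF DERIV_ident, of 2]] by simp
   thus "EX y. (h has_real_derivative y) (at r) & 0 <= y" using D(2)[OF r] by (intro exI conjI) auto
  qed
  thus ?thesis by (simp add: h_def field_simps)
 qed
 have "continuous_on {- a..a} (%s. Th b g (sh \<eta> s))"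
  by (intro continuous_at_imp_continuous_on ballI DERIV_isCont[OF D(1)]) (use a in auto)
 moreover have "Th b g (sh \<eta> (- a)) <= 0" "0 <= Th b g (sh \<eta> a)"
  using mono[of "- a" 0] mono[of 0 a] a Th0 by (auto simp: abs_le_iff)
 ultimately obtain t where t: "- a <= t" "t <= a" "Th b g (sh \<eta> t) = 0"
  using IVT'[of "%s. Th b g (sh \<eta> s)" "- a" 0 a] a by auto
 have ta: "\<bar>t\<bar> <= a" using t by auto
 have st: "\<eta> s \<in> inn 3 b" if "\<bar>s\<bar> <= a" for s using geo_stay[OF g(2) b 0(2,3), of s] that a by auto
 have mv: "norm (xx b \<eta> s - xx b \<eta> 0) <= C*a" "norm (vv b \<eta> s - vv b \<eta> 0) <= C^3*a" if s: "\<bar>s\<bar> <= a" for s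
 proof -
  have 1: "!!r. min 0 s <= r ==> r <= max 0 s ==> \<eta> r \<in> inn 3 b" by (rule st) (use s in auto)
  have "C*\<bar>s - 0\<bar> <= C*a" "C^3*\<bar>s - 0\<bar> <= C^3*a" using s C1 by (auto intro!: mult_left_mono)
  thus "norm (xx b \<eta> s - xx b \<eta> 0) <= C*a" "norm (vv b \<eta> s - vv b \<eta> 0) <= C^3*a"
   using geo_move[OF g(2) b 1] by (meson order_trans)+
 qed
 have Ca: "C*a = 2*C^2*?m" "C^3*a = 2*C^4*?m" by (simp_all add: a_def power2_eq_square power_eq_if)
 have P: "C^2*?m <= C^4*?m" "?m <= C^4*?m" "C^4*?m >= 0"
  using Cpow(2)[of 2 4] Cpow(1)[of 4] mult_right_mono[of "C^2" "C^4" ?m] mult_right_mono[of 1 "C^4" ?m] by auto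
 have v: "norm (vv b \<eta> s - vv b g 0) <= 3*(C^4*?m)" if s: "\<bar>s\<bar> <= a" for s
  using norm_triangle_ineq[of "vv b \<eta> s - vv b \<eta> 0" "vv b \<eta> 0 - vv b g 0"] mv(2)[OF s] dx(2) P unfolding Ca by simp
 have x: "norm (xx b \<eta> t - xx b g 0) <= 3*(C^4*?m)"
  using norm_triangle_ineq[of "xx b \<eta> t - xx b \<eta> 0" "xx b \<eta> 0 - xx b g 0"] mv(1)[OF ta] dx(1) P unfolding Ca by simp
 have "nz b g (sh \<eta> t) <= norm (xx b \<eta> t - xx b g 0) + norm (vv b \<eta> t - vv b g 0)"
  unfolding Dz_def using norm_Pair_le by (auto simp: sh_apply geodesic_sh(2)[OF g(2)])
 hence Dz': "nz b g (sh \<eta> t) <= 6*C^4*?m" using x v[OF ta] by simp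
 let ?L = "%w. vol ?c (xx b g 0) * cross (vv b g 0) w"
 have lin: "linear ?L" by (rule linearI) (simp_all add: cross_def algebra_simps)
 hence bl: "bounded_linear ?L" by (simp add: linear_conv_bounded_linear)
 define y where "y s = ?L (xx b \<eta> s - xx b g 0)" for s
 have y': "(y has_vector_derivative ?L (vv b \<eta> s)) (at s)" if "\<bar>s\<bar> <= a" for s
  unfolding y_def
 proof (rule bounded_linear.has_vector_derivative[OF bl])
  show "((%s. xx b \<eta> s - xx b g 0) has_vector_derivative vv b \<eta> s) (at s)"
   using geo_deriv(1)[OF g(2) b st[OF that]] by (auto intro!: derivative_eq_intros)
 qed
 have yb: "norm (?L (vv b \<eta> s)) <= 3*C^5*?m" if "\<bar>s\<bar> <= a" for s
 proof -
  \<comment> \<open>The part along \<open>g\<close> drops out of \<open>cross\<close>; this gains a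
    factor of the offset and makes the change of \<open>J\<close> quadratic.\<close>
  have "cross (vv b g 0) (vv b \<eta> s) = cross (vv b g 0) (vv b \<eta> s - vv b g 0)" by (simp add: cross_def algebra_simps)
  hence "norm (?L (vv b \<eta> s)) <= C*norm (vv b \<eta> s - vv b g 0)"
   using unit_bounds(1)[OF b K un, of "vv b \<eta> s - vv b g 0"] by (simp only: real_norm_def)
  also have "... <= C*(3*(C^4*?m))" using v[OF that] C1 by (intro mult_left_mono) auto
  finally show ?thesis by (simp add: power_eq_if algebra_simps)
 qed
 have "norm (y (max 0 t) - y (min 0 t)) <= 3*C^5*?m*(max 0 t - min 0 t)"
  by (rule mvt_norm[OF _ y' yb]) (use ta C1 in auto)
 also have "... <= 3*C^5*?m*a" using ta C1 by (intro mult_left_mono) auto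
 also have "... = 6*C^6*?m^2" by (simp add: a_def power_eq_if power2_eq_square)
 finally have "\<bar>y t - y 0\<bar> <= 6*C^6*?m^2" by (cases "0 <= t") (auto simp: max_def min_def abs_minus_commute)
 hence "\<bar>J b g (sh \<eta> t) - J b g \<eta>\<bar> <= 6*C^6*?m^2" by (simp add: y_def J_def sh_apply)
 moreover have "\<bar>t\<bar> <= 2*\<bar>Th b g \<eta>\<bar>"
  using mono[of 0 t] mono[of t 0] t a by (cases "0 <= t") auto
 ultimately show ?thesis using that t ta Dz' st[OF ta] unfolding a_def by blast
qed

end

section \<open>Growth of the normal distance by the Jacobi equation\<close>

lemma taylor_lower:
 fixes f :: "real => real"
 assumes f: "!!t. 0 <= t ==> t <= T ==> (f has_real_derivative f1 t) (at t)"
  and f1: "!!t. 0 <= t ==> t <= T ==> (f1 has_real_derivative f2 t) (at t)"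
  and a: "!!t. 0 <= t ==> t <= T ==> a <= f2 t" and t: "0 <= t" "t <= T"
 shows "f 0 + f1 0*t + a*t^2/2 <= f t"
proof -
 have 1: "f1 0 + a * s <= f1 s" if s: "0 <= s" "s <= T" for s
 proof -
  have "f1 0 - a*0 <= f1 s - a * s"
  proof (rule DERIV_nonneg_imp_nondecreasing[OF s(1)])
   fix r assume "0 <= r" "r <= s"
   hence "((%r. f1 r - a*r) has_real_derivative f2 r - a) (at r)" "0 <= f2 r - a"
    using f1[of r] a[of r] s by (auto intro!: derivative_eq_intros)
   thus "EX y. ((%r. f1 r - a*r) has_real_derivative y) (at r) & 0 <= y" by blast
  qed
  thus ?thesis by simp
 qed
 have "f 0 - f1 0*0 - a*0^2/2 <= f t - f1 0*t - a*t^2/2"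
 proof (rule DERIV_nonneg_imp_nondecreasing[OF t(1)])
  fix r assume "0 <= r" "r <= t"
  hence "((%r. f r - f1 0*r - a*r^2/2) has_real_derivative f1 r - f1 0 - a*r) (at r)" "0 <= f1 r - f1 0 - a*r"
   using f[of r] 1[of r] t by (auto intro!: derivative_eq_intros)
  thus "EX y. ((%r. f r - f1 0*r - a*r^2/2) has_real_derivative y) (at r) & 0 <= y" by blast
 qed
 thus ?thesis by simp
qed

text \<open>The equation \<open>y'' = \<kappa> * y + e\<close> is bootstrapped: the crude bound
  \<open>y'' >= - D\<close> keeps \<open>y\<close> above \<open>y 0 - D * T^2 / 2\<close>, and
  inserting this into the equation leaves \<open>y'' >= k * y 0\<close> up to small terms.\<close>

lemma scalar_growth:
 fixes y :: "real => real"
 assumes T: "0 <= T"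
  and y: "!!t. 0 <= t ==> t <= T ==> (y has_real_derivative y1 t) (at t)"
  and y1: "!!t. 0 <= t ==> t <= T ==> (y1 has_real_derivative \<kappa> t*y t + e t) (at t)"
  and \<kappa>: "!!t. 0 <= t ==> t <= T ==> k <= \<kappa> t & \<kappa> t <= 1/k" and k: "0 < k" "k <= 1"
  and e: "!!t. 0 <= t ==> t <= T ==> \<bar>e t\<bar> <= E" and Y: "!!t. 0 <= t ==> t <= T ==> \<bar>y t\<bar> <= Y"
  and D: "Y/k + E <= D" and pos: "0 <= y 0" "0 <= y1 0"
 shows "y 0 + y1 0*T + (k*y 0 - D*T^2/(2*k) - E)*T^2/2 <= y T"
proof -
 have Y0: "0 <= Y" using Y[of 0] T by auto
 have E0: "0 <= E" using e[of 0] T by auto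
 have D0: "0 <= D" using D Y0 E0 k by (auto intro: order_trans[rotated])
 have b1: "- D <= \<kappa> t*y t + e t" if t: "0 <= t" "t <= T" for t
 proof -
  have "\<bar>\<kappa> t*y t\<bar> <= 1/k*Y" unfolding abs_mult using \<kappa>[OF t] Y[OF t] k by (intro mult_mono) auto
  thus ?thesis using e[OF t] D by (simp add: abs_le_iff)
 qed
 have low: "y 0 + y1 0*t - D*t^2/2 <= y t" if t: "0 <= t" "t <= T" for t
  using taylor_lower[where T=T and f=y and ?f1.0=y1, OF y y1 b1 t] by simp
 have b2: "k*y 0 - D*T^2/(2*k) - E <= \<kappa> t*y t + e t" if t: "0 <= t" "t <= T" for t
 proof -
  define h where "h = D*T^2/2"
  have h: "0 <= h" using D0 by (simp add: h_def)
  have "t^2 <= T^2" using t by (simp add: power_mono)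
  hence "D*t^2 <= D*T^2" using D0 by (rule mult_left_mono)
  hence "D*t^2/2 <= h" by (simp add: h_def)
  hence yl: "y 0 - h <= y t" using low[OF t] mult_nonneg_nonneg[OF pos(2) t(1)] by linarith
  \<comment> \<open>The sign of \<open>y t\<close> is not known: the lower bound \<open>k\<close> of
    \<kappa> serves where \<open>y t\<close> is nonnegative, the upper bound \<open>1/k\<close>
    elsewhere, which explains the loss \<open>h/k\<close>.\<close>
  have "k*y 0 - h/k <= \<kappa> t*y t"
  proof (cases "0 <= y t")
   case True
   have "k*y 0 - k*h <= k*y t" using mult_left_mono[OF yl, of k] k by (simp add: algebra_simps)
   also have "... <= \<kappa> t*y t" using \<kappa>[OF t] True by (intro mult_right_mono) auto
   finally have "k*y 0 - k*h <= \<kappa> t*y t" .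
   moreover have "k*h <= h/k"
   proof -
    have "k*k <= 1" using k mult_mono[of k 1 k 1] by simp
    hence "(k*k)*h <= 1*h" using h by (rule mult_right_mono)
    thus ?thesis using k by (simp add: field_simps)
   qed
   ultimately show ?thesis by linarith
  next
   case False
   have "k*y 0 <= (1/k)*y 0" using k pos(1) mult_mono[of k 1 k 1] by (intro mult_right_mono) (auto simp: field_simps)
   hence "k*y 0 - h/k <= (1/k)*(y 0 - h)" by (simp add: algebra_simps diff_divide_distrib)
   also have "... <= (1/k)*y t" using yl k by (intro mult_left_mono) auto
   also have "... <= \<kappa> t*y t" using \<kappa>[OF t] False by (intro mult_right_mono_neg) auto
   finally show ?thesis .
  qed
  moreover have "h/k = D*T^2/(2*k)" by (simp add: h_def)
  ultimately show ?thesis using e[OF t] by (simp add: abs_le_iff)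
 qed
 show ?thesis by (rule taylor_lower[where T=T and f=y and ?f1.0=y1, OF y y1 b2 T order_refl])
qed

context riem begin

lemma dGam_lin2 [simp]:
 "dGam c p h (u + v) w = dGam c p h u w + dGam c p h v w" "dGam c p h w (u + v) = dGam c p h w u + dGam c p h w v"
 by (simp_all add: dGam_def sum_2 vec_eq_iff algebra_simps)

lemma dGam_sym: assumes "c \<in> \<A>" "p \<in> cimg c" shows "dGam c p h u w = dGam c p h w u"
proof -
 have "partial (cimg c) l (chr c k 1 2) p = partial (cimg c) l (chr c k 2 1) p" for l k
  by (rule partial_cong[OF _ assms(2)]) (rule christoffel_sym[OF assms(1)])
 thus ?thesis by (simp add: dGam_def sum_2 vec_eq_iff algebra_simps)
qed

text \<open>For a linear map \<open>A\<close> of the plane,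
  \<open>cross (A v) d + cross v (A d)\<close> is the trace of \<open>A\<close> times
  \<open>cross v d\<close>; here \<open>A\<close> is \<open>Gam c p v\<close>.\<close>

lemma cross_trace:
 "cross (Gam c p v v) d + cross v (Gam c p v d) = (Gam c p v (axis 1 1) $ 1 + Gam c p v (axis 2 1) $ 2) * cross v d"
 by (simp add: cross_def Gam_def sum_2 axis_def algebra_simps)

end

context boxes begin

text \<open>The area form is parallel, and so is the velocity of a geodesic; differentiating the
  area spanned by the velocity and \<open>d\<close> therefore replaces \<open>d\<close> by its
  covariant derivative.\<close>

lemma vc_deriv:
 assumes g: "G g" and b: "b \<in> B" and t: "g t \<in> inn n b" and d: "(d has_vector_derivative e) (at t)"
 shows "((%s. vol (bch b) (xx b g s) * cross (vv b g s) (d s)) has_real_derivative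
  vol (bch b) (xx b g t) * cross (vv b g t) (e + Gam (bch b) (xx b g t) (vv b g t) (d t))) (at t)"
proof -
 let ?c = "bch b" and ?x = "xx b g t" and ?v = "vv b g t"
 let ?S = "{s. g s \<in> cdom ?c}"
 let ?A = "Gam ?c ?x ?v (axis 1 1) $ 1 + Gam ?c ?x ?v (axis 2 1) $ 2" and ?B = "cross (- Gam ?c ?x ?v ?v) (d t)" and ?D = "Gam ?c ?x ?v (d t)"
 have S: "open ?S" "t \<in> ?S" using cont_open[OF geodesic_continuous[OF g] bA[OF b]] inn_dom[OF t] by auto
 have nth: "((%s. f s $ i) has_real_derivative f' $ i) (at t)" if "(f has_vector_derivative f') (at t)" for f :: "real => real^2" and f' i
  using bounded_linear.has_vector_derivative[OF bounded_linear_vec_nth that, of i]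
  by (simp add: has_real_derivative_iff_has_vector_derivative)
 note x = geo_deriv(1)[OF g b t] and v = nth[OF geo_deriv(2)[OF g b t]] and d' = nth[OF d]
 have vol: "((%s. vol ?c (xx b g s)) has_real_derivative
  (vol ?c ?x*?A)) (at t)"
  by (rule vol_vd[OF bA[OF b] S x]) auto
 have cr: "((%s. cross (vv b g s) (d s)) has_real_derivative ?B + cross ?v e) (at t)"
  unfolding cross_def
  by (rule DERIV_cong[OF DERIV_diff[OF DERIV_mult[OF v d'] DERIV_mult[OF v d']]]) (simp add: algebra_simps)
 show ?thesis
 proof (rule DERIV_cong[OF DERIV_mult[OF vol cr]])
  have "?B + ?A * cross ?v (d t)
   = cross ?v (?D)"
   unfolding cross_trace[symmetric] by (simp add: cross_def)
  hence "cross ?v (e + ?D) = cross ?v e + (?B + ?A * cross ?v (d t))"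
   by (simp add: cross_def algebra_simps)
  thus "vol ?c ?x*?A * cross ?v (d t) +
   (?B + cross ?v e) * vol ?c ?x = vol ?c ?x * cross ?v (e + ?D)"
   by (simp add: algebra_simps)
 qed
qed

text \<open>\<open>J1\<close> is the derivative of \<open>J\<close> along the flow; \<open>Jerr\<close> is the error term in \<open>J'' = - K J\<close>.\<close>

definition J1 :: "'a box => (real => 'a) => (real => 'a) => real" where
 "J1 b g h = vol (bch b) (xx b g 0) * cross (vv b g 0)
  (vv b h 0 - vv b g 0 + Gam (bch b) (xx b g 0) (vv b g 0) (xx b h 0 - xx b g 0))"

definition Jerr :: "'a box => (real => 'a) => (real => 'a) => real^2" where
 "Jerr b g h = Gam (bch b) (xx b g 0) (vv b g 0) (vv b g 0) + dGam (bch b) (xx b g 0) (xx b h 0 - xx b g 0) (vv b g 0) (vv b g 0)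
  + 2 *\<^sub>R Gam (bch b) (xx b g 0) (vv b g 0) (vv b h 0 - vv b g 0) - Gam (bch b) (xx b h 0) (vv b h 0) (vv b h 0)"

text \<open>\<open>vc_deriv\<close> is applied twice. The second covariant derivative of the
  coordinate difference is the curvature term \<open>Rm\<close> plus \<open>Jerr\<close>, and
  \<open>cross_Rm\<close> evaluates the normal part of the former.\<close>

lemma J_deriv:
 assumes g: "G g" "G h" and b: "b \<in> B" and t: "g t \<in> inn n b" "h t \<in> inn n b" and n: "n <= 3"
 shows "((%s. J b (sh g s) (sh h s)) has_real_derivative J1 b (sh g t) (sh h t)) (at t)"
  and "((%s. J1 b (sh g s) (sh h s)) has_real_derivative
   - gK (bch b) (xx b g t)*J b (sh g t) (sh h t)
   + vol (bch b) (xx b g t) * cross (vv b g t) (Jerr b (sh g t) (sh h t))) (at t)"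
proof -
 let ?c = "bch b" and ?x = "xx b g t" and ?v = "vv b g t" and ?y = "xx b h t" and ?w = "vv b h t"
 let ?A = "Jerr b (sh g t) (sh h t)"
 have c: "?c \<in> \<A>" and p: "?x \<in> cimg ?c" using bA[OF b] inn_dom[OF t(1)] by auto
 note vs = geodesic_sh(2)[OF g(1)] geodesic_sh(2)[OF g(2)]
 have dx: "((%s. xx b h s - xx b g s) has_vector_derivative ?w - ?v) (at t)"
  by (intro has_vector_derivative_diff geo_deriv(1)[OF g(1) b t(1)] geo_deriv(1)[OF g(2) b t(2)])
 have dv: "((%s. vv b h s - vv b g s) has_vector_derivative - Gam ?c ?y ?w ?w - - Gam ?c ?x ?v ?v) (at t)"
  by (intro has_vector_derivative_diff geo_deriv(2)[OF g(1) b t(1)] geo_deriv(2)[OF g(2) b t(2)])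
 show "((%s. J b (sh g s) (sh h s)) has_real_derivative J1 b (sh g t) (sh h t)) (at t)"
  using vc_deriv[OF g(1) b t(1) dx] by (simp add: J_def J1_def sh_apply vs)
 let ?S = "{s. g s \<in> cdom ?c}"
 have S: "open ?S" "t \<in> ?S" using cont_open[OF geodesic_continuous[OF g(1)] c] inn_dom[OF t(1)] by auto
 have Gd: "((%s. Gam ?c (xx b g s) (vv b g s) (xx b h s - xx b g s)) has_vector_derivative
  (dGam ?c ?x ?v ?v (?y - ?x) + Gam ?c ?x (- Gam ?c ?x ?v ?v) (?y - ?x) + Gam ?c ?x ?v (?w - ?v))) (at t)"
  by (rule Gam_vd[OF c S geo_deriv(1)[OF g(1) b t(1)] _ geo_deriv(2)[OF g(1) b t(1)] dx]) auto
 define E where "E = (- Gam ?c ?y ?w ?w - - Gam ?c ?x ?v ?v) + (dGam ?c ?x ?v ?v (?y - ?x) + Gam ?c ?x (- Gam ?c ?x ?v ?v) (?y - ?x) + Gam ?c ?x ?v (?w - ?v))"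
 have Z: "((%s. vv b h s - vv b g s + Gam ?c (xx b g s) (vv b g s) (xx b h s - xx b g s)) has_vector_derivative E) (at t)"
  unfolding E_def by (intro has_vector_derivative_add dv Gd)
 have W: "E + Gam ?c ?x ?v (?w - ?v + Gam ?c ?x ?v (?y - ?x)) = Rm ?c ?x ?v (?y - ?x) ?v + ?A"
  unfolding E_def Rm_def Jerr_def sh_apply vs add_0 dGam_sym[OF c p, of ?v ?v "?y - ?x"]
   Gam_sym[OF c p, of "?y - ?x" ?v] Gam_sym[OF c p, of "?y - ?x" "Gam ?c ?x ?v ?v"]
  by (simp add: scaleR_2)
 have un: "ip ?c ?x ?v ?v = 1" by (rule geo_unit[OF g(1) b t(1)])
 have e: "cross ?v (Rm ?c ?x ?v (?y - ?x) ?v + q) = - gK ?c ?x * cross ?v (?y - ?x) + cross ?v q" for q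
  using cross_Rm[OF c p, of ?v "?y - ?x"] unfolding un by (simp add: cross_def algebra_simps)
 have "((%s. J1 b (sh g s) (sh h s)) has_real_derivative
   vol ?c ?x * cross ?v (Rm ?c ?x ?v (?y - ?x) ?v + ?A)) (at t)"
  using vc_deriv[OF g(1) b t(1) Z] unfolding W J1_def sh_apply vs add_0 .
 thus "((%s. J1 b (sh g s) (sh h s)) has_real_derivative
   - gK ?c ?x*J b (sh g t) (sh h t) + vol ?c ?x * cross ?v (?A)) (at t)"
  by (rule DERIV_cong) (simp only: e J_def sh_apply vs add_0 distrib_left mult.left_commute)
qed

lemma ip_abs: "b \<in> B ==> q \<in> Kb b ==> \<bar>ip (bch b) q u w\<bar> <= C^2*norm u*norm w"
proof -
 assume b: "b \<in> B" and q: "q \<in> Kb b"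
 have qc: "q \<in> cimg (bch b)" using q KbA[OF b] by auto
 have "(ip (bch b) q u w)^2 <= ip (bch b) q u u*ip (bch b) q w w"
  using vol_cross_sq[OF bA[OF b] qc, of u w] zero_le_power2[of "vol (bch b) q * cross u w"] by linarith
 also have "... <= (C^2*(norm u)^2)*(C^2*(norm w)^2)"
  using ipC[OF b q] ip_nonneg[OF bA[OF b] qc] by (intro mult_mono) auto
 also have "... = (C^2*norm u*norm w)^2" by (simp add: power_mult_distrib power2_eq_square)
 finally show ?thesis by (rule abs_le_square_iff[THEN iffD2, THEN order_trans]) simp
qed

text \<open>\<open>Jerr\<close> is minus the remainder of the first order expansion of
  \<open>Gam y w w\<close> at the position and velocity of \<open>g\<close>, hence small compared
  with the offset.\<close>

lemma Jerr_small:
 assumes e: "e > 0"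
 shows "EX d>0. ALL b:B. ALL g \<eta>. G g --> G \<eta> --> g 0 \<in> inn 3 b --> \<eta> 0 \<in> inn 3 b --> nz b g \<eta> <= d -->
  norm (Jerr b g \<eta>) <= e*nz b g \<eta>"
proof -
 define e0 where "e0 = e/(2*C^2)"
 have e0: "e0 > 0" using e C1 by (simp add: e0_def)
 have "EX d>0. ALL b:B. ALL q:Kb b. ALL q':half_plane. dist q' q <= d -->
  (ALL u w. norm (Gam (bch b) q' u w - Gam (bch b) q u w - dGam (bch b) q (q' - q) u w) <= e0*dist q' q*norm u*norm w)"
  by (rule finite_uniform_small[OF finB]) (use Gam_linearization[OF validB e0] in blast, meson order_trans)
 then obtain d0 where d0: "d0 > 0" and lin: "!!b q q' u w. b \<in> B ==> q \<in> Kb b ==> q' \<in> half_plane ==> dist q' q <= d0 ==>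
  norm (Gam (bch b) q' u w - Gam (bch b) q u w - dGam (bch b) q (q' - q) u w) <= e0*dist q' q*norm u*norm w" by blast
 define d where "d = min d0 (e/(6*C^2))"
 have d: "d > 0" "d <= d0" using d0 e C1 by (auto simp: d_def)
 have "norm (Jerr b g \<eta>) <= e*nz b g \<eta>"
  if b: "b \<in> B" and g: "G g" "G \<eta>" and 0: "g 0 \<in> inn 3 b" "\<eta> 0 \<in> inn 3 b" and m: "nz b g \<eta> <= d" for b g \<eta>
 proof -
  let ?c = "bch b" and ?m = "nz b g \<eta>"
  define x y v w h where xy: "x = xx b g 0" "y = xx b \<eta> 0" "v = vv b g 0" "w = vv b \<eta> 0" "h = w - v"
  have K: "x \<in> Kb b" "y \<in> Kb b" using inn_K[OF b 0(1)] inn_K[OF b 0(2)] by (auto simp: xy)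
  have p: "x \<in> cimg ?c" "y \<in> cimg ?c" using K KbA[OF b] by auto
  have v: "norm v <= C" using speed[OF g(1) b 0(1)] by (simp add: xy)
  have dx: "dist y x <= ?m" "norm h <= ?m" using norm_fst_snd[of "Dz b g \<eta>"] by (auto simp: Dz_def xy dist_norm)
  have w: "w = v + h" by (simp add: xy)
  have J: "Jerr b g \<eta> = - ((Gam ?c y v v - Gam ?c x v v - dGam ?c x (y - x) v v) + 2 *\<^sub>R (Gam ?c y v h - Gam ?c x v h) + Gam ?c y h h)"
   unfolding Jerr_def xy(1-4)[symmetric] xy(5)[symmetric] w using Gam_sym[OF bA[OF b] p(2), of h v] by (simp add: scaleR_2 scaleR_diff_right)
  have "norm (Gam ?c y v v - Gam ?c x v v - dGam ?c x (y - x) v v) <= e0*dist y x*norm v * norm v"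
   using lin[OF b K(1), of y] dx(1) m d K(2) by (auto simp: Kb_def)
  also have "... <= e0*?m*C*C" using dx v e0 C1 by (intro mult_mono) auto
  also have "... = e/2*?m" using C1 by (simp add: e0_def power2_eq_square)
  finally have 1: "norm (Gam ?c y v v - Gam ?c x v v - dGam ?c x (y - x) v v) <= e/2*?m" .
  have "norm (Gam ?c y v h - Gam ?c x v h) <= C*dist y x*norm v * norm h" by (rule GamL[OF b K])
  also have "... <= C*d*C*?m" using dx v m C1 d(1) by (intro mult_mono mult_nonneg_nonneg) auto
  finally have 2: "norm (Gam ?c y v h - Gam ?c x v h) <= C^2*d*?m" by (simp add: power2_eq_square algebra_simps)
  have "norm (Gam ?c y h h) <= C*norm h*norm h" by (rule GamC[OF b K(2)])
  also have "... <= C^2*d*?m" using dx m C1 d(1) Cpow(2)[of 1 2] by (intro mult_mono mult_nonneg_nonneg) auto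
  finally have 3: "norm (Gam ?c y h h) <= C^2*d*?m" .
  have "norm (Jerr b g \<eta>) <= norm (Gam ?c y v v - Gam ?c x v v - dGam ?c x (y - x) v v)
    + norm (2 *\<^sub>R (Gam ?c y v h - Gam ?c x v h)) + norm (Gam ?c y h h)"
   unfolding J norm_minus_cancel by (intro order_trans[OF norm_triangle_ineq] add_mono norm_triangle_ineq) simp
  also have "... <= e/2*?m + 2*(C^2*d*?m) + C^2*d*?m"
   unfolding norm_scaleR using 1 2 3 by (intro add_mono) auto
  also have "... = (e/2 + 3*(C^2*d))*?m" by (simp add: algebra_simps)
  also have "... <= e*?m"
  proof (rule mult_right_mono)
   have "C^2*d <= C^2*(e/(6*C^2))" using C1 by (intro mult_left_mono) (auto simp: d_def)
   thus "e/2 + 3*(C^2*d) <= e" using C1 by simp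
  qed simp
  finally show ?thesis .
 qed
 thus ?thesis using d(1) by blast
qed

text \<open>With \<open>Th b g \<eta> = 0\<close> the position offset is normal, hence measured by
  \<open>J\<close>. Both velocities have length 1, so the tangential part of the covariant velocity
  offset is small compared with the whole offset, and the normal part is \<open>J1\<close>.\<close>

lemma sync_size:
 "EX d>0. ALL b:B. ALL g \<eta>. G g --> G \<eta> --> g 0 \<in> inn 3 b --> \<eta> 0 \<in> inn 3 b --> nz b g \<eta> <= d --> Th b g \<eta> = 0 -->
  nz b g \<eta> <= 4*C^3*(\<bar>J b g \<eta>\<bar> + \<bar>J1 b g \<eta>\<bar>)"
proof -
 let ?A = "4*C^4 + 2*C + C^2"
 define e1 where "e1 = 1/(2*C^3)"
 have "1 <= 2*C^3" using Cpow(1)[of 3] by linarith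
 hence e1: "e1 > 0" "e1 <= 1" using C1 by (auto simp: e1_def divide_simps)
 have "EX d>0. ALL b:B. ALL q:Kb b. ALL q':half_plane. dist q' q <= d -->
  (ALL u w. \<bar>ip (bch b) q' u w - ip (bch b) q u w - dip (bch b) q (q' - q) u w\<bar> <= e1*dist q' q*norm u*norm w)"
  by (rule finite_uniform_small[OF finB]) (use ip_linearization[OF validB e1(1)] in blast, meson order_trans)
 then obtain d0 where d0: "d0 > 0" and lin: "!!b q q' u w. b \<in> B ==> q \<in> Kb b ==> q' \<in> half_plane ==> dist q' q <= d0 ==>
  \<bar>ip (bch b) q' u w - ip (bch b) q u w - dip (bch b) q (q' - q) u w\<bar> <= e1*dist q' q*norm u*norm w" by blast
 define d where "d = min d0 (1/(14*C^5))"
 have d: "d > 0" "d <= d0" using d0 C1 by (auto simp: d_def)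
 have "nz b g \<eta> <= 4*C^3*(\<bar>J b g \<eta>\<bar> + \<bar>J1 b g \<eta>\<bar>)"
  if b: "b \<in> B" and g: "G g" "G \<eta>" and 0: "g 0 \<in> inn 3 b" "\<eta> 0 \<in> inn 3 b" and m: "nz b g \<eta> <= d"
   and th: "Th b g \<eta> = 0" for b g \<eta>
 proof -
  let ?c = "bch b" and ?m = "nz b g \<eta>"
  define x y v w h where xy: "x = xx b g 0" "y = xx b \<eta> 0" "v = vv b g 0" "w = vv b \<eta> 0" "h = w - v"
  define \<zeta> where "\<zeta> = h + Gam ?c x v (y - x)"
  have K: "x \<in> Kb b" "y \<in> Kb b" using inn_K[OF b 0(1)] inn_K[OF b 0(2)] by (auto simp: xy)
  have c: "?c \<in> \<A>" and p: "x \<in> cimg ?c" "y \<in> cimg ?c" using K KbA[OF b] bA[OF b] by auto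
  have v: "norm v <= C" using speed[OF g(1) b 0(1)] by (simp add: xy)
  have dx: "norm (y - x) <= ?m" "norm h <= ?m" using norm_fst_snd[of "Dz b g \<eta>"] by (auto simp: Dz_def xy)
  have w: "w = v + h" by (simp add: xy)
  have un: "ip ?c x v v = 1" "ip ?c y w w = 1" using geo_unit[OF g(1) b 0(1)] geo_unit[OF g(2) b 0(2)] by (auto simp: xy)
  have near: "y \<in> half_plane" "dist y x <= d0" using K(2) dx(1) m d by (auto simp: Kb_def dist_norm)
  note L = lin[OF b K(1) near]
  have dipb: "\<bar>dip ?c x (y - x) v h\<bar> <= 2*C^4*?m*?m"
  proof -
   have "\<bar>ip ?c x (Gam ?c x (y - x) v) h\<bar> <= C^2*norm (Gam ?c x (y - x) v)*norm h" by (rule ip_abs[OF b K(1)])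
   also have "... <= C^2*(C*norm (y - x)*norm v)*norm h"
    by (intro mult_right_mono mult_left_mono GamC[OF b K(1)]) auto
   also have "... <= C^2*(C*?m*C)*?m" using dx v C1 by (intro mult_mono) auto
   finally have 1: "\<bar>ip ?c x (Gam ?c x (y - x) v) h\<bar> <= C^4*?m*?m" by (simp add: power_eq_if algebra_simps)
   have "\<bar>ip ?c x v (Gam ?c x (y - x) h)\<bar> <= C^2*norm v * norm (Gam ?c x (y - x) h)" by (rule ip_abs[OF b K(1)])
   also have "... <= C^2*norm v * (C*norm (y - x)*norm h)"
    by (intro mult_left_mono GamC[OF b K(1)]) auto
   also have "... <= C^2*C*(C*?m*?m)" using dx v C1 by (intro mult_mono) auto
   finally have 2: "\<bar>ip ?c x v (Gam ?c x (y - x) h)\<bar> <= C^4*?m*?m" by (simp add: power_eq_if algebra_simps)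
   show ?thesis unfolding compat[OF c p(1)] using 1 2 by linarith
  qed
  have E1: "\<bar>ip ?c y v v - 1 - dip ?c x (y - x) v v\<bar> <= e1*C^2*?m"
  proof -
   have "\<bar>ip ?c y v v - 1 - dip ?c x (y - x) v v\<bar> <= e1*dist y x*norm v * norm v" using L[of v v] unfolding un .
   also have "... <= e1*?m*C*C" using dx v e1 C1 by (intro mult_mono) (auto simp: dist_norm)
   finally show ?thesis by (simp add: power2_eq_square algebra_simps)
  qed
  have E2: "\<bar>ip ?c y v h - ip ?c x v h\<bar> <= 2*C^4*?m*?m + C*?m*?m"
  proof -
   have "\<bar>ip ?c y v h - ip ?c x v h - dip ?c x (y - x) v h\<bar> <= e1*dist y x*norm v * norm h" by (rule L)
   also have "... <= 1*?m*C*?m" using dx v e1 C1 by (intro mult_mono) (auto simp: dist_norm)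
   finally show ?thesis using dipb by (simp add: algebra_simps)
  qed
  have E3: "\<bar>ip ?c y h h\<bar> <= C^2*?m*?m"
   using order_trans[OF ip_abs[OF b K(2), of h h]] mult_mono[OF mult_left_mono[OF dx(2), of "C^2"] dx(2)] by simp
  \<comment> \<open>Metric compatibility brings in the derivative of the metric. The same derivative
    appears when the unit length of \<open>w\<close> at \<open>y\<close> is expanded at
    \<open>x\<close>, so the leading terms cancel and only the errors \<open>E1\<close>,
    \<open>E2\<close>, \<open>E3\<close> remain.\<close>
  have "2*ip ?c x v \<zeta> = dip ?c x (y - x) v v + 2*ip ?c x v h"
   unfolding compat[OF c p(1)] \<zeta>_def Gam_sym[OF c p(1), of "y - x" v] ip_sym[OF c p(1), of "Gam ?c x v (y - x)" v] ip_lin(2) by (simp only: distrib_left mult_2 add_ac)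
  moreover have "1 = ip ?c y v v + 2*ip ?c y v h + ip ?c y h h"
   using un(2) ip_sym[OF c p(2), of h v] unfolding w by simp
  ultimately have zz: "2*ip ?c x v \<zeta> = - (ip ?c y v v - 1 - dip ?c x (y - x) v v) - 2*(ip ?c y v h - ip ?c x v h) - ip ?c y h h"
   by simp
  have "2*\<bar>ip ?c x v \<zeta>\<bar> <= e1*C^2*?m + 2*(2*C^4*?m*?m + C*?m*?m) + C^2*?m*?m"
  proof -
   have "2*z = - a - 2*b - c ==> \<bar>a\<bar> <= p ==> \<bar>b\<bar> <= q ==> \<bar>c\<bar> <= r ==> 2*\<bar>z\<bar> <= p + 2*q + r" for z a b c p q r :: real
    by linarith
   from this[OF zz E1 E2 E3] show ?thesis .
  qed
  also have "... = (e1*C^2 + ?A*?m)*?m" by (simp add: algebra_simps)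
  also have "... <= (1/(2*C) + 1/(2*C))*?m"
  proof (intro mult_right_mono add_mono)
   show "e1*C^2 <= 1/(2*C)" using C1 by (simp add: e1_def power_eq_if field_simps)
   have "?A*?m <= (7*C^4)*(1/(14*C^5))"
    using Cpow(2)[of 1 4] Cpow(2)[of 2 4] m C1 by (intro mult_mono) (auto simp: d_def)
   also have "... = 1/(2*C)" using C1 by (simp add: power_eq_if field_simps)
   finally show "?A*?m <= 1/(2*C)" .
  qed simp
  finally have iz: "\<bar>ip ?c x v \<zeta>\<bar> <= ?m/(2*C)" by (simp add: field_simps)
  have J: "J b g \<eta> = vol ?c x * cross v (y - x)" "J1 b g \<eta> = vol ?c x * cross v \<zeta>" by (simp_all add: J_def J1_def xy \<zeta>_def)
  have nx: "norm (y - x) <= C*\<bar>J b g \<eta>\<bar>"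
   using unit_bounds(4)[OF b K(1) un(1), of "y - x"] th unfolding J Th_def xy by simp
  have "norm \<zeta> <= C*(\<bar>J1 b g \<eta>\<bar> + \<bar>ip ?c x v \<zeta>\<bar>)" unfolding J by (rule unit_bounds(4)[OF b K(1) un(1)])
  also have "... <= C*(\<bar>J1 b g \<eta>\<bar> + ?m/(2*C))" using iz C1 by (intro mult_left_mono add_left_mono) auto
  also have "... = C*\<bar>J1 b g \<eta>\<bar> + ?m/2" using C1 by (simp add: field_simps)
  finally have nz: "norm \<zeta> <= C*\<bar>J1 b g \<eta>\<bar> + ?m/2" .
  have "norm (Gam ?c x v (y - x)) <= C*norm v * norm (y - x)" by (rule GamC[OF b K(1)])
  also have "... <= C*C*(C*\<bar>J b g \<eta>\<bar>)" using v nx C1 by (intro mult_mono) auto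
  finally have nG: "norm (Gam ?c x v (y - x)) <= C^3*\<bar>J b g \<eta>\<bar>" by (simp add: power3_eq_cube)
  have "norm h <= norm \<zeta> + norm (Gam ?c x v (y - x))" using norm_triangle_ineq4[of \<zeta> "Gam ?c x v (y - x)"] by (simp add: \<zeta>_def)
  hence "norm h <= C*\<bar>J1 b g \<eta>\<bar> + ?m/2 + C^3*\<bar>J b g \<eta>\<bar>" using nz nG by linarith
  moreover have "?m <= norm (y - x) + norm h" using norm_fst_snd(3)[of "Dz b g \<eta>"] by (simp add: Dz_def xy)
  moreover have "C*\<bar>J b g \<eta>\<bar> <= C^3*\<bar>J b g \<eta>\<bar>" "C*\<bar>J1 b g \<eta>\<bar> <= 2*(C^3*\<bar>J1 b g \<eta>\<bar>)"
   using Cpow(2)[of 1 3] Cpow(1)[of 3] mult_right_mono[of C "C^3" "\<bar>J b g \<eta>\<bar>"] mult_right_mono[of C "2*C^3" "\<bar>J1 b g \<eta>\<bar>"] by auto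
  ultimately show ?thesis using nx by (simp add: algebra_simps)
 qed
 thus ?thesis using d(1) by blast
qed

lemma rev_rel:
 assumes g: "G g" "G h" and b: "b \<in> B"
 shows "nz b (rv g) (rv h) = nz b g h" "Th b (rv g) (rv h) = - Th b g h"
  "J b (rv g) (rv h) = - J b g h" "J1 b (rv g) (rv h) = J1 b g h"
proof -
 have v: "vv b (rv g) 0 = - vv b g 0" "vv b (rv h) 0 = - vv b h 0" using geodesic_rv(2) g by auto
 have "norm (p, - q) = norm (p, q)" for p q :: "real^2" by (simp add: norm_Pair)
 from this[of _ "vv b h 0 - vv b g 0"] show "nz b (rv g) (rv h) = nz b g h"
  by (simp add: Dz_def v sh_apply)
 show "Th b (rv g) (rv h) = - Th b g h" by (simp add: Th_def v sh_apply)
 show "J b (rv g) (rv h) = - J b g h" by (simp add: J_def v sh_apply cross_def algebra_simps)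
 have n: "- q - - p + Gam c x (- p) d = - (q - p + Gam c x p d)" "cross (- p) (- q) = cross p q" for p q x d c
  by (simp_all add: cross_def)
 show "J1 b (rv g) (rv h) = J1 b g h" by (simp only: J1_def v sh_apply minus_zero n)
qed

text \<open>The gain \<open>k * T^2 / 4\<close> per unit of \<open>|J| + |J1|\<close> in one time
  step, converted to the offset by the factor \<open>4 * C^3\<close> of
  \<open>sync_size\<close>.\<close>

definition c0 :: real where "c0 = k*T^2/(16*C^3)"

lemma c0_pos: "c0 > 0"
 using kpos tau_pos C1 by (simp add: c0_def)

text \<open>Negative curvature makes \<open>|J|\<close> convex up to errors: if \<open>J\<close> and
  \<open>J1\<close> have the same sign it grows forwards in time. Otherwise the reversed geodesics
  fall under this case, since reversal changes the sign of \<open>J\<close> and not of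
  \<open>J1\<close>.\<close>

lemma local_growth:
 "EX d>0. ALL b:B. ALL g h. G g --> G h --> g 0 \<in> inn 2 b --> h 0 \<in> inn 2 b --> nz b g h <= d --> Th b g h = 0 -->
  \<bar>J b g h\<bar> + c0*nz b g h <= max \<bar>J b (sh g T) (sh h T)\<bar> \<bar>J b (sh g (- T)) (sh h (- T))\<bar>"
proof -
 \<comment> \<open>With this value \<open>Jerr\<close> contributes
   \<open>2 * C * \<epsilon> = k / (16 * C^3)\<close> times the offset, as much as
   \<open>tau2\<close> grants to the Taylor error; by \<open>sync_size\<close> both together cost at
   most \<open>k / 2 * (|J| + |J1|)\<close>.\<close>
 define \<epsilon> where "\<epsilon> = k/(32*C^4)"
 have eps: "\<epsilon> > 0" using kpos C1 by (simp add: \<epsilon>_def)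
 obtain d1 where d1: "d1 > 0" and err: "!!b g h. b \<in> B ==> G g ==> G h ==> g 0 \<in> inn 3 b ==> h 0 \<in> inn 3 b ==>
  nz b g h <= d1 ==> norm (Jerr b g h) <= \<epsilon> * nz b g h"
  using Jerr_small[OF eps] by blast
 obtain d2 where d2: "d2 > 0" and size: "!!b g h. b \<in> B ==> G g ==> G h ==> g 0 \<in> inn 3 b ==> h 0 \<in> inn 3 b ==>
  nz b g h <= d2 ==> Th b g h = 0 ==> nz b g h <= 4*C^3*(\<bar>J b g h\<bar> + \<bar>J1 b g h\<bar>)"
  using sync_size by blast
 define d where "d = min (d1/2) d2"
 have d: "d > 0" "2*d <= d1" "d <= d2" using d1 d2 by (auto simp: d_def)
 have tau2': "T^2 <= T"
 proof -
  have "T <= C^4*T" using Cpow(1)[of 4] tau_pos mult_right_mono[of 1 "C^4" T] by simp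
  hence "T <= 1" using tau1 by linarith
  thus ?thesis using tau_pos by (simp add: power2_eq_square mult_left_le)
 qed
 have main: "\<bar>J b g h\<bar> + c0*nz b g h <= \<bar>J b (sh g T) (sh h T)\<bar>"
  if b: "b \<in> B" and g: "G g" "G h" and 0: "g 0 \<in> inn 2 b" "h 0 \<in> inn 2 b" and m: "nz b g h <= d"
   and th: "Th b g h = 0" and sg: "\<sigma> = 1 \<or> \<sigma> = - 1" "0 <= \<sigma> * J b g h" "0 <= \<sigma> * J1 b g h" for b g h and \<sigma> :: real
 proof -
  let ?m = "nz b g h" and ?c = "bch b"
  define y where "y t = \<sigma> * J b (sh g t) (sh h t)" for t
  define y1 where "y1 t = \<sigma> * J1 b (sh g t) (sh h t)" for t
  define e where "e t = \<sigma> * (vol ?c (xx b g t) * cross (vv b g t) (Jerr b (sh g t) (sh h t)))" for t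
  have tt: "\<bar>t\<bar> <= 4*T" if "0 <= t" "t <= T" for t using that tau_pos by auto
  have st: "g t \<in> inn 3 b" "h t \<in> inn 3 b" if "0 <= t" "t <= T" for t
   using geo_stay[OF g(1) b 0(1) _ tt[OF that]] geo_stay[OF g(2) b 0(2) _ tt[OF that]] by auto
  have Dm: "nz b (sh g t) (sh h t) <= 2*?m" if "0 <= t" "t <= T" for t
   by (rule flow_diff[OF g b 0 _ tt[OF that]]) simp
  have unb: "\<bar>vol ?c (xx b g t) * cross (vv b g t) w\<bar> <= C*norm w" if "0 <= t" "t <= T" for t w
   by (rule unit_bounds(1)[OF b inn_K[OF b st(1)[OF that]] geo_unit[OF g(1) b st(1)[OF that]]]) simp
  have y01: "y 0 = \<sigma> * J b g h" "y1 0 = \<sigma> * J1 b g h" by (simp_all add: y_def y1_def)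
  have ab: "\<bar>J b g h\<bar> = y 0" "\<bar>J1 b g h\<bar> = y1 0" using sg by (auto simp: y01)
  have "y 0 + y1 0*T + (k*y 0 - (4*C*?m/k)*T^2/(2*k) - C*(\<epsilon> * (2*?m)))*T^2/2 <= y T"
  proof (rule scalar_growth[where \<kappa>="%t. - gK ?c (xx b g t)" and e=e and Y="C*(2*?m)"])
   fix t assume t: "0 <= t" "t <= T"
   show "(y has_real_derivative y1 t) (at t)" unfolding y_def y1_def
    by (intro DERIV_cmult J_deriv(1)[OF g b st[OF t]]) simp
   have "(y1 has_real_derivative \<sigma> * (- gK ?c (xx b g t)*J b (sh g t) (sh h t)
     + vol ?c (xx b g t) * cross (vv b g t) (Jerr b (sh g t) (sh h t)))) (at t)" unfolding y1_def
    by (intro DERIV_cmult J_deriv(2)[OF g b st[OF t]]) simp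
   thus "(y1 has_real_derivative - gK ?c (xx b g t)*y t + e t) (at t)"
    by (rule DERIV_cong) (simp add: y_def e_def algebra_simps)
   show "k <= - gK ?c (xx b g t) & - gK ?c (xx b g t) <= 1/k"
    by (rule curv[OF b inn_K[OF b st(1)[OF t]]]) simp
   have "norm (Jerr b (sh g t) (sh h t)) <= \<epsilon> * nz b (sh g t) (sh h t)"
    using Dm[OF t] m d st[OF t] by (intro err b geodesic_sh(1) g) (auto simp: sh_apply)
   also have "... <= \<epsilon> * (2*?m)" using Dm[OF t] eps by (intro mult_left_mono) auto
   finally have "C*norm (Jerr b (sh g t) (sh h t)) <= C*(\<epsilon> * (2*?m))" using C1 by (intro mult_left_mono) auto
   thus "\<bar>e t\<bar> <= C*(\<epsilon> * (2*?m))" unfolding e_def abs_mult[of \<sigma>]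
    using unb[OF t, of "Jerr b (sh g t) (sh h t)"] sg(1) by auto
   have "norm (xx b h t - xx b g t) <= 2*?m"
    using Dm[OF t] norm_fst_snd(1)[of "Dz b (sh g t) (sh h t)"] by (simp add: Dz_def sh_apply)
   hence "C*norm (xx b h t - xx b g t) <= C*(2*?m)" using C1 by (intro mult_left_mono) auto
   thus "\<bar>y t\<bar> <= C*(2*?m)" unfolding y_def abs_mult[of \<sigma>] J_def sh_apply geodesic_sh(2)[OF g(1)] add_0
    using unb[OF t, of "xx b h t - xx b g t"] sg(1) by auto
  next
   have "\<epsilon> <= 1/k"
   proof -
    have "\<epsilon> <= k" using kpos Cpow(1)[of 4] by (simp add: \<epsilon>_def divide_le_eq mult_left_le)
    also have "k <= 1/k" using kpos mult_mono[of k 1 k 1] by (simp add: field_simps)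
    finally show ?thesis .
   qed
   hence "\<epsilon> * (C*(2*?m)) <= 1/k*(C*(2*?m))" using C1 by (intro mult_right_mono) auto
   hence "C*(2*?m)/k + C*(\<epsilon> * (2*?m)) <= C*(2*?m)/k + C*(2*?m)/k"
    by (intro add_left_mono) (simp add: mult.left_commute)
   also have "... = 4*C*?m/k" using kpos by (simp add: field_simps)
   finally show "C*(2*?m)/k + C*(\<epsilon> * (2*?m)) <= 4*C*?m/k" .
   show "0 <= y 0" "0 <= y1 0" using sg by (auto simp: y01)
  qed (use tau_pos kpos in auto)
  moreover have "(4*C*?m/k)*T^2/(2*k) + C*(\<epsilon> * (2*?m)) <= k/2*(y 0 + y1 0)"
  proof -
   have "?m <= 4*C^3*(y 0 + y1 0)" unfolding ab[symmetric]
    using m d inn_mono[OF validB[OF b], of 2 3] 0 th by (intro size b g) auto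
   moreover have "32*C^4*T^2/(32*C^4) <= k^3/(32*C^4)" by (rule divide_right_mono[OF tau2]) simp
   hence "T^2 <= k^3/(32*C^4)" using C1 by simp
   hence "T^2*(2*C/k^2) <= k^3/(32*C^4)*(2*C/k^2)" using C1 kpos by (intro mult_right_mono) auto
   hence "2*C*T^2/k^2 <= k/(16*C^3)" using C1 kpos by (simp add: power_eq_if field_simps)
   moreover have "C*\<epsilon> * 2 = k/(16*C^3)" using C1 by (simp add: \<epsilon>_def power_eq_if field_simps)
   ultimately have "(2*C*T^2/k^2 + C*\<epsilon> * 2)*?m <= (k/(16*C^3) + k/(16*C^3))*(4*C^3*(y 0 + y1 0))"
    using C1 kpos eps by (intro mult_mono add_mono) auto
   also have "... = k/2*(y 0 + y1 0)" using C1 by (simp add: field_simps)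
   finally show ?thesis by (simp add: power2_eq_square algebra_simps)
  qed
  ultimately have "y 0 + y1 0*T + (k*y 0 - k/2*(y 0 + y1 0))*T^2/2 <= y T"
  proof -
   assume 1: "y 0 + y1 0*T + (k*y 0 - (4*C*?m/k)*T^2/(2*k) - C*(\<epsilon> * (2*?m)))*T^2/2 <= y T"
    and 2: "(4*C*?m/k)*T^2/(2*k) + C*(\<epsilon> * (2*?m)) <= k/2*(y 0 + y1 0)"
   have "(k*y 0 - k/2*(y 0 + y1 0))*(T^2/2) <= (k*y 0 - (4*C*?m/k)*T^2/(2*k) - C*(\<epsilon> * (2*?m)))*(T^2/2)"
    by (rule mult_right_mono) (use 2 in linarith, simp)
   thus ?thesis using 1 unfolding times_divide_eq_right by linarith
  qed
  moreover have "y 0 + c0*?m <= y 0 + y1 0*T + (k*y 0 - k/2*(y 0 + y1 0))*T^2/2"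
  proof -
   have "?m <= 4*C^3*(y 0 + y1 0)" unfolding ab[symmetric]
    using m d inn_mono[OF validB[OF b], of 2 3] 0 th by (intro size b g) auto
   hence "c0*?m <= c0*(4*C^3*(y 0 + y1 0))" using c0_pos by (intro mult_left_mono) auto
   also have "... = k*T^2/4*(y 0 + y1 0)" using C1 by (simp add: c0_def field_simps)
   finally have 1: "c0*?m <= (k*T^2*y 0)/4 + (k*T^2*y1 0)/4" by (simp add: field_simps)
   \<comment> \<open>Since \<open>T^2 <= T\<close>, the first order term \<open>y1 0 * T\<close>
     absorbs the negative contribution of \<open>y1 0\<close> at second order.\<close>
   have "k*T^2 <= 1*T" using kpos tau2' by (intro mult_mono) auto
   hence "k*T^2*y1 0 <= 1*T * y1 0" using sg(3) by (intro mult_right_mono) (auto simp: y01)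
   hence 2: "k*T^2*y1 0 <= y1 0*T" by (simp add: mult.commute)
   have 3: "0 <= y1 0*T" using sg(3) tau_pos by (simp add: y01)
   have 4: "(k*y 0 - k/2*(y 0 + y1 0))*T^2/2 = (k*T^2*y 0)/4 - (k*T^2*y1 0)/4"
    by (simp add: field_simps)
   show ?thesis unfolding 4 using 1 2 3 by linarith
  qed
  ultimately have "y 0 + c0*?m <= y T" by linarith
  moreover have "y T <= \<bar>J b (sh g T) (sh h T)\<bar>" using sg(1) by (auto simp: y_def)
  ultimately show ?thesis unfolding ab by linarith
 qed
 have "\<bar>J b g h\<bar> + c0*nz b g h <= max \<bar>J b (sh g T) (sh h T)\<bar> \<bar>J b (sh g (- T)) (sh h (- T))\<bar>"
  if b: "b \<in> B" and g: "G g" "G h" and 0: "g 0 \<in> inn 2 b" "h 0 \<in> inn 2 b" and m: "nz b g h <= d"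
   and th: "Th b g h = 0" for b g h
 proof (cases "0 <= J b g h*J1 b g h")
  case True
  hence "(0 <= 1*J b g h & 0 <= 1*J1 b g h) \<or> (0 <= - 1*J b g h & 0 <= - 1*J1 b g h)"
   by (auto simp: zero_le_mult_iff)
  thus ?thesis using main[OF b g 0 m th, of 1] main[OF b g 0 m th, of "- 1"] by (auto simp: le_max_iff_disj)
 next
  case False
  have r: "G (rv g)" "G (rv h)" using geodesic_rv(1) g by auto
  note R = rev_rel[OF g b]
  have "(0 <= 1*J b (rv g) (rv h) & 0 <= 1*J1 b (rv g) (rv h)) \<or> (0 <= - 1*J b (rv g) (rv h) & 0 <= - 1*J1 b (rv g) (rv h))"
   using False unfolding R by (auto simp: zero_le_mult_iff)
  moreover have "rv g 0 \<in> inn 2 b" "rv h 0 \<in> inn 2 b" "nz b (rv g) (rv h) <= d" "Th b (rv g) (rv h) = 0"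
   using 0 m th unfolding R by (auto simp: sh_apply)
  ultimately have "\<bar>J b (rv g) (rv h)\<bar> + c0*nz b (rv g) (rv h) <= \<bar>J b (sh (rv g) T) (sh (rv h) T)\<bar>"
   using main[OF b r, of 1] main[OF b r, of "- 1"] by auto
  thus ?thesis unfolding sh_rv R rev_rel[OF geodesic_sh(1)[OF g(1)] geodesic_sh(1)[OF g(2)] b]
   by (auto simp: le_max_iff_disj)
 qed
 thus ?thesis using d(1) by blast
qed

end

section \<open>Comparison of pairs of geodesics in different charts\<close>

context riem begin

lemma chart_image_compact:
 assumes c: "c \<in> \<A>" and S: "compactin X S" "S <= cdom c" shows "compact (cmap c ` S)"
proof -
 have "compactin (subtopology X (cdom c)) S" using S by (simp add: compactin_subtopology)
 hence "compactin (top_of_set (cimg c)) (cmap c ` S)"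
  using chart_homeo[OF c] homeomorphic_imp_continuous_map image_compactin by blast
 thus ?thesis by (simp add: compactin_subtopology)
qed

lemma norm_comp: "norm (x :: real^2) <= \<bar>x$1\<bar> + \<bar>x$2\<bar>"
 using norm_le_l1_cart[of x] by (simp add: sum_2)

lemma transition_linearization:
 assumes c: "c \<in> \<A>" "d \<in> \<A>" and P: "compact P" "P <= overlap c d" and e: "e > 0"
 shows "EX \<delta>>0. ALL p:P. ALL q:half_plane. dist q p <= \<delta> --> q \<in> overlap c d &
  norm (transition c d q - transition c d p - DT c d p (q - p)) <= e*dist q p"
proof -
 let ?A = "overlap c d"
 have "e/2 > 0" using e by simp
 note L = C1_uniform_linearization[OF overlap_relopen(1)[OF c] transition_C1(1)[OF c] P this]
 obtain d1 where d1: "d1 > 0" and D1: "!!p q. p \<in> P ==> q \<in> half_plane ==> dist q p <= d1 ==> q \<in> ?A &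
  \<bar>transition c d q $ 1 - transition c d p $ 1 - ((q - p)$1*partial (?A) 1 (%q. transition c d q $ 1) p + (q - p)$2*partial (?A) 2 (%q. transition c d q $ 1) p)\<bar> <= e/2*dist q p"
  using L[of 1] by blast
 obtain d2 where d2: "d2 > 0" and D2: "!!p q. p \<in> P ==> q \<in> half_plane ==> dist q p <= d2 ==> q \<in> ?A &
  \<bar>transition c d q $ 2 - transition c d p $ 2 - ((q - p)$1*partial (?A) 1 (%q. transition c d q $ 2) p + (q - p)$2*partial (?A) 2 (%q. transition c d q $ 2) p)\<bar> <= e/2*dist q p"
  using L[of 2] by blast
 have "q \<in> ?A & norm (transition c d q - transition c d p - DT c d p (q - p)) <= e*dist q p"
  if p: "p \<in> P" "q \<in> half_plane" "dist q p <= min d1 d2" for p q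
 proof
  have po: "p \<in> ?A" using p P by auto
  show "q \<in> ?A" using D1[OF p(1,2)] p(3) by simp
  let ?v = "transition c d q - transition c d p - DT c d p (q - p)"
  have "\<bar>?v $ 1\<bar> <= e/2*dist q p" "\<bar>?v $ 2\<bar> <= e/2*dist q p"
   using D1[OF p(1,2)] D2[OF p(1,2)] p(3) by (simp_all add: DT_has_derivative(2)[OF c po] sum_2)
  thus "norm ?v <= e*dist q p" using norm_comp[of ?v] by simp
 qed
 thus ?thesis using d1 d2 by (intro exI[of _ "min d1 d2"]) auto
qed

lemma DT_lipschitz:
 assumes c: "c \<in> \<A>" "d \<in> \<A>" and P: "compact P" "P <= overlap c d"
 shows "EX L>=0. EX \<delta>>0. ALL p:P. ALL q:half_plane. dist q p <= \<delta> --> q \<in> overlap c d &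
  (ALL w. norm (DT c d q w - DT c d p w) <= L*dist q p*norm w)"
proof -
 let ?f = "%i k. partial (overlap c d) i (%q. transition c d q $ k)"
 let ?A = "overlap c d"
 let ?P = "%l i k d. ALL p:P. ALL q:half_plane. dist q p <= d --> q \<in> ?A & \<bar>?f i k q - ?f i k p\<bar> <= l*dist q p"
 have N: "EX L>=0. EX \<delta>>0. ?P L i k \<delta>" for i k
  by (rule C1_lipschitz_near[OF overlap_relopen(1)[OF c] transition_C1(2)[OF c] P])
 have "EX L. ALL i k. L i k >= 0 & (EX \<delta>>0. ?P (L i k) i k \<delta>)"
  using N by (intro choice allI) blast
 then obtain L where L: "!!i k. L i k >= 0"
  and L': "!!i k. EX \<delta>>0. ?P (L i k) i k \<delta>" by blast
 have "EX \<delta>>0. ALL (i, k):UNIV. ?P (L i k) i k \<delta>"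
 proof (rule finite_uniform_small)
  fix x :: "2 \<times> 2"
  show "EX \<delta>>0. case x of (i, k) => ?P (L i k) i k \<delta>"
   using L'[of "fst x" "snd x"] by (simp add: case_prod_beta)
 next
  fix x :: "2 \<times> 2" and \<delta> \<delta>' :: real
  assume "case x of (i, k) => ?P (L i k) i k \<delta>" "\<delta>' <= \<delta>"
  thus "case x of (i, k) => ?P (L i k) i k \<delta>'"
   unfolding case_prod_beta using order_trans by blast
 qed simp
 then obtain \<delta> where \<delta>: "\<delta> > 0" "!!i k p q. p \<in> P ==> q \<in> half_plane ==> dist q p <= \<delta> ==> q \<in> ?A & \<bar>?f i k q - ?f i k p\<bar> <= L i k*dist q p"
  unfolding case_prod_beta by (metis UNIV_I fst_conv snd_conv)
 define S where "S = L 1 1 + L 1 2 + L 2 1 + L 2 2"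
 have S: "L i k <= S" "0 <= S" for i k using L[of 1 1] L[of 1 2] L[of 2 1] L[of 2 2] exhaust_2[of i] exhaust_2[of k] by (auto simp: S_def)
 have "q \<in> ?A & (ALL w. norm (DT c d q w - DT c d p w) <= 4*S*dist q p*norm w)"
  if p: "p \<in> P" "q \<in> half_plane" "dist q p <= \<delta>" for p q
 proof (intro conjI allI)
  have po: "p \<in> ?A" using p P by auto
  show qo: "q \<in> ?A" using \<delta>(2)[OF p] by simp
  fix w
  have "\<bar>(DT c d q w - DT c d p w) $ k\<bar> <= 2*(S*dist q p)*norm w" for k
  proof -
   have b: "\<bar>?f i k q - ?f i k p\<bar> <= S*dist q p" for i
    using \<delta>(2)[OF p, of i k] mult_right_mono[OF S(1)[of i k], of "dist q p"] by auto
   have "(DT c d q w - DT c d p w) $ k = w$1*(?f 1 k q - ?f 1 k p) + w$2*(?f 2 k q - ?f 2 k p)"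
    by (simp add: DT_has_derivative(2)[OF c po] DT_has_derivative(2)[OF c qo] sum_2 algebra_simps)
   thus ?thesis using partial_bound[OF b b, of w] by simp
  qed
  from this[of 1] this[of 2] show "norm (DT c d q w - DT c d p w) <= 4*S*dist q p*norm w"
   using norm_comp[of "DT c d q w - DT c d p w"] by simp
 qed
 thus ?thesis using S(2) \<delta>(1) by (intro exI[of _ "4*S"]) auto
qed

end

context boxes begin

abbreviation "nbr b b' d g h n P \<equiv> n <= 2 --> G g --> G h --> g 0 \<in> inn 3 b --> g 0 \<in> inn n b' --> h 0 \<in> inn 3 b --> nz b g h <= d --> P"

text \<open>The area form is intrinsic up to orientation, so \<open>|J|\<close> changes only through
  the deviation of the transition map from its derivative, which is small compared with the offset;
  the offset itself changes by a bounded factor.\<close>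

lemma chart_change_pair:
 assumes b: "b \<in> B" and b': "b' \<in> B" and e: "e > 0"
 shows "EX d>0. ALL g h n. nbr b b' d g h n (h 0 \<in> inn (n + 1/2) b' & \<bar>\<bar>J b' g h\<bar> - \<bar>J b g h\<bar>\<bar> <= e*nz b g h)"
  "EX L. EX d>0. ALL g h n. nbr b b' d g h n (nz b' g h <= L*nz b g h)"
proof -
 let ?c = "bch b" and ?d = "bch b'"
 let ?T = "transition ?c ?d" and ?D = "DT ?c ?d"
 have c: "?c \<in> \<A>" "?d \<in> \<A>" using bA b b' by auto
 define S where "S = inn 3 b \<inter> inn 2 b'"
 have "compactin X S" unfolding S_def
  using closed_Int_compactin[OF inn_closed(2)[OF validB[OF b'], of 2] inn_closed(1)[OF validB[OF b], of 3]] by (simp add: Int_commute)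
 hence P: "compact (cmap ?c ` S)" using chart_image_compact[OF c(1)] by (auto simp: S_def inn_def)
 have Po: "cmap ?c ` S <= overlap ?c ?d" by (auto simp: S_def inn_def overlap_def)
 have dom: "y \<in> cdom ?d" if "y \<in> inn 3 b" "cmap ?c y \<in> overlap ?c ?d" for y
  using that chart_inj[OF c(1)] unfolding overlap_def inj_on_def inn_def by auto
 have T: "?T (cmap ?c y) = cmap ?d y" if "y \<in> inn 3 b" for y
  by (rule transition_cmap[OF c(1) inn_dom[OF that]])
 have V: "vv b' g 0 = ?D (xx b g 0) (vv b g 0)" if "G g" "g 0 \<in> inn 3 b" "g 0 \<in> cdom ?d" for g
  by (rule geodesic_chart(4)[OF that(1) c(1) inn_dom[OF that(2)] c(2) that(3)])
 have hp: "cmap ?c y \<in> half_plane" if "y \<in> inn 3 b" for y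
  using inn_K[OF b that] by (simp add: Kb_def)
 have near: "dist (xx b h 0) (xx b g 0) <= nz b g h" for g h
  using norm_fst_snd(1)[of "Dz b g h"] by (simp add: Dz_def dist_norm)
 have Dbd: "norm (?D (cmap ?c y) w) <= C^2*norm w" if g: "y \<in> inn 3 b" "y \<in> inn 2 b'" for y w
 proof -
  have po: "cmap ?c y \<in> overlap ?c ?d" using Po g by (auto simp: S_def)
  have "norm (?D (cmap ?c y) w) <= C * sqrt (ip ?d (?T (cmap ?c y)) (?D (cmap ?c y) w) (?D (cmap ?c y) w))"
   unfolding T[OF g(1)] by (rule norm_le_ip[OF b' inn_K[OF b' g(2)]]) simp
  also have "... = C * sqrt (ip ?c (cmap ?c y) w w)" unfolding metric_DT[OF c po] ..
  also have "... <= C * sqrt (C^2*(norm w)^2)" using ipC[OF b inn_K[OF b g(1)]] C1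
   by (intro mult_left_mono real_sqrt_le_mono) auto
  also have "... = C^2*norm w" using C1 by (simp add: real_sqrt_mult power2_eq_square)
  finally show ?thesis .
 qed
 define e' where "e' = min (e/C) 1"
 have e': "e' > 0" "C*e' <= e" using e C1 by (auto simp: e'_def min_def field_simps)
 obtain d0 where d0: "d0 > 0" and lin: "!!p q. p \<in> cmap ?c ` S ==> q \<in> half_plane ==> dist q p <= d0 ==> q \<in> overlap ?c ?d &
  norm (?T q - ?T p - ?D p (q - p)) <= e' * dist q p"
  using transition_linearization[OF c P Po e'(1)] by blast
 have mv: "norm (xx b' h 0 - xx b' g 0) <= 2*C^2*nz b g h" "h 0 \<in> cdom ?d" "xx b h 0 \<in> overlap ?c ?d"
  "norm (xx b' h 0 - xx b' g 0 - ?D (xx b g 0) (xx b h 0 - xx b g 0)) <= e' * nz b g h"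
  if g: "g 0 \<in> inn 3 b" "g 0 \<in> inn 2 b'" "h 0 \<in> inn 3 b" and m: "nz b g h <= d0" for g h
 proof -
  have dd: "dist (xx b h 0) (xx b g 0) <= d0" using near[of h g] m by linarith
  have pS: "xx b g 0 \<in> cmap ?c ` S" using g by (auto simp: S_def)
  note l = lin[OF pS hp[OF g(3)] dd]
  show o: "xx b h 0 \<in> overlap ?c ?d" using l by simp
  show "h 0 \<in> cdom ?d" by (rule dom[OF g(3) o])
  have "norm (xx b' h 0 - xx b' g 0 - ?D (xx b g 0) (xx b h 0 - xx b g 0)) <= e' * dist (xx b h 0) (xx b g 0)"
   using l T[OF g(1)] T[OF g(3)] by simp
  also have "... <= e' * nz b g h" using near e' by (intro mult_left_mono) auto
  finally show 1: "norm (xx b' h 0 - xx b' g 0 - ?D (xx b g 0) (xx b h 0 - xx b g 0)) <= e' * nz b g h" .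
  have "norm (?D (xx b g 0) (xx b h 0 - xx b g 0)) <= C^2*norm (xx b h 0 - xx b g 0)" by (rule Dbd[OF g(1,2)])
  also have "... <= C^2*nz b g h" using near[of h g] by (intro mult_left_mono) (auto simp: dist_norm)
  finally have 2: "norm (?D (xx b g 0) (xx b h 0 - xx b g 0)) <= C^2*nz b g h" .
  have "e' * nz b g h <= C^2*nz b g h" using Cpow(1)[of 2] by (intro mult_right_mono) (auto simp: e'_def)
  thus "norm (xx b' h 0 - xx b' g 0) <= 2*C^2*nz b g h"
   using norm_triangle_ineq2[of "xx b' h 0 - xx b' g 0" "?D (xx b g 0) (xx b h 0 - xx b g 0)"] 1 2 by simp
 qed
 define d1 where "d1 = min d0 (brad b' / (4*C^2))"
 have d1: "d1 > 0" "d1 <= d0" "4*C^2*d1 <= brad b'"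
 proof -
  have p: "0 < 4*C^2" using C1 by simp
  show "d1 > 0" "d1 <= d0" using d0 brad_pos[OF b'] p by (auto simp: d1_def)
  have "4*C^2*d1 <= 4*C^2*(brad b' / (4*C^2))" using p by (intro mult_left_mono) (auto simp: d1_def)
  thus "4*C^2*d1 <= brad b'" using p by simp
 qed
 have "h 0 \<in> inn (n + 1/2) b' & \<bar>\<bar>J b' g h\<bar> - \<bar>J b g h\<bar>\<bar> <= e*nz b g h"
  if g: "G g" "G h" "g 0 \<in> inn 3 b" "g 0 \<in> inn 2 b'" "h 0 \<in> inn 3 b" and gn: "g 0 \<in> inn n b'" and m: "nz b g h <= d1" for g h n
 proof
  have m0: "nz b g h <= d0" using m d1 by linarith
  note M = mv[OF g(3-5) m0]
  have "2*C^2*nz b g h <= 2*C^2*d1" using m by (intro mult_left_mono) auto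
  hence "dist (xx b' h 0) (xx b' g 0) <= brad b' / 2" using M(1) d1(3) by (simp add: dist_norm)
  moreover have "dist (xx b' g 0) (bpt b') <= n*brad b'" using gn by (simp add: inn_def)
  ultimately show "h 0 \<in> inn (n + 1/2) b'" using M(2) dist_triangle[of "xx b' h 0" "bpt b'" "xx b' g 0"] by (simp add: inn_def algebra_simps)
  let ?p = "xx b g 0" and ?v = "vv b g 0" and ?h = "xx b h 0 - xx b g 0"
  have po: "?p \<in> overlap ?c ?d" using Po g by (auto simp: S_def)
  have dq: "g 0 \<in> cdom ?d" using g(4) by (rule inn_dom)
  have K': "xx b' g 0 \<in> Kb b'" using inn_K[OF b' g(4)] by simp
  note u' = geo_unit[OF g(1) b' g(4)]
  define r where "r = xx b' h 0 - xx b' g 0 - ?D ?p ?h"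
  have cl: "cross u (w + z) = cross u w + cross u z" for u w z by (simp add: cross_def algebra_simps)
  have "J b' g h = vol ?d (xx b' g 0) * cross (vv b' g 0) (?D ?p ?h) + vol ?d (xx b' g 0) * cross (vv b' g 0) r"
   unfolding J_def distrib_left[symmetric] cl[symmetric] by (simp add: r_def)
  moreover have "\<bar>vol ?d (xx b' g 0) * cross (vv b' g 0) (?D ?p ?h)\<bar> = \<bar>J b g h\<bar>"
  proof -
   \<comment> \<open>Only the squares agree, by \<open>vol_cross_sq\<close>, because a transition
     may reverse the orientation.\<close>
   have "(vol ?d (xx b' g 0) * cross (vv b' g 0) (?D ?p ?h))^2 = (vol ?c ?p * cross ?v ?h)^2"
    using vol_cross_sq[OF c(2) transition_in(1)[OF c(1) po], of "?D ?p ?v" "?D ?p ?h"] vol_cross_sq[OF c(1) transition_in(2)[OF c(1) po], of ?v ?h]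
    unfolding metric_DT[OF c po] T[OF g(3)] V[OF g(1,3) dq] by linarith
   thus ?thesis unfolding J_def by (simp only: power2_eq_iff abs_eq_iff)
  qed
  moreover have "\<bar>vol ?d (xx b' g 0) * cross (vv b' g 0) r\<bar> <= e*nz b g h"
  proof -
   have "\<bar>vol ?d (xx b' g 0) * cross (vv b' g 0) r\<bar> <= C*norm r" by (rule unit_bounds(1)[OF b' K' u'])
   also have "... <= C*(e' * nz b g h)" using M(4) C1 unfolding r_def by (intro mult_left_mono) auto
   also have "... <= e*nz b g h" using mult_right_mono[OF e'(2), of "nz b g h"] by (simp add: mult.assoc)
   finally show ?thesis .
  qed
  ultimately show "\<bar>\<bar>J b' g h\<bar> - \<bar>J b g h\<bar>\<bar> <= e*nz b g h" by linarith
 qed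
 thus "EX d>0. ALL g h n. nbr b b' d g h n (h 0 \<in> inn (n + 1/2) b' & \<bar>\<bar>J b' g h\<bar> - \<bar>J b g h\<bar>\<bar> <= e*nz b g h)" using d1(1) inn_mono[OF validB[OF b']] by (meson subsetD)
 obtain L d2 where L: "L >= 0" and d2: "d2 > 0" and lip: "!!p q w. p \<in> cmap ?c ` S ==> q \<in> half_plane ==> dist q p <= d2 ==>
  norm (?D q w - ?D p w) <= L*dist q p*norm w"
  using DT_lipschitz[OF c P Po] by blast
 have "nz b' g h <= (3*C^2 + L*C)*nz b g h"
  if g: "G g" "G h" "g 0 \<in> inn 3 b" "g 0 \<in> inn 2 b'" "h 0 \<in> inn 3 b" and m: "nz b g h <= min d0 d2" for g h
 proof -
  let ?m = "nz b g h"
  have m0: "?m <= d0" and dd: "dist (xx b h 0) (xx b g 0) <= d2" using m near[of h g] by auto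
  note M = mv[OF g(3-5) m0]
  have pS: "xx b g 0 \<in> cmap ?c ` S" using g by (auto simp: S_def)
  have dq: "g 0 \<in> cdom ?d" using g(4) by (rule inn_dom)
  have po: "xx b g 0 \<in> overlap ?c ?d" using Po pS by auto
  let ?w = "vv b h 0" and ?v = "vv b g 0"
  have "vv b' h 0 - vv b' g 0 = (?D (xx b h 0) ?w - ?D (xx b g 0) ?w) + ?D (xx b g 0) (?w - ?v)"
   unfolding V[OF g(1,3) dq] V[OF g(2,5) M(2)] linear_diff[OF DT_has_derivative(3)[OF c po]] by simp
  hence "norm (vv b' h 0 - vv b' g 0) <= norm (?D (xx b h 0) ?w - ?D (xx b g 0) ?w) + norm (?D (xx b g 0) (?w - ?v))"
   by (simp only: norm_triangle_ineq)
  also have "norm (?D (xx b h 0) ?w - ?D (xx b g 0) ?w) <= L*dist (xx b h 0) (xx b g 0)*norm ?w"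
   by (rule lip[OF pS hp[OF g(5)] dd])
  also have "... <= L*?m*C" using near[of h g] speed[OF g(2) b g(5)] L by (intro mult_mono) auto
  also have "norm (?D (xx b g 0) (?w - ?v)) <= C^2*norm (?w - ?v)" by (rule Dbd[OF g(3,4)])
  also have "... <= C^2*?m" using norm_fst_snd(2)[of "Dz b g h"] by (intro mult_left_mono) (auto simp: Dz_def)
  finally have "norm (vv b' h 0 - vv b' g 0) <= L*?m*C + C^2*?m" by simp
  thus ?thesis using M(1) norm_fst_snd(3)[of "Dz b' g h"] by (simp add: Dz_def algebra_simps)
 qed
 thus "EX L. EX d>0. ALL g h n. nbr b b' d g h n (nz b' g h <= L*nz b g h)"
  using d0 d2 inn_mono[OF validB[OF b']] by (intro exI[of _ "3*C^2 + L*C"] exI[of _ "min d0 d2"]) (simp, meson subsetD)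
qed

text \<open>A fixed choice of a box at each point makes \<open>sync\<close>, \<open>mm\<close> and
  \<open>jj\<close> depend on the two geodesics alone. \<open>jj\<close> carries an absolute value
  since charts need not agree in orientation.\<close>

definition bx :: "'a => 'a box" where "bx y = (SOME b. b \<in> B & y \<in> inn 1 b)"

definition close :: "'a box => real => (real => 'a) => (real => 'a) => bool" where
 "close b d g h \<longleftrightarrow> b \<in> B & G g & G h & g 0 \<in> inn 2 b & h 0 \<in> inn 2 b & nz b g h <= d"

definition sync :: "(real => 'a) => (real => 'a) => bool" where
 "sync g h \<longleftrightarrow> G g & G h & h 0 \<in> inn 2 (bx (g 0)) & Th (bx (g 0)) g h = 0"

definition mm :: "(real => 'a) => (real => 'a) => real" where "mm g h = nz (bx (g 0)) g h"
definition jj :: "(real => 'a) => (real => 'a) => real" where "jj g h = \<bar>J (bx (g 0)) g h\<bar>"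

lemma geo_top: "G g ==> g t \<in> topspace X"
 using geodesic_continuous[of g] by (auto simp: continuous_map_def)

lemma bx: assumes "y \<in> topspace X" shows "bx y \<in> B" "y \<in> inn 1 (bx y)"
proof -
 have "EX b. b \<in> B & y \<in> inn 1 b" using assms cover by auto
 from someI_ex[OF this] show "bx y \<in> B" "y \<in> inn 1 (bx y)" unfolding bx_def by auto
qed

lemma inn_le: "b \<in> B ==> y \<in> inn n b ==> n <= n' ==> y \<in> inn n' b"
 using inn_mono[OF validB] by blast

abbreviation "trp b b' g h t n K e \<equiv> h t \<in> inn (n + 1/2) b' & nz b' (sh g t) (sh h t) <= K*nz b g h &
 \<bar>\<bar>J b' (sh g t) (sh h t)\<bar> - \<bar>J b (sh g t) (sh h t)\<bar>\<bar> <= e*nz b g h"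
abbreviation "trA d K e \<equiv> ALL b b' g h t n. close b d g h --> b' \<in> B --> \<bar>t\<bar> <= 4*T --> n <= 2 --> g t \<in> inn n b' --> trp b b' g h t n K e"
abbreviation "trs b g h t K e \<equiv> EX u. \<bar>u - t\<bar> <= K*nz b g h & sync (sh g t) (sh h u) & mm (sh g t) (sh h u) <= K*nz b g h &
 \<bar>jj (sh g t) (sh h u) - \<bar>J b (sh g t) (sh h t)\<bar>\<bar> <= e*nz b g h"
abbreviation "tsA d K e \<equiv> ALL b g h t. close b d g h --> \<bar>t\<bar> <= 3*T --> trs b g h t K e"

lemma chart_change_uniform:
 shows "EX L>=1. EX d>0. ALL b:B. ALL b':B. ALL g h n. nbr b b' d g h n (nz b' g h <= L*nz b g h)" (is ?A)
  and "e > 0 ==> EX d>0. ALL b:B. ALL b':B. ALL g h n. nbr b b' d g h n (h 0 \<in> inn (n + 1/2) b' & \<bar>\<bar>J b' g h\<bar> - \<bar>J b g h\<bar>\<bar> <= e*nz b g h)" (is "_ ==> ?B")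
proof -
 define P where "P = (%(b, b') L d. ALL g h n. nbr b b' d g h n (nz b' g h <= L*nz b g h))"
 have fin: "finite (B \<times> B)" using finB by simp
 have mono: "P p L' d'" if "P p L d" "d' <= d" "L <= L'" for p L L' d d'
  using that(1) unfolding P_def case_prod_beta
 proof (intro allI impI, goal_cases)
  case (1 g h n)
  have "nz (fst p) g h <= d" using 1(8) that(2) by (rule order_trans)
  with 1 have "nz (snd p) g h <= L*nz (fst p) g h" by simp
  also have "... <= L' * nz (fst p) g h" using that(3) by (intro mult_right_mono) auto
  finally show ?case .
 qed
 have "EX L>=1. ALL p:B \<times> B. EX d>0. P p L d"
 proof (rule finite_uniform_large[OF fin])
  fix p assume "p \<in> B \<times> B"
  then obtain b b' where p: "p = (b, b')" "b \<in> B" "b' \<in> B" by auto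
  show "EX L. EX d>0. P p L d" unfolding p(1) P_def case_prod_conv by (rule chart_change_pair(2)[OF p(2,3), of 1]) simp
 qed (use mono in blast)
 then obtain L where L: "L >= 1" "!!p. p \<in> B \<times> B ==> EX d>0. P p L d" by auto
 have "EX d>0. ALL p:B \<times> B. P p L d"
  by (rule finite_uniform_small[OF fin L(2)]) (use mono in blast)+
 then obtain d where d: "d > 0" "!!b b'. b \<in> B ==> b' \<in> B ==> P (b, b') L d" by auto
 show ?A
  by (intro exI[of _ L] exI[of _ d] conjI ballI L(1) d(1)) (use d(2) in \<open>simp only: P_def case_prod_conv\<close>)
next
 assume e: "e > 0"
 define P where "P = (%(b, b') d. ALL g h n. nbr b b' d g h n (h 0 \<in> inn (n + 1/2) b' & \<bar>\<bar>J b' g h\<bar> - \<bar>J b g h\<bar>\<bar> <= e*nz b g h))"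
 have "EX d>0. ALL p:B \<times> B. P p d"
 proof (rule finite_uniform_small)
  show "finite (B \<times> B)" using finB by simp
  fix p assume "p \<in> B \<times> B"
  then obtain b b' where p: "p = (b, b')" "b \<in> B" "b' \<in> B" by auto
  show "EX d>0. P p d" unfolding p(1) P_def case_prod_conv by (rule chart_change_pair(1)[OF p(2,3) e])
 next
  fix p d d' assume "P p d" "d' <= d" thus "P p d'"
   unfolding P_def case_prod_beta by (intro allI impI) (simp only: order_trans[OF _ \<open>d' <= d\<close>])
 qed
 then obtain d where d: "d > 0" "!!b b'. b \<in> B ==> b' \<in> B ==> P (b, b') d" by auto
 show ?B
  by (intro exI[of _ d] conjI ballI d(1)) (use d(2) in \<open>simp only: P_def case_prod_conv\<close>)
qed

text \<open>The factor \<open>L\<close> comes before the tolerance \<open>e\<close>: offsets change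
  by a fixed factor, while the error in \<open>|J|\<close> becomes any desired fraction of the
  offset when \<open>d\<close> shrinks. Otherwise it could not be kept below the gain
  \<open>c0\<close>.\<close>

lemma transport:
 "EX L>=1. ALL e>0. EX d>0. trA d L e"
proof -
 obtain L d1 where L: "L >= 1" and d1: "d1 > 0" and L1: "!!b b' g h n. b \<in> B ==> b' \<in> B ==> n <= 2 ==> G g ==> G h ==> g 0 \<in> inn 3 b ==>
  g 0 \<in> inn n b' ==> h 0 \<in> inn 3 b ==> nz b g h <= d1 ==> nz b' g h <= L*nz b g h"
  using chart_change_uniform(1) proof (elim exE conjE, goal_cases) case 1 show ?case by (rule 1(1)[OF 1(2,3) 1(4)[rule_format]]) qed
 have "EX d>0. trA d (2*L) e" if e: "e > 0" for e
 proof -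
  have "e/2 > 0" using e by simp
  from chart_change_uniform(2)[OF this] obtain d2 where d2: "d2 > 0" and L2: "!!b b' g h n. b \<in> B ==> b' \<in> B ==> n <= 2 ==> G g ==> G h ==> g 0 \<in> inn 3 b ==>
  g 0 \<in> inn n b' ==> h 0 \<in> inn 3 b ==> nz b g h <= d2 ==> h 0 \<in> inn (n + 1/2) b' & \<bar>\<bar>J b' g h\<bar> - \<bar>J b g h\<bar>\<bar> <= e/2*nz b g h"
   proof (elim exE conjE, goal_cases) case 1 show ?case by (rule 1(1)[OF 1(2) 1(3)[rule_format]]) qed
  have "trp b b' g h t n (2*L) e"
   if c: "close b (min d1 d2/2) g h" and b': "b' \<in> B" and t: "\<bar>t\<bar> <= 4*T" and n: "n <= 2" "g t \<in> inn n b'" for b b' g h t n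
  proof -
   have b: "b \<in> B" and g: "G g" "G h" and 0: "g 0 \<in> inn 2 b" "h 0 \<in> inn 2 b" and m: "nz b g h <= min d1 d2/2"
    using c by (auto simp: close_def)
   have f: "nz b (sh g t) (sh h t) <= 2*nz b g h" by (rule flow_diff[OF g b 0 _ t]) simp
   have s: "sh g t 0 \<in> inn 3 b" "sh h t 0 \<in> inn 3 b"
    using geo_stay[OF g(1) b 0(1) _ t] geo_stay[OF g(2) b 0(2) _ t] by (simp_all add: sh_apply)
   have gs: "G (sh g t)" "G (sh h t)" using g by (auto intro: geodesic_sh)
   have n': "sh g t 0 \<in> inn n b'" using n by (simp add: sh_apply)
   have "nz b (sh g t) (sh h t) <= d1" "nz b (sh g t) (sh h t) <= d2" using f m by linarith+
   note A = L1[OF b b' n(1) gs s(1) n' s(2) this(1)] L2[OF b b' n(1) gs s(1) n' s(2) this(2)]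
   have "L*nz b (sh g t) (sh h t) <= 2*L*nz b g h" using mult_left_mono[OF f, of L] L by simp
   moreover have "e/2*nz b (sh g t) (sh h t) <= e*nz b g h" using mult_left_mono[OF f, of "e/2"] e by simp
   ultimately show ?thesis using A by (simp add: sh_apply)
  qed
  thus ?thesis using d1 d2 by (intro exI[of _ "min d1 d2/2"]) simp
 qed
 thus ?thesis using L by (intro exI[of _ "2*L"]) simp
qed

lemma sync_close:
 assumes "sync g h" "mm g h <= d" shows "close (bx (g 0)) d g h"
proof -
 have g: "G g" using assms by (simp add: sync_def)
 note b = bx[OF geo_top[OF g, of 0]]
 thus ?thesis using assms inn_le[OF b] by (simp add: close_def sync_def mm_def)
qed

lemma jj_le: "G g ==> jj g h <= C*mm g h"
proof -
 let ?A = "bx (g 0)"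
 assume g: "G g"
 note b = bx[OF geo_top[OF g, of 0]]
 have K: "xx ?A g 0 \<in> Kb ?A" using inn_K[OF b] by simp
 have "jj g h <= C*norm (xx ?A h 0 - xx ?A g 0)"
  unfolding jj_def J_def by (rule unit_bounds(1)[OF b(1) K geo_unit[OF g b]])
 also have "... <= C*mm g h" using C1 norm_fst_snd(1)[of "Dz ?A g h"]
  by (intro mult_left_mono) (auto simp: mm_def Dz_def)
 finally show ?thesis .
qed

lemma transport_sync:
 "EX L>=1. ALL e>0. EX d>0. tsA d L e"
proof -
 from transport obtain L where L: "L >= 1" and T: "!!e. e > 0 ==> EX d>0. trA d L e"
  proof (elim exE conjE, goal_cases) case 1 show ?case by (rule 1(1)[OF 1(2) 1(3)[rule_format]]) qed
 define L' where "L' = 6*C^4*L"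
 have CL: "1 <= C^4" "C <= C^4" "0 <= C^6" using Cpow(1)[of 4] Cpow(2)[of 1 4] Cpow(1)[of 6] by auto
 have "2*(C*L) <= 6*C^4*L" using mult_right_mono[OF CL(2), of L] C1 L by simp
 hence L'C: "L' >= 1" "2*C*L <= L'" using L mult_mono[of 1 "C^4" 1 L] CL unfolding L'_def by (linarith, simp)
 obtain R where R: "R > 0" "!!b. b \<in> B ==> R <= brad b"
 proof -
  have "EX R>0. ALL b:B. R <= brad b" proof (rule finite_uniform_small[OF finB]) fix b assume "b \<in> B" thus "EX d>0. d <= brad b" using brad_pos by blast qed simp
  thus ?thesis using that by auto
 qed
 have "EX d>0. tsA d L' e" if e: "e > 0" for e
 proof -
  have e2: "e/2 > 0" using e by simp
  from T[OF e2] obtain d1 where d1: "d1 > 0" and T1: "!!b b' g h t n. close b d1 g h ==> b' \<in> B ==> \<bar>t\<bar> <= 4*T ==> n <= 2 ==> g t \<in> inn n b' ==>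
  trp b b' g h t n L (e/2)"
   proof (elim exE conjE, goal_cases) case 1 show ?case by (rule 1(1)[OF 1(2) 1(3)[rule_format]]) qed
  \<comment> \<open>\<open>q\<close> bounds the offset on arrival. Its five entries keep the pair
    within the range of \<open>T1\<close>, admit \<open>resync\<close> (two conditions), leave
    \<open>h\<close> in \<open>inn 2\<close>, and make the quadratic change of \<open>J\<close> at
    most \<open>e/2\<close> times the offset.\<close>
  define q where "q = Min {d1*L, 1/(8*C), T / C, R/(6*C^4), e/(12*C^6*L)}"
  define d where "d = q/L"
  have qp: "q > 0" unfolding q_def using d1 C1 L tau_pos R(1) e by auto
  have dp: "d > 0" using qp L by (simp add: d_def)
  have q: "q <= d1*L" "q <= 1/(8*C)" "q*C <= T" "6*C^4*q <= R" "6*C^6*L*q <= e/2"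
  proof -
   have q': "q <= T / C" "q <= R/(6*C^4)" "q <= e/(12*C^6*L)" "q <= d1*L" "q <= 1/(8*C)" by (auto simp: q_def)
   thus "q <= d1*L" "q <= 1/(8*C)" by auto
   have p: "0 < C" "0 < 6*C^4" "0 < 12*C^6*L" using C1 L by auto
   show "q*C <= T" using q'(1) p(1) by (simp add: pos_le_divide_eq)
   show "6*C^4*q <= R" using q'(2) p(2) by (simp add: pos_le_divide_eq mult.commute)
   show "6*C^6*L*q <= e/2" using q'(3) p(3) by (simp add: pos_le_divide_eq mult_ac)
  qed
  have Ld: "L*d = q" using L by (simp add: d_def)
  have dd1: "d <= d1" using q(1) L by (simp add: d_def divide_le_eq)
  have "trs b g h t L' e"
   if c: "close b d g h" and t: "\<bar>t\<bar> <= 3*T" for b g h t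
  proof -
   let ?m = "nz b g h"
   have b: "b \<in> B" and g: "G g" "G h" and m: "?m <= d" using c by (auto simp: close_def)
   have c1: "close b d1 g h" using c dd1 by (auto simp: close_def)
   have gs: "G (sh g t)" "G (sh h t)" using g by (auto intro: geodesic_sh)
   define b' where "b' = bx (g t)"
   have b': "b' \<in> B" "g t \<in> inn 1 b'" using bx[OF geo_top[OF g(1)]] by (simp_all add: b'_def)
   have t4: "\<bar>t\<bar> <= 4*T" using t tau_pos by linarith
   note A = T1[OF c1 b'(1) t4 _ b'(2)]
   let ?m' = "nz b' (sh g t) (sh h t)"
   have m': "?m' <= L*?m" "L*?m <= q" using A mult_left_mono[OF m, of L] L Ld by auto
   have 0: "sh g t 0 \<in> inn 3 b'" "sh h t 0 \<in> inn (3/2) b'" "3/2 <= (2::real)"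
    using inn_le[OF b', of 3] A by (simp_all add: sh_apply)
   have mC: "?m' <= 1/(8*C)" using m' q(2) by linarith
   have "?m' * C <= q*C" using m' C1 by (intro mult_right_mono) auto
   hence mt: "?m' * C <= T" using q(3) by linarith
   obtain r where r: "\<bar>r\<bar> <= 2*C*?m'" "Th b' (sh g t) (sh (sh h t) r) = 0" "sh h t r \<in> inn 3 b'"
    "nz b' (sh g t) (sh (sh h t) r) <= 6*C^4*?m'"
    "\<bar>J b' (sh g t) (sh (sh h t) r) - J b' (sh g t) (sh h t)\<bar> <= 6*C^6*?m'^2"
    using resync[OF gs b'(1) 0 mC mt] by metis
   have s: "sh (sh h t) r = sh h (t + r)" by simp
   have bb: "bx (sh g t 0) = b'" by (simp add: b'_def sh_apply)
   have "6*C^4*?m' <= 6*C^4*(L*?m)" using m' CL by (intro mult_left_mono) auto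
   hence mL: "nz b' (sh g t) (sh h (t + r)) <= L' * ?m" using r(4) unfolding s L'_def by linarith
   have "6*C^4*?m' <= 6*C^4*q" using m' CL by (intro mult_left_mono) auto
   hence "nz b' (sh g t) (sh h (t + r)) <= brad b'" using r(4) q(4) R(2)[OF b'(1)] unfolding s by linarith
   hence "dist (xx b' h (t + r)) (xx b' g t) <= brad b'"
    using norm_fst_snd(1)[of "Dz b' (sh g t) (sh h (t + r))"] by (simp add: Dz_def sh_apply dist_norm add.commute)
   hence "h (t + r) \<in> inn 2 b'"
    using r(3) b'(2) dist_triangle[of "xx b' h (t + r)" "bpt b'" "xx b' g t"] by (simp add: inn_def sh_apply add.commute)
   hence sy: "sync (sh g t) (sh h (t + r))"
    unfolding sync_def bb using gs r(2) g by (simp add: s sh_apply geodesic_sh add.commute)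
   have "2*C*?m' <= 2*C*(L*?m)" using m' C1 by (intro mult_left_mono) auto
   also have "... <= L' * ?m" using mult_right_mono[OF L'C(2), of ?m] by (simp add: mult.assoc)
   finally have r1: "\<bar>(t + r) - t\<bar> <= L' * ?m" using r(1) by simp
   have "?m' * ?m' <= (L*?m)*q" using m' qp L by (intro mult_mono) auto
   hence "6*C^6*?m'^2 <= 6*C^6*((L*?m)*q)" using CL unfolding power2_eq_square by (intro mult_left_mono) auto
   also have "... = (6*C^6*L*q)*?m" by simp
   also have "... <= e/2*?m" using q(5) by (intro mult_right_mono) auto
   finally have "\<bar>J b' (sh g t) (sh h (t + r)) - J b' (sh g t) (sh h t)\<bar> <= e/2*?m" using r(5) unfolding s by linarith
   moreover have "\<bar>\<bar>J b' (sh g t) (sh h t)\<bar> - \<bar>J b (sh g t) (sh h t)\<bar>\<bar> <= e/2*?m" using A by simp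
   ultimately have "\<bar>jj (sh g t) (sh h (t + r)) - \<bar>J b (sh g t) (sh h t)\<bar>\<bar> <= e*?m"
    unfolding jj_def bb by (simp only: abs_le_iff) (auto simp: abs_if split: if_splits)
   thus ?thesis using r1 sy mL unfolding mm_def bb by blast
  qed
  thus ?thesis using dp by blast
 qed
 thus ?thesis using L'C(1) by blast
qed

end

text \<open>Negative curvature enters through \<open>step\<close>: the normal distance \<open>jj\<close> grows in one of the two time directions.\<close>

locale tracking = boxes M B C T k for M :: "'a surface" and B C T k +
 fixes L d0 c :: real
 assumes L1: "1 <= L" and d0: "0 < d0" "L*d0 <= T / 64" "L*d0 <= 1/(64*C)" and CL: "6*C^4 <= L" and c: "0 < c" "c <= 1"
  and jjL: "!!g h. G g ==> jj g h <= L*mm g h"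
  and near: "!!b b' g h t n. close b d0 g h ==> b' \<in> B ==> \<bar>t\<bar> <= 3*T ==> n <= 2 ==> g t \<in> inn n b' ==>
   h t \<in> inn (n + 1/2) b' & nz b' (sh g t) (sh h t) <= L*nz b g h"
  and trans: "!!b g h t. close b d0 g h ==> \<bar>t\<bar> <= 3*T ==>
   EX u. \<bar>u - t\<bar> <= L*nz b g h & sync (sh g t) (sh h u) & mm (sh g t) (sh h u) <= L*nz b g h"
  and step: "!!g h. sync g h ==> mm g h <= d0 ==>
   EX u v. \<bar>u - T\<bar> <= L*mm g h & \<bar>v + T\<bar> <= L*mm g h & sync (sh g T) (sh h u) & sync (sh g (- T)) (sh h v) &
    mm (sh g T) (sh h u) <= L*mm g h & mm (sh g (- T)) (sh h v) <= L*mm g h &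
    jj g h + c*mm g h <= max (jj (sh g T) (sh h u)) (jj (sh g (- T)) (sh h v))"

text \<open>Transport is taken with tolerance \<open>c0/2\<close>: passing from \<open>J\<close> in
  the old box to \<open>jj\<close> in the new one loses at most half of the gain of
  \<open>local_growth\<close>, and the other half, capped by 1, remains as the constant of the
  locale.\<close>

lemma (in boxes) tracking_exists: "EX L d0 c. tracking M B C T k L d0 c"
proof -
 from transport obtain L1 where L1: "L1 >= 1" and T: "!!e. e > 0 ==> EX d>0. trA d L1 e"
  proof (elim exE conjE, goal_cases) case 1 show ?case by (rule 1(1)[OF 1(2) 1(3)[rule_format]]) qed
 from T[OF zero_less_one] obtain d1 where d1: "d1 > 0" and T1: "!!b b' g h t n. close b d1 g h ==> b' \<in> B ==> \<bar>t\<bar> <= 4*T ==> n <= 2 ==> g t \<in> inn n b' ==>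
  trp b b' g h t n L1 1"
  proof (elim exE conjE, goal_cases) case 1 show ?case by (rule 1(1)[OF 1(2) 1(3)[rule_format]]) qed
 from transport_sync obtain L2 where L2: "L2 >= 1" and S: "!!e. e > 0 ==> EX d>0. tsA d L2 e"
  proof (elim exE conjE, goal_cases) case 1 show ?case by (rule 1(1)[OF 1(2) 1(3)[rule_format]]) qed
 have "c0/2 > 0" using c0_pos by simp
 from S[OF this] obtain d2 where d2: "d2 > 0" and S2: "!!b g h t. close b d2 g h ==> \<bar>t\<bar> <= 3*T ==>
  trs b g h t L2 (c0/2)"
  proof (elim exE conjE, goal_cases) case 1 show ?case by (rule 1(1)[OF 1(2) 1(3)[rule_format]]) qed
 from local_growth obtain d3 where d3: "d3 > 0" and LG: "!!b g h. close b d3 g h ==> Th b g h = 0 ==>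
  \<bar>J b g h\<bar> + c0*nz b g h <= max \<bar>J b (sh g T) (sh h T)\<bar> \<bar>J b (sh g (- T)) (sh h (- T))\<bar>"
  by (elim exE conjE) (rule that, assumption, simp only: close_def)
 define L where "L = Max {L1, L2, C, 6*C^4}"
 have L: "L1 <= L" "L2 <= L" "C <= L" "6*C^4 <= L" by (auto simp: L_def)
 hence Lp: "1 <= L" using L1 by simp
 define d where "d = Min {d1, d2, d3, T / 64/L, 1/(64*C)/L}"
 have dp: "d > 0" unfolding d_def using d1 d2 d3 tau_pos Lp C1 by auto
 have d: "d <= d1" "d <= d2" "d <= d3" "d <= T / 64/L" "d <= 1/(64*C)/L" by (auto simp: d_def)
 have mo: "close b d' g h" if "close b d g h" "d <= d'" for b g h d' using that by (auto simp: close_def)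
 have mx: "x + c0/2*m <= max p q" if "x + c0*m <= max \<bar>p'\<bar> \<bar>q'\<bar>" "\<bar>p - \<bar>p'\<bar>\<bar> <= c0/2*m" "\<bar>q - \<bar>q'\<bar>\<bar> <= c0/2*m" for x m p q p' q' :: real
 proof -
  have "max \<bar>p'\<bar> \<bar>q'\<bar> <= max p q + c0/2*m" using that(2,3) by linarith
  moreover have "c0*m = c0/2*m + c0/2*m" by simp
  ultimately show ?thesis using that(1) by linarith
 qed
 have Lm: "L1*norm x <= L*norm x" "L2*norm x <= L*norm x" for x :: "(real^2) \<times> (real^2)" using L by (auto intro: mult_right_mono)
 have "tracking M B C T k L d (min 1 (c0/2))"
 proof (unfold_locales)
  show "1 <= L" "0 < d" "6*C^4 <= L" "0 < min 1 (c0/2)" "min 1 (c0/2) <= 1" using Lp dp c0_pos L(4) by auto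
  show "L*d <= T / 64" "L*d <= 1/(64*C)" using mult_left_mono[OF d(4), of L] mult_left_mono[OF d(5), of L] Lp by simp_all
  show "jj g h <= L*mm g h" if "G g" for g h
   using jj_le[OF that, of h] mult_right_mono[OF L(3), of "mm g h"] by (simp add: mm_def)
  show "h t \<in> inn (n + 1/2) b' & nz b' (sh g t) (sh h t) <= L*nz b g h"
   if "close b d g h" "b' \<in> B" "\<bar>t\<bar> <= 3*T" "n <= 2" "g t \<in> inn n b'" for b b' g h t n
  proof -
   have "\<bar>t\<bar> <= 4*T" using that(3) tau_pos by linarith
   from T1[OF mo[OF that(1) d(1)] that(2) this that(4,5)] Lm(1)[of "Dz b g h"] show ?thesis by auto
  qed
  show "EX u. \<bar>u - t\<bar> <= L*nz b g h & sync (sh g t) (sh h u) & mm (sh g t) (sh h u) <= L*nz b g h"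
   if h: "close b d g h" "\<bar>t\<bar> <= 3*T" for b g h t
  proof -
   obtain u where "\<bar>u - t\<bar> <= L2*nz b g h" "sync (sh g t) (sh h u)" "mm (sh g t) (sh h u) <= L2*nz b g h"
    using S2[OF mo[OF h(1) d(2)] h(2)] by (elim exE conjE)
   thus ?thesis using Lm(2)[of "Dz b g h"] by (intro exI[of _ u] conjI) linarith+
  qed
  show "EX u v. \<bar>u - T\<bar> <= L*mm g h & \<bar>v + T\<bar> <= L*mm g h & sync (sh g T) (sh h u) & sync (sh g (- T)) (sh h v) &
    mm (sh g T) (sh h u) <= L*mm g h & mm (sh g (- T)) (sh h v) <= L*mm g h &
    jj g h + min 1 (c0/2)*mm g h <= max (jj (sh g T) (sh h u)) (jj (sh g (- T)) (sh h v))"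
   if s: "sync g h" and m: "mm g h <= d" for g h
  proof -
   let ?b = "bx (g 0)"
   have cl: "close ?b d g h" by (rule sync_close[OF s m])
   have tt: "\<bar>T\<bar> <= 3*T" "\<bar>- T\<bar> <= 3*T" using tau_pos by auto
   obtain u where u: "\<bar>u - T\<bar> <= L2*mm g h" "sync (sh g T) (sh h u)" "mm (sh g T) (sh h u) <= L2*mm g h"
    "\<bar>jj (sh g T) (sh h u) - \<bar>J ?b (sh g T) (sh h T)\<bar>\<bar> <= c0/2*mm g h"
    using S2[OF mo[OF cl d(2)] tt(1)] unfolding mm_def by blast
   obtain v where v: "\<bar>v - - T\<bar> <= L2*mm g h" "sync (sh g (- T)) (sh h v)" "mm (sh g (- T)) (sh h v) <= L2*mm g h"
    "\<bar>jj (sh g (- T)) (sh h v) - \<bar>J ?b (sh g (- T)) (sh h (- T))\<bar>\<bar> <= c0/2*mm g h"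
    using S2[OF mo[OF cl d(2)] tt(2)] unfolding mm_def by blast
   have "\<bar>J ?b g h\<bar> + c0*mm g h <= max \<bar>J ?b (sh g T) (sh h T)\<bar> \<bar>J ?b (sh g (- T)) (sh h (- T))\<bar>"
    using LG[OF mo[OF cl d(3)]] s by (simp add: sync_def mm_def)
   hence 1: "jj g h + c0/2*mm g h <= max (jj (sh g T) (sh h u)) (jj (sh g (- T)) (sh h v))"
    using mx[OF _ u(4) v(4)] unfolding jj_def[of g] by simp
   have "min 1 (c0/2)*mm g h <= c0/2*mm g h" by (rule mult_right_mono) (auto simp: mm_def)
   moreover have "L2*mm g h <= L*mm g h" using Lm(2) by (simp add: mm_def)
   ultimately show ?thesis using u(1-3) v(1-3) 1 by (intro exI[of _ u] exI[of _ v] conjI) linarith+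
  qed
 qed
 thus ?thesis by blast
qed

section \<open>Discretely convex sequences of separations\<close>

locale separation_sequence =
 fixes D m :: "nat => real" and n :: nat and L c :: real
 assumes c: "0 < c" and L: "1 <= L" and nonneg: "!!j. 0 <= D j" "!!j. 0 <= m j"
  and DL: "!!j. j <= n ==> D j <= L*m j"
  and conv: "!!j. 0 < j ==> j < n ==> D j + c*m j <= max (D (j + 1)) (D (j - 1))"
begin

text \<open>A sequence that has begun to increase cannot turn: growth backwards at the next index
  would contradict the increase just made, unless the terms involved vanish.\<close>

lemma inherit:
 assumes "D j + c*m j <= D (j + 1)" "Suc j < n"
 shows "D (Suc j) + c*m (Suc j) <= D (Suc j + 1)"
proof (rule ccontr)
 assume "\<not> ?thesis"
 hence "D (Suc j) + c*m (Suc j) <= D j" using conv[of "Suc j"] assms(2) by auto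
 moreover have "0 <= c*m j" "0 <= c*m (Suc j)" using c nonneg by auto
 moreover have "D j + c*m j <= D (Suc j)" using assms(1) by simp
 ultimately have "c*m (Suc j) = 0" by linarith
 hence "m (Suc j) = 0" using c by simp
 hence "D (Suc j) = 0" using DL[of "Suc j"] nonneg(1)[of "Suc j"] assms(2) by simp
 with \<open>m (Suc j) = 0\<close> \<open>\<not> ?thesis\<close> show False using nonneg(1) by simp
qed

text \<open>By \<open>inherit\<close> the sequence first decreases and then increases. In each phase
  \<open>c * m j\<close> is at most the change of \<open>D\<close>, so the sum telescopes, and its
  bound does not depend on the length \<open>n\<close>.\<close>

lemma sum_bound:
 assumes d: "!!j. j <= n ==> D j <= d" and i: "i < n"
 shows "(\<Sum>j=1..i. c*m j) <= 2*d"
proof -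
 define A where "A j \<longleftrightarrow> D j + c*m j <= D (j + 1)" for j
 \<comment> \<open>The invariant of the induction: while \<open>D\<close> decreases the sum is at
   most \<open>D 0 - D i\<close>, after the turn at most \<open>D 0 + D (i + 1)\<close>.\<close>
 have "(A i & 0 < i --> (\<Sum>j=1..i. c*m j) <= D 0 + D (i + 1)) & (\<not> (A i & 0 < i) --> (\<Sum>j=1..i. c*m j) <= D 0 - D i)"
  using i
 proof (induction i)
  case (Suc i)
  have S: "(\<Sum>j=1..Suc i. c*m j) = (\<Sum>j=1..i. c*m j) + c*m (Suc i)" by simp
  show ?case
  proof (cases "A (Suc i)")
   case True
   hence "c*m (Suc i) <= D (Suc i + 1) - D (Suc i)" by (simp add: A_def)
   thus ?thesis using Suc True nonneg(1)[of "i"] nonneg(1)[of "Suc i"] unfolding S by (cases "A i & 0 < i") auto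
  next
   case False
   hence "\<not> A i" using inherit[of i] Suc.prems by (auto simp: A_def)
   moreover have "D (Suc i) + c*m (Suc i) <= D i" using False conv[of "Suc i"] Suc.prems by (auto simp: A_def max_def split: if_splits)
   ultimately show ?thesis using Suc False unfolding S by auto
  qed
 qed simp
 moreover have "D 0 <= d" "D (i + 1) <= d" "0 <= D i" "0 <= d" using d[of 0] d[of "i + 1"] i nonneg(1)[of i] nonneg(1)[of 0] by auto
 ultimately show ?thesis by (cases "A i & 0 < i") auto
qed

text \<open>Once the increasing phase has begun \<open>D\<close> is at least \<open>c * e\<close>,
  and each step adds \<open>c * m\<close>, which is at least \<open>c * D / L\<close>; so
  \<open>D\<close> increases at least linearly.\<close>

lemma grow_forward:
 assumes i: "D i + c*m i <= D (i + 1)" "i < n" and e: "e <= m i" "0 <= e" and q: "i + 1 + q <= n"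
 shows "real q*(c*(c*e)/L) <= D (i + 1 + q)"
proof -
 let ?A = "c*(c*e)/L"
 have A: "D (i + r) + c*m (i + r) <= D (i + r + 1)" if "i + r < n" for r
  using that by (induction r) (use i inherit[of "i + r" for r] in auto)
 have ce: "c*e <= D (i + 1)" using i(1) nonneg(1)[of i] mult_left_mono[OF e(1), of c] c by linarith
 have "c*e + real q*?A <= D (i + 1 + q)" using q
 proof (induction q)
  case (Suc q)
  have IH: "c*e + real q*?A <= D (i + 1 + q)" using Suc by simp
  moreover have "0 <= real q*?A" using c e L by simp
  ultimately have ce': "c*e <= D (i + 1 + q)" by linarith
  have "c*(D (i + 1 + q)/L) <= c*m (i + 1 + q)" using DL[of "i + 1 + q"] Suc.prems c L by (intro mult_left_mono) (auto simp: divide_le_eq mult.commute)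
  moreover have "c*(c*e)/L <= c*(D (i + 1 + q)/L)" using ce' c L by (simp add: divide_right_mono)
  moreover have "D (i + 1 + q) + c*m (i + 1 + q) <= D (i + 1 + Suc q)" using A[of "1 + q"] Suc.prems by (simp add: add.commute add.left_commute)
  moreover have "real (Suc q)*?A = real q*?A + c*(c*e)/L" by (simp add: algebra_simps add_divide_distrib)
  ultimately show ?case using IH by linarith
 qed (use ce in simp)
 moreover have "0 <= c*e" using c e by simp
 ultimately show ?thesis by linarith
qed

lemma reversed: "separation_sequence (%j. D (n - j)) (%j. m (n - j)) n L c"
proof
 fix j :: nat assume j: "0 < j" "j < n"
 have "D (n - j) + c*m (n - j) <= max (D (n - j + 1)) (D (n - j - 1))" by (rule conv) (use j in auto)
 moreover have "n - j + 1 = n - (j - 1)" "n - j - 1 = n - (j + 1)" using j by auto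
 ultimately show "D (n - j) + c*m (n - j) <= max (D (n - (j + 1))) (D (n - (j - 1)))" by (simp only: max.commute)
qed (use c L nonneg DL in auto)

lemma grow_backward:
 assumes i: "D i + c*m i <= D (i - 1)" "0 < i" "i <= n" and e: "e <= m i" "0 <= e" and q: "1 + q <= i"
 shows "real q*(c*(c*e)/L) <= D (i - 1 - q)"
proof -
 interpret r: separation_sequence "%j. D (n - j)" "%j. m (n - j)" n L c by (rule reversed)
 have *: "n - (n - i) = i" "n - (n - i + 1) = i - 1" "n - (n - i + 1 + q) = i - 1 - q" using i q by auto
 show ?thesis using r.grow_forward[of "n - i" e q] i e q unfolding*by auto
qed

end

section \<open>Expansivity, and tracking with bounded clock drift\<close>

context tracking begin

lemma d0_le: "d0 <= T / 64" "d0 <= 1/(64*C)" "L*x <= T / 64" if "x <= d0" for x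
proof -
 have "d0 <= L*d0" "L*x <= L*d0" using L1 d0(1) that by auto
 thus "d0 <= T / 64" "d0 <= 1/(64*C)" "L*x <= T / 64" using d0 by linarith+
qed

lemma mm_nonneg: "0 <= mm g h" and jj_nonneg: "0 <= jj g h"
 by (simp_all add: mm_def jj_def)

lemma close_zero_step:
 assumes "close b 0 g h" "\<bar>t\<bar> <= T"
 shows "close (bx (g t)) 0 (sh g t) (sh h t)" "g t = h t"
proof -
 let ?A = "bx (g t)"
 have g: "G g" "G h" and c: "close b d0 g h" and z: "nz b g h = 0" using assms d0 by (auto simp: close_def)
 note b = bx[OF geo_top[OF g(1)], of t]
 have t3: "\<bar>t\<bar> <= 3*T" using assms(2) by linarith
 have N: "h t \<in> inn (1 + 1/2) ?A" "Dz ?A (sh g t) (sh h t) = 0"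
  using near[OF c b(1) t3 _ b(2)] z by auto
 thus "close ?A 0 (sh g t) (sh h t)"
  using b inn_le[OF b, of 2] inn_le[OF b(1) N(1), of 2] g by (simp add: close_def sh_apply geodesic_sh)
 have "xx ?A g t = xx ?A h t" using N(2) by (simp add: Dz_def sh_apply zero_prod_def)
 thus "g t = h t" using chart_inj[OF bA[OF b(1)]] inn_dom[OF b(2)] inn_dom[OF N(1)] by (auto simp: inj_on_def)
qed

text \<open>Uniqueness of geodesics with given initial velocity comes from the estimate
  \<open>near\<close> with offset zero, propagated in steps of length \<open>T\<close>.\<close>

lemma geo_unique: assumes c: "close b 0 g h" shows "g = h"
proof
 fix t :: real
 define \<sigma> where "\<sigma> = (if 0 <= t then 1 else - 1 :: real)"
 have st: "\<bar>\<sigma> * T\<bar> <= T" using tau_pos by (auto simp: \<sigma>_def)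
 have C: "EX b. close b 0 (sh g (real n*(\<sigma> * T))) (sh h (real n*(\<sigma> * T)))" for n
 proof (induction n)
  case 0 show ?case using c by (intro exI[of _ b]) simp
 next
  case (Suc n)
  then obtain b where "close b 0 (sh g (real n*(\<sigma> * T))) (sh h (real n*(\<sigma> * T)))" by (elim exE)
  from close_zero_step(1)[OF this st] show ?case
   by (intro exI[of _ "bx (sh g (real n*(\<sigma> * T)) (\<sigma> * T))"]) (simp add: algebra_simps)
 qed
 define n where "n = nat \<lfloor>\<bar>t\<bar> / T\<rfloor>"
 obtain b where "close b 0 (sh g (real n*(\<sigma> * T))) (sh h (real n*(\<sigma> * T)))" using C by blast
 moreover have "real n <= \<bar>t\<bar> / T" "\<bar>t\<bar> / T <= real n + 1" using tau_pos by (auto simp: n_def)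
 hence "real n*T <= \<bar>t\<bar>" "\<bar>t\<bar> <= (real n + 1)*T" using tau_pos by (auto simp: pos_le_divide_eq pos_divide_le_eq)
 hence "\<bar>t - real n*(\<sigma> * T)\<bar> <= T" by (auto simp: \<sigma>_def algebra_simps)
 ultimately have "sh g (real n*(\<sigma> * T)) (t - real n*(\<sigma> * T)) = sh h (real n*(\<sigma> * T)) (t - real n*(\<sigma> * T))"
  by (rule close_zero_step(2))
 thus "g t = h t" by (simp add: sh_apply)
qed

lemma sync_zero: assumes "sync g h" "mm g h <= 0" shows "g = h"
 by (rule geo_unique[OF sync_close[OF assms]])

lemma sync_uniq:
 assumes s: "sync g (sh h u)" "mm g (sh h u) <= d0" "sync g (sh h v)" and uv: "\<bar>v - u\<bar> <= 4*T"
 shows "v = u"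
proof -
 let ?A = "bx (g 0)"
 note b = bx[OF geo_top, of g 0]
 have g: "G g" "G (sh h u)" using s by (auto simp: sync_def)
 have d8: "1/(64*C) <= 1/(8*C)" using C1 by (simp add: field_simps)
 have "v - u = 0"
 proof (rule sync_unique[OF g b(1)[OF g(1)] _ _ _ _ uv])
  show "g 0 \<in> inn 3 ?A" using inn_le[OF b[OF g(1)]] by simp
  show "sh h u 0 \<in> inn 2 ?A" "Th ?A g (sh h u) = 0" using s(1) by (auto simp: sync_def)
  show "nz ?A g (sh h u) <= 1/(8*C)" using s(2) d0_le(2)[of d0] d8 by (simp add: mm_def)
  show "Th ?A g (sh (sh h u) (v - u)) = 0" using s(3) by (simp add: sync_def)
 qed simp
 thus ?thesis by simp
qed

lemma step_at:
 assumes s: "sync (sh g t) (sh h u)" "mm (sh g t) (sh h u) <= d0"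
 obtains u' v' where "\<bar>u' - u - T\<bar> <= L*mm (sh g t) (sh h u)" "\<bar>v' - u + T\<bar> <= L*mm (sh g t) (sh h u)"
  "sync (sh g (t + T)) (sh h u')" "sync (sh g (t - T)) (sh h v')"
  "mm (sh g (t + T)) (sh h u') <= L*mm (sh g t) (sh h u)" "mm (sh g (t - T)) (sh h v') <= L*mm (sh g t) (sh h u)"
  "jj (sh g t) (sh h u) + c*mm (sh g t) (sh h u) <= max (jj (sh g (t + T)) (sh h u')) (jj (sh g (t - T)) (sh h v'))"
proof -
 let ?A = "mm (sh g t) (sh h u)" and ?B = "sh (sh g t) (- T)" and ?D = "sh (sh g t) T"
 from step[OF s] obtain a b where ab: "\<bar>a - T\<bar> <= L*?A" "\<bar>b + T\<bar> <= L*?A"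
  "sync ?D (sh (sh h u) a)" "sync ?B (sh (sh h u) b)"
  "mm ?D (sh (sh h u) a) <= L*?A" "mm ?B (sh (sh h u) b) <= L*?A"
  "jj (sh g t) (sh h u) + c*?A <= max (jj ?D (sh (sh h u) a)) (jj ?B (sh (sh h u) b))"
  by (elim exE conjE)
 have "t + - T = t - T" by simp
 with ab show ?thesis by (intro that[of "u + a" "u + b"]) (simp_all add: algebra_simps)
qed

text \<open>Convexity holds at all integer times, so the supremum \<open>S\<close> of the normal
  distances satisfies \<open>(1 + c/L) * S <= S\<close>. Hence \<open>S\<close> vanishes, and with
  it the offset at time 0.\<close>

lemma expansive:
 fixes u :: "int => real"
 assumes s: "!!j. sync (sh g (of_int j*T)) (sh h (u j))" "!!j. mm (sh g (of_int j*T)) (sh h (u j)) <= d0"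
  and u: "!!j. \<bar>u (j + 1) - u j - T\<bar> <= T / 2"
 shows "sh h (u 0) = g"
proof -
 define D where "D j = jj (sh g (of_int j*T)) (sh h (u j))" for j
 define m where "m j = mm (sh g (of_int j*T)) (sh h (u j))" for j
 have g: "G (sh g (of_int j*T))" for j using s(1)[of j] by (simp add: sync_def)
 have conv: "D j + c*m j <= max (D (j + 1)) (D (j - 1))" for j
 proof -
  obtain u' v' where st: "\<bar>u' - u j - T\<bar> <= L*m j" "\<bar>v' - u j + T\<bar> <= L*m j"
  "sync (sh g (of_int j*T + T)) (sh h u')" "sync (sh g (of_int j*T - T)) (sh h v')"
  "D j + c*m j <= max (jj (sh g (of_int j*T + T)) (sh h u')) (jj (sh g (of_int j*T - T)) (sh h v'))"
   using step_at[OF s] unfolding D_def m_def by metis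
  have e: "of_int j*T + T = of_int (j + 1)*T" "of_int j*T - T = of_int (j - 1)*T" by (simp_all add: algebra_simps)
  have Lm: "L*m j <= T / 64" using s(2)[of j] unfolding m_def by (rule d0_le)
  \<comment> \<open>The shifts delivered by \<open>step\<close> are close to the given ones, and
    synchronizing shifts are unique within \<open>4 * T\<close>.\<close>
  have "u' = u (j + 1)"
  proof (rule sync_uniq[OF s(1,2)])
   show "sync (sh g (of_int (j + 1)*T)) (sh h u')" using st(3) unfolding e .
   show "\<bar>u' - u (j + 1)\<bar> <= 4*T" using st(1) u[of j] Lm tau_pos by linarith
  qed
  moreover have "v' = u (j - 1)"
  proof (rule sync_uniq[OF s(1,2)])
   show "sync (sh g (of_int (j - 1)*T)) (sh h v')" using st(4) unfolding e .
   show "\<bar>v' - u (j - 1)\<bar> <= 4*T" using st(2) u[of "j - 1", unfolded diff_add_cancel] Lm tau_pos by linarith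
  qed
  ultimately show ?thesis using st(5) unfolding e D_def by simp
 qed
 have Dm: "0 <= D j" "D j <= L*m j" "m j <= d0" "0 <= m j" for j
  using jjL[OF g] s(2) by (auto simp: D_def m_def jj_nonneg mm_nonneg)
 have bdd: "bdd_above (range D)"
 proof (rule bdd_aboveI2)
  show "D j <= L*d0" for j using Dm(2)[of j] mult_left_mono[OF Dm(3)[of j], of L] L1 by linarith
 qed
 define S where "S = Sup (range D)"
 have DS: "D j <= S" for j unfolding S_def using bdd by (rule cSUP_upper[OF UNIV_I])
 have DcS: "D j + c*m j <= S" for j using conv[of j] DS[of "j + 1"] DS[of "j - 1"] by linarith
 have cL: "0 < c/L" using c L1 by simp
 have "D j <= S/(1 + c/L)" for j
 proof -
  have "c/L*D j <= c*m j" using Dm(2)[of j] c L1 by (simp add: field_simps)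
  hence "(1 + c/L)*D j <= S" using DcS[of j] by (simp add: algebra_simps)
  thus ?thesis using cL by (simp add: pos_le_divide_eq mult.commute)
 qed
 hence "S <= S/(1 + c/L)" unfolding S_def by (intro cSUP_least) auto
 hence "S*(c/L) <= 0" using cL by (simp add: pos_le_divide_eq algebra_simps)
 hence "S <= 0" using cL mult_pos_pos[of S "c/L"] by linarith
 hence "c*m 0 <= 0" using DcS[of 0] Dm(1)[of 0] by linarith
 hence "m 0 <= 0" using c by (simp add: mult_le_0_iff)
 thus ?thesis using sync_zero[OF s(1)[of 0]] by (simp add: m_def)
qed

text \<open>\<open>e\<close> limits the clock drift, \<open>d\<close> the offset.\<close>

definition trk :: "(real => 'a) => (real => 'a) => real => real => real => bool" where
 "trk g h e d t \<longleftrightarrow> (EX u. \<bar>u - t\<bar> <= e & sync (sh g t) (sh h u) & mm (sh g t) (sh h u) <= d)"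

text \<open>\<open>U g h t\<close> is meaningful only if \<open>h\<close> tracks \<open>g\<close> at time \<open>t\<close>.\<close>

definition U :: "(real => 'a) => (real => 'a) => real => real" where
 "U g h t = (THE u. \<bar>u - t\<bar> <= 2*T & sync (sh g t) (sh h u) & mm (sh g t) (sh h u) <= d0)"

definition DD :: "(real => 'a) => (real => 'a) => real => real" where "DD g h t = jj (sh g t) (sh h (U g h t))"
definition MM :: "(real => 'a) => (real => 'a) => real => real" where "MM g h t = mm (sh g t) (sh h (U g h t))"

lemma U_eq:
 assumes "\<bar>u - t\<bar> <= 2*T" "sync (sh g t) (sh h u)" "mm (sh g t) (sh h u) <= d0"
 shows "U g h t = u"
 unfolding U_def
proof (rule the_equality)
 fix v assume v: "\<bar>v - t\<bar> <= 2*T & sync (sh g t) (sh h v) & mm (sh g t) (sh h v) <= d0"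
 have "\<bar>v - u\<bar> <= 4*T" using v assms(1) by linarith
 thus "v = u" using sync_uniq[OF assms(2,3)] v by blast
qed (use assms in auto)

lemma trkD:
 assumes "trk g h e d t" "e <= 2*T" "d <= d0"
 shows "\<bar>U g h t - t\<bar> <= e" "sync (sh g t) (sh h (U g h t))" "MM g h t <= d" "G g" "G h"
  "DD g h t <= L*MM g h t"
proof -
 obtain u where u: "\<bar>u - t\<bar> <= e" "sync (sh g t) (sh h u)" "mm (sh g t) (sh h u) <= d" using assms(1) by (auto simp: trk_def)
 have [simp]: "U g h t = u" by (rule U_eq) (use u assms in auto)
 show "\<bar>U g h t - t\<bar> <= e" "sync (sh g t) (sh h (U g h t))" "MM g h t <= d" using u by (auto simp: MM_def)
 have g: "G (sh g t)" "G (sh h u)" using u(2) by (auto simp: sync_def)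
 thus "G g" "G h" using geodesic_sh(1)[OF g(1), of "- t"] geodesic_sh(1)[OF g(2), of "- u"] by auto
 show "DD g h t <= L*MM g h t" unfolding DD_def MM_def by (rule jjL[OF g(1)])
qed

lemma DD_nonneg: "0 <= DD g h t" and MM_nonneg: "0 <= MM g h t"
 by (simp_all add: DD_def MM_def jj_nonneg mm_nonneg)

text \<open>Thresholds for normal distances. If these stay below \<delta>, convexity bounds the
  offset at interior times by \<open>\<delta> / c\<close>, and two steps with factor
  \<open>L\<close> carry the bound to the newest time; this is the value of
  \<open>\<kappa> \<delta>\<close> below. \<open>small\<close> makes it and the resulting clock
  drift tiny compared with \<open>d0\<close> and \<open>T\<close>.\<close>

definition small :: "real => bool" where "small \<delta> \<longleftrightarrow> 0 < \<delta> & 64*L^4*\<delta> <= c*d0"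

definition \<kappa> :: "real => real" where "\<kappa> \<delta> = L^2*\<delta> / c"

lemma small:
 assumes "small \<delta>"
 shows "0 < \<delta>" "\<delta> <= \<kappa> \<delta>" "\<kappa> \<delta> <= d0" "L*(\<delta> + (2*\<delta> / c + \<kappa> \<delta>)) <= T / 16" "\<delta> / c <= \<kappa> \<delta>" "L^2*\<delta> <= \<kappa> \<delta>" "L*\<kappa> \<delta> <= T / 64"
  "64*(L^2*\<kappa> \<delta>) <= d0"
proof -
 let ?A = "\<kappa> \<delta>"
 let ?B = "\<delta> / c"
 let ?D = "\<delta> + (2*\<delta> / c + ?A)"
 show d: "0 < \<delta>" using assms by (simp add: small_def)
 have L: "1 <= L^2" "L <= L^4" "L^3 <= L^4" "L^2 <= L^4" using L1 by (auto intro: power_increasing[of 1 4 L, simplified] power_increasing)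
 have cd: "\<delta> <= \<delta> / c" using c d by (simp add: pos_le_divide_eq mult_left_le)
 show a: "\<delta> / c <= ?A" unfolding \<kappa>_def using L(1) c d by (simp add: divide_right_mono)
 thus b: "\<delta> <= ?A" using cd by linarith
 have "L^2*\<delta> <= L^2*?B" using cd by (intro mult_left_mono) auto
 thus "L^2*\<delta> <= ?A" by (simp add: \<kappa>_def)
 have e: "64*(L^4*\<delta> / c) <= d0" using assms c by (simp add: small_def pos_divide_le_eq mult_ac)
 have "L^2*\<delta> / c <= L^4*\<delta> / c" using L(4) d c by (intro divide_right_mono mult_right_mono) auto
 thus k: "?A <= d0" using e d0(1) unfolding \<kappa>_def by linarith
 thus "L*?A <= T / 64" by (rule d0_le(3))
 have "L^2*?A = L^4*\<delta> / c" by (simp add: \<kappa>_def power_eq_if)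
 thus "64*(L^2*?A) <= d0" using e by simp
 have p: "L*?B <= L^4*\<delta> / c" using L(2) d c by (simp add: divide_right_mono mult_right_mono)
 have "L*?A = L^3*\<delta> / c" by (simp add: \<kappa>_def power_eq_if)
 hence q: "L*?A <= L^4*\<delta> / c" using L(3) d c by (simp only: divide_right_mono mult_right_mono less_imp_le)
 have r: "L*\<delta> <= L*?B" using cd L1 by (intro mult_left_mono) auto
 have "L*?D = L*\<delta> + (2*(L*?B) + L*?A)" by (simp add: algebra_simps)
 also have "... <= 4*(L^4*\<delta> / c)"
 proof -
  have "x + (2*y + z) <= 4*w" if "y <= w" "z <= w" "x <= y" for x y z w :: real using that by linarith
  from this[OF p q r] show ?thesis .
 qed
 also have "... <= d0" using e d0(1) by linarith
 also have "... <= T / 16" using d0_le(1)[of d0] tau_pos by linarith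
 finally show "L*?D <= T / 16" .
qed

text \<open>Beyond the start only the normal distances are assumed small; offsets and clock drift
  follow. The drift is a sum of offsets over all steps, and \<open>sum_bound\<close> keeps it below
  \<open>T / 8\<close> however large \<open>n\<close> is.\<close>

lemma track:
 assumes sm: "small \<delta>" and 0: "trk g h (T / 16) \<delta> 0" and D: "!!j. j < n ==> DD g h (real j*T) < \<delta>"
 shows "j <= n ==> trk g h (T / 8) (\<kappa> \<delta>) (real j*T)"
  and "0 < j ==> j < n ==> DD g h (real j*T) + c*MM g h (real j*T) <=
   max (DD g h (real (j + 1)*T)) (DD g h (real (j - 1)*T))"
  and "j < n ==> MM g h (real (j + 1)*T) <= L*MM g h (real j*T)"
proof -
 let ?A = "\<kappa> \<delta>"
 let ?B = "T / 8"
 let ?D = "\<delta> + (2*\<delta> / c + ?A)"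
 note S = small[OF sm]
 define u where "u j = U g h (real j*T)" for j
 define d where "d j = DD g h (real j*T)" for j
 define m where "m j = MM g h (real j*T)" for j
 have nn: "0 <= d j" "0 <= m j" for j by (simp_all add: d_def m_def DD_nonneg MM_nonneg)
 have kt: "T / 8 <= 2*T" using tau_pos by simp
 have k0: "T / 16 <= 2*T" "\<delta> <= d0" using tau_pos S(2,3) by auto
 have u0: "\<bar>u 0\<bar> <= T / 16" "m 0 <= \<delta>" using trkD(1,3)[OF 0 k0] by (simp_all add: u_def m_def)
 have "(ALL j<=n. trk g h ?B (?A) (real j*T)) & (ALL j<n. \<bar>u (j + 1) - u j - T\<bar> <= L*m j & m (j + 1) <= L*m j) &
  (ALL j. 0 < j & j < n --> d j + c*m j <= max (d (j + 1)) (d (j - 1)))" using D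
 proof (induction n)
  case 0
  have "trk g h ?B (?A) 0" using assms(2) S(2) tau_pos unfolding trk_def by force
  thus ?case by simp
 next
  case (Suc n)
  have dl: "d j < \<delta>" if "j <= n" for j using Suc.prems[of j] that by (simp add: d_def)
  have IH1: "trk g h ?B (?A) (real j*T)" if "j <= n" for j using Suc that by auto
  have IH2: "\<bar>u (j + 1) - u j - T\<bar> <= L*m j" "m (j + 1) <= L*m j" if "j < n" for j using Suc that by auto
  have IH3: "d j + c*m j <= max (d (j + 1)) (d (j - 1))" if "0 < j" "j < n" for j using Suc that by auto
  note T = trkD[OF IH1 kt S(3)]
  have ml: "m j <= ?A" "d j <= L*m j" "\<bar>u j - real j*T\<bar> <= T / 8" "L*m j <= T / 64" if "j <= n" for j
   using T(1,3,6)[OF that] d0_le(3)[of "m j"] S(3) by (auto simp: m_def d_def u_def)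
  have sy: "sync (sh g (real j*T)) (sh h (u j))" "mm (sh g (real j*T)) (sh h (u j)) <= d0" if "j <= n" for j
   using T(2,3)[OF that] S(3) by (auto simp: u_def MM_def)
  have mu: "mm (sh g (real j*T)) (sh h (u j)) = m j" "jj (sh g (real j*T)) (sh h (u j)) = d j" for j
   by (simp_all add: m_def d_def u_def MM_def DD_def)
  obtain u' v' where st: "\<bar>u' - u n - T\<bar> <= L*m n" "\<bar>v' - u n + T\<bar> <= L*m n"
   "sync (sh g (real n*T + T)) (sh h u')" "sync (sh g (real n*T - T)) (sh h v')"
   "mm (sh g (real n*T + T)) (sh h u') <= L*m n"
   "d n + c*m n <= max (jj (sh g (real n*T + T)) (sh h u')) (jj (sh g (real n*T - T)) (sh h v'))"
   using step_at[OF sy[OF order_refl]] unfolding mu by metis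
  have e: "real n*T + T = real (Suc n)*T" by (simp add: algebra_simps)
  \<comment> \<open>Convexity at index \<open>n - 1\<close> uses both neighbours below \<delta> and
    so bounds the offset one step back; for \<open>n < 2\<close> the initial offset is used
    instead.\<close>
  have mn: "L*m n <= ?A"
  proof (cases "n >= 2")
   case True
   hence "d (n - 1) + c*m (n - 1) <= \<delta>" using IH3[of "n - 1"] dl[of n] dl[of "n - 1 - 1"] by auto
   hence "c*m (n - 1) <= \<delta>" using nn(1)[of "n - 1"] by linarith
   hence "m (n - 1) <= \<delta> / c" using c by (simp add: pos_le_divide_eq mult.commute)
   hence "L*(L*m (n - 1)) <= L*(L*(\<delta> / c))" using L1 by (intro mult_left_mono) auto
   moreover have "L*m n <= L*(L*m (n - 1))" using IH2(2)[of "n - 1"] True L1 by (intro mult_left_mono) auto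
   ultimately show ?thesis by (simp add: \<kappa>_def power2_eq_square)
  next
   case False
   have "L*m n <= L^2*\<delta>"
   proof (cases "n = 0")
    case True
    have "L*m n <= L*\<delta>" using u0 True L1 by (intro mult_left_mono) auto
    also have "... <= L^2*\<delta>" using L1 S(1) by (intro mult_right_mono) (auto simp: power2_eq_square)
    finally show ?thesis .
   next
    case 2: False
    hence "n = 1" using False by simp
    hence "m n <= L*m 0" using IH2(2)[of 0] by simp
    also have "... <= L*\<delta>" using u0 L1 by (intro mult_left_mono) auto
    finally have "L*m n <= L*(L*\<delta>)" using L1 by (intro mult_left_mono) auto
    thus ?thesis by (simp add: power2_eq_square)
   qed
   thus ?thesis using S(6) by linarith
  qed
  have mm': "mm (sh g (real (Suc n)*T)) (sh h u') <= ?A" using st(5) mn unfolding e by linarith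
  have sum: "\<bar>u j - real j*T\<bar> <= T / 16 + L*(\<Sum>i<j. m i)" if "j <= n" for j using that
  proof (induction j)
   case (Suc j)
   thus ?case using IH2(1)[of j] by (simp add: algebra_simps)
  qed (use u0 in simp)
  have sb: "(\<Sum>i<n. m i) <= \<delta> + 2*\<delta> / c"
  proof (cases "n = 0")
   case True thus ?thesis using S(1) c by simp
  next
   case False
   interpret q: separation_sequence d m n L c
    by unfold_locales (use c L1 nn ml(2) IH3 in auto)
   have "(\<Sum>j=1..n-1. c*m j) <= 2*\<delta>" by (rule q.sum_bound) (use dl False in \<open>auto intro: less_imp_le\<close>)
   hence "(\<Sum>j=1..n-1. m j) <= 2*\<delta> / c" using c by (simp add: sum_distrib_left[symmetric] pos_le_divide_eq mult.commute)
   moreover have "(\<Sum>i<n. m i) = m 0 + (\<Sum>j=1..n-1. m j)"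
   proof -
    have "{..<n} = insert 0 {1..n-1}" using False by auto
    thus ?thesis by simp
   qed
   ultimately show ?thesis using u0 by linarith
  qed
  have "L*?D = L*(\<delta> + 2*\<delta> / c) + L*?A" by (simp only: distrib_left add.assoc)
  hence "L*(\<Sum>i<n. m i) + L*m n <= L*?D"
   using mult_left_mono[OF sb, of L] mult_left_mono[OF ml(1)[of n], of L] L1 by linarith
  hence ut: "\<bar>u' - real (Suc n)*T\<bar> <= T / 8" using sum[of n] st(1) S(4) e by linarith
  have uu: "u (Suc n) = u'" unfolding u_def
   by (rule U_eq) (use ut st(3) mm' S(3) tau_pos e in auto)
  have t': "trk g h ?B (?A) (real (Suc n)*T)"
   unfolding trk_def using ut st(3) mm' unfolding e by blast
  have 3: "d n + c*m n <= max (d (n + 1)) (d (n - 1))" if "0 < n"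
  proof -
   have e': "real n*T - T = real (n - 1)*T" using that by (simp add: algebra_simps of_nat_diff)
   have "\<bar>v' - u (n - 1)\<bar> <= 4*T" using st(2) IH2(1)[of "n - 1"] ml(4)[of n] ml(4)[of "n - 1"] that tau_pos by auto
   hence "v' = u (n - 1)" using sync_uniq[OF sy[of "n - 1"]] st(4) unfolding e' by auto
   thus ?thesis using st(6) unfolding e e' uu[symmetric] by (simp only: mu Suc_eq_plus1)
  qed
  have "m (Suc n) <= L*m n" using st(5) unfolding e uu[symmetric] mu .
  thus ?case using t' IH1 IH2 IH3 3 st(1) uu by (auto simp: le_Suc_eq less_Suc_eq)
 qed
 thus "j <= n ==> trk g h ?B (?A) (real j*T)"
  "0 < j ==> j < n ==> DD g h (real j*T) + c*MM g h (real j*T) <=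
   max (DD g h (real (j + 1)*T)) (DD g h (real (j - 1)*T))"
  "j < n ==> MM g h (real (j + 1)*T) <= L*MM g h (real j*T)"
  by (auto simp: d_def m_def)
qed

section \<open>Convergence of geodesics\<close>

text \<open>Closeness of position and velocity at time 0 only; by \<open>gconv_sh\<close> it then
  holds at every time.\<close>

definition gconv :: "('i => real => 'a) => (real => 'a) => 'i filter => bool" where
 "gconv f g F \<longleftrightarrow> G g & (ALL e>0. eventually (%i. close (bx (g 0)) e g (f i)) F)"

lemma closeD: assumes "close b e g h"
 shows "b \<in> B" "G g" "G h" "g 0 \<in> inn 2 b" "h 0 \<in> inn 2 b" "nz b g h <= e"
 using assms by (auto simp: close_def)

lemma close_mono: "close b e g h ==> e <= e' ==> close b e' g h"
 by (auto simp: close_def)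

lemma Dz_sym: "nz b h g = nz b g h"
proof -
 have "Dz b h g = - Dz b g h" by (simp add: Dz_def)
 thus ?thesis by (simp only: norm_minus_cancel)
qed

lemma Dz_triangle: "nz b g h <= nz b g \<xi> + nz b \<xi> h"
proof -
 have "Dz b g h = Dz b g \<xi> + Dz b \<xi> h" by (simp add: Dz_def)
 thus ?thesis by (simp only: norm_triangle_ineq)
qed

lemma close_sym: "close b e g h ==> close b e h g"
 by (simp add: close_def Dz_sym)

lemma close_trans: "close b e g \<xi> ==> close b e' \<xi> h ==> close b (e + e') g h"
 using Dz_triangle[of b g h \<xi>] by (auto simp: close_def)

lemma close_near:
 assumes c: "close b e g h" "e <= d0" and t: "\<bar>t\<bar> <= 3*T" and b': "b' \<in> B" "g t \<in> inn n b'" "n <= 3/2"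
 shows "close b' (L*e) (sh g t) (sh h t)" "h t \<in> inn (n + 1/2) b'"
proof -
 have N: "h t \<in> inn (n + 1/2) b'" "nz b' (sh g t) (sh h t) <= L*nz b g h"
  using near[OF close_mono[OF c] b'(1) t _ b'(2)] b'(3) by auto
 show "h t \<in> inn (n + 1/2) b'" by (rule N)
 have "L*nz b g h <= L*e" using closeD(6)[OF c(1)] L1 by (intro mult_left_mono) auto
 thus "close b' (L*e) (sh g t) (sh h t)"
  using N b' inn_le[OF b'(1,2), of 2] inn_le[OF b'(1) N(1), of 2] closeD[OF c(1)] by (simp add: close_def sh_apply geodesic_sh)
qed

lemma close_near0:
 assumes c: "close b e g h" "e <= d0" and b': "b' \<in> B" "g 0 \<in> inn n b'" "n <= 3/2"
 shows "close b' (L*e) g h" "h 0 \<in> inn (n + 1/2) b'"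
 using close_near[OF c, of 0 b' n] b' tau_pos by auto

lemma gconvI:
 assumes g: "G g" and c: "!!e. 0 < e ==> eventually (%i. close b e g (f i)) F"
 shows "gconv f g F"
 unfolding gconv_def
proof (intro conjI allI impI g)
 fix e :: real assume e: "0 < e"
 note b = bx[OF geo_top[OF g, of 0]]
 have "0 < min d0 (e/L)" using d0 e L1 by auto
 from c[OF this] show "eventually (%i. close (bx (g 0)) e g (f i)) F"
 proof (rule eventually_mono)
  fix i assume i: "close b (min d0 (e/L)) g (f i)"
  have "L*min d0 (e/L) <= L*(e/L)" using L1 by (intro mult_left_mono) auto
  hence le: "L*min d0 (e/L) <= e" using L1 by simp
  show "close (bx (g 0)) e g (f i)"
   by (rule close_mono[OF close_near0(1)[OF i _ b] le]) auto
 qed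
qed

lemma gconvD:
 assumes g: "gconv f g F" and b: "b \<in> B" "g 0 \<in> inn n b" "n <= 3/2" and e: "0 < e"
 shows "eventually (%i. close b e g (f i) & f i 0 \<in> inn (n + 1/2) b) F"
proof -
 let ?A = "min d0 (e/L)"
 have "0 < ?A" using d0 e L1 by auto
 hence "eventually (%i. close (bx (g 0)) (?A) g (f i)) F" using g by (simp only: gconv_def)
 thus ?thesis
 proof (rule eventually_mono)
  fix i assume i: "close (bx (g 0)) (?A) g (f i)"
  have "L*?A <= L*(e/L)" using L1 by (intro mult_left_mono) auto
  hence le: "L*?A <= e" using L1 by simp
  show "close b e g (f i) & f i 0 \<in> inn (n + 1/2) b"
   using close_mono[OF close_near0(1)[OF i _ b] le] close_near0(2)[OF i _ b] by simp
 qed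
qed

lemma gconv_G: "gconv f g F ==> G g" by (simp add: gconv_def)

lemma gconv_sh_small:
 assumes g: "gconv f g F" and t: "\<bar>t\<bar> <= 3*T" shows "gconv (%i. sh (f i) t) (sh g t) F"
 unfolding gconv_def
proof (intro conjI allI impI)
 let ?A = "bx (sh g t 0)"
 have G: "G g" using g by (rule gconv_G)
 thus "G (sh g t)" by (rule geodesic_sh)
 fix e :: real assume e: "0 < e"
 have b: "?A \<in> B" "g t \<in> inn 1 (?A)" using bx[OF geo_top[OF G, of t]] by (simp_all add: sh_apply)
 have "0 < min d0 (e/L)" using d0 e L1 by auto
 hence "eventually (%i. close (bx (g 0)) (min d0 (e/L)) g (f i)) F" using g by (simp only: gconv_def)
 thus "eventually (%i. close (?A) e (sh g t) (sh (f i) t)) F"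
 proof (rule eventually_mono)
  fix i assume i: "close (bx (g 0)) (min d0 (e/L)) g (f i)"
  have "L*min d0 (e/L) <= L*(e/L)" using L1 by (intro mult_left_mono) auto
  hence le: "L*min d0 (e/L) <= e" using L1 by simp
  show "close (?A) e (sh g t) (sh (f i) t)"
   by (rule close_mono[OF close_near(1)[OF i _ t b] le]) auto
 qed
qed

lemma gconv_sh:
 assumes g: "gconv f g F" shows "gconv (%i. sh (f i) t) (sh g t) F"
proof -
 obtain n :: nat where n: "\<bar>t\<bar> / T < real n" using reals_Archimedean2 by blast
 have n0: "0 < real n" using n tau_pos by (meson abs_ge_zero divide_nonneg_pos le_less_trans)
 have t: "\<bar>t/real n\<bar> <= 3*T"
 proof -
  have "\<bar>t\<bar> <= real n*T" using n tau_pos by (simp add: pos_divide_less_eq)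
  also have "... <= real n*(3*T)" using tau_pos by (intro mult_left_mono) auto
  finally show ?thesis using n0 by (simp add: pos_divide_le_eq mult.commute)
 qed
 have "gconv (%i. sh (f i) (real m*(t/real n))) (sh g (real m*(t/real n))) F" for m
 proof (induction m)
  case (Suc m)
  have "real m*(t/real n) + t/real n = real (Suc m)*(t/real n)" by (simp add: algebra_simps add_divide_distrib)
  with gconv_sh_small[OF Suc t] show ?case by (simp only: sh_sh)
 qed (use g in simp)
 from this[of n] show ?thesis using n0 by simp
qed

lemma tau_brad: "b \<in> B ==> 64*d0 <= brad b/4" "b \<in> B ==> C*T <= brad b/4"
proof -
 assume b: "b \<in> B"
 show "C*T <= brad b/4" using tau_rad[OF b] by linarith
 moreover have "T <= C*T" using C1 tau_pos by simp
 ultimately show "64*d0 <= brad b/4" using d0_le(1)[of d0] by linarith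
qed

lemma close_shift:
 assumes c: "close b e g h" "e <= d0" and g0: "g 0 \<in> inn n b" "n <= 3/2" and r: "\<bar>r\<bar> <= T"
 shows "close b (e + 2*C^3*\<bar>r\<bar>) g (sh h r)"
proof -
 note D = closeD[OF c(1)]
 have st: "h s \<in> inn 3 b" if "min 0 r <= s" "s <= max 0 r" for s
  by (rule geo_stay[OF D(3,1,5)]) (use that r tau_pos in \<open>auto simp: abs_le_iff\<close>)
 note mv = geo_move[of h b 0 r, OF D(3,1) st]
 have x: "norm (xx b h r - xx b h 0) <= C*\<bar>r\<bar>" "norm (vv b h r - vv b h 0) <= C^3*\<bar>r\<bar>" using mv by simp_all
 have "C*\<bar>r\<bar> <= C^3*\<bar>r\<bar>" using Cpow(2)[of 1 3] by (intro mult_right_mono) auto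
 hence "nz b h (sh h r) <= 2*C^3*\<bar>r\<bar>"
  using x norm_fst_snd(3)[of "Dz b h (sh h r)"] by (simp add: Dz_def sh_apply geodesic_sh(2)[OF D(3)])
 hence 1: "nz b g (sh h r) <= e + 2*C^3*\<bar>r\<bar>" using Dz_triangle[of b g "sh h r" h] D(6) by linarith
 have "dist (xx b h r) (xx b h 0) <= C*T" using x(1) mult_left_mono[OF r, of C] C1 unfolding dist_norm by linarith
 moreover have "dist (xx b h 0) (xx b g 0) <= d0"
  using D(6) c(2) norm_fst_snd(1)[of "Dz b g h"] by (simp add: Dz_def dist_norm)
 moreover have "dist (xx b g 0) (bpt b) <= 3/2*brad b" using inn_le[OF D(1) g0] by (simp add: inn_def)
 ultimately have "dist (xx b h r) (bpt b) <= C*T + d0 + 3/2*brad b"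
  using dist_triangle[of "xx b h r" "bpt b" "xx b h 0"] dist_triangle[of "xx b h 0" "bpt b" "xx b g 0"] by linarith
 also have "... <= 2*brad b" using tau_brad[OF D(1)] d0(1) brad_pos[OF D(1)] by linarith
 finally have "h r \<in> inn 2 b" using st[of r] by (simp add: inn_def)
 thus ?thesis using 1 D by (simp add: close_def sh_apply geodesic_sh)
qed

lemma gconv_shift:
 assumes g: "gconv f g F" and r: "(r \<longlongrightarrow> t) F" shows "gconv (%i. sh (f i) (r i)) (sh g t) F"
proof (rule gconvI[where b="bx (g t)"])
 let ?A = "bx (g t)"
 have G: "G g" using g by (rule gconv_G)
 note b = bx[OF geo_top[OF G, of t]]
 show "G (sh g t)" using G by (rule geodesic_sh)
 fix e :: real assume e: "0 < e"
 let ?d = "min d0 (e/2)"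
 define q where "q = min T (e/(4*C^3))"
 have q: "0 < q" "q <= T" "2*C^3*q <= e/2"
 proof -
  have p: "0 < 4*C^3" using C1 by simp
  thus "0 < q" "q <= T" using tau_pos e by (auto simp: q_def)
  have "4*C^3*q <= 4*C^3*(e/(4*C^3))" using p by (intro mult_left_mono) (auto simp: q_def)
  thus "2*C^3*q <= e/2" using p by simp
 qed
 have b': "sh g t 0 \<in> inn 1 ?A" using b by (simp add: sh_apply)
 have "eventually (%i. close ?A ?d (sh g t) (sh (f i) t)) F"
  using gconv_sh[OF g, of t] d0 e unfolding gconv_def by (simp add: sh_apply)
 moreover have "eventually (%i. \<bar>r i - t\<bar> < q) F" using tendstoD[OF r q(1)] by (simp add: dist_real_def)
 ultimately show "eventually (%i. close ?A e (sh g t) (sh (f i) (r i))) F"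
 proof (rule eventually_elim2)
  fix i assume c: "close ?A ?d (sh g t) (sh (f i) t)" and ri: "\<bar>r i - t\<bar> < q"
  have le: "?d <= d0" "\<bar>r i - t\<bar> <= T" using ri q by auto
  have "close ?A (?d + 2*C^3*\<bar>r i - t\<bar>) (sh g t) (sh (sh (f i) t) (r i - t))"
   by (rule close_shift[OF c le(1) b' _ le(2)]) simp
  moreover have "2*C^3*\<bar>r i - t\<bar> <= 2*C^3*q" using ri C1 by (intro mult_left_mono) auto
  hence "?d + 2*C^3*\<bar>r i - t\<bar> <= e" using q(3) by linarith
  ultimately show "close ?A e (sh g t) (sh (f i) (r i))" using close_mono by fastforce
 qed
qed

lemma gconv_unique:
 assumes f: "gconv f g F" "gconv f g' F" and F: "F ~= bot" shows "g = g'"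
proof -
 let ?A = "bx (g 0)"
 define b where "b = bx (g' 0)"
 have G': "G g'" using f(2) by (rule gconv_G)
 have b: "b \<in> B" "g' 0 \<in> inn 1 b" using bx[OF geo_top[OF G', of 0]] by (simp_all add: b_def)
 have main: "g 0 \<in> inn 3 b & nz b g' g <= (L + 1)*e" if e: "0 < e" "e <= d0" for e
 proof -
  have "eventually (%i. close ?A e g (f i)) F" using f(1) e by (simp add: gconv_def)
  moreover have "eventually (%i. close b e g' (f i)) F" using f(2) e by (simp add: gconv_def b_def)
  ultimately have "eventually (%i. close ?A e g (f i) & close b e g' (f i)) F" by (rule eventually_conj)
  then obtain i where i: "close ?A e g (f i)" "close b e g' (f i)" using F eventually_happens by blast
  have c: "close ?A d0 (f i) g" using close_sym[OF i(1)] e(2) by (rule close_mono)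
  have t0: "\<bar>0\<bar> <= 3*T" using tau_pos by simp
  have N: "g 0 \<in> inn (2 + 1/2) b" "nz b (f i) g <= L*nz ?A (f i) g"
   using near[OF c b(1) t0 order_refl closeD(5)[OF i(2)]] by auto
  have "L*nz ?A (f i) g <= L*e" using closeD(6)[OF close_sym[OF i(1)]] L1 by (intro mult_left_mono) auto
  hence "nz b g' g <= (L + 1)*e" using N(2) Dz_triangle[of b g' g "f i"] closeD(6)[OF i(2)] by (simp add: distrib_right)
  thus ?thesis using inn_le[OF b(1) N(1), of 3] by simp
 qed
 have "nz b g' g <= 0"
 proof (rule field_le_epsilon)
  fix e :: real assume e: "0 < e"
  let ?e = "min d0 (e/(L + 1))"
  have "(L + 1)*?e <= (L + 1)*(e/(L + 1))" using L1 by (intro mult_left_mono) auto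
  thus "nz b g' g <= 0 + e" using main[of ?e] e d0 L1 by simp
 qed
 hence z: "Dz b g' g = 0" by simp
 hence "xx b g 0 = xx b g' 0" by (simp add: Dz_def zero_prod_def)
 hence "g 0 \<in> inn 2 b" using main[of d0] d0 inn_le[OF b, of 2] by (auto simp: inn_def)
 hence "close b 0 g' g" using z G' b inn_le[OF b, of 2] gconv_G[OF f(1)] by (simp add: close_def)
 thus ?thesis using geo_unique by blast
qed

lemma gconv_track:
 assumes g: "gconv f g F" and d: "0 < d"
 shows "eventually (%i. ALL r:{0..R}. trk g (f i) d d r) F"
proof -
 define e where "e = min d0 (d/L)"
 have e: "0 < e" "e <= d0" "L*e <= d"
 proof -
  show "0 < e" "e <= d0" using d0 d L1 by (auto simp: e_def)
  have "L*e <= L*(d/L)" using L1 by (intro mult_left_mono) (auto simp: e_def)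
  thus "L*e <= d" using L1 by simp
 qed
 define N where "N = nat \<lceil>R/T\<rceil>"
 have "eventually (%i. ALL n:{..N}. close (bx (g (real n*T))) e (sh g (real n*T)) (sh (f i) (real n*T))) F"
 proof (rule eventually_ball_finite)
  show "ALL n:{..N}. eventually (%i. close (bx (g (real n*T))) e (sh g (real n*T)) (sh (f i) (real n*T))) F"
   using gconv_sh[OF g] e(1) by (simp add: gconv_def sh_apply)
 qed simp
 thus ?thesis
 proof (rule eventually_mono, intro ballI)
  fix i r assume c: "ALL n:{..N}. close (bx (g (real n*T))) e (sh g (real n*T)) (sh (f i) (real n*T))" and r: "r \<in> {0..R}"
  define n where "n = nat \<lfloor>r/T\<rfloor>"
  have "0 <= r/T" "r/T <= R/T" using r tau_pos by (auto simp: divide_right_mono)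
  hence n: "n <= N" "real n <= r/T" "r/T <= real n + 1" unfolding n_def N_def by linarith+
  hence rn: "\<bar>r - real n*T\<bar> <= 3*T" using tau_pos by (auto simp: field_simps)
  let ?g = "sh g (real n*T)" and ?h = "sh (f i) (real n*T)"
  have cn: "close (bx (g (real n*T))) e ?g ?h" using c n(1) by simp
  obtain u where u: "\<bar>u - (r - real n*T)\<bar> <= L*norm (Dz (bx (g (real n*T))) ?g ?h)"
   "sync (sh ?g (r - real n*T)) (sh ?h u)" "mm (sh ?g (r - real n*T)) (sh ?h u) <= L*norm (Dz (bx (g (real n*T))) ?g ?h)"
   using trans[OF close_mono[OF cn e(2)] rn] by blast
  have "L*norm (Dz (bx (g (real n*T))) ?g ?h) <= L*e" using closeD(6)[OF cn] L1 by (intro mult_left_mono) auto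
  hence "\<bar>(real n*T + u) - r\<bar> <= d" "sync (sh g r) (sh (f i) (real n*T + u))" "mm (sh g r) (sh (f i) (real n*T + u)) <= d"
   using u e(3) by auto
  thus "trk g (f i) d d r" unfolding trk_def by blast
 qed
qed

lemma gconv_rv:
 assumes g: "gconv f g F" shows "gconv (%i. rv (f i)) (rv g) F"
proof (rule gconvI[where b="bx (g 0)"])
 show "G (rv g)" using gconv_G[OF g] by (rule geodesic_rv)
 fix e :: real assume "0 < e"
 hence "eventually (%i. close (bx (g 0)) e g (f i)) F" using g by (simp add: gconv_def)
 thus "eventually (%i. close (bx (g 0)) e (rv g) (rv (f i))) F"
  by (rule eventually_mono) (auto simp: close_def geodesic_rv rev_rel sh_apply)
qed

lemma sync_rv: "sync (rv g) (rv h) \<longleftrightarrow> sync g h" and mm_rv: "G g ==> G h ==> mm (rv g) (rv h) = mm g h"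
proof -
 have *: "sync (rv g) (rv h)" if s: "sync g h" for g h
 proof -
  have g: "G g" "G h" using s by (auto simp: sync_def)
  show ?thesis using s rev_rel(2)[OF g bx(1)[OF geo_top[OF g(1), of 0]]]
   by (simp add: sync_def geodesic_rv sh_apply)
 qed
 show "sync (rv g) (rv h) \<longleftrightarrow> sync g h" using *[of g h] *[of "rv g" "rv h"] unfolding sh_rv(2) by blast
 show "mm (rv g) (rv h) = mm g h" if g: "G g" "G h"
  using rev_rel(1)[OF g bx(1)[OF geo_top[OF g(1), of 0]]] by (simp add: mm_def sh_apply)
qed

lemma trk_rv: "trk g h e d t ==> trk (rv g) (rv h) e d (- t)"
proof -
 assume "trk g h e d t"
 then obtain u where u: "\<bar>u - t\<bar> <= e" "sync (sh g t) (sh h u)" "mm (sh g t) (sh h u) <= d" by (auto simp: trk_def)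
 have g: "G (sh g t)" "G (sh h u)" using u(2) by (auto simp: sync_def)
 have "\<bar>(- u) - (- t)\<bar> <= e" using u(1) by linarith
 moreover have "sync (sh (rv g) (- t)) (sh (rv h) (- u))" using u(2) by (simp add: sh_rv sync_rv)
 moreover have "mm (sh (rv g) (- t)) (sh (rv h) (- u)) <= d" using u(3) mm_rv[OF g] by (simp add: sh_rv)
 ultimately show ?thesis unfolding trk_def by blast
qed

lemma C_le_L: "C <= L" "C^3 <= L" "5*C^4 <= L"
 using Cpow(2)[of 1 4] Cpow(2)[of 3 4] Cpow(1)[of 4] CL by auto

section \<open>Crossings of a fixed normal\<close>

lemma Th_diff: assumes "G g" "b \<in> B" "g 0 \<in> inn 1 b"
 shows "\<bar>Th b g \<zeta> - Th b g h\<bar> <= C*nz b h \<zeta>" "\<bar>J b g \<zeta> - J b g h\<bar> <= C*nz b h \<zeta>"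
proof -
 let ?A = "nz b h \<zeta>"
 have K: "xx b g 0 \<in> Kb b" using inn_K[OF assms(2,3)] by simp
 note ub = unit_bounds[OF assms(2) K geo_unit[OF assms]]
 let ?w = "xx b \<zeta> 0 - xx b h 0"
 have le: "C*norm ?w <= C*?A" using C1 norm_fst_snd(1)[of "Dz b h \<zeta>"] by (intro mult_left_mono) (auto simp: Dz_def)
 have w: "?w = (xx b \<zeta> 0 - xx b g 0) - (xx b h 0 - xx b g 0)" by simp
 have cl: "cross u (x - y) = cross u x - cross u y" for u x y by (simp add: cross_def algebra_simps)
 have "Th b g \<zeta> - Th b g h = ip (bch b) (xx b g 0) (vv b g 0) ?w" unfolding Th_def w ip_lin(4) ..
 thus "\<bar>Th b g \<zeta> - Th b g h\<bar> <= C*?A" using ub(2)[of ?w] le by linarith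
 have "J b g \<zeta> - J b g h = vol (bch b) (xx b g 0) * cross (vv b g 0) ?w" unfolding J_def w cl by (simp add: right_diff_distrib)
 thus "\<bar>J b g \<zeta> - J b g h\<bar> <= C*?A" using ub(1)[of ?w] le by linarith
qed

text \<open>The box is a parameter, so that all geodesics of a family are read in one chart while
  they cross the same normal of \<open>g\<close>.\<close>

definition hit :: "'a box => (real => 'a) => (real => 'a) => bool" where
 "hit b g h \<longleftrightarrow> b \<in> B & G g & G h & g 0 \<in> inn 1 b & h 0 \<in> inn 2 b & Th b g h = 0 & nz b g h <= d0"

lemma near_inn:
 assumes "b \<in> B" "g 0 \<in> inn 1 b" "h 0 \<in> inn n b" "nz b g h <= d0"
 shows "h 0 \<in> inn (5/4) b"
proof -
 have "dist (xx b h 0) (xx b g 0) <= d0" using assms(4) norm_fst_snd(1)[of "Dz b g h"] by (simp add: Dz_def dist_norm)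
 hence "dist (xx b h 0) (bpt b) <= 5/4*brad b"
  using dist_triangle[of "xx b h 0" "bpt b" "xx b g 0"] assms(2) tau_brad(1)[OF assms(1)] d0(1)
  by (simp add: inn_def)
 thus ?thesis using assms(3) by (simp add: inn_def)
qed

lemma sync_hit: assumes "sync g h" "mm g h <= d0" shows "hit (bx (g 0)) g h"
proof -
 have g: "G g" using assms by (simp add: sync_def)
 show ?thesis using assms bx[OF geo_top[OF g, of 0]] by (simp add: hit_def sync_def mm_def)
qed

lemma hit_unique:
 assumes h: "hit b g (sh h u)" and v: "Th b g (sh h v) = 0" "\<bar>v - u\<bar> <= 4*T"
 shows "v = u"
proof -
 have "1/(64*C) <= 1/(8*C)" using C1 by (simp add: field_simps)
 hence m: "nz b g (sh h u) <= 1/(8*C)" using h d0_le(2)[of d0] by (simp add: hit_def)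
 have h': "b \<in> B" "G g" "G (sh h u)" "g 0 \<in> inn 3 b" "sh h u 0 \<in> inn 2 b" "Th b g (sh h u) = 0"
  using h inn_le[of b "g 0" 1 3] by (auto simp: hit_def)
 have "v - u = 0"
  by (rule sync_unique[OF h'(2,3,1,4,5) _ m v(2) h'(6)]) (use v in simp_all)
 thus ?thesis by simp
qed

text \<open>Near a geodesic that crosses the normal of \<open>g\<close>, every geodesic crosses it
  at a nearby time. \<open>resync\<close> provides the shift; as \<open>Th b g h = 0\<close>,
  \<open>Th_diff\<close> bounds it by the distance from \<open>h\<close> instead of that from
  \<open>g\<close>.\<close>

lemma resync_near:
 assumes h: "hit b g h" and c: "close b e h \<zeta>" and e: "L*e <= d0"
 obtains t where "\<bar>t\<bar> <= 2*(C*e)" "Th b g (sh \<zeta> t) = 0" "close b (L*e) h (sh \<zeta> t)"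
proof -
 let ?A = "nz b g \<zeta>"
 have b: "b \<in> B" and g: "G g" "G \<zeta>" and 0: "g 0 \<in> inn 1 b" "g 0 \<in> inn 3 b" "\<zeta> 0 \<in> inn 2 b"
  using h closeD[OF c] inn_le[of b "g 0" 1 3] by (auto simp: hit_def)
 have e0: "0 <= e" using closeD(6)[OF c] norm_ge_zero order_trans by blast
 have eL: "e <= L*e" using L1 e0 mult_right_mono[of 1 L e] by simp
 have m: "?A <= 2*d0" using Dz_triangle[of b g \<zeta> h] closeD(6)[OF c] h e eL by (auto simp: hit_def)
 have "?A*C <= 2*d0*L" using m C_le_L C1 d0 by (intro mult_mono) auto
 also have "... <= T" using d0(2) tau_pos by (simp add: mult.commute)
 finally have mt: "?A*C <= T" .
 have "4*(1/(64*C)) <= 1/(8*C)" using C1 by (simp add: field_simps)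
 hence m8: "?A <= 1/(8*C)" using m d0_le(2)[of d0] d0(1) by linarith
 obtain t where t: "Th b g (sh \<zeta> t) = 0" "\<bar>t\<bar> <= 2*\<bar>Th b g \<zeta>\<bar>"
  by (rule resync[OF g b 0(2,3) order_refl m8 mt])
 have Ce: "C*nz b h \<zeta> <= C*e" using closeD(6)[OF c] C1 by (intro mult_left_mono) auto
 have t2: "\<bar>t\<bar> <= 2*(C*e)" using t(2) Th_diff(1)[OF g(1) b 0(1), of \<zeta> h] h Ce by (simp add: hit_def)
 have "C*e <= L*e" using C_le_L(1) e0 by (intro mult_right_mono)
 hence tt: "\<bar>t\<bar> <= T" using t2 e d0_le(1)[of d0] tau_pos by linarith
 have eta: "h 0 \<in> inn (5/4) b" by (rule near_inn) (use h in \<open>auto simp: hit_def\<close>)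
 have "e <= d0" using e eL by linarith
 from close_shift[OF c this eta _ tt] have cs: "close b (e + 2*C^3*\<bar>t\<bar>) h (sh \<zeta> t)" by simp
 have "2*C^3*\<bar>t\<bar> <= 2*C^3*(2*(C*e))" using t2 C1 by (intro mult_left_mono) auto
 also have "... = 4*C^4*e" by (simp add: power_eq_if)
 finally have 1: "e + 2*C^3*\<bar>t\<bar> <= e + 4*C^4*e" by simp
 have "1*e <= C^4*e" using Cpow(1)[of 4] e0 by (rule mult_right_mono)
 moreover have "5*C^4*e <= L*e" using C_le_L(3) e0 by (rule mult_right_mono)
 ultimately have "e + 2*C^3*\<bar>t\<bar> <= L*e" using 1 by linarith
 from that[OF t2 t(1) close_mono[OF cs this]] show ?thesis .
qed

text \<open>The crossing times \<open>u s\<close> are only known to lie in a window around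
  \<open>t0\<close>. Uniqueness of the crossing identifies \<open>u s\<close> with the one that
  \<open>resync_near\<close> finds close to \<open>u s0\<close>, and this gives continuity.\<close>

lemma hit_continuous_at:
 assumes u: "!!s. s \<in> K ==> hit b \<gamma> (sh (g s) (u s))" "!!s. s \<in> K ==> \<bar>u s - t0\<bar> <= 3/2*T"
  and s0: "s0 \<in> K" "gconv g (g s0) (at s0 within K)" and e: "0 < e"
 shows "eventually (%s. nz b (sh (g s0) (u s0)) (sh (g s) (u s)) <= e) (at s0 within K)"
proof -
 let ?h = "sh (g s0) (u s0)"
 note h0 = u(1)[OF s0(1)]
 have h: "b \<in> B" "?h 0 \<in> inn (5/4) b" "\<gamma> 0 \<in> inn 1 b" using h0 near_inn[of b \<gamma> ?h 2] by (auto simp: hit_def)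
 define e' where "e' = min (d0/L) (e/L)"
 have e': "0 < e'" "L*e' <= d0" "L*e' <= e"
 proof -
  show "0 < e'" using d0 e L1 by (auto simp: e'_def)
  have le: "e' <= d0/L" "e' <= e/L" by (simp_all add: e'_def)
  have "L*e' <= L*(d0/L)" "L*e' <= L*(e/L)" using mult_left_mono[OF le(1), of L] mult_left_mono[OF le(2), of L] L1 by linarith+
  moreover have "L*(d0/L) = d0" "L*(e/L) = e" using L1 by auto
  ultimately show "L*e' <= d0" "L*e' <= e" by simp_all
 qed
 have "eventually (%s. close b e' ?h (sh (g s) (u s0)) & sh (g s) (u s0) 0 \<in> inn (5/4 + 1/2) b) (at s0 within K)"
  by (rule gconvD[OF gconv_sh[OF s0(2)] h(1,2) _ e'(1)]) simp
 moreover have "eventually (%s. s \<in> K) (at s0 within K)" by (simp add: eventually_at_filter)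
 ultimately show ?thesis
 proof (rule eventually_elim2)
  fix s assume c: "close b e' ?h (sh (g s) (u s0)) & sh (g s) (u s0) 0 \<in> inn (5/4 + 1/2) b" and s: "s \<in> K"
  obtain t where t: "\<bar>t\<bar> <= 2*(C*e')" "Th b \<gamma> (sh (sh (g s) (u s0)) t) = 0" "close b (L*e') ?h (sh (sh (g s) (u s0)) t)"
   using resync_near[OF h0 conjunct1[OF c] e'(2)] by metis
  have "C*e' <= L*e'" using C_le_L(1) e'(1) by (intro mult_right_mono) auto
  hence tt: "\<bar>t\<bar> <= T" using t(1) e' d0_le(1)[of d0] tau_pos by linarith
  have "u s0 + t = u s"
  proof (rule hit_unique[OF u(1)[OF s]])
   show "Th b \<gamma> (sh (g s) (u s0 + t)) = 0" using t(2) by simp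
   show "\<bar>u s0 + t - u s\<bar> <= 4*T" using tt u(2)[OF s] u(2)[OF s0(1)] by linarith
  qed
  thus "nz b ?h (sh (g s) (u s)) <= e" using closeD(6)[OF t(3)] e'(3) by simp
 qed
qed

lemma hit_continuous:
 assumes u: "!!s. s \<in> K ==> hit b \<gamma> (sh (g s) (u s))" "!!s. s \<in> K ==> \<bar>u s - t0\<bar> <= 3/2*T"
  and g: "!!s. s \<in> K ==> gconv g (g s) (at s within K)"
 shows "continuous_on K (%s. J b \<gamma> (sh (g s) (u s)))" "continuous_on K (%s. nz b \<gamma> (sh (g s) (u s)))"
proof -
 have 1: "((%s. J b \<gamma> (sh (g s) (u s))) \<longlongrightarrow> J b \<gamma> (sh (g s0) (u s0))) (at s0 within K)"
  "((%s. nz b \<gamma> (sh (g s) (u s))) \<longlongrightarrow> nz b \<gamma> (sh (g s0) (u s0))) (at s0 within K)" if s0: "s0 \<in> K" for s0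
 proof (rule_tac [!] tendstoI)
  fix e :: real assume e: "0 < e"
  hence "0 < e/(2*C)" using C1 by simp
  from hit_continuous_at[OF u s0 g[OF s0] this]
  show "eventually (%s. dist (J b \<gamma> (sh (g s) (u s))) (J b \<gamma> (sh (g s0) (u s0))) < e) (at s0 within K)"
  proof (rule eventually_mono)
   fix s assume s: "nz b (sh (g s0) (u s0)) (sh (g s) (u s)) <= e/(2*C)"
   have h: "G \<gamma>" "b \<in> B" "\<gamma> 0 \<in> inn 1 b" using u(1)[OF s0] by (auto simp: hit_def)
   have "C*nz b (sh (g s0) (u s0)) (sh (g s) (u s)) <= C*(e/(2*C))" using s C1 by (intro mult_left_mono) auto
   also have "... < e" using C1 e by simp
   finally show "dist (J b \<gamma> (sh (g s) (u s))) (J b \<gamma> (sh (g s0) (u s0))) < e"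
    using Th_diff(2)[OF h, of "sh (g s) (u s)" "sh (g s0) (u s0)"] by (simp add: dist_real_def)
  qed
  have "0 < e/2" using e by simp
  from hit_continuous_at[OF u s0 g[OF s0] this]
  show "eventually (%s. dist (nz b \<gamma> (sh (g s) (u s))) (nz b \<gamma> (sh (g s0) (u s0))) < e) (at s0 within K)"
  proof (rule eventually_mono)
   fix s assume s: "nz b (sh (g s0) (u s0)) (sh (g s) (u s)) <= e/2"
   thus "dist (nz b \<gamma> (sh (g s) (u s))) (nz b \<gamma> (sh (g s0) (u s0))) < e"
    using Dz_triangle[of b \<gamma> "sh (g s) (u s)" "sh (g s0) (u s0)"] Dz_triangle[of b \<gamma> "sh (g s0) (u s0)" "sh (g s) (u s)"] e
     Dz_sym[of b "sh (g s0) (u s0)" "sh (g s) (u s)"] by (simp add: dist_real_def)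
  qed
 qed
 thus "continuous_on K (%s. J b \<gamma> (sh (g s) (u s)))" "continuous_on K (%s. nz b \<gamma> (sh (g s) (u s)))"
  by (auto simp: continuous_on_def)
qed

text \<open>On the normal of \<open>g\<close> the signed distance \<open>J\<close> is a coordinate,
  since area form and inner product with the unit velocity together determine a vector.\<close>

lemma hits_meet:
 assumes h: "hit b g h" "hit b g \<zeta>" and J: "J b g h = J b g \<zeta>" shows "h 0 = \<zeta> 0"
proof -
 have b: "b \<in> B" and g: "G g" "g 0 \<in> inn 1 b" and i: "h 0 \<in> inn 2 b" "\<zeta> 0 \<in> inn 2 b" using h by (auto simp: hit_def)
 have K: "xx b g 0 \<in> Kb b" using inn_K[OF b g(2)] by simp
 let ?w = "(xx b h 0 - xx b g 0) - (xx b \<zeta> 0 - xx b g 0)"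
 have cl: "cross u (x - y) = cross u x - cross u y" for u x y by (simp add: cross_def algebra_simps)
 have "vol (bch b) (xx b g 0) * cross (vv b g 0) ?w = 0" using J unfolding J_def cl right_diff_distrib by linarith
 moreover have "ip (bch b) (xx b g 0) (vv b g 0) ?w = 0" using h unfolding ip_lin(4) hit_def Th_def by linarith
 ultimately have "norm ?w <= 0" using unit_bounds(4)[OF b K geo_unit[OF g(1) b g(2)], of ?w]
  by (simp only: abs_zero add_0_left mult_zero_right)
 hence "xx b h 0 = xx b \<zeta> 0" by simp
 thus ?thesis using chart_inj[OF bA[OF b]] inn_dom[OF i(1)] inn_dom[OF i(2)] by (auto simp: inj_on_def)
qed

end

text \<open>If the component \<open>E\<close> stayed strictly below level \<open>e\<close>, the
  Sura-Bura theorem would give a clopen neighbourhood of it in the sublevel set on which still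
  \<open>f < e\<close>. That neighbourhood is clopen in all of \<open>Q\<close>, hence equal to
  \<open>Q\<close>.\<close>

lemma boundary_bumping:
 fixes Q :: "'s::euclidean_space set" and f :: "'s => real"
 assumes Q: "compact Q" "connected Q" and f: "continuous_on Q f" and y: "y \<in> Q" "f y <= e"
 defines "E \<equiv> connected_component_set {s \<in> Q. f s <= e} y"
 shows "compact E" "connected E" "y \<in> E" "E <= Q" "!!s. s \<in> E ==> f s <= e" "E = Q \<or> (EX s:E. f s = e)"
proof -
 let ?A = "top_of_set Q"
 define A where "A = {s \<in> Q. f s <= e}"
 have "closedin (?A) (Q \<inter> f -` {..e})" by (rule continuous_closedin_preimage[OF f]) simp
 moreover have "Q \<inter> f -` {..e} = A" by (auto simp: A_def)
 ultimately have A: "compact A" using Q(1) closedin_compact by metis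
 have yA: "y \<in> A" using y by (simp add: A_def)
 have EA: "E <= A" unfolding E_def A_def[symmetric] by (rule connected_component_subset)
 show E: "compact E" "connected E" "y \<in> E"
 proof -
  have "E \<in> components A" unfolding E_def A_def[symmetric] using yA by (auto simp: components_def)
  thus "compact E" using A compact_components by blast
  show "connected E" "y \<in> E" unfolding E_def A_def[symmetric] using yA by simp_all
 qed
 show EQ: "E <= Q" "!!s. s \<in> E ==> f s <= e" using EA by (auto simp: A_def)
 show "E = Q \<or> (EX s:E. f s = e)"
 proof (rule disjCI)
  assume n: "\<not> (EX s:E. f s = e)"
  have lt: "f s < e" if "s \<in> E" for s using EQ(2)[OF that] n that by force
  have "openin (top_of_set A) (A \<inter> f -` {..<e})"
   by (rule continuous_openin_preimage_gen) (auto intro: continuous_on_subset[OF f] simp: A_def)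
  moreover have "E <= A \<inter> f -` {..<e}" using lt EA by auto
  moreover have "E \<in> components A" unfolding E_def A_def[symmetric] using yA by (auto simp: components_def)
  ultimately obtain W where W: "openin (top_of_set A) W" "compact W" "E <= W" "W <= A \<inter> f -` {..<e}"
   using Sura_Bura_clopen_subset_alt[OF closed_imp_locally_compact[OF compact_imp_closed[OF A]] _ E(1)] by metis
  obtain O' where O': "open O'" "W = A \<inter> O'" using W(1) by (auto simp: openin_open)
  have "openin (?A) (Q \<inter> f -` {..<e})" by (rule continuous_openin_preimage_gen[OF f]) simp
  hence "openin (?A) ((Q \<inter> f -` {..<e}) \<inter> (Q \<inter> O'))" using openin_open_Int[OF O'(1), of Q] by (rule openin_Int)
  moreover have "(Q \<inter> f -` {..<e}) \<inter> (Q \<inter> O') = W" using O'(2) W(4) by (auto simp: A_def)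
  ultimately have "openin (?A) W" by simp
  moreover have "closedin (?A) W" using W(2,4) by (intro closed_subset compact_imp_closed) (auto simp: A_def)
  moreover have "W ~= {}" using W(3) E(3) by auto
  ultimately have "W = Q" using Q(2) unfolding connected_clopen by blast
  hence "A = Q" using W(4) by (auto simp: A_def)
  thus "E = Q" unfolding E_def A_def[symmetric] using Q(2) yA connected_component_eq_self by metis
 qed
qed

section \<open>Self-returns, and the scales of the nested construction\<close>

context tracking begin

text \<open>Equal tangent lines mean equal or opposite velocities. Equal ones give a period by
  \<open>geo_unique\<close>. Opposite ones would make the geodesic retrace itself, and at the
  midpoint between \<open>t1\<close> and \<open>t2\<close> its velocity would be its own
  negative.\<close>

lemma simple_return:
 assumes s: "SG g" and eq: "g t1 = g t2" and ne: "t1 ~= t2"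
 shows "sh g (t2 - t1) = g"
proof -
 let ?A = "t1 + t2" and ?B = "sh g t2" and ?D = "sh g t1"
 have g: "G g" and l: "line_of (vel g t1) = line_of (vel g t2)"
  using s eq unfolding simple_complete_geodesic_def by blast+
 note b = bx[OF geo_top[OF g]]
 let ?b = "bx (g t1)" and ?v = "vel g"
 have "?v t2 \<in> line_of (?v t2)" unfolding line_of_def by (auto intro!: exI[of _ 1])
 hence "?v t2 \<in> line_of (?v t1)" using l by simp
 then obtain r where "?v t2 = (%c. r *\<^sub>R ?v t1 c)" unfolding line_of_def by (elim CollectE exE conjE)
 hence r: "?v t2 c = r *\<^sub>R ?v t1 c" for c by (rule fun_cong)
 have "ip (bch ?b) (xx ?b g t2) (vv ?b g t2) (vv ?b g t2) = 1"
  by (rule geo_unit[OF g b(1)]) (use b(2)[of t2] eq in simp)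
 moreover have "ip (bch ?b) (xx ?b g t1) (vv ?b g t1) (vv ?b g t1) = 1" by (rule geo_unit[OF g b])
 ultimately have "r*r = 1" using eq by (simp add: r)
 hence r1: "r = 1 \<or> r = - 1" by (simp add: square_eq_1_iff)
 have i: "g t1 \<in> inn 2 ?b" "g t2 \<in> inn 2 ?b" using inn_le[OF b[of t1], of 2] eq by simp_all
 show ?thesis
 proof (cases "r = 1")
  case True
  have "close ?b 0 ?D ?B"
   using b(1) i g eq True by (simp add: close_def geodesic_sh sh_apply Dz_def r zero_prod_def)
  hence "sh g t1 = sh g t2" by (rule geo_unique)
  hence "sh ?D (- t1) = sh ?B (- t1)" by simp
  thus ?thesis by simp
 next
  case False
  hence r: "?v t2 c = - ?v t1 c" for c using r[of c] r1 by simp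
  have g2: "G ?D" "G ?B" "G (rv ?B)" using g by (auto intro: geodesic_sh geodesic_rv)
  have "vel (rv ?B) 0 c = vel ?D 0 c" for c
   using geodesic_rv(2)[OF g2(2), of 0 c] geodesic_sh(2)[OF g, of t2 0] geodesic_sh(2)[OF g, of t1 0] r by simp
  hence "close ?b 0 ?D (rv ?B)"
   using b(1) i eq g2 by (simp add: close_def sh_apply Dz_def zero_prod_def)
  hence e: "sh g t1 = rv ?B" by (rule geo_unique)
  define h where "h = (t2 - t1)/2"
  have m: "t1 + h = ?A/2" "h + t1 = ?A/2" "- h + t2 = ?A/2" by (simp_all add: h_def field_simps)
  have "vel ?D h c = vel (rv ?B) h c" for c unfolding e ..
  hence "?v (?A/2) c = - ?v (?A/2) c" for c
   unfolding geodesic_rv(2)[OF g2(2)] geodesic_sh(2)[OF g] m by simp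
  hence z: "?v (?A/2) c = 0" for c using real_vector.scale_left_imp_eq[of _ 1 "- 1"]
   by (metis eq_neg_iff_add_eq_0 scaleR_2 scaleR_eq_0_iff zero_neq_numeral)
  have "ip (bch (bx (g (?A/2)))) (xx (bx (g (?A/2))) g (?A/2)) 0 0 = 1"
   using geo_unit[OF g b[of "?A/2"]] unfolding z .
  thus ?thesis by simp
 qed
qed

text \<open>\<open>dl\<close> is the normal distance that counts as separation. \<open>e1\<close> is
  the width given to the next subcontinuum, so small that its geodesics are not separated from each
  other at that time. \<open>GG\<close> is a number of steps in which a growing offset
  \<open>e1\<close> reaches \<open>dl\<close>, and \<open>d1\<close> an initial offset that cannot
  reach \<open>dl\<close> within \<open>GG + 1\<close> steps.\<close>

definition dl :: real where "dl = c*d0/(64*L^4)"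
definition e1 :: real where "e1 = dl/(64*L^6)"
definition GG :: nat where "GG = nat \<lceil>dl/(c*(c*e1)/L)\<rceil>"
definition d1 :: real where "d1 = dl/(2*L^(GG + 3))"

lemma Lpow: "1 <= L ^ n" "L ~= 0" "0 < L" using L1 one_le_power[OF L1] by auto

lemma small_dl: "small dl"
 using c d0(1) Lpow(3) by (simp add: small_def dl_def)

lemmas dl = small[OF small_dl]

lemma e1: "0 < e1" "64*(L^6*e1) = dl" "64*(L*e1) <= dl" "e1 <= dl" "64*(L^2*e1) <= dl" "64*(L^4*e1) <= dl"
proof -
 show 1: "0 < e1" using dl(1) Lpow(3) by (simp add: e1_def)
 show 2: "64*(L^6*e1) = dl" using Lpow(2) by (simp add: e1_def)
 have "L^n*e1 <= L^6*e1" if "n <= 6" for n using 1 L1 that by (intro mult_right_mono power_increasing) auto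
 from this[of 0] this[of 1] this[of 2] this[of 4]
 have le: "e1 <= L^6*e1" "L*e1 <= L^6*e1" "L^2*e1 <= L^6*e1" "L^4*e1 <= L^6*e1" by auto
 have "64*x <= dl" if "x <= L^6*e1" for x using that 2 by linarith
 from this[OF le(1)] this[OF le(2)] this[OF le(3)] this[OF le(4)] 1
 show "64*(L*e1) <= dl" "e1 <= dl" "64*(L^2*e1) <= dl" "64*(L^4*e1) <= dl" by simp_all
qed

lemma GG: "dl <= real GG*(c*(c*e1)/L)"
proof -
 have "0 < c*(c*e1)/L" using c e1(1) Lpow(3) by simp
 moreover have "dl/(c*(c*e1)/L) <= real GG" unfolding GG_def by linarith
 ultimately show ?thesis by (simp only: pos_divide_le_eq)
qed

lemma d1: "0 < d1" "d1 <= dl" "j <= GG + 2 ==> L*(L^j*d1) < dl"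
proof -
 have p: "0 < 2*L^(GG + 3)" using Lpow(3) by simp
 show 0: "0 < d1" unfolding d1_def using dl(1) p by (rule divide_pos_pos)
 have *: "2*L^(GG + 3)*d1 = dl" unfolding d1_def times_divide_eq_right using p by (intro nonzero_mult_div_cancel_left) linarith
 have "1*d1 <= 2*L^(GG + 3)*d1" using 0 Lpow(1)[of "GG + 3"] by (intro mult_right_mono) auto
 thus "d1 <= dl" using*by simp
 assume "j <= GG + 2"
 hence "L ^ Suc j <= L ^ (GG + 3)" using L1 by (intro power_increasing) auto
 also have "... < 2*L^(GG + 3)" using Lpow(1)[of "GG + 3"] by linarith
 finally have "L ^ Suc j*d1 < 2*L^(GG + 3)*d1" using 0 by (intro mult_strict_right_mono)
 thus "L*(L^j*d1) < dl" using*by (simp add: mult.assoc)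
qed

lemma trk_mono: "trk g h e d t ==> d <= d' ==> e <= e' ==> trk g h e' d' t"
 unfolding trk_def by (meson order_trans)

text \<open>A step multiplies the offset by at most \<open>L\<close>, and the passage from offset to
  normal distance costs one more factor; this explains the exponent in \<open>d1\<close>.\<close>

lemma early:
 assumes t: "trk g h (T / 16) d1 0" and j: "j <= GG + 1"
 shows "DD g h (real j*T) < dl"
 using j
proof (induction j rule: less_induct)
 case (less j)
 have t0: "trk g h (T / 16) dl 0" using trk_mono[OF t d1(2)] by simp
 have D: "DD g h (real i*T) < dl" if "i < j" for i using less that by simp
 have T1: "trk g h (T / 8) (\<kappa> dl) (real j*T)" by (rule track(1)[OF small_dl t0 D order_refl])
 have T3: "MM g h (real (i + 1)*T) <= L*MM g h (real i*T)" if "i < j" for i by (rule track(3)[OF small_dl t0 D that])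
 have M: "i <= j ==> MM g h (real i*T) <= L ^ i*d1" for i
 proof (induction i)
  case 0
  have "T / 16 <= 2*T" "d1 <= d0" using tau_pos d1(2) dl(2,3) by auto
  from trkD(3)[OF t this] show ?case by simp
 next
  case (Suc i)
  have "MM g h (real (Suc i)*T) <= L*MM g h (real i*T)" using T3[of i] Suc.prems by simp
  also have "... <= L*(L ^ i*d1)" using Suc L1 by (intro mult_left_mono) auto
  finally show ?case by (simp add: mult.assoc)
 qed
 have "T / 8 <= 2*T" using tau_pos by simp
 from trkD(6)[OF T1 this dl(3)] have "DD g h (real j*T) <= L*MM g h (real j*T)" .
 also have "... <= L*(L ^ j*d1)" using M[of j] L1 by (intro mult_left_mono) auto
 also have "... < dl" using less.prems by (intro d1(3)) simp
 finally show ?case .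
qed

text \<open>An offset \<open>e1\<close> at time \<open>n\<close> is amplified in one time direction,
  and \<open>GG\<close> further steps bring it to \<open>dl\<close>. The hypothesis
  \<open>GG + 1 <= n\<close> provides the room for growth backwards. If nothing has separated before
  time \<open>n\<close>, the index \<open>j\<close> lies between \<open>n\<close> and
  \<open>n + GG + 1\<close>.\<close>

lemma gap:
 assumes t: "trk g h (T / 16) d1 0" and n: "GG + 1 <= n" and m: "e1 <= MM g h (real n*T)"
 shows "EX j<n + GG + 2. dl <= DD g h (real j*T)"
proof (rule ccontr)
 let ?A = "real n*T"
 assume "\<not> ?thesis"
 hence D: "DD g h (real j*T) < dl" if "j < n + GG + 2" for j using that by force
 have t0: "trk g h (T / 16) dl 0" using trk_mono[OF t d1(2)] by simp
 note T = track[OF small_dl t0 D]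
 have k8: "T / 8 <= 2*T" using tau_pos by simp
 interpret q: separation_sequence "%j. DD g h (real j*T)" "%j. MM g h (real j*T)" "n + GG + 2" L c
 proof
  show "DD g h (real j*T) <= L*MM g h (real j*T)" if "j <= n + GG + 2" for j
   by (rule trkD(6)[OF T(1)[OF _ that] k8 dl(3)])
 qed (use c L1 DD_nonneg MM_nonneg T(2) in auto)
 have "DD g h ?A + c*MM g h ?A <= max (DD g h (real (n + 1)*T)) (DD g h (real (n - 1)*T))"
  using n by (intro q.conv) auto
 then consider "DD g h ?A + c*MM g h ?A <= DD g h (real (n + 1)*T)"
  | "DD g h ?A + c*MM g h ?A <= DD g h (real (n - 1)*T)" by linarith
 thus False
 proof cases
  case 1
  have "real GG*(c*(c*e1)/L) <= DD g h (real (n + 1 + GG)*T)"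
   by (rule q.grow_forward[OF 1 _ m]) (use e1(1) in auto)
  thus False using D[of "n + 1 + GG"] GG by simp
 next
  case 2
  have "real GG*(c*(c*e1)/L) <= DD g h (real (n - 1 - GG)*T)"
   by (rule q.grow_backward[OF 2 _ _ m]) (use n e1(1) in auto)
  moreover have "n - 1 - GG < n + GG + 2" by simp
  ultimately show False using D[of "n - 1 - GG"] GG by linarith
 qed
qed

text \<open>Two geodesics within \<open>e1\<close> of a third are not separated from each other. In
  \<open>next_state\<close> this excludes a further separation at the same time, so that separation
  times strictly increase.\<close>

lemma merge:
 assumes "trk g h (T / 8) e1 t" "trk g \<zeta> (T / 8) e1 t"
 shows "DD h \<zeta> t < dl"
proof -
 let ?A = "e1 + e1"
 obtain u where u: "\<bar>u - t\<bar> <= T / 8" "sync (sh g t) (sh h u)" "mm (sh g t) (sh h u) <= e1" using assms(1) by (auto simp: trk_def)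
 obtain v where v: "\<bar>v - t\<bar> <= T / 8" "sync (sh g t) (sh \<zeta> v)" "mm (sh g t) (sh \<zeta> v) <= e1" using assms(2) by (auto simp: trk_def)
 let ?b = "bx (sh g t 0)"
 have cl: "close ?b ?A (sh h u) (sh \<zeta> v)"
  by (rule close_trans[OF close_sym[OF sync_close[OF u(2,3)]] sync_close[OF v(2,3)]])
 \<comment> \<open>One factor \<open>L\<close> is spent on transporting the pair to time
   \<open>t\<close>, the second on passing from the offset to the normal distance.\<close>
 have e: "e1 + e1 <= d0" "L*?A <= T / 64" "L*(L*?A) < dl" "L*?A <= d0"
 proof -
  have eL: "e1 <= L*e1" using L1 e1(1) by simp
  show 1: "e1 + e1 <= d0" using eL e1(3) e1(1) dl(2,3) by linarith
  thus "L*?A <= T / 64" by (rule d0_le(3))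
  have "L*(L*?A) = 2*(L^2*e1)" by (simp add: power2_eq_square algebra_simps)
  thus "L*(L*?A) < dl" using e1(5) dl(1) by linarith
  have "L*?A = 2*(L*e1)" by simp
  thus "L*?A <= d0" using e1(3) dl(1,2,3) by linarith
 qed
 have "\<bar>t - u\<bar> <= 3*T" using u(1) tau_pos by linarith
 from trans[OF close_mono[OF cl e(1)] this] obtain w where
  w: "\<bar>w - (t - u)\<bar> <= L*nz ?b (sh h u) (sh \<zeta> v)" "sync (sh (sh h u) (t - u)) (sh (sh \<zeta> v) w)"
   "mm (sh (sh h u) (t - u)) (sh (sh \<zeta> v) w) <= L*nz ?b (sh h u) (sh \<zeta> v)" by blast
 have le: "L*nz ?b (sh h u) (sh \<zeta> v) <= L*?A" using closeD(6)[OF cl] L1 by (intro mult_left_mono) auto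
 have w2: "sync (sh h t) (sh \<zeta> (v + w))" "mm (sh h t) (sh \<zeta> (v + w)) <= L*?A" using w(2,3) le by auto
 have "U h \<zeta> t = v + w"
  by (rule U_eq[OF _ w2(1)]) (use w(1) le e u(1) v(1) w2(2) tau_pos in linarith)+
 hence "DD h \<zeta> t <= L*mm (sh h t) (sh \<zeta> (v + w))" using jjL[of "sh h t"] w2(1) by (simp add: DD_def sync_def)
 also have "... <= L*(L*?A)" using w2(2) L1 by (intro mult_left_mono) auto
 finally show ?thesis using e(3) by linarith
qed

text \<open>Unit tangent vectors, read in the chosen boxes, lie in a compact set. Finitely many
  balls of radius \<open>e1/2\<close> cover it; a cell is a box together with such a ball.\<close>

lemma pigeonhole:
 "EX N::nat. ALL Y. (ALL i<=N. G (Y i)) --> (EX i j. i < j & j <= N & bx (Y i 0) = bx (Y j 0) & nz (bx (Y j 0)) (Y j) (Y i) <= e1)"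
proof -
 define P where "P = (\<Union>b\<in>B. Kb b) \<times> cball (0::real^2) C"
 have "compact P" unfolding P_def using finB by (intro compact_Times compact_UN Kb_compact) auto
 hence "EX F. finite F & F <= P & P <= (\<Union>x\<in>F. ball x (e1/2))"
  using compactE_image[of P P "%x. ball x (e1/2)"] e1(1)
  by (metis (no_types, lifting) UN_I centre_in_ball half_gt_zero open_ball subsetI)
 then obtain F where F: "finite F" "P <= (\<Union>x\<in>F. ball x (e1/2))" by auto
 define z where "z Y = (xx (bx (Y 0)) Y 0, vv (bx (Y 0)) Y 0)" for Y :: "real => 'a"
 define r where "r Y = (bx (Y 0), SOME x. x \<in> F & z Y \<in> ball x (e1/2))" for Y :: "real => 'a"
 have zr: "snd (r Y) \<in> F & z Y \<in> ball (snd (r Y)) (e1/2)" "fst (r Y) \<in> B" if "G Y" for Y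
 proof -
  note b = bx[OF geo_top[OF that, of 0]]
  have "z Y \<in> P" using b inn_K[OF b] speed[OF that b] by (auto simp: z_def P_def)
  hence "EX x. x \<in> F & z Y \<in> ball x (e1/2)" using F(2) by (meson UN_E subsetD)
  from someI_ex[OF this] show "snd (r Y) \<in> F & z Y \<in> ball (snd (r Y)) (e1/2)" by (simp add: r_def)
  show "fst (r Y) \<in> B" using b by (simp add: r_def)
 qed
 show ?thesis
 proof (rule exI[of _ "card (B \<times> F)"], intro allI impI)
  fix Y :: "nat => real => 'a" assume Y: "ALL i<=card (B \<times> F). G (Y i)"
  have "(%i. r (Y i)) ` {..card (B \<times> F)} <= B \<times> F" using zr Y by (intro image_subsetI) (simp only: mem_Times_iff atMost_iff)
  hence "card ((%i. r (Y i)) ` {..card (B \<times> F)}) <= card (B \<times> F)" using F(1) finB by (intro card_mono) auto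
  hence "\<not> inj_on (%i. r (Y i)) {..card (B \<times> F)}" by (intro pigeonhole) simp
  then obtain i j where ij: "i <= card (B \<times> F)" "j <= card (B \<times> F)" "i ~= j" "r (Y i) = r (Y j)" by (auto simp: inj_on_def)
  have main: "bx (Y i 0) = bx (Y j 0) & nz (bx (Y j 0)) (Y j) (Y i) <= e1"
   if ij: "i <= card (B \<times> F)" "j <= card (B \<times> F)" "r (Y i) = r (Y j)" for i j
  proof
   show b: "bx (Y i 0) = bx (Y j 0)" using ij(3) by (simp add: r_def)
   have "dist (z (Y i)) (z (Y j)) <= e1"
    using zr(1)[of "Y i"] zr(1)[of "Y j"] Y ij dist_triangle_half_l[of "z (Y i)" "snd (r (Y j))" e1 "z (Y j)"]
    by (auto simp: dist_commute intro: less_imp_le)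
   moreover have "Dz (bx (Y j 0)) (Y j) (Y i) = z (Y i) - z (Y j)" by (simp add: Dz_def z_def b)
   ultimately show "nz (bx (Y j 0)) (Y j) (Y i) <= e1" by (simp add: dist_norm)
  qed
  show "EX i j. i < j & j <= card (B \<times> F) & bx (Y i 0) = bx (Y j 0) & nz (bx (Y j 0)) (Y j) (Y i) <= e1"
  proof (cases "i < j")
   case True
   thus ?thesis using main[OF ij(1,2,4)] ij(2) by (intro exI[of _ i] exI[of _ j] conjI) simp_all
  next
   case False
   thus ?thesis using main[OF ij(2,1) ij(4)[symmetric]] ij(1,3) by (intro exI[of _ j] exI[of _ i] conjI) simp_all
  qed
 qed
qed

text \<open>Independent of any family of geodesics, so that the bound \<open>R0\<close> on periods
  is the same for all continua.\<close>

definition NN :: nat where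
 "NN = (SOME N. ALL Y. (ALL i<=N. complete_geodesic M (Y i)) --> (EX i j. i < j & j <= N & bx (Y i 0) = bx (Y j 0) & nz (bx (Y j 0)) (Y j) (Y i) <= e1))"

lemma NN: assumes "!!i. i <= NN ==> complete_geodesic M (Y i)"
 obtains i j where "i < j" "j <= NN" "bx (Y i 0) = bx (Y j 0)" "nz (bx (Y j 0)) (Y j) (Y i) <= e1"
 using someI_ex[OF pigeonhole, folded NN_def] assms by blast

end

lemma (in tracking) gconv_mono: "gconv f g F ==> F' <= F ==> gconv f g F'"
 unfolding gconv_def by (auto intro: filter_leD)

section \<open>Closed geodesics in a continuum\<close>

text \<open>A continuous family of simple geodesics, pairwise so close at time 0 that
  \<open>early\<close> applies to every pair.\<close>

locale geodesic_family = tracking M B C T k L d0 c for M :: "'a surface" and B C T k L d0 c +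
 fixes K :: "'s::euclidean_space set" and g :: "'s => real => 'a"
 assumes simple: "!!s. s \<in> K ==> SG (g s)"
  and conv: "!!s. s \<in> K ==> gconv g (g s) (at s within K)"
  and trk0: "!!s s'. s \<in> K ==> s' \<in> K ==> trk (g s) (g s') (T / 16) d1 0"
begin

abbreviation Utn where "Utn n s s' \<equiv> U (g s) (g s') (real n*T)"
abbreviation Dn where "Dn n s s' \<equiv> DD (g s) (g s') (real n*T)"
abbreviation Mn where "Mn n s s' \<equiv> MM (g s) (g s') (real n*T)"
abbreviation bn where "bn n s \<equiv> bx (g s (real n*T))"
abbreviation Jn where "Jn n s s' \<equiv> J (bn n s) (sh (g s) (real n*T)) (sh (g s') (Utn n s s'))"

definition sepd :: "nat => 's set => bool" where "sepd n Q \<longleftrightarrow> (EX s:Q. EX s':Q. dl <= Dn n s s')"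

lemma Gg: "s \<in> K ==> G (g s)"
 using simple by (simp add: simple_complete_geodesic_def)

lemma tracked:
 assumes Q: "Q <= K" "ALL j<n. \<not> sepd j Q" and s: "s \<in> Q" "s' \<in> Q"
 shows "trk (g s) (g s') (T / 8) (\<kappa> dl) (real n*T)" "\<bar>Utn n s s' - real n*T\<bar> <= T / 8"
  "sync (sh (g s) (real n*T)) (sh (g s') (Utn n s s'))" "Mn n s s' <= \<kappa> dl" "Dn n s s' <= L*Mn n s s'"
  "hit (bn n s) (sh (g s) (real n*T)) (sh (g s') (Utn n s s'))"
proof -
 let ?A = "real n*T"
 have t: "trk (g s) (g s') (T / 16) dl 0" using trk_mono[OF trk0 d1(2)] s Q(1) by blast
 have "DD (g s) (g s') (real j*T) < dl" if "j < n" for j using Q(2)[rule_format, OF that] s unfolding sepd_def by force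
 thus 1: "trk (g s) (g s') (T / 8) (\<kappa> dl) ?A" by (rule track(1)[OF small_dl t _ order_refl])
 have "T / 8 <= 2*T" using tau_pos by simp
 note T = trkD[OF 1 this dl(3)]
 show "\<bar>Utn n s s' - real n*T\<bar> <= T / 8" "sync (sh (g s) ?A) (sh (g s') (Utn n s s'))" "Mn n s s' <= \<kappa> dl" "Dn n s s' <= L*Mn n s s'"
  by (fact T)+
 have "mm (sh (g s) ?A) (sh (g s') (Utn n s s')) <= d0" using T(3) dl(3) by (simp add: MM_def)
 from sync_hit[OF T(2) this] show "hit (bn n s) (sh (g s) ?A) (sh (g s') (Utn n s s'))" by (simp add: sh_apply)
qed

lemma Jn_abs: "\<bar>Jn n s s'\<bar> = Dn n s s'"
 by (simp add: DD_def jj_def sh_apply)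

lemma Mn_norm: "nz (bn n s) (sh (g s) (real n*T)) (sh (g s') (Utn n s s')) = Mn n s s'"
 by (simp add: MM_def mm_def sh_apply)

lemma self: assumes "s \<in> K" shows "Utn n s s = real n*T" "Jn n s s = 0" "Mn n s s = 0"
proof -
 let ?A = "sh (g s) (real n*T)"
 have gs: "G ?A" using Gg[OF assms] by (rule geodesic_sh)
 note b = bx[OF geo_top[OF gs, of 0]]
 show u: "Utn n s s = real n*T"
 proof (rule U_eq)
  show "sync ?A ?A" using gs b inn_le[OF b, of 2] by (simp add: sync_def Th_def)
  show "mm ?A ?A <= d0" using d0(1) by (simp add: mm_def Dz_def zero_prod_def[symmetric])
 qed (use tau_pos in simp)
 show "Jn n s s = 0" "Mn n s s = 0" unfolding u MM_def by (simp_all add: J_def cross_def mm_def Dz_def zero_prod_def[symmetric])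
qed

lemma conv_on: "Q <= K ==> s \<in> Q ==> gconv g (g s) (at s within Q)"
 using gconv_mono[OF conv at_le] by blast

lemma cont:
 assumes Q: "Q <= K" "ALL j<n. \<not> sepd j Q" and s: "s \<in> Q"
 shows "continuous_on Q (Jn n s)" "continuous_on Q (Mn n s)"
proof -
 have t: "\<bar>Utn n s s' - real n*T\<bar> <= 3/2*T" if "s' \<in> Q" for s' using tracked(2)[OF Q s that] tau_pos by linarith
 show "continuous_on Q (Jn n s)" by (rule hit_continuous(1)[OF tracked(6)[OF Q s] t conv_on[OF Q(1)]])
 have "continuous_on Q (%s'. nz (bn n s) (sh (g s) (real n*T)) (sh (g s') (Utn n s s')))"
  by (rule hit_continuous(2)[OF tracked(6)[OF Q s] t conv_on[OF Q(1)]])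
 thus "continuous_on Q (Mn n s)" unfolding Mn_norm .
qed

text \<open>No two geodesics of \<open>Q\<close> have separated before time \<open>n\<close>. At time \<open>n\<close>, \<open>y\<close> is halfway between the base point \<open>p\<close>
and some \<open>y'\<close>; the next subcontinuum is built around \<open>y\<close>.\<close>

definition state :: "'s set => 's => 's => nat => bool" where
 "state Q p y n \<longleftrightarrow> compact Q & connected Q & Q <= K & p \<in> Q & y \<in> Q & GG + 1 <= n & (ALL j<n. \<not> sepd j Q) &
  (EX \<sigma> y'. \<bar>\<sigma>\<bar> = 1 & y' \<in> Q & dl <= \<sigma> * Jn n p y' & \<sigma> * Jn n p y = dl/2)"

lemma connected_ivt:
 fixes f :: "'s => real"
 assumes "connected Q" "continuous_on Q f" "x \<in> Q" "y \<in> Q" "f x <= e" "e <= f y"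
 obtains z where "z \<in> Q" "f z = e"
proof -
 have "{f x..f y} <= f ` Q"
  using connected_continuous_image[OF assms(2,1)] assms(3,4) by (intro connected_contains_Icc) auto
 thus ?thesis using assms(5,6) that by (auto simp: subset_iff image_iff)
qed

text \<open>\<open>n\<close> is the first separation time, and \<open>early\<close> makes it at
  least \<open>GG + 1\<close>. The level \<open>dl/2\<close> for \<open>y\<close> leaves room on
  both sides: on the normal of \<open>p\<close> the family reaches from 0 to \<open>dl\<close>, and
  an earlier passage close to \<open>y\<close> will lie strictly between.\<close>

lemma start:
 assumes Q: "compact Q" "connected Q" "Q <= K" and N: "sepd N Q"
 obtains p y n where "state Q p y n" "n <= N" "sepd n Q"
proof -
 define n where "n = (LEAST n. sepd n Q)"
 have n: "sepd n Q" "n <= N" "ALL j<n. \<not> sepd j Q"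
  unfolding n_def using N by (auto intro: LeastI Least_le dest: not_less_Least)
 obtain p y' where p: "p \<in> Q" "y' \<in> Q" "dl <= Dn n p y'" using n(1) by (auto simp: sepd_def)
 have "GG + 1 <= n"
 proof (rule ccontr)
  assume "\<not> GG + 1 <= n"
  hence "Dn n p y' < dl" using early[OF trk0[of p y'], of n] p Q(3) by auto
  thus False using p(3) by simp
 qed
 moreover define \<sigma> where "\<sigma> = (if 0 <= Jn n p y' then 1 else - 1 :: real)"
 have "\<sigma> * Jn n p y' = \<bar>Jn n p y'\<bar>" by (simp add: \<sigma>_def)
 hence s: "\<bar>\<sigma>\<bar> = 1" "dl <= \<sigma> * Jn n p y'" using p(3) unfolding Jn_abs by (simp_all add: \<sigma>_def)
 have pK: "p \<in> K" using p(1) Q(3) by auto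
 obtain y where y: "y \<in> Q" "\<sigma> * Jn n p y = dl/2"
 proof (rule connected_ivt[OF Q(2) _ p(1,2)])
  show "continuous_on Q (%s. \<sigma> * Jn n p s)" by (intro continuous_intros cont(1)[OF Q(3) n(3) p(1)])
  show "\<sigma> * Jn n p p <= dl/2" "dl/2 <= \<sigma> * Jn n p y'" using self(2)[OF pK] dl(1) s(2) by simp_all
 qed
 ultimately have "state Q p y n" unfolding state_def using Q p n(3) s by blast
 thus ?thesis using that n(1,2) by blast
qed

lemma sepd_mono: "sepd n Q' ==> Q' <= Q ==> sepd n Q"
 unfolding sepd_def by blast

text \<open>\<open>E\<close> is the component around \<open>y\<close> of the parameters still within
  \<open>e1\<close> of \<open>y\<close> at time \<open>n\<close>, and it has width at least
  \<open>e1\<close> there. By \<open>gap\<close> it separates at most \<open>GG + 1\<close> steps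
  after \<open>n\<close>; it cannot do so before \<open>n\<close> because \<open>Q\<close> does not,
  nor at \<open>n\<close> by \<open>merge\<close>.\<close>

lemma next_state:
 assumes st: "state Q p y n"
 obtains Q' p' y' n' where "state Q' p' y' n'" "Q' <= Q" "n < n'" "n' <= n + GG + 1" "!!s. s \<in> Q' ==> Mn n y s <= e1"
proof -
 have Q: "compact Q" "connected Q" "Q <= K" and p: "p \<in> Q" "y \<in> Q" and n: "GG + 1 <= n" "ALL j<n. \<not> sepd j Q"
  and J: "Dn n p y = dl/2"
  using st dl(1) unfolding state_def Jn_abs[symmetric] by (auto simp: abs_if split: if_splits)
 have yK: "y \<in> K" using p Q by auto
 define E where "E = connected_component_set {s \<in> Q. Mn n y s <= e1} y"
 have "Mn n y y <= e1" using self(3)[OF yK] e1(1) by simp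
 note bb = boundary_bumping[OF Q(1,2) cont(2)[OF Q(3) n(2) p(2)] p(2) this, folded E_def]
 have E: "compact E" "connected E" "y \<in> E" "E <= Q" "!!s. s \<in> E ==> Mn n y s <= e1" "E = Q \<or> (EX s:E. Mn n y s = e1)"
  using bb by blast+
 have EK: "E <= K" using E(4) Q(3) by auto
 \<comment> \<open>If \<open>E\<close> is all of \<open>Q\<close> it contains \<open>p\<close>, and
   the normal distance \<open>dl/2\<close> between \<open>p\<close> and \<open>y\<close> forces an
   offset of at least \<open>e1\<close>. Otherwise boundary bumping gives a point with offset
   exactly \<open>e1\<close>.\<close>
 have "EX s:E. EX s':E. e1 <= Mn n s s'"
 proof (cases "E = Q")
  case True
  have "dl/2 <= L*Mn n p y" using tracked(5)[OF Q(3) n(2) p] J by simp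
  moreover have "L*e1 <= dl/2" using e1(3) dl(1) by linarith
  ultimately have "L*e1 <= L*Mn n p y" by linarith
  hence "e1 <= Mn n p y" using Lpow(3) by simp
  thus ?thesis using True p by blast
 next
  case False
  thus ?thesis using E(3,6) by force
 qed
 then obtain s s' where s: "s \<in> E" "s' \<in> E" "e1 <= Mn n s s'" by auto
 from gap[OF trk0 n(1) s(3)] s EK obtain j where j: "j < n + GG + 2" "dl <= Dn j s s'" by auto
 hence "sepd j E" using s by (auto simp: sepd_def)
 from start[OF E(1,2) EK this] obtain p' y' n' where st': "state E p' y' n'" "n' <= j" "sepd n' E" by blast
 have "n' ~= n"
 proof
  assume "n' = n"
  then obtain a b where ab: "a \<in> E" "b \<in> E" "dl <= Dn n a b" using st'(3) by (auto simp: sepd_def)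
  have tr: "trk (g y) (g a) (T / 8) e1 (real n*T)" if "a \<in> E" for a
  proof -
   have aQ: "a \<in> Q" using that E(4) by auto
   show ?thesis unfolding trk_def
    using tracked(2,3)[OF Q(3) n(2) p(2) aQ] E(5)[OF that] by (auto simp: MM_def)
  qed
  show False using merge[OF tr[OF ab(1)] tr[OF ab(2)]] ab(3) by simp
 qed
 moreover have "\<not> n' < n" using n(2) sepd_mono[OF st'(3) E(4)] by auto
 ultimately have "n < n'" by simp
 moreover have "n' <= n + GG + 1" using st'(2) j(1) by simp
 ultimately show ?thesis using that st'(1) E(4,5) by blast
qed

lemma closed_geodesic:
 assumes K: "compact K" "connected K" and N: "sepd N K"
 obtains s t where "s \<in> K" "T / 2 <= t" "t <= (real (NN*(GG + 1)) + 2)*T" "sh (g s) t = g s"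
proof -
 have "EX f. ALL i. (case f i of (Q, p, y, n) => state Q p y n) & (case (f i, f (Suc i)) of ((Q, p, y, n), (Q', p', y', n')) =>
   Q' <= Q & n < n' & n' <= n + GG + 1 & (ALL s:Q'. Mn n y s <= e1))"
 proof (rule dependent_nat_choice)
  obtain p y n where "state K p y n" using start[OF K order_refl N] by blast
  thus "\<exists>x. case x of (Q, p, y, n) \<Rightarrow> state Q p y n" by (intro exI[of _ "(K, p, y, n)"]) simp
  fix x :: "'s set \<times> 's \<times> 's \<times> nat" and i :: nat
  obtain Q p y n where x: "x = (Q, p, y, n)" by (cases x) auto
  assume "case x of (Q, p, y, n) \<Rightarrow> state Q p y n"
  hence "state Q p y n" by (simp add: x)
  from next_state[OF this] obtain Q' p' y' n' where "state Q' p' y' n'" "Q' <= Q" "n < n'" "n' <= n + GG + 1" "!!s. s \<in> Q' ==> Mn n y s <= e1"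
   by metis
  thus "EX y. (case y of (Q, p, y, n) => state Q p y n) & (case (x, y) of ((Q, p, y, n), (Q', p', y', n')) =>
   Q' <= Q & n < n' & n' <= n + GG + 1 & (ALL s:Q'. Mn n y s <= e1))"
   by (intro exI[of _ "(Q', p', y', n')"]) (simp add: x)
 qed
 then obtain f where f: "!!i. case f i of (Q, p, y, n) => state Q p y n"
  "!!i. case (f i, f (Suc i)) of ((Q, p, y, n), (Q', p', y', n')) => Q' <= Q & n < n' & n' <= n + GG + 1 & (ALL s:Q'. Mn n y s <= e1)" proof (elim exE, goal_cases)
  case (1 f)
  show ?case by (rule 1(1)[of f]) (rule conjunct1[OF spec[OF 1(2)]], rule conjunct2[OF spec[OF 1(2)]])
 qed
 define Q p y n where "Q i = fst (f i)" and "p i = fst (snd (f i))" and "y i = fst (snd (snd (f i)))" and "n i = snd (snd (snd (f i)))" for i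
 have st: "state (Q i) (p i) (y i) (n i)" for i using f(1)[of i] by (simp add: Q_def p_def y_def n_def case_prod_beta)
 have nx: "Q (Suc i) <= Q i" "n i < n (Suc i)" "n (Suc i) <= n i + (GG + 1)" "!!s. s \<in> Q (Suc i) ==> Mn (n i) (y i) s <= e1" for i
  using f(2)[of i] by (simp_all add: Q_def p_def y_def n_def case_prod_beta)
 have S: "Q i <= K" "p i \<in> Q i" "y i \<in> Q i" "ALL l<n i. \<not> sepd l (Q i)" "connected (Q i)" for i using st[of i] by (auto simp: state_def)
 have mono: "Q j <= Q i & n i <= n j & n j <= n i + (j - i)*(GG + 1)" if "i <= j" for i j
  using that
 proof (induction j rule: dec_induct)
  case (step m)
  have "Suc m - i = Suc (m - i)" using step(1) by simp
  thus ?case using step nx(1-3)[of m] by auto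
 qed simp
 \<comment> \<open>\<open>Y i\<close> is the geodesic with parameter \<open>y i\<close>, shifted to
   the moment when it crosses the normal of the base geodesic \<open>p i\<close>, at half the
   separation distance.\<close>
 define u where "u i = Utn (n i) (p i) (y i)" for i
 define Y where "Y i = sh (g (y i)) (u i)" for i
 have yK: "y i \<in> K" "p i \<in> K" for i using S by auto
 have GY: "G (Y i)" for i unfolding Y_def by (rule geodesic_sh(1)[OF Gg[OF yK(1)]])
 obtain i j where ij: "i < j" "j <= NN" "bx (Y i 0) = bx (Y j 0)" "nz (bx (Y j 0)) (Y j) (Y i) <= e1"
  using NN[of Y] GY by blast
 define \<gamma> where "\<gamma> = sh (g (p j)) (real (n j)*T)"
 define b where "b = bn (n j) (p j)"
 have Qj: "Q j <= Q (Suc i)" "Q j <= Q i" "n i < n j" "n j <= n i + NN*(GG + 1)"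
 proof -
  have "Suc i <= j" using ij(1) by simp
  from mono[OF this] nx(1,2)[of i] show "Q j <= Q (Suc i)" "Q j <= Q i" "n i < n j" by auto
  have "(j - i)*(GG + 1) <= NN*(GG + 1)" using ij by (intro mult_right_mono) auto
  thus "n j <= n i + NN*(GG + 1)" using mono[of i j] ij(1) by linarith
 qed
 obtain \<sigma> y' where sg: "\<bar>\<sigma>\<bar> = 1" "y' \<in> Q j" "dl <= \<sigma> * Jn (n j) (p j) y'" "\<sigma> * Jn (n j) (p j) (y j) = dl/2"
  using st[of j] unfolding state_def by blast
 have hY: "hit b \<gamma> (Y j)" unfolding b_def \<gamma>_def Y_def u_def by (rule tracked(6)[OF S(1,4,2,3)])
 have b: "b \<in> B" "\<gamma> 0 \<in> inn 1 b" "G \<gamma>" using hY by (auto simp: hit_def)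
 have Yb: "Y j 0 \<in> inn (5/4) b" by (rule near_inn[where g=\<gamma> and n=2]) (use hY in \<open>auto simp: hit_def\<close>)
 have mY: "nz b \<gamma> (Y j) <= \<kappa> dl"
  using tracked(4)[OF S(1,4,2,3)[of j]] unfolding Mn_norm[symmetric] b_def \<gamma>_def Y_def u_def .
 \<comment> \<open>The offset after two changes of boxes: \<open>e1\<close> is carried to the box of
   \<open>Y i\<close>, the distance \<open>e1\<close> between \<open>Y i\<close> and
   \<open>Y j\<close> is added, and the sum is carried to \<open>b\<close>.\<close>
 define e where "e = L*(e1 + L*e1)"
 have eL: "e <= 2*(L^2*e1)" "0 <= e"
 proof -
  have "L*e1 <= L*(L*e1)" using L1 e1(1) by simp
  thus "e <= 2*(L^2*e1)" by (simp add: e_def power2_eq_square distrib_left)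
  show "0 <= e" using L1 e1(1) by (simp add: e_def)
 qed
 have e: "L*e <= dl" "L*(L*e) <= dl/8"
 proof -
  have "L*(L*e) <= L*(L*(2*(L^2*e1)))" using eL L1 by (intro mult_left_mono) auto
  also have "... = 2*(L^4*e1)" by (simp add: power_eq_if)
  finally show 1: "L*(L*e) <= dl/8" using e1(6) dl(1) by linarith
  have "1*(L*e) <= L*(L*e)" using L1 eL(2) by (intro mult_right_mono) auto
  thus "L*e <= dl" using 1 dl(1) by linarith
 qed
 have ed: "L*e <= d0" "\<kappa> dl + L*e <= d0"
 proof -
  have "\<kappa> dl <= L^2*\<kappa> dl" using Lpow(1)[of 2] dl(1,2) mult_right_mono[of 1 "L^2" "\<kappa> dl"] by auto
  thus "L*e <= d0" "\<kappa> dl + L*e <= d0" using e(1) dl(1,2,8) by linarith+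
 qed
 \<comment> \<open>Each geodesic of \<open>Q j\<close> is within \<open>e1\<close> of
   \<open>y i\<close> at time \<open>n i\<close>, because \<open>Q j\<close> lies in
   \<open>Q (Suc i)\<close>, and \<open>Y i\<close> is within \<open>e1\<close> of
   \<open>Y j\<close> by the choice of \<open>i\<close> and \<open>j\<close>. So it crosses the
   normal of \<gamma>, which belongs to the later time \<open>n j\<close>, already around time
   \<open>n i\<close> and near \<open>Y j\<close>.\<close>
 have ex: "EX w. \<bar>w - real (n i)*T\<bar> <= 3/8*T & hit b \<gamma> (sh (g s) w) & \<bar>J b \<gamma> (sh (g s) w) - J b \<gamma> (Y j)\<bar> <= dl/8"
  if s: "s \<in> Q j" for s
 proof -
  have sK: "s \<in> K" using s S(1) by auto
  have sQ: "s \<in> Q i" "Mn (n i) (y i) s <= e1" using s Qj nx(4) by auto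
  define v where "v = Utn (n i) (y i) s"
  define t where "t = u i - real (n i)*T"
  note T = tracked[OF S(1,4,3) sQ(1)]
  have v: "\<bar>v - real (n i)*T\<bar> <= T / 8" using T(2) by (simp add: v_def)
  have t: "\<bar>t\<bar> <= T / 8" using tracked(2)[OF S(1,4,2,3)[of i]] by (simp add: t_def u_def)
  have c1: "close (bx (sh (g (y i)) (real (n i)*T) 0)) e1 (sh (g (y i)) (real (n i)*T)) (sh (g s) v)"
   by (rule sync_close) (use T(3) sQ(2) in \<open>simp_all add: v_def MM_def\<close>)
  have by': "bx (Y i 0) \<in> B" "sh (g (y i)) (real (n i)*T) t \<in> inn 1 (bx (Y i 0))"
   using bx[OF geo_top[OF GY[of i], of 0]] by (simp_all add: Y_def t_def sh_apply)
  have "\<bar>t\<bar> <= 3*T" "e1 <= d0" using t tau_pos e1(4) dl(2,3) by linarith+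
  from close_near(1)[OF c1 this(2,1) by'] have "close (bx (Y i 0)) (L*e1) (Y i) (sh (g s) (v + t))"
   by (simp add: Y_def t_def)
  moreover have "close (bx (Y i 0)) e1 (Y j) (Y i)"
   using GY bx[OF geo_top[OF GY[of i], of 0]] bx[OF geo_top[OF GY[of j], of 0]] inn_le[of "bx (Y i 0)" _ 1 2] ij(3,4) by (simp add: close_def)
  ultimately have c2: "close (bx (Y i 0)) (e1 + L*e1) (Y j) (sh (g s) (v + t))" by (intro close_trans)
  have "e1 + L*e1 <= d0"
  proof -
   have "e1 <= L*e1" using L1 e1(1) by simp
   thus ?thesis using e1(3) e1(1) dl(2,3) by linarith
  qed
  from close_near0(1)[OF c2 this b(1) Yb] have c3: "close b e (Y j) (sh (g s) (v + t))" by (simp add: e_def)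
  obtain r where r: "\<bar>r\<bar> <= 2*(C*e)" "Th b \<gamma> (sh (sh (g s) (v + t)) r) = 0" "close b (L*e) (Y j) (sh (sh (g s) (v + t)) r)"
   using resync_near[OF hY c3 ed(1)] by metis
  have w: "sh (sh (g s) (v + t)) r = sh (g s) (v + t + r)" by simp
  have "C*e <= L*e" using C_le_L(1) eL(2) by (intro mult_right_mono)
  hence rt: "\<bar>r\<bar> <= T / 8" using r(1) ed(1) d0_le(1)[of d0] tau_pos by linarith
  have "\<bar>v + t + r - real (n i)*T\<bar> <= 3/8*T" using v t rt by linarith
  moreover have "hit b \<gamma> (sh (g s) (v + t + r))"
   using r(2) closeD[OF r(3)] b Dz_triangle[of b \<gamma> "sh (g s) (v + t + r)" "Y j"] mY ed(2) unfolding hit_def w by simp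
  moreover have "\<bar>J b \<gamma> (sh (g s) (v + t + r)) - J b \<gamma> (Y j)\<bar> <= dl/8"
  proof -
   have "\<bar>J b \<gamma> (sh (g s) (v + t + r)) - J b \<gamma> (Y j)\<bar> <= C*nz b (Y j) (sh (g s) (v + t + r))" by (rule Th_diff(2)[OF b(3,1,2)])
   also have "... <= L*(L*e)" using closeD(6)[OF r(3)] C_le_L(1) C1 L1 unfolding w by (intro mult_mono) auto
   finally show ?thesis using e(2) by linarith
  qed
  ultimately show ?thesis by blast
 qed
 then obtain w where w: "!!s. s \<in> Q j ==> \<bar>w s - real (n i)*T\<bar> <= 3/8*T" "!!s. s \<in> Q j ==> hit b \<gamma> (sh (g s) (w s))"
  "!!s. s \<in> Q j ==> \<bar>J b \<gamma> (sh (g s) (w s)) - J b \<gamma> (Y j)\<bar> <= dl/8" by metis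
 have w': "\<bar>w s - real (n i)*T\<bar> <= 3/2*T" if "s \<in> Q j" for s using w(1)[OF that] tau_pos by linarith
 have ca: "continuous_on (Q j) (%s. J b \<gamma> (sh (g s) (w s)))"
  by (rule hit_continuous(1)[OF w(2) w' conv_on[OF S(1)]])
 have cb: "continuous_on (Q j) (%s. J b \<gamma> (sh (g s) (Utn (n j) (p j) s)))"
  using cont(1)[OF S(1,4,2)[of j]] unfolding b_def \<gamma>_def .
 have JY: "\<sigma> * J b \<gamma> (Y j) = dl/2" using sg(4) unfolding b_def \<gamma>_def Y_def u_def .
 have aJ: "3/8*dl <= \<sigma> * J b \<gamma> (sh (g s) (w s))" "\<sigma> * J b \<gamma> (sh (g s) (w s)) <= 5/8*dl" if "s \<in> Q j" for s
 proof -
  have "\<bar>\<sigma> * J b \<gamma> (sh (g s) (w s)) - \<sigma> * J b \<gamma> (Y j)\<bar> <= dl/8"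
   using w(3)[OF that] sg(1) unfolding right_diff_distrib[symmetric] abs_mult by simp
  thus "3/8*dl <= \<sigma> * J b \<gamma> (sh (g s) (w s))" "\<sigma> * J b \<gamma> (sh (g s) (w s)) <= 5/8*dl" using JY dl(1) by linarith+
 qed
 \<comment> \<open>\<open>F\<close> compares two crossings of the same normal by one geodesic: the
   late one near time \<open>n j\<close>, which moves from 0 at \<open>p j\<close> to at least
   \<open>dl\<close> at \<open>y'\<close>, and the early one near time \<open>n i\<close>, which
   stays between \<open>3/8 * dl\<close> and \<open>5/8 * dl\<close>.\<close>
 define F where "F s = \<sigma> * J b \<gamma> (sh (g s) (Utn (n j) (p j) s)) - \<sigma> * J b \<gamma> (sh (g s) (w s))" for s
 obtain s where s: "s \<in> Q j" "F s = 0"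
 proof (rule connected_ivt[OF S(5)[of j] _ S(2) sg(2), where f=F])
  show "continuous_on (Q j) F" unfolding F_def by (intro continuous_intros ca cb)
  have "J b \<gamma> (sh (g (p j)) (Utn (n j) (p j) (p j))) = 0" using self(2)[OF yK(2)] unfolding b_def \<gamma>_def .
  thus "F (p j) <= 0" using aJ(1)[OF S(2)] dl(1) by (simp add: F_def)
  have "dl <= \<sigma> * J b \<gamma> (sh (g y') (Utn (n j) (p j) y'))" using sg(3) unfolding b_def \<gamma>_def .
  thus "0 <= F y'" using aJ(2)[OF sg(2)] dl(1) unfolding F_def by linarith
 qed
 have sK: "s \<in> K" using s S(1) by auto
 define t1 t2 where "t1 = w s" and "t2 = Utn (n j) (p j) s"
 have h2: "hit b \<gamma> (sh (g s) t2)" using tracked(6)[OF S(1,4,2) s(1)] unfolding b_def \<gamma>_def t2_def .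
 have h1: "hit b \<gamma> (sh (g s) t1)" unfolding t1_def by (rule w(2)[OF s(1)])
 have "\<sigma> ~= 0" using sg(1) by auto
 hence "J b \<gamma> (sh (g s) t1) = J b \<gamma> (sh (g s) t2)" using s(2) by (simp add: F_def t1_def t2_def)
 from hits_meet[OF h1 h2 this] have eq: "g s t1 = g s t2" by (simp add: sh_apply)
 have t: "\<bar>t1 - real (n i)*T\<bar> <= 3/8*T" "\<bar>t2 - real (n j)*T\<bar> <= T / 8"
  using w(1)[OF s(1)] tracked(2)[OF S(1,4,2) s(1)] by (simp_all add: t1_def t2_def)
 \<comment> \<open>At least one and at most \<open>NN * (GG + 1)\<close> steps lie between the
   crossings; the clock errors \<open>3/8 * T\<close> and \<open>T / 8\<close> leave a period of at
   least \<open>T / 2\<close>.\<close>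
 have nn: "(real (n i) + 1)*T <= real (n j)*T" "real (n j)*T <= (real (n i) + real (NN*(GG + 1)))*T"
  using Qj(3,4) tau_pos by (intro mult_right_mono; linarith)+
 have lo: "T / 2 <= t2 - t1" and hi: "t2 - t1 <= (real (NN*(GG + 1)) + 2)*T"
  using t nn tau_pos unfolding distrib_right by linarith+
 have "t1 ~= t2" using lo tau_pos by auto
 from simple_return[OF simple[OF sK] eq this] have "sh (g s) (t2 - t1) = g s" .
 thus ?thesis using that sK lo hi by blast
qed

end

section \<open>Exclusion of continua of simple geodesics\<close>

lemma small_subcontinuum:
 fixes Q :: "'s::euclidean_space set"
 assumes Q: "compact Q" "connected Q" "s \<in> Q" "s' \<in> Q" "s ~= s'" and r: "0 < r"
 obtains E where "compact E" "connected E" "s \<in> E" "E <= Q" "E <= cball s r" "EX x:E. x ~= s"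
proof -
 define E where "E = connected_component_set {x \<in> Q. dist s x <= r} s"
 have f: "continuous_on Q (dist s)" by (intro continuous_intros)
 have "dist s s <= r" using r by simp
 note bb = boundary_bumping[OF Q(1,2) f Q(3) this, folded E_def]
 have "EX x:E. x ~= s" using bb(6) Q(4,5) r by auto
 thus ?thesis using that bb by (meson mem_cball subsetI)
qed

lemma sh_periodic: assumes "sh g p = g" shows "sh g (of_int q*p) = g"
proof -
 have n: "sh g (real n*p) = g" for n
 proof (induction n)
  case (Suc n)
  have "sh (sh g (real n*p)) p = g" using Suc assms by simp
  thus ?case by (simp add: algebra_simps)
 qed simp
 show ?thesis
 proof (cases "0 <= q")
  case True
  thus ?thesis using n[of "nat q"] by simp
 next
  case False
  have "sh (sh g (real (nat (- q))*p)) (of_int q*p) = g" using False by (simp add: algebra_simps)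
  thus ?thesis using n by simp
 qed
qed

context tracking begin

lemma close_refl: "G g ==> 0 <= e ==> close (bx (g 0)) e g g"
 using bx[of "g 0"] geo_top[of g 0] inn_le[of "bx (g 0)" "g 0" 1 2] by (simp add: close_def Dz_def zero_prod_def[symmetric])

lemma initial_tracking:
 assumes g: "G (g s0)" "gconv g (g s0) (at s0 within K)" and s0: "s0 \<in> (K :: 's::metric_space set)" and d: "0 < d" "d <= d0"
 shows "EX r>0. ALL s:K. ALL s':K. dist s0 s <= r --> dist s0 s' <= r --> trk (g s) (g s') (T / 16) d 0"
proof -
 let ?A = "bx (g s0 0)"
 define e where "e = d/(2*L)"
 have e: "0 < e" "L*(e + e) = d" "e + e <= d0"
 proof -
  show 0: "0 < e" using d L1 by (simp add: e_def)
  show 1: "L*(e + e) = d" using L1 by (simp add: e_def field_simps)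
  have "e + e = 1*(e + e)" by simp
  also have "... <= L*(e + e)" using L1 0 by (intro mult_right_mono) auto
  also have "... <= d0" using 1 d(2) by (simp only:)
  finally show "e + e <= d0" .
 qed
 have "eventually (%s. close ?A e (g s0) (g s)) (at s0 within K)" using g(2) e(1) by (simp add: gconv_def)
 then obtain r where r: "0 < r" "!!s. s \<in> K ==> s ~= s0 ==> dist s s0 < r ==> close ?A e (g s0) (g s)"
  unfolding eventually_at by auto
 have cl: "close ?A e (g s0) (g s)" if "s \<in> K" "dist s0 s <= r/2" for s
  using r that close_refl[OF g(1), of e] e(1) by (cases "s = s0") (auto simp: dist_commute)
 have "trk (g s) (g s') (T / 16) d 0" if s: "s \<in> K" "s' \<in> K" "dist s0 s <= r/2" "dist s0 s' <= r/2" for s s'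
 proof -
  have c: "close ?A (e + e) (g s) (g s')" by (rule close_trans[OF close_sym[OF cl[OF s(1,3)]] cl[OF s(2,4)]])
  have "\<bar>0\<bar> <= 3*T" using tau_pos by simp
  from trans[OF close_mono[OF c e(3)] this] obtain u where u: "\<bar>u - 0\<bar> <= L*nz ?A (g s) (g s')"
   "sync (sh (g s) 0) (sh (g s') u)" "mm (sh (g s) 0) (sh (g s') u) <= L*nz ?A (g s) (g s')" by blast
  have le: "L*nz ?A (g s) (g s') <= d" using closeD(6)[OF c] L1 e(2) mult_left_mono[of "nz ?A (g s) (g s')" "e + e" L] by linarith
  have "\<bar>u - 0\<bar> <= T / 16" using u(1) le d(2) d0_le(1)[of d0] tau_pos by linarith
  moreover have "mm (sh (g s) 0) (sh (g s') u) <= d" using u(3) le by linarith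
  ultimately show ?thesis unfolding trk_def using u(2) by blast
 qed
 thus ?thesis using r(1) by (intro exI[of _ "r/2"]) auto
qed

lemma tracked_forever:
 assumes t: "!!j::int. trk g h (T / 8) (\<kappa> dl) (of_int j*T)"
 shows "EX t. \<bar>t\<bar> <= T & sh h t = g"
proof -
 have "EX u. ALL j. \<bar>u j - of_int j*T\<bar> <= T / 8 & sync (sh g (of_int j*T)) (sh h (u j)) & mm (sh g (of_int j*T)) (sh h (u j)) <= \<kappa> dl"
  using t unfolding trk_def by (rule_tac choice allI)+
 then obtain u :: "int => real" where u: "!!j. \<bar>u j - of_int j*T\<bar> <= T / 8" "!!j. sync (sh g (of_int j*T)) (sh h (u j))"
  "!!j. mm (sh g (of_int j*T)) (sh h (u j)) <= \<kappa> dl" by blast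
 have "sh h (u 0) = g"
 proof (rule expansive[where u=u and g=g and h=h, OF u(2)])
  show "mm (sh g (of_int j*T)) (sh h (u j)) <= d0" for j using u(3)[of j] dl(3) by linarith
  show "\<bar>u (j + 1) - u j - T\<bar> <= T / 2" for j
  proof -
   have "of_int (j + 1)*T = of_int j*T + T" by (simp add: algebra_simps)
   thus ?thesis using u(1)[of j] u(1)[of "j + 1"] tau_pos by linarith
  qed
 qed
 moreover have "\<bar>u 0\<bar> <= T" using u(1)[of 0] tau_pos by simp
 ultimately show ?thesis by blast
qed

definition R0 :: real where "R0 = (real (NN*(GG + 1)) + 2)*T"

text \<open>In a subcontinuum small enough for \<open>geodesic_family\<close> some pair separates in
  one of the two time directions: otherwise expansivity, in the form \<open>tracked_forever\<close>,
  would identify two different parameters. Separation in the past is treated by reversing the whole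
  family.\<close>

lemma continuum_has_closed_geodesic:
 fixes Q :: "'s::euclidean_space set"
 assumes simple: "!!s. s \<in> Q ==> SG (g s)"
  and conv: "!!s. s \<in> Q ==> gconv g (g s) (at s within Q)"
  and inj: "!!s s' t. s \<in> Q ==> s' \<in> Q ==> \<bar>t\<bar> <= T ==> sh (g s') t = g s ==> s' = s"
  and Q: "compact Q" "connected Q" "s0 \<in> Q" "s1 \<in> Q" "s0 ~= s1"
 shows "EX s:Q. EX t:{T / 2..R0}. sh (g s) t = g s"
proof -
 note s0 = Q(3)
 have gG: "G (g s0)" using simple[OF s0] by (simp add: simple_complete_geodesic_def)
 have "d1 <= d0" using d1(2) dl(2,3) by linarith
 from initial_tracking[OF gG conv[OF s0] s0 d1(1) this] obtain r where r: "0 < r"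
  "!!s s'. s \<in> Q ==> s' \<in> Q ==> dist s0 s <= r ==> dist s0 s' <= r ==> trk (g s) (g s') (T / 16) d1 0"
  by (elim exE conjE) (rule that, assumption, blast)
 obtain E where E: "compact E" "connected E" "s0 \<in> E" "E <= Q" "E <= cball s0 r" "EX x:E. x ~= s0"
  using small_subcontinuum[OF Q r(1)] by metis
 have EK: "s \<in> Q" if "s \<in> E" for s using that E Q by auto
 have tr: "trk (g s) (g s') (T / 16) d1 0" if "s \<in> E" "s' \<in> E" for s s'
 proof -
  have "dist s0 s <= r" "dist s0 s' <= r" using E(5) that by (meson mem_cball subsetD)+
  thus ?thesis by (rule r(2)[OF EK[OF that(1)] EK[OF that(2)]])
 qed
 have cv: "gconv g (g s) (at s within E)" if "s \<in> E" for s
  using gconv_mono[OF conv[OF EK[OF that]] at_le] EK by blast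
 interpret p: geodesic_family M B C T k L d0 c E g
  by unfold_locales (use simple EK cv tr in auto)
 interpret m: geodesic_family M B C T k L d0 c E "%s. rv (g s)"
 proof unfold_locales
  show "SG (rv (g s))" if "s \<in> E" for s using simple_rv(1) simple EK that by blast
  show "gconv (%s. rv (g s)) (rv (g s)) (at s within E)" if "s \<in> E" for s by (rule gconv_rv[OF cv[OF that]])
  show "trk (rv (g s)) (rv (g s')) (T / 16) d1 0" if "s \<in> E" "s' \<in> E" for s s' using trk_rv[OF tr[OF that]] by simp
 qed
 obtain s2 where s2: "s2 \<in> E" "s2 ~= s0" using E(6) by auto
 have "EX n. p.sepd n E \<or> m.sepd n E"
 proof (rule ccontr)
  assume n: "\<not> ?thesis"
  have "trk (g s0) (g s2) (T / 8) (\<kappa> dl) (of_int j*T)" for j :: int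
  proof (cases "0 <= j")
   case True
   have "trk (g s0) (g s2) (T / 8) (\<kappa> dl) (real (nat j)*T)" by (rule p.tracked(1)[OF order_refl _ E(3) s2(1)]) (use n in blast)
   thus ?thesis using True by simp
  next
   case False
   have "trk (rv (g s0)) (rv (g s2)) (T / 8) (\<kappa> dl) (real (nat (- j))*T)" by (rule m.tracked(1)[OF order_refl _ E(3) s2(1)]) (use n in blast)
   from trk_rv[OF this] show ?thesis using False by (simp add: sh_rv(2))
  qed
  from tracked_forever[OF this] obtain t where "\<bar>t\<bar> <= T" "sh (g s2) t = g s0" by (elim exE conjE)
  hence "s2 = s0" by (rule inj[OF s0 EK[OF s2(1)]])
  with s2(2) show False by (rule notE)
 qed
 then obtain n where "p.sepd n E \<or> m.sepd n E" by blast
 thus ?thesis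
 proof
  assume "p.sepd n E"
  then obtain s t where "s \<in> E" "T / 2 <= t" "t <= R0" "sh (g s) t = g s"
   by (rule p.closed_geodesic[OF E(1,2), folded R0_def])
  thus ?thesis using E(4) by (intro bexI[of _ s] bexI[of _ t]) auto
 next
  assume "m.sepd n E"
  then obtain s t where st: "s \<in> E" "T / 2 <= t" "t <= R0" "sh (rv (g s)) t = rv (g s)"
   by (rule m.closed_geodesic[OF E(1,2), folded R0_def])
  have "rv (rv (sh (g s) (- t))) = rv (rv (g s))" using st(4) unfolding sh_rv(1) by simp
  hence "sh (g s) (- t) = g s" unfolding sh_rv(2) .
  hence "sh (sh (g s) (- t)) t = sh (g s) t" by simp
  hence "sh (g s) t = g s" by simp
  thus ?thesis using st(1-3) E(4) by (intro bexI[of _ s] bexI[of _ t]) auto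
 qed
qed

text \<open>Closed geodesics with periods in \<open>{T / 2..R0}\<close> exist arbitrarily close to a
  parameter \<open>z\<close>, and a limit of their periods makes \<open>g z\<close> closed too. Two
  nearby closed geodesics with nearly equal periods track each other for all time, against
  expansivity and \<open>inj\<close>.\<close>

lemma no_geodesic_continuum:
 fixes K :: "'s::euclidean_space set"
 assumes K: "compact K" "connected K"
  and simple: "!!s. s \<in> K ==> SG (g s)"
  and conv: "!!s. s \<in> K ==> gconv g (g s) (at s within K)"
  and inj: "!!s s' t. s \<in> K ==> s' \<in> K ==> \<bar>t\<bar> <= T ==> sh (g s') t = g s ==> s' = s"
  and xy: "x \<in> K" "y \<in> K"
 shows "x = y"
proof (rule ccontr)
 assume ne: "x ~= y"
 have gG: "G (g s)" if "s \<in> K" for s using simple[OF that] by (simp add: simple_complete_geodesic_def)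
 have closed: "EX s:Q. EX t:{T / 2..R0}. sh (g s) t = g s"
  if Q: "compact Q" "connected Q" "Q <= K" "s0 \<in> Q" "s1 \<in> Q" "s0 ~= s1" for Q s0 s1
 proof (rule continuum_has_closed_geodesic[OF _ _ _ Q(1,2,4-6)])
  fix s assume s: "s \<in> Q"
  hence sK: "s \<in> K" using Q(3) by auto
  show "SG (g s)" by (rule simple[OF sK])
  show "gconv g (g s) (at s within Q)" by (rule gconv_mono[OF conv[OF sK] at_le[OF Q(3)]])
  fix s' t assume "s' \<in> Q" "\<bar>t\<bar> <= T" "sh (g s') t = g s"
  thus "s' = s" using inj[OF sK] Q(3) by blast
 qed
 from closed[OF K order_refl xy ne] obtain z where z: "z \<in> K" by (elim bexE) (rule that)
 define z' where "z' = (if x = z then y else x)"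
 have z': "z' \<in> K" "z' ~= z" using xy ne by (auto simp: z'_def)
 \<comment> \<open>A parameter different from \<open>z\<close> is needed: \<open>w\<close> is first
   chosen different from \<open>z\<close>, and the search then takes place in a continuum around
   \<open>w\<close> that keeps half the distance to \<open>z\<close>.\<close>
 have "EX w p. w \<in> K & w ~= z & dist w z <= 1/(real i + 1) & p \<in> {T / 2..R0} & sh (g w) p = g w" for i
 proof -
  have "0 < 1/(real i + 1)" by simp
  then obtain E where E: "compact E" "connected E" "z \<in> E" "E <= K" "E <= cball z (1/(real i + 1))" "EX x:E. x ~= z"
   using small_subcontinuum[OF K z z'(1) z'(2)[symmetric]] by metis
  obtain w where w: "w \<in> E" "w ~= z" using E(6) by auto
  have "0 < dist w z/2" using w by simp
  then obtain F where F: "compact F" "connected F" "w \<in> F" "F <= E" "F <= cball w (dist w z/2)" "EX x:F. x ~= w"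
   using small_subcontinuum[OF E(1,2) w(1) E(3) w(2)] by metis
  obtain v where v: "v \<in> F" "v ~= w" using F(6) by auto
  have FK: "F <= K" using F(4) E(4) by auto
  obtain s t where s: "s \<in> F" "t \<in> {T / 2..R0}" "sh (g s) t = g s" using closed[OF F(1,2) FK F(3) v(1) v(2)[symmetric]] by (elim bexE) (rule that)
  have "dist w s <= dist w z/2" using s(1) F(5) by auto
  hence "s ~= z" using w(2) by auto
  moreover have "dist s z <= 1/(real i + 1)" using s(1) F(4) E(5) by (auto simp: dist_commute)
  ultimately show ?thesis using s FK by (intro exI[of _ s] exI[of _ t]) (simp add: subsetD)
 qed
 then obtain w p where w: "!!i. w i \<in> K" "!!i. w i ~= z" "!!i. dist (w i) z <= 1/(real i + 1)" "!!i. p i \<in> {T / 2..R0}" "!!i. sh (g (w i)) (p i) = g (w i)"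
  by metis
 have "seq_compact {T / 2..R0}" using compact_Icc compact_eq_seq_compact_metric by blast
 then obtain q \<phi> where q: "q \<in> {T / 2..R0}" "strict_mono \<phi>" "(p \<circ> \<phi>) \<longlonglongrightarrow> q"
  using seq_compactE[of "{T / 2..R0}" p] w(4) by blast
 have wz: "(%i. w (\<phi> i)) \<longlonglongrightarrow> z"
 proof -
  have "(%i. dist (w i) z) \<longlonglongrightarrow> 0"
   by (rule tendsto_sandwich[of "%_. 0" _ _ "%i. 1/(real i + 1)"]) (use w(3) LIMSEQ_inverse_real_of_nat in \<open>auto simp: inverse_eq_divide add.commute\<close>)
  hence "w \<longlonglongrightarrow> z" by (rule tendsto_dist_iff[THEN iffD2])
  from LIMSEQ_subseq_LIMSEQ[OF this q(2)] show ?thesis by (simp add: comp_def)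
 qed
 have fl: "filterlim (%i. w (\<phi> i)) (at z within K) sequentially"
  unfolding filterlim_at using wz w(1,2) by auto
 have gc: "gconv (%i. g (w (\<phi> i))) (g z) sequentially"
  using conv[OF z] eventually_compose_filterlim[OF _ fl] unfolding gconv_def by blast
 have "gconv (%i. sh (g (w (\<phi> i))) ((p \<circ> \<phi>) i)) (sh (g z) q) sequentially" by (rule gconv_shift[OF gc q(3)])
 hence "gconv (%i. g (w (\<phi> i))) (sh (g z) q) sequentially" using w(5) by simp
 from gconv_unique[OF this gc] have qz: "sh (g z) q = g z" by simp
 have qp: "0 < q" "T / 2 <= q" using q(1) tau_pos by auto
 have "eventually (%i. (ALL r:{0..q}. trk (g z) (g (w (\<phi> i))) d0 d0 r) & \<bar>(p \<circ> \<phi>) i - q\<bar> < T / 64) sequentially"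
  by (rule eventually_conj[OF gconv_track[OF gc d0(1)]]) (use tendstoD[OF q(3), of "T / 64"] tau_pos in \<open>simp add: dist_real_def\<close>)
 then obtain i where i: "!!r. r \<in> {0..q} ==> trk (g z) (g (w (\<phi> i))) d0 d0 r" "\<bar>p (\<phi> i) - q\<bar> < T / 64"
  using eventually_happens by force
 define h where "h = g (w (\<phi> i))"
 \<comment> \<open>\<open>n j\<close> counts the periods of \<open>g z\<close> completed by time
   \<open>j * T\<close> and \<open>r j\<close> is the remaining time. Tracking is used only at
   \<open>r j\<close>, within one period, and \<open>v j\<close> below adds \<open>n j\<close>
   periods of \<open>h\<close> in place of those of \<open>g z\<close>.\<close>
 define n where "n j = \<lfloor>of_int j*T / q\<rfloor>" for j :: int
 define r where "r j = of_int j*T - of_int (n j)*q" for j :: int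
 have nr: "of_int (n j)*q <= of_int j*T" "of_int j*T < (of_int (n j) + 1)*q" for j
 proof -
  have "of_int (n j) <= of_int j*T / q" "of_int j*T / q < of_int (n j) + 1" unfolding n_def by linarith+
  thus "of_int (n j)*q <= of_int j*T" "of_int j*T < (of_int (n j) + 1)*q" using qp(1) by (simp_all add: pos_le_divide_eq pos_divide_less_eq)
 qed
 have r0: "r j \<in> {0..q}" for j using nr[of j] by (simp add: r_def distrib_right)
 have "EX u. ALL j. \<bar>u j - r j\<bar> <= d0 & sync (sh (g z) (r j)) (sh h (u j)) & mm (sh (g z) (r j)) (sh h (u j)) <= d0"
  using i(1)[OF r0] unfolding trk_def h_def by (rule_tac choice allI)+
 then obtain u where u: "!!j. \<bar>u j - r j\<bar> <= d0" "!!j. sync (sh (g z) (r j)) (sh h (u j))" "!!j. mm (sh (g z) (r j)) (sh h (u j)) <= d0" by blast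
 define v where "v j = of_int (n j)*p (\<phi> i) + u j" for j
 have z1: "sh (g z) (of_int j*T) = sh (g z) (r j)" for j
 proof -
  have "sh (sh (g z) (of_int (n j)*q)) (r j) = sh (g z) (r j)" unfolding sh_periodic[OF qz] ..
  thus ?thesis by (simp add: r_def)
 qed
 have e1: "sh h (v j) = sh h (u j)" for j
 proof -
  have "sh h (p (\<phi> i)) = h" unfolding h_def by (rule w(5))
  from sh_periodic[OF this, of "n j"] have "sh (sh h (of_int (n j)*p (\<phi> i))) (u j) = sh h (u j)" by simp
  thus ?thesis by (simp add: v_def)
 qed
 have "sh h (v 0) = g z"
 proof (rule expansive[where u=v and g="g z" and h=h])
  show "sync (sh (g z) (of_int j*T)) (sh h (v j))" "mm (sh (g z) (of_int j*T)) (sh h (v j)) <= d0" for j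
   unfolding z1 e1 by (rule u)+
  show "\<bar>v (j + 1) - v j - T\<bar> <= T / 2" for j
  proof -
   \<comment> \<open>\<open>N\<close> is the number of periods completed in one step. Since
     \<open>q >= T / 2\<close> it is at most 3, so exchanging the period \<open>q\<close> for
     \<open>p (\<phi> i)\<close> costs at most \<open>3 * (T / 64)\<close> per step.\<close>
   define N where "N = real_of_int (n (j + 1) - n j)"
   have jt: "of_int (j + 1)*T = of_int j*T + T" by (simp add: algebra_simps)
   have "of_int (n j) <= (of_int (n (j + 1)) + 1 - (1::real))"
   proof -
    have "n j <= n (j + 1)" unfolding n_def using qp(1) tau_pos by (intro floor_mono divide_right_mono mult_right_mono) auto
    thus ?thesis by simp
   qed
   hence N0: "0 <= N" by (simp add: N_def)
   have "(of_int (n (j + 1)) - of_int (n j) - 1)*q < T" using nr(1)[of "j + 1"] nr(2)[of j] jt unfolding left_diff_distrib distrib_right by linarith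
   hence "(N - 1)*q < 2*q" using qp(2) by (simp add: N_def)
   hence N3: "N <= 3" using qp(1) by simp
   have "\<bar>N*(p (\<phi> i) - q)\<bar> <= 3*(T / 64)" unfolding abs_mult using N0 N3 i(2) by (intro mult_mono) auto
   moreover have "v (j + 1) - v j - T = N*(p (\<phi> i) - q) + (u (j + 1) - r (j + 1)) - (u j - r j)"
    using jt by (simp add: v_def r_def N_def algebra_simps)
   ultimately show ?thesis using u(1)[of j] u(1)[of "j + 1"] d0_le(1)[of d0] tau_pos by linarith
  qed
 qed
 moreover have "\<bar>v 0\<bar> <= T" using u(1)[of 0] d0_le(1)[of d0] tau_pos by (simp add: v_def n_def r_def)
 ultimately have "w (\<phi> i) = z" using inj[OF z w(1), of "v 0"] unfolding h_def by blast
 thus False using w(2) by blast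
qed

end

text \<open>A quadratic remainder bound with a common constant survives pointwise limits; this gives
  differentiability of limits of geodesics.\<close>

lemma has_vector_derivative_quadratic:
 fixes x :: "real => 'e::real_normed_vector"
 assumes e: "0 < e" and q: "!!t. \<bar>t - s\<bar> < e ==> norm (x t - x s - (t - s) *\<^sub>R v) <= D*\<bar>t - s\<bar>^2"
 shows "(x has_vector_derivative v) (at s)"
 unfolding has_vector_derivative_def
proof (rule has_derivativeI_sandwich[OF e])
 show "bounded_linear (%h. h *\<^sub>R v)" by (rule bounded_linear_scaleR_left)
 show "norm (x t - x s - (t - s) *\<^sub>R v)/norm (t - s) <= D*\<bar>t - s\<bar>" if "t ~= s" "dist t s < e" for t
 proof -
  have "norm (x t - x s - (t - s) *\<^sub>R v) <= (D*\<bar>t - s\<bar>)*\<bar>t - s\<bar>" using q[of t] that(2) by (simp add: dist_real_def power2_eq_square)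
  thus ?thesis using that(1) by (simp add: pos_divide_le_eq)
 qed
 show "((%t. D*\<bar>t - s\<bar>) \<longlongrightarrow> 0) (at s)" by (rule tendsto_eq_intros refl | simp)+
qed

context riem begin

lemma chart_nbhd:
 assumes c: "c \<in> \<A>" and y: "y \<in> cdom c" and V: "openin X V" "y \<in> V"
 shows "EX \<delta>>0. ALL y':cdom c. dist (cmap c y') (cmap c y) < \<delta> --> y' \<in> V"
proof -
 let ?A = "V \<inter> cdom c"
 have "openin (subtopology X (cdom c)) ?A" using V(1) by (simp add: openin_subtopology_Int)
 hence "openin (top_of_set (cimg c)) (cmap c ` ?A)"
  using chart_homeo[OF c] homeomorphic_imp_open_map open_map_def by blast
 then obtain e where e: "0 < e" "ball (cmap c y) e \<inter> cimg c <= cmap c ` ?A"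
  using V(2) y openin_contains_ball[of "cimg c"] by (metis (no_types, lifting) IntI imageI)
 have "y' \<in> V" if y': "y' \<in> cdom c" "dist (cmap c y') (cmap c y) < e" for y'
 proof -
  have "cmap c y' \<in> cmap c ` ?A" using e(2) y' by (auto simp: dist_commute)
  then obtain w where "w \<in> V" "w \<in> cdom c" "cmap c w = cmap c y'" by auto
  thus ?thesis using chart_inj[OF c] y'(1) by (metis inj_onD)
 qed
 thus ?thesis using e(1) by blast
qed

lemma limitin_chart:
 assumes c: "c \<in> \<A>" and y: "y \<in> cdom c" and f: "eventually (%i. f i \<in> cdom c) F"
 shows "limitin X f y F \<longleftrightarrow> ((%i. cmap c (f i)) \<longlongrightarrow> cmap c y) F"
proof
 assume l: "limitin X f y F"
 show "((%i. cmap c (f i)) \<longlongrightarrow> cmap c y) F"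
 proof (rule topological_tendstoI)
  fix U assume U: "open U" "cmap c y \<in> U"
  have "openin X {y \<in> cdom c. cmap c y \<in> U} & y \<in> {y \<in> cdom c. cmap c y \<in> U}"
   using chart_preimage_open[OF c U(1)] y U(2) by simp
  hence "eventually (%i. f i \<in> {y \<in> cdom c. cmap c y \<in> U}) F"
   by (rule conjunct2[OF l[unfolded limitin_def], rule_format])
  thus "eventually (%i. cmap c (f i) \<in> U) F" by (rule eventually_mono) simp
 qed
next
 assume t: "((%i. cmap c (f i)) \<longlongrightarrow> cmap c y) F"
 show "limitin X f y F" unfolding limitin_def
 proof (intro conjI allI impI)
  show "y \<in> topspace X" using openin_subset[OF chart_open[OF c]] y by auto
  fix V assume V: "openin X V & y \<in> V"
  from chart_nbhd[OF c y conjunct1[OF V] conjunct2[OF V]] obtain \<delta> where d: "0 < \<delta>" "ALL y':cdom c. dist (cmap c y') (cmap c y) < \<delta> --> y' \<in> V"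
   by (elim exE conjE)
  show "eventually (%i. f i \<in> V) F"
   by (rule eventually_elim2[OF f tendstoD[OF t d(1)]]) (rule d(2)[rule_format])
 qed
qed

lemma Gam_tendsto:
 assumes c: "c \<in> \<A>" and p: "(p \<longlongrightarrow> q) F" "q \<in> cimg c" "eventually (%i. p i \<in> cimg c) F" and u: "(u \<longlongrightarrow> u') F"
 shows "((%i. Gam c (p i) (u i) (u i)) \<longlongrightarrow> Gam c q u' u') F" "((%i. ip c (p i) (u i) (u i)) \<longlongrightarrow> ip c q u' u') F"
proof -
 have "((%i. chr c k a b (p i)) \<longlongrightarrow> chr c k a b q) F" for k a b
  by (rule continuous_on_tendsto_compose[OF C1_onD(2)[OF christoffel_C1[OF c]] p])
 thus "((%i. Gam c (p i) (u i) (u i)) \<longlongrightarrow> Gam c q u' u') F"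
  unfolding Gam_def using u by (intro tendsto_vec_lambda tendsto_intros) auto
 have m: "((%i. gm c (p i) $ a $ b) \<longlongrightarrow> gm c q $ a $ b) F" for a b
  by (rule continuous_on_tendsto_compose[OF C1_onD(2)[OF metric_C1(1)[OF c]] p])
 thus "((%i. ip c (p i) (u i) (u i)) \<longlongrightarrow> ip c q u' u') F"
  unfolding ip_expand by (intro tendsto_sum tendsto_mult tendsto_vec_nth[OF u] m)
qed

lemma chart_curve_continuous:
 assumes c: "c \<in> \<A>" and f: "!!s. s \<in> S ==> f s \<in> cdom c" and x: "continuous_on S (%s. cmap c (f s))"
 shows "continuous_map (top_of_set S) X f"
proof -
 let ?A = "top_of_set (cimg c)" and ?B = "subtopology X (cdom c)"
 obtain h where h: "homeomorphic_maps ?B ?A (cmap c) h"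
  using chart_homeo[OF c] homeomorphic_map_maps by blast
 have "continuous_map ?A ?B h" using h by (simp add: homeomorphic_maps_def)
 hence hc: "continuous_map ?A X h" using continuous_map_in_subtopology by blast
 have "continuous_map (top_of_set S) ?A (%s. cmap c (f s))"
  using x f by (simp add: continuous_map_in_subtopology image_subset_iff)
 from continuous_map_compose[OF this hc] have "continuous_map (top_of_set S) X (h \<circ> (%s. cmap c (f s)))" .
 moreover have "h (cmap c (f s)) = f s" if "s \<in> S" for s
 proof -
  have "f s \<in> topspace ?B" using f[OF that] openin_subset[OF chart_open[OF c]] by (auto simp: topspace_subtopology)
  thus ?thesis using h by (simp add: homeomorphic_maps_def)
 qed
 ultimately show ?thesis by (elim continuous_map_eq) simp
qed

end

context tracking begin

section \<open>Limits of geodesics\<close>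

definition gcauchy :: "'a box => (nat => real => 'a) => bool" where
 "gcauchy b f \<longleftrightarrow> (ALL e>0. EX N. ALL i>=N. ALL j>=N. close b e (f i) (f j))"

lemma gcauchyD:
 assumes f: "gcauchy b f"
 shows "b \<in> B" "eventually (%i. G (f i) & f i 0 \<in> inn 2 b) sequentially"
  "\<bar>t\<bar> <= 4*T ==> Cauchy (%i. xx b (f i) t)" "\<bar>t\<bar> <= 4*T ==> Cauchy (%i. vv b (f i) t)"
proof -
 from f[unfolded gcauchy_def, rule_format, OF d0(1)] obtain N where N: "!!i j. i >= N ==> j >= N ==> close b d0 (f i) (f j)" by blast
 show b: "b \<in> B" using closeD(1)[OF N[OF order_refl order_refl]] .
 show "eventually (%i. G (f i) & f i 0 \<in> inn 2 b) sequentially"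
  unfolding eventually_sequentially using closeD(2,4)[OF N] by blast
 assume t: "\<bar>t\<bar> <= 4*T"
 have C: "EX N. ALL i>=N. ALL j>=N. nz b (sh (f j) t) (sh (f i) t) < e" if e: "0 < e" for e
 proof -
  have "0 < e/4" using e by simp
  from f[unfolded gcauchy_def, rule_format, OF this] obtain N where N: "!!i j. i >= N ==> j >= N ==> close b (e/4) (f i) (f j)" by blast
  have "nz b (sh (f j) t) (sh (f i) t) < e" if ij: "i >= N" "j >= N" for i j
  proof -
   note c = closeD[OF N[OF ij(2,1)]]
   have "nz b (sh (f j) t) (sh (f i) t) <= 2*nz b (f j) (f i)" by (rule flow_diff[OF c(2,3) b c(4,5) order_refl t])
   thus ?thesis using c(6) e by linarith
  qed
  thus ?thesis by blast
 qed
 have G: "EX N. ALL i>=N. G (f i)" using closeD(2)[OF N] by blast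
 show "Cauchy (%i. xx b (f i) t)"
  unfolding Cauchy_def dist_norm
 proof (intro allI impI)
  fix e :: real assume "0 < e"
  from C[OF this] obtain N where N: "!!i j. i >= N ==> j >= N ==> nz b (sh (f j) t) (sh (f i) t) < e" by blast
  show "EX N. ALL i>=N. ALL j>=N. norm (xx b (f i) t - xx b (f j) t) < e"
  proof (intro exI allI impI)
   fix i j assume "i >= N" "j >= N"
   from N[OF this] show "norm (xx b (f i) t - xx b (f j) t) < e"
    using norm_fst_snd(1)[of "Dz b (sh (f j) t) (sh (f i) t)"] by (simp add: Dz_def sh_apply)
  qed
 qed
 show "Cauchy (%i. vv b (f i) t)"
  unfolding Cauchy_def dist_norm
 proof (intro allI impI)
  fix e :: real assume "0 < e"
  from C[OF this] obtain N where N: "!!i j. i >= N ==> j >= N ==> nz b (sh (f j) t) (sh (f i) t) < e" by blast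
  obtain N' where N': "!!i. i >= N' ==> G (f i)" using G by blast
  show "EX N. ALL i>=N. ALL j>=N. norm (vv b (f i) t - vv b (f j) t) < e"
  proof (intro exI allI impI)
   fix i j assume ij: "i >= max N N'" "j >= max N N'"
   hence "nz b (sh (f j) t) (sh (f i) t) < e" by (intro N) auto
   thus "norm (vv b (f i) t - vv b (f j) t) < e"
    using norm_fst_snd(2)[of "Dz b (sh (f j) t) (sh (f i) t)"] N' ij by (simp add: Dz_def geodesic_sh(2))
  qed
 qed
qed

lemma gcauchy_stay:
 assumes f: "gcauchy b f" shows "eventually (%i. G (f i) & (ALL t. \<bar>t\<bar> <= 4*T --> f i t \<in> inn 3 b)) sequentially"
 using gcauchyD(2)[OF f] by (rule eventually_mono) (use geo_stay[OF _ gcauchyD(1)[OF f] _ order_refl] in blast)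

lemma gcauchy_limit:
 assumes f: "gcauchy b f" and t: "\<bar>t\<bar> <= 4*T"
 obtains y where "y \<in> inn 3 b" "limitin X (%i. f i t) y sequentially"
proof -
 have b: "b \<in> B" by (rule gcauchyD(1)[OF f])
 have K: "compact (cmap (bch b) ` inn 3 b)"
  by (rule chart_image_compact[OF bA[OF b] inn_closed(1)[OF validB[OF b]]]) (auto simp: inn_def)
 obtain q where q: "(%i. xx b (f i) t) \<longlonglongrightarrow> q" using Cauchy_convergent[OF gcauchyD(3)[OF f t]] by (auto simp: convergent_def)
 have ev: "eventually (%i. f i t \<in> inn 3 b) sequentially" using gcauchy_stay[OF f] by (rule eventually_mono) (use t in blast)
 have "q \<in> cmap (bch b) ` inn 3 b"
  by (rule Lim_in_closed_set[OF compact_imp_closed[OF K] _ sequentially_bot q]) (use ev in \<open>auto elim: eventually_mono\<close>)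
 then obtain y where y: "y \<in> inn 3 b" "q = cmap (bch b) y" by auto
 have "eventually (%i. f i t \<in> cdom (bch b)) sequentially" using ev by (rule eventually_mono) (rule inn_dom)
 from limitin_chart[OF bA[OF b] inn_dom[OF y(1)] this] q y have "limitin X (%i. f i t) y sequentially" by simp
 thus ?thesis using that y(1) by blast
qed

text \<open>The positions at time \<open>t\<close> converge because \<open>inn 3 b\<close> has a
  compact image. The box chosen at their limit contains almost all of them, and this moves the
  Cauchy property to a new box.\<close>

lemma gcauchy_shift:
 assumes f: "gcauchy b f" and t: "\<bar>t\<bar> <= 3*T" shows "EX b. gcauchy b (%i. sh (f i) t)"
proof -
 have t4: "\<bar>t\<bar> <= 4*T" using t tau_pos by linarith
 obtain y where y: "y \<in> inn 3 b" "limitin X (%i. f i t) y sequentially" by (rule gcauchy_limit[OF f t4])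
 have yX: "y \<in> topspace X" using y(2) by (simp add: limitin_def)
 note b' = bx[OF yX]
 let ?b = "bx y"
 have b: "b \<in> B" by (rule gcauchyD(1)[OF f])
 have "openin X {z \<in> cdom (bch ?b). cmap (bch ?b) z \<in> ball (bpt ?b) (2*brad ?b)}"
  by (rule chart_preimage_open[OF bA[OF b'(1)] open_ball])
 moreover have "y \<in> {z \<in> cdom (bch ?b). cmap (bch ?b) z \<in> ball (bpt ?b) (2*brad ?b)}"
  using b'(2) brad_pos[OF b'(1)] by (simp add: inn_def dist_commute)
 ultimately have "eventually (%i. f i t \<in> {z \<in> cdom (bch ?b). cmap (bch ?b) z \<in> ball (bpt ?b) (2*brad ?b)}) sequentially"
  using y(2) unfolding limitin_def by blast
 hence "eventually (%i. f i t \<in> inn 2 ?b) sequentially" by (rule eventually_mono) (simp add: inn_def dist_commute)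
 then obtain N where N: "!!i. i >= N ==> f i t \<in> inn 2 ?b" unfolding eventually_sequentially by blast
 have "gcauchy ?b (%i. sh (f i) t)" unfolding gcauchy_def
 proof (intro allI impI)
  fix e :: real assume e: "0 < e"
  have "0 < min d0 (e/L)" using d0 e L1 by auto
  from f[unfolded gcauchy_def, rule_format, OF this] obtain N' where N': "!!i j. i >= N' ==> j >= N' ==> close b (min d0 (e/L)) (f i) (f j)" by blast
  show "EX N. ALL i>=N. ALL j>=N. close ?b e (sh (f i) t) (sh (f j) t)"
  proof (intro exI allI impI)
   fix i j assume ij: "i >= max N N'" "j >= max N N'"
   hence c: "close b (min d0 (e/L)) (f i) (f j)" using N' by simp
   have i2: "f i t \<in> inn 2 ?b" "f j t \<in> inn 2 ?b" using N ij by auto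
   have "nz ?b (sh (f i) t) (sh (f j) t) <= L*nz b (f i) (f j)"
    using near[OF close_mono[OF c min.cobounded1] b'(1) t order_refl i2(1)] by blast
   also have "... <= L*(e/L)" using closeD(6)[OF c] L1 by (intro mult_left_mono) auto
   also have "... = e" using L1 by simp
   finally show "close ?b e (sh (f i) t) (sh (f j) t)"
    using i2 b'(1) closeD(2,3)[OF c] by (simp add: close_def sh_apply geodesic_sh)
  qed
 qed
 thus ?thesis by blast
qed

lemma gcauchy_all:
 assumes f: "gcauchy b f" shows "EX b. gcauchy b (%i. sh (f i) t)"
proof -
 obtain n :: nat where n: "\<bar>t\<bar> / T < real n" using reals_Archimedean2 by blast
 have n0: "0 < real n" using n tau_pos by (meson abs_ge_zero divide_nonneg_pos le_less_trans)
 have t: "\<bar>t/real n\<bar> <= 3*T"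
 proof -
  have "\<bar>t\<bar> <= real n*T" using n tau_pos by (simp add: pos_divide_less_eq)
  also have "... <= real n*(3*T)" using tau_pos by (intro mult_left_mono) auto
  finally show ?thesis using n0 by (simp add: pos_divide_le_eq mult.commute)
 qed
 have "EX b. gcauchy b (%i. sh (f i) (real m*(t/real n)))" for m
 proof (induction m)
  case 0 show ?case using f by (intro exI[of _ b]) simp
 next
  case (Suc m)
  then obtain b where "gcauchy b (%i. sh (f i) (real m*(t/real n)))" by (elim exE)
  from gcauchy_shift[OF this t] have "EX b. gcauchy b (%i. sh (f i) (real m*(t/real n) + t/real n))" by simp
  moreover have "real m*(t/real n) + t/real n = real (Suc m)*(t/real n)" by (simp add: algebra_simps add_divide_distrib)
  ultimately show ?case by simp
 qed
 from this[of n] show ?thesis using n0 by simp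
qed

text \<open>\<open>C^3\<close> bounds the acceleration and \<open>3 * C^5\<close> its rate of
  change; both come from the constants of the box and are the same for all geodesics.\<close>

lemma geo_taylor:
 assumes g: "G g" and b: "b \<in> B" and st: "!!r. \<bar>r\<bar> <= Z ==> g r \<in> inn 3 b" and r: "\<bar>s\<bar> <= Z" "\<bar>t\<bar> <= Z"
 shows "norm (xx b g t - xx b g s - (t - s) *\<^sub>R vv b g s) <= C^3*\<bar>t - s\<bar>^2"
  "norm (vv b g t - vv b g s - (t - s) *\<^sub>R (- Gam (bch b) (xx b g s) (vv b g s) (vv b g s))) <= 3*C^5*\<bar>t - s\<bar>^2"
proof -
 have gen: "norm (x t - x s - (t - s) *\<^sub>R x' s) <= D*\<bar>t - s\<bar>^2"
  if x: "!!r. \<bar>r\<bar> <= Z ==> (x has_vector_derivative x' r) (at r)" and D: "0 <= D" "!!r. \<bar>r\<bar> <= Z ==> norm (x' r - x' s) <= D*\<bar>r - s\<bar>"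
  for x x' :: "real => real^2" and D
 proof -
  define h where "h q = x q - q *\<^sub>R x' s" for q
  have in_T: "\<bar>q\<bar> <= Z" if "min s t <= q" "q <= max s t" for q using that r by linarith
  have "norm (h (max s t) - h (min s t)) <= (D*\<bar>t - s\<bar>)*(max s t - min s t)"
  proof (rule mvt_norm)
   fix q assume q: "min s t <= q" "q <= max s t"
   show "(h has_vector_derivative x' q - x' s) (at q)"
    unfolding h_def by (rule derivative_eq_intros x[OF in_T[OF q]] | simp)+
   have "norm (x' q - x' s) <= D*\<bar>q - s\<bar>" by (rule D(2)[OF in_T[OF q]])
   also have "... <= D*\<bar>t - s\<bar>" using q D(1) by (intro mult_left_mono) auto
   finally show "norm (x' q - x' s) <= D*\<bar>t - s\<bar>" .
  qed (use D in auto)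
  moreover have "norm (h (max s t) - h (min s t)) = norm (x t - x s - (t - s) *\<^sub>R x' s)"
  proof (cases "s <= t")
   case True
   have "h t - h s = x t - x s - (t - s) *\<^sub>R x' s" by (simp add: h_def algebra_simps)
   thus ?thesis using True by (simp add: max_def min_def)
  next
   case False
   have "h t - h s = x t - x s - (t - s) *\<^sub>R x' s" by (simp add: h_def algebra_simps)
   thus ?thesis using False norm_minus_commute[of "h s" "h t"] by (simp add: max_def min_def)
  qed
  moreover have "max s t - min s t = \<bar>t - s\<bar>" by linarith
  ultimately show ?thesis by (simp only: power2_eq_square mult.assoc)
 qed
 have mv: "norm (xx b g q - xx b g s) <= C*\<bar>q - s\<bar>" "norm (vv b g q - vv b g s) <= C^3*\<bar>q - s\<bar>" if "\<bar>q\<bar> <= Z" for q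
 proof -
  have 1: "!!r. min s q <= r ==> r <= max s q ==> g r \<in> inn 3 b" by (rule st) (use r that in auto)
  show "norm (xx b g q - xx b g s) <= C*\<bar>q - s\<bar>" "norm (vv b g q - vv b g s) <= C^3*\<bar>q - s\<bar>" using geo_move[OF g b 1] by auto
 qed
 show "norm (xx b g t - xx b g s - (t - s) *\<^sub>R vv b g s) <= C^3*\<bar>t - s\<bar>^2"
  by (rule gen[of "%q. xx b g q"]) (use geo_deriv(1)[OF g b st] mv(2) C1 in auto)
 show "norm (vv b g t - vv b g s - (t - s) *\<^sub>R (- Gam (bch b) (xx b g s) (vv b g s) (vv b g s))) <= 3*C^5*\<bar>t - s\<bar>^2"
 proof (rule gen[of "%q. vv b g q" "%q. - Gam (bch b) (xx b g q) (vv b g q) (vv b g q)"])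
  fix q assume q: "\<bar>q\<bar> <= Z"
  show "((%q. vv b g q) has_vector_derivative - Gam (bch b) (xx b g q) (vv b g q) (vv b g q)) (at q)"
   by (rule geo_deriv(2)[OF g b st[OF q]])
  let ?x = "xx b g s" and ?y = "xx b g q" and ?u = "vv b g s" and ?w = "vv b g q" and ?c = "bch b"
  have K: "?x \<in> Kb b" "?y \<in> Kb b" using inn_K[OF b st[OF r(1)]] inn_K[OF b st[OF q]] by auto
  have sp: "norm ?u <= C" "norm ?w <= C" using speed[OF g b st[OF r(1)]] speed[OF g b st[OF q]] by auto
  let ?d = "\<bar>q - s\<bar>"
  have "norm (Gam ?c ?y ?w ?w - Gam ?c ?x ?w ?w) <= C*dist ?y ?x*norm ?w*norm ?w" by (rule GamL[OF b K])
  also have "... <= C*(C*?d)*C*C" using mv(1)[OF q] sp C1 by (intro mult_mono) (auto simp: dist_norm)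
  finally have 1: "norm (Gam ?c ?y ?w ?w - Gam ?c ?x ?w ?w) <= C^4*?d" by (simp add: power_eq_if algebra_simps)
  have "norm (Gam ?c ?x ?w (?w - ?u)) <= C*norm ?w*norm (?w - ?u)" by (rule GamC[OF b K(1)])
  also have "... <= C*C*(C^3*?d)" using mv(2)[OF q] sp C1 by (intro mult_mono) auto
  finally have 2: "norm (Gam ?c ?x ?w (?w - ?u)) <= C^5*?d" by (simp add: power_eq_if algebra_simps)
  have "norm (Gam ?c ?x (?w - ?u) ?u) <= C*norm (?w - ?u)*norm ?u" by (rule GamC[OF b K(1)])
  also have "... <= C*(C^3*?d)*C" using mv(2)[OF q] sp C1 by (intro mult_mono) auto
  finally have 3: "norm (Gam ?c ?x (?w - ?u) ?u) <= C^5*?d" by (simp add: power_eq_if algebra_simps)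
  have 4: "C^4*?d <= C^5*?d" using Cpow(2)[of 4 5] by (intro mult_right_mono) auto
  have "- Gam ?c ?y ?w ?w - - Gam ?c ?x ?u ?u = - (Gam ?c ?y ?w ?w - Gam ?c ?x ?w ?w) - Gam ?c ?x ?w (?w - ?u) - Gam ?c ?x (?w - ?u) ?u"
   by simp
  moreover have "norm (- a - b - d) <= norm a + norm b + norm d" for a b d :: "real^2"
   using norm_triangle_ineq4[of "- a - b" d] norm_triangle_ineq4[of "- a" b] by simp
  ultimately have "norm (- Gam ?c ?y ?w ?w - - Gam ?c ?x ?u ?u) <= norm (Gam ?c ?y ?w ?w - Gam ?c ?x ?w ?w) + norm (Gam ?c ?x ?w (?w - ?u)) + norm (Gam ?c ?x (?w - ?u) ?u)"
   by (simp only:)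
  thus "norm (- Gam ?c ?y ?w ?w - - Gam ?c ?x ?u ?u) <= 3*C^5*?d" using 1 2 3 4 by linarith
 next
  show "0 <= 3*C^5" using Cpow(1)[of 5] by linarith
 qed
qed

text \<open>The limit is taken pointwise at every time. The bounds of \<open>geo_taylor\<close> are
  uniform in \<open>i\<close> and pass to the limit, which therefore solves the geodesic equation.
  No solution has to be constructed, so the boundary causes no difficulty.\<close>

lemma gcauchy_convergent:
 assumes f: "gcauchy b0 f"
 obtains g where "gconv f g sequentially"
proof -
 have ex: "EX y. limitin X (%i. f i t) y sequentially" for t
 proof -
  from gcauchy_all[OF f, of t] obtain b where b: "gcauchy b (%i. sh (f i) t)" by (elim exE)
  have "\<bar>0\<bar> <= 4*T" using tau_pos by simp
  from gcauchy_limit[OF b this] obtain y where "limitin X (%i. sh (f i) t 0) y sequentially" by blast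
  thus ?thesis by (auto simp: sh_apply)
 qed
 define g where "g t = (SOME y. limitin X (%i. f i t) y sequentially)" for t
 have lim: "limitin X (%i. f i t) (g t) sequentially" for t unfolding g_def by (rule someI_ex[OF ex])
 define v where "v b t = lim (%i. vv b (f i) t)" for b t
 let ?Q = "%b s. g s \<in> cdom (bch b) & ((%s. xx b g s) has_vector_derivative v b s) (at s) & (v b has_vector_derivative - Gam (bch b) (xx b g s) (v b s) (v b s)) (at s) & ip (bch b) (xx b g s) (v b s) (v b s) = 1"
 have local: "g (t + s) \<in> inn 3 b & ((%i. xx b (f i) (t + s)) \<longlonglongrightarrow> cmap (bch b) (g (t + s))) & (%i. vv b (f i) (t + s)) \<longlonglongrightarrow> v b (t + s)"
  if b: "gcauchy b (%i. sh (f i) t)" and s: "\<bar>s\<bar> <= 4*T" for b t s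
 proof -
  have bB: "b \<in> B" by (rule gcauchyD(1)[OF b])
  have ev: "eventually (%i. G (f i) & f i (t + s) \<in> inn 3 b) sequentially"
   using gcauchy_stay[OF b]
  proof (rule eventually_mono)
   fix i assume i: "G (sh (f i) t) & (ALL s. \<bar>s\<bar> <= 4*T --> sh (f i) t s \<in> inn 3 b)"
   hence "G (sh (sh (f i) t) (- t))" by (intro geodesic_sh(1)[OF conjunct1])
   thus "G (f i) & f i (t + s) \<in> inn 3 b" using i s by (auto simp: sh_apply add.commute)
  qed
  have 1: "g (t + s) \<in> inn 3 b"
   by (rule limitin_closedin[OF lim inn_closed(2)[OF validB[OF bB]] eventually_mono[OF ev] sequentially_bot]) simp_all
  have ed: "eventually (%i. f i (t + s) \<in> cdom (bch b)) sequentially" using ev by (rule eventually_mono) (auto intro: inn_dom)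
  have 2: "(%i. xx b (f i) (t + s)) \<longlonglongrightarrow> cmap (bch b) (g (t + s))"
   using limitin_chart[OF bA[OF bB] inn_dom[OF 1] ed] lim by blast
  have "Cauchy (%i. vv b (sh (f i) t) s)" by (rule gcauchyD(4)[OF b s])
  then obtain l where "(%i. vv b (sh (f i) t) s) \<longlonglongrightarrow> l" using Cauchy_convergent convergent_def by blast
  moreover have "eventually (%i. vv b (sh (f i) t) s = vv b (f i) (t + s)) sequentially"
   using ev by (rule eventually_mono) (simp add: geodesic_sh(2) add.commute)
  ultimately have l: "(%i. vv b (f i) (t + s)) \<longlonglongrightarrow> l" by (rule Lim_transform_eventually)
  hence "(%i. vv b (f i) (t + s)) \<longlonglongrightarrow> v b (t + s)" unfolding v_def by (simp add: limI)
  thus ?thesis using 1 2 by blast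
 qed
 have der: "((%q. xx b g q) has_vector_derivative v b (t + s)) (at (t + s)) &
   (v b has_vector_derivative - Gam (bch b) (xx b g (t + s)) (v b (t + s)) (v b (t + s))) (at (t + s)) &
   ip (bch b) (xx b g (t + s)) (v b (t + s)) (v b (t + s)) = 1"
  if b: "gcauchy b (%i. sh (f i) t)" and s: "\<bar>s\<bar> < 4*T" for b t s
 proof -
  have bB: "b \<in> B" by (rule gcauchyD(1)[OF b])
  have s': "\<bar>s\<bar> <= 4*T" using s by simp
  note L0 = local[OF b s']
  have xi: "eventually (%i. xx b (f i) (t + s) \<in> cimg (bch b)) sequentially"
   using gcauchy_stay[OF b] by (rule eventually_mono) (use s' in \<open>auto simp: sh_apply add.commute dest!: spec[of _ s] inn_dom\<close>)
  have xc: "cmap (bch b) (g (t + s)) \<in> cimg (bch b)" by (rule imageI[OF inn_dom[OF conjunct1[OF L0]]])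
  note GT = Gam_tendsto[OF bA[OF bB] conjunct1[OF conjunct2[OF L0]] xc xi conjunct2[OF conjunct2[OF L0]]]
  have ev: "eventually (%i. G (sh (f i) t) & (ALL r. \<bar>r\<bar> <= 4*T --> sh (f i) t r \<in> inn 3 b)) sequentially" by (rule gcauchy_stay[OF b])
  have vsh: "vel (sh (f i) t) r c = vel (f i) (t + r) c" if "G (sh (f i) t)" for i r c
  proof -
   have "G (sh (sh (f i) t) (- t))" using that by (rule geodesic_sh)
   hence "G (f i)" by simp
   from geodesic_sh(2)[OF this, of t r] show ?thesis by (simp add: add.commute)
  qed
  have e: "0 < 4*T - \<bar>s\<bar>" using s by simp
  have q4: "\<bar>q - t\<bar> <= 4*T" if "\<bar>q - (t + s)\<bar> < 4*T - \<bar>s\<bar>" for q using that by linarith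
  let ?R = "%i q. norm (xx b (f i) q - xx b (f i) (t + s) - (q - (t + s)) *\<^sub>R vv b (f i) (t + s)) <= C^3*\<bar>q - (t + s)\<bar>^2 & norm (vv b (f i) q - vv b (f i) (t + s) - (q - (t + s)) *\<^sub>R (- Gam (bch b) (xx b (f i) (t + s)) (vv b (f i) (t + s)) (vv b (f i) (t + s)))) <= 3*C^5*\<bar>q - (t + s)\<bar>^2"
  have tay: "eventually (%i. ?R i q) sequentially"
   if q: "\<bar>q - t\<bar> <= 4*T" for q
   using ev
  proof (rule eventually_mono)
   fix i assume i: "G (sh (f i) t) & (ALL r. \<bar>r\<bar> <= 4*T --> sh (f i) t r \<in> inn 3 b)"
   have st: "sh (f i) t r \<in> inn 3 b" if "\<bar>r\<bar> <= 4*T" for r using i that by blast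
   have e: "q - t - s = q - (t + s)" "sh (f i) t (q - t) = f i q" "sh (f i) t s = f i (t + s)" "t + (q - t) = q"
    by (simp_all add: sh_apply add.commute)
   from geo_taylor[OF conjunct1[OF i] bB st s' q] show "?R i q"
    unfolding vsh[OF conjunct1[OF i]] e by (rule conjI)
  qed
  have lim_at: "(%i. xx b (f i) q) \<longlonglongrightarrow> cmap (bch b) (g q) & (%i. vv b (f i) q) \<longlonglongrightarrow> v b q" if "\<bar>q - t\<bar> <= 4*T" for q
   using local[OF b that] by simp
  have D1: "((%q. xx b g q) has_vector_derivative v b (t + s)) (at (t + s))"
  proof (rule has_vector_derivative_quadratic[OF e])
   fix q assume q: "\<bar>q - (t + s)\<bar> < 4*T - \<bar>s\<bar>"
   have "(%i. norm (xx b (f i) q - xx b (f i) (t + s) - (q - (t + s)) *\<^sub>R vv b (f i) (t + s))) \<longlonglongrightarrow> norm (xx b g q - xx b g (t + s) - (q - (t + s)) *\<^sub>R v b (t + s))"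
    using lim_at[OF q4[OF q]] L0 by (intro tendsto_intros) auto
   thus "norm (xx b g q - xx b g (t + s) - (q - (t + s)) *\<^sub>R v b (t + s)) <= C^3*\<bar>q - (t + s)\<bar>^2"
    by (rule tendsto_upperbound[OF _ eventually_mono[OF tay[OF q4[OF q]]] sequentially_bot]) (erule conjunct1)
  qed
  have D2: "(v b has_vector_derivative - Gam (bch b) (xx b g (t + s)) (v b (t + s)) (v b (t + s))) (at (t + s))"
  proof (rule has_vector_derivative_quadratic[OF e])
   fix q assume q: "\<bar>q - (t + s)\<bar> < 4*T - \<bar>s\<bar>"
   have "(%i. norm (vv b (f i) q - vv b (f i) (t + s) - (q - (t + s)) *\<^sub>R (- Gam (bch b) (xx b (f i) (t + s)) (vv b (f i) (t + s)) (vv b (f i) (t + s))))) \<longlonglongrightarrow>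
    norm (v b q - v b (t + s) - (q - (t + s)) *\<^sub>R (- Gam (bch b) (xx b g (t + s)) (v b (t + s)) (v b (t + s))))"
    using lim_at[OF q4[OF q]] L0 GT(1) by (intro tendsto_intros) auto
   thus "norm (v b q - v b (t + s) - (q - (t + s)) *\<^sub>R (- Gam (bch b) (xx b g (t + s)) (v b (t + s)) (v b (t + s)))) <= 3*C^5*\<bar>q - (t + s)\<bar>^2"
    by (rule tendsto_upperbound[OF _ eventually_mono[OF tay[OF q4[OF q]]] sequentially_bot]) (erule conjunct2)
  qed
  have "eventually (%i. ip (bch b) (xx b (f i) (t + s)) (vv b (f i) (t + s)) (vv b (f i) (t + s)) = 1) sequentially"
   using ev
  proof (rule eventually_mono)
   fix i assume i: "G (sh (f i) t) & (ALL r. \<bar>r\<bar> <= 4*T --> sh (f i) t r \<in> inn 3 b)"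
   have "sh (f i) t s \<in> inn 3 b" using i s' by blast
   moreover have e: "sh (f i) t s = f i (t + s)" by (simp add: sh_apply add.commute)
   ultimately show "ip (bch b) (xx b (f i) (t + s)) (vv b (f i) (t + s)) (vv b (f i) (t + s)) = 1"
    using geo_unit[OF conjunct1[OF i] bB] unfolding vsh[OF conjunct1[OF i], symmetric] e[symmetric] by blast
  qed
  hence "(%i. ip (bch b) (xx b (f i) (t + s)) (vv b (f i) (t + s)) (vv b (f i) (t + s))) \<longlonglongrightarrow> 1" by (rule tendsto_eventually)
  from LIMSEQ_unique[OF GT(2) this] D1 D2 show ?thesis by blast
 qed
 have "G g"
 proof (rule complete_geodesicI)
  have nb: "EX b S. b \<in> B & open S & t \<in> S & (ALL s:S. ?Q b s)" for t
  proof -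
   from gcauchy_all[OF f, of t] obtain b where b: "gcauchy b (%i. sh (f i) t)" by (elim exE)
   show ?thesis
   proof (intro exI conjI ballI)
    show "b \<in> B" by (rule gcauchyD(1)[OF b])
    show "open (ball t (4*T))" "t \<in> ball t (4*T)" using tau_pos by auto
    fix s assume "s \<in> ball t (4*T)"
    hence s: "\<bar>s - t\<bar> < 4*T" "\<bar>s - t\<bar> <= 4*T" by (auto simp: dist_real_def abs_minus_commute)
    show "g s \<in> cdom (bch b)" using inn_dom[OF conjunct1[OF local[OF b s(2)]]] by simp
    show "((%s. xx b g s) has_vector_derivative v b s) (at s)" "(v b has_vector_derivative - Gam (bch b) (xx b g s) (v b s) (v b s)) (at s)"
     "ip (bch b) (xx b g s) (v b s) (v b s) = 1" using der[OF b s(1)] by simp_all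
   qed
  qed
  show "EX c S w. c \<in> \<A> & open S & t \<in> S & (ALL s:S. g s \<in> cdom c & ((%s. cmap c (g s)) has_vector_derivative w s) (at s) &
   (w has_vector_derivative - Gam c (cmap c (g s)) (w s) (w s)) (at s) & ip c (cmap c (g s)) (w s) (w s) = 1)" for t
  proof -
   from nb[of t] obtain b S where n: "b \<in> B" "open S" "t \<in> S" "ALL s:S. ?Q b s" by (elim exE conjE) (rule that)
   show ?thesis by (intro exI[of _ "bch b"] exI[of _ S] exI[of _ "v b"] conjI bA n)
  qed
  show "continuous_map euclideanreal X g"
   unfolding continuous_map_def
  proof (intro conjI allI impI)
   show "g \<in> topspace euclideanreal \<rightarrow> topspace X" using lim by (simp add: limitin_def)
   fix V assume V: "openin X V"
   have "EX T. open T & t \<in> T & T <= {s. g s \<in> V}" if "g t \<in> V" for t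
   proof -
    from nb[of t] obtain b S where n: "b \<in> B" "open S" "t \<in> S" "ALL s:S. ?Q b s" by (elim exE conjE) (rule that)
    have bS: "b \<in> B" "open S" "t \<in> S" "!!s. s \<in> S ==> g s \<in> cdom (bch b)" "!!s. s \<in> S ==> ((%s. xx b g s) has_vector_derivative v b s) (at s)"
     using n by simp_all
    have "continuous_on S (%s. xx b g s)"
     using bS(5) by (meson continuous_at_imp_continuous_on has_vector_derivative_continuous)
    with bS(4) have "continuous_map (top_of_set S) X g" by (rule chart_curve_continuous[OF bA[OF bS(1)]])
    hence "openin (top_of_set S) {s \<in> S. g s \<in> V}" using V unfolding continuous_map_def by simp
    hence "open {s \<in> S. g s \<in> V}" using bS(2) openin_open_eq by blast
    thus ?thesis using that bS(3) by (intro exI[of _ "{s \<in> S. g s \<in> V}"]) auto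
   qed
   hence "open {s. g s \<in> V}" by (subst open_subopen) auto
   thus "openin euclideanreal {x \<in> topspace euclideanreal. g x \<in> V}" by simp
  qed
 qed
 moreover have "eventually (%i. close b0 e g (f i)) sequentially" if e: "0 < e" for e
 proof -
  have b0: "gcauchy b0 (%i. sh (f i) 0)" using f by simp
  have bB: "b0 \<in> B" by (rule gcauchyD(1)[OF f])
  have z: "\<bar>0\<bar> <= 4*T" "\<bar>0\<bar> < 4*T" using tau_pos by auto
  note l = local[OF b0 z(1)] and d = der[OF b0 z(2)]
  have v0: "vv b0 g 0 = v b0 0"
  proof (rule velocity_eq[OF bA[OF bB]])
   show "g 0 \<in> cdom (bch b0)" using inn_dom[OF conjunct1[OF l]] by simp
   show "((%q. xx b0 g q) has_vector_derivative v b0 0) (at 0)" using conjunct1[OF d] by simp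
  qed
  have g2: "g 0 \<in> inn 2 b0"
   by (rule limitin_closedin[OF lim inn_closed(2)[OF validB[OF bB]] eventually_mono[OF gcauchyD(2)[OF f]] sequentially_bot]) simp_all
  have "(%i. nz b0 g (f i)) \<longlonglongrightarrow> norm ((cmap (bch b0) (g 0) - xx b0 g 0, v b0 0 - vv b0 g 0))"
   unfolding Dz_def using l by (intro tendsto_intros) auto
  hence "(%i. nz b0 g (f i)) \<longlonglongrightarrow> 0" by (simp add: v0 zero_prod_def[symmetric])
  hence "eventually (%i. nz b0 g (f i) < e) sequentially" using e by (rule order_tendstoD(2))
  thus ?thesis using gcauchyD(2)[OF f]
   by eventually_elim (use \<open>G g\<close> g2 bB in \<open>simp add: close_def\<close>)
 qed
 ultimately have "gconv f g sequentially" by (intro gconvI[where b=b0]) auto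
 thus ?thesis using that by blast
qed

end

section \<open>Stability of transverse intersections, and limits of simple geodesics\<close>

context riem begin

lemma abs_cross_le: "\<bar>cross u w\<bar> <= 2*norm u*norm w"
proof -
 have "\<bar>cross u w\<bar> <= \<bar>u$1\<bar> * \<bar>w$2\<bar> + \<bar>u$2\<bar> * \<bar>w$1\<bar>"
  unfolding cross_def abs_mult[symmetric] by (rule abs_triangle_ineq4)
 also have "... <= norm u*norm w + norm u*norm w"
  by (intro add_mono mult_mono component_le_norm_cart) auto
 finally show ?thesis by simp
qed

lemma cross_lin:
 "cross (u + v) w = cross u w + cross v w" "cross w (u + v) = cross w u + cross w v"
 "cross (u - v) w = cross u w - cross v w" "cross w (u - v) = cross w u - cross w v"
 "cross (a *\<^sub>R u) w = a * cross u w" "cross w (a *\<^sub>R u) = a * cross w u"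
 "cross u u = 0" "cross u w = - cross w u"
 by (simp_all add: cross_def algebra_simps)

text \<open>Brouwer's fixed point theorem, applied to the map that solves the linearized intersection problem.\<close>

lemma crossing:
 fixes x y :: "real => real^2"
 assumes d: "cross v w ~= 0" and r: "0 < r"
  and x: "continuous_on {-r..r} x" "!!t. \<bar>t\<bar> <= r ==> norm (x t - p - t *\<^sub>R v) <= e"
  and y: "continuous_on {-r..r} y" "!!t. \<bar>t\<bar> <= r ==> norm (y t - p - t *\<^sub>R w) <= e"
  and e: "4*(norm v + norm w)*e <= r*\<bar>cross v w\<bar>"
 obtains s t where "\<bar>s\<bar> <= r" "\<bar>t\<bar> <= r" "x s = y t"
proof -
 let ?A = "cross v w" and ?B = "norm v + norm w"
 \<comment> \<open>Cramer's rule: \<open>g u\<close> has the coefficients \<open>a\<close>,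
   \<open>b\<close> with \<open>a *\<^sub>R v - b *\<^sub>R w = u\<close>. So the fixed points of
   \<open>h\<close> below are the parameters at which the curves meet, and for straight lines
   \<open>h\<close> would be constantly 0.\<close>
 define g :: "real^2 => real^2" where "g u = (\<chi> i. if i = 1 then cross u w/?A else - cross v u/?A)" for u
 define F where "F q = x (q$1) - y (q$2)" for q :: "real^2"
 define h where "h q = q - g (F q)" for q
 have comp: "\<bar>q$i\<bar> <= r" if "q \<in> cball 0 r" for q :: "real^2" and i
  using that component_le_norm_cart[of q i] by simp
 have comp': "q$i \<in> {-r..r}" if "q \<in> cball 0 r" for q :: "real^2" and i
  using comp[OF that, of i] by (auto simp: abs_le_iff)
 have gb: "norm (g u) <= 2*?B*norm u/\<bar>?A\<bar>" for u
 proof -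
  have "norm (g u) <= \<bar>g u $ 1\<bar> + \<bar>g u $ 2\<bar>" by (rule norm_comp)
  also have "... = (\<bar>cross u w\<bar> + \<bar>cross v u\<bar>)/\<bar>?A\<bar>" by (simp add: g_def add_divide_distrib)
  also have "... <= (2*norm u*norm w + 2*norm v * norm u)/\<bar>?A\<bar>"
   by (intro divide_right_mono add_mono abs_cross_le) auto
  finally show ?thesis by (simp add: algebra_simps)
 qed
 have gA: "g (a *\<^sub>R v - b *\<^sub>R w) = (\<chi> i. if i = 1 then a else b)" for a b
  using d by (simp add: g_def vec_eq_iff cross_lin(3,4,5,6,7))
 have gl: "g (u - z) = g u - g z" for u z
  by (simp add: g_def vec_eq_iff cross_lin(3,4) diff_divide_distrib)
 have Ae: "norm (F q - ((q$1) *\<^sub>R v - (q$2) *\<^sub>R w)) <= 2*e" if "q \<in> cball 0 r" for q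
 proof -
  have "F q - ((q$1) *\<^sub>R v - (q$2) *\<^sub>R w) = (x (q$1) - p - (q$1) *\<^sub>R v) - (y (q$2) - p - (q$2) *\<^sub>R w)" by (simp add: F_def)
  hence "norm (F q - ((q$1) *\<^sub>R v - (q$2) *\<^sub>R w)) = norm ((x (q$1) - p - (q$1) *\<^sub>R v) - (y (q$2) - p - (q$2) *\<^sub>R w))" by (simp only:)
  thus ?thesis using norm_triangle_ineq4[of "x (q$1) - p - (q$1) *\<^sub>R v" "y (q$2) - p - (q$2) *\<^sub>R w"]
   add_mono[OF x(2)[OF comp[OF that]] y(2)[OF comp[OF that]], of 1 2] by linarith
 qed
 have hm: "h q \<in> cball 0 r" if q: "q \<in> cball 0 r" for q
 proof -
  have "h q = g ((q$1) *\<^sub>R v - (q$2) *\<^sub>R w) - g (F q)" unfolding gA h_def by (simp add: vec_eq_iff) (metis exhaust_2)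
  hence "norm (h q) = norm (g ((q$1) *\<^sub>R v - (q$2) *\<^sub>R w - F q))" by (simp add: gl)
  also have "... <= 2*?B*norm ((q$1) *\<^sub>R v - (q$2) *\<^sub>R w - F q)/\<bar>?A\<bar>" by (rule gb)
  also have "... <= 2*?B*(2*e)/\<bar>?A\<bar>"
   using Ae[OF q] by (intro divide_right_mono mult_left_mono) (auto simp: norm_minus_commute)
  also have "... <= r" using e d by (simp add: pos_divide_le_eq algebra_simps)
  finally show ?thesis by simp
 qed
 have Fc: "continuous_on (cball 0 r) F"
  unfolding F_def
 proof (intro continuous_intros)
  show "continuous_on (cball 0 r) (%q::real^2. x (q$1))"
   by (rule continuous_on_compose2[OF x(1)]) (intro continuous_intros, use comp' in blast)
  show "continuous_on (cball 0 r) (%q::real^2. y (q$2))"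
   by (rule continuous_on_compose2[OF y(1)]) (intro continuous_intros, use comp' in blast)
 qed
 have hc: "continuous_on (cball 0 r) h"
  unfolding h_def g_def
 proof (intro continuous_on_diff continuous_on_id continuous_on_vec_lambda)
  fix i :: 2
  show "continuous_on (cball 0 r) (%q. if i = 1 then cross (F q) w/?A else - cross v (F q)/?A)"
   unfolding cross_def by (cases "i = 1"; simp; intro continuous_intros Fc; use d in \<open>simp add: cross_def\<close>)
 qed
 obtain q where q: "q \<in> cball 0 r" "h q = q"
  by (rule brouwer[OF compact_cball convex_cball _ hc]) (use r hm in auto)
 hence "g (F q) = 0" by (simp add: h_def)
 hence "g (F q) $ 1 = 0" "g (F q) $ 2 = 0" by simp_all
 hence z: "cross (F q) w = 0" "cross v (F q) = 0" using d by (simp_all add: g_def)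
 have "?A *\<^sub>R F q = cross (F q) w *\<^sub>R v + cross v (F q) *\<^sub>R w"
  by (simp add: vec_eq_iff forall_2 cross_def algebra_simps)
 hence "F q = 0" using z d by simp
 hence "x (q$1) = y (q$2)" by (simp add: F_def)
 thus ?thesis using that comp[OF q(1)] by blast
qed

end

context tracking begin

lemma line_of_scale: assumes "r ~= 0" shows "line_of (%c. r *\<^sub>R \<xi> c) = line_of (\<xi> :: 'a tvec)"
proof -
 have "(%c. q *\<^sub>R r *\<^sub>R \<xi> c) = (%c. (q*r) *\<^sub>R \<xi> c)" "(%c. q *\<^sub>R \<xi> c) = (%c. (q/r) *\<^sub>R r *\<^sub>R \<xi> c)" for q using assms by auto
 thus ?thesis unfolding line_of_def by blast
qed

lemma line_eqI:
 assumes g: "G g" and b: "b \<in> B" "g s \<in> inn n b" and eq: "g s = g t" and z: "cross (vv b g s) (vv b g t) = 0"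
 shows "line_of (vel g s) = line_of (vel g t)"
proof -
 let ?v = "vel g"
 have dom: "g s \<in> cdom (bch b)" "g t \<in> cdom (bch b)" using inn_dom[OF b(2)] eq by auto
 have u: "ip (bch b) (xx b g s) (vv b g s) (vv b g s) = 1" "ip (bch b) (xx b g s) (vv b g t) (vv b g t) = 1"
  using geo_unit[OF g b] geodesic_chart(3)[OF g bA[OF b(1)] dom(2)] eq by simp_all
 hence nz: "vv b g s ~= 0" "vv b g t ~= 0" by auto
 obtain r where r: "vv b g t = r *\<^sub>R vv b g s"
 proof (cases "vv b g s $ 1 = 0")
  case True
  hence "vv b g s $ 2 ~= 0" using nz(1) by (auto simp: vec_eq_iff forall_2)
  hence "vv b g t = (vv b g t $ 2/vv b g s $ 2) *\<^sub>R vv b g s" using z True by (simp add: vec_eq_iff forall_2 cross_def)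
  thus ?thesis by (rule that)
 next
  case False
  hence "vv b g t = (vv b g t $ 1/vv b g s $ 1) *\<^sub>R vv b g s" using z by (simp add: vec_eq_iff forall_2 cross_def field_simps)
  thus ?thesis by (rule that)
 qed
 have r0: "r ~= 0" using r nz by auto
 have "?v t c = r *\<^sub>R ?v s c" for c
 proof (cases "c \<in> \<A> & g s \<in> cdom c")
  case True
  have po: "xx b g s \<in> overlap (bch b) c" using dom True by (auto simp: overlap_def)
  have "?v t c = DT (bch b) c (xx b g t) (vv b g t)" "?v s c = DT (bch b) c (xx b g s) (vv b g s)"
   using geodesic_chart(4)[OF g bA[OF b(1)] dom(1), of c] geodesic_chart(4)[OF g bA[OF b(1)] dom(2), of c] True eq by auto
  thus ?thesis using r eq linear_scale[OF DT_has_derivative(3)[OF bA[OF b(1)] conjunct1[OF True] po]] by simp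
 next
  case False thus ?thesis using eq by (auto simp: velocity_def)
 qed
 hence vt: "?v t = (%c. r *\<^sub>R ?v s c)" by auto
 show ?thesis unfolding vt by (rule line_of_scale[OF r0, symmetric])
qed

text \<open>A transverse self-intersection of the limit persists, by \<open>crossing\<close>, in the
  approximating geodesics, which are nearly straight over short times. There the two velocities are
  parallel by simplicity, yet close to the transverse velocities of the limit.\<close>

lemma gconv_simple:
 assumes f: "gconv f g F" "F ~= bot" and s: "!!i. SG (f i)"
 shows "SG g"
 unfolding simple_complete_geodesic_def
proof (intro conjI allI impI)
 show g: "G g" by (rule gconv_G[OF f(1)])
 fix s1 s2 assume eq: "g s1 = g s2"
 note bb = bx[OF geo_top[OF g, of s1]]
 define b where "b = bx (g s1)"
 have b: "b \<in> B" "g s1 \<in> inn 1 b" using bb by (simp_all add: b_def)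
 define v w where "v = vv b g s1" and "w = vv b g s2"
 have "cross v w = 0"
 proof (rule ccontr)
  assume d: "cross v w ~= 0"
  define D where "D = \<bar>cross v w\<bar>"
  have D: "0 < D" using d by (simp add: D_def)
  have sp: "norm v <= C" "norm w <= C" using speed[OF g b] speed[OF g b(1), of s2 1] b(2) eq by (simp_all add: v_def w_def)
  \<comment> \<open>For times up to \<open>r\<close> the curves follow the tangent lines up to
    \<open>2 * e + C^3 * r^2\<close>. First \<open>r\<close> and then \<open>e\<close> are chosen so
    small compared with \<open>D\<close> that \<open>crossing\<close> applies and the velocities
    vary too little to become parallel.\<close>
  define r where "r = min T (D/(32*C^4))"
  define e where "e = min d0 (r*D/(64*C))"
  have C0: "0 < C" "0 < 32*C^4" "0 < 64*C" using C1 by auto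
  have r: "0 < r" "r <= T" "r <= D/(32*C^4)" using tau_pos D C0 by (auto simp: r_def)
  have e: "0 < e" "e <= d0" "e <= r*D/(64*C)" using d0 r(1) D C0 by (auto simp: e_def)
  have t1: "T <= 1"
  proof -
   have "T * 1 <= T * (40*C^4)" using Cpow(1)[of 4] tau_pos by (intro mult_left_mono) linarith+
   thus ?thesis using tau1 by (simp add: mult.commute)
  qed
  have rC: "32*(C^4*r) <= D" "64*(C*e) <= r*D"
   using r(3) e(3) C0 by (simp_all add: pos_le_divide_eq mult_ac)
  have "eventually (%i. close b e (sh g s1) (sh (f i) s1)) F" "eventually (%i. close b e (sh g s2) (sh (f i) s2)) F"
   using gconv_sh[OF f(1), of s1] gconv_sh[OF f(1), of s2] e(1) eq unfolding gconv_def b_def by (simp_all add: sh_apply)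
  hence "eventually (%i. close b e (sh g s1) (sh (f i) s1) & close b e (sh g s2) (sh (f i) s2)) F" by (rule eventually_conj)
  then obtain i where i: "close b e (sh g s1) (sh (f i) s1)" "close b e (sh g s2) (sh (f i) s2)"
   using eventually_happens'[OF f(2)] by blast
  have near_line: "norm (xx b (sh (f i) q) t - xx b g s1 - t *\<^sub>R vv b g q) <= 2*e + C^3*r^2"
   "norm (vv b (sh (f i) q) t - vv b g q) <= e + C^3*r" "sh (f i) q t \<in> inn 3 b"
   "continuous_on {-r..r} (%t. xx b (sh (f i) q) t)"
   if q: "close b e (sh g q) (sh (f i) q)" "g q = g s1" and t: "\<bar>t\<bar> <= r" for q t
  proof -
   note c = closeD[OF q(1)]
   have st: "sh (f i) q t \<in> inn 3 b" if "\<bar>t\<bar> <= 4*T" for t by (rule geo_stay[OF c(3,1,5) order_refl that])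
   have t4: "\<bar>t\<bar> <= 4*T" "\<bar>0\<bar> <= 4*T" using t r(2) tau_pos by auto
   show "sh (f i) q t \<in> inn 3 b" by (rule st[OF t4(1)])
   have Dz0: "norm (xx b (sh (f i) q) 0 - xx b g s1) <= e" "norm (vv b (sh (f i) q) 0 - vv b g q) <= e"
    using c(6) norm_fst_snd(1,2)[of "Dz b (sh g q) (sh (f i) q)"] q(2) by (simp_all add: Dz_def sh_apply geodesic_sh(2)[OF g])
   have T: "norm (xx b (sh (f i) q) t - xx b (sh (f i) q) 0 - t *\<^sub>R vv b (sh (f i) q) 0) <= C^3*\<bar>t\<bar>^2"
    using geo_taylor(1)[OF c(3,1) st t4(2,1)] by simp
   have Ct: "C^3*\<bar>t\<bar>^2 <= C^3*r^2" using t C1 by (intro mult_left_mono power_mono) auto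
   have te: "norm (t *\<^sub>R (vv b (sh (f i) q) 0 - vv b g q)) <= 1*e"
    unfolding norm_scaleR using t r(2) t1 Dz0(2) by (intro mult_mono) auto
   have "xx b (sh (f i) q) t - xx b g s1 - t *\<^sub>R vv b g q =
    (xx b (sh (f i) q) t - xx b (sh (f i) q) 0 - t *\<^sub>R vv b (sh (f i) q) 0) + (xx b (sh (f i) q) 0 - xx b g s1) + t *\<^sub>R (vv b (sh (f i) q) 0 - vv b g q)"
    by (simp add: algebra_simps)
   moreover have "norm (p + q + u) <= norm p + norm q + norm u" for p q u :: "real^2"
    using norm_triangle_ineq[of "p + q" u] norm_triangle_ineq[of p q] by linarith
   ultimately have "norm (xx b (sh (f i) q) t - xx b g s1 - t *\<^sub>R vv b g q) <=
    norm (xx b (sh (f i) q) t - xx b (sh (f i) q) 0 - t *\<^sub>R vv b (sh (f i) q) 0) + norm (xx b (sh (f i) q) 0 - xx b g s1) + norm (t *\<^sub>R (vv b (sh (f i) q) 0 - vv b g q))"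
    by (simp only:)
   thus "norm (xx b (sh (f i) q) t - xx b g s1 - t *\<^sub>R vv b g q) <= 2*e + C^3*r^2"
    using T Dz0(1) Ct te by linarith
   have st0: "!!u. min 0 t <= u ==> u <= max 0 t ==> sh (f i) q u \<in> inn 3 b" by (rule st) (use t4 in linarith)
   have "norm (vv b (sh (f i) q) t - vv b (sh (f i) q) 0) <= C^3*\<bar>t - 0\<bar>" by (rule geo_move(2)[OF c(3,1) st0])
   also have "... <= C^3*r" using t C1 by (intro mult_left_mono) auto
   finally show "norm (vv b (sh (f i) q) t - vv b g q) <= e + C^3*r"
    using norm_triangle_ineq[of "vv b (sh (f i) q) t - vv b (sh (f i) q) 0" "vv b (sh (f i) q) 0 - vv b g q"] Dz0(2) by simp
   show "continuous_on {-r..r} (%t. xx b (sh (f i) q) t)"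
   proof (intro continuous_at_imp_continuous_on ballI)
    fix u assume "u \<in> {-r..r}"
    hence "\<bar>u\<bar> <= 4*T" using r(2) tau_pos by auto
    from geo_deriv(1)[OF c(3,1) st[OF this]] show "isCont (%t. xx b (sh (f i) q) t) u" by (rule has_vector_derivative_continuous)
   qed
  qed
  have z: "\<bar>0\<bar> <= r" using r(1) by simp
  obtain a a' where a: "\<bar>a\<bar> <= r" "\<bar>a'\<bar> <= r" "xx b (sh (f i) s1) a = xx b (sh (f i) s2) a'"
  proof (rule crossing[OF d r(1) near_line(4)[OF i(1) refl z] _ near_line(4)[OF i(2) eq[symmetric] z]])
   show "norm (xx b (sh (f i) s1) t - xx b g s1 - t *\<^sub>R v) <= 2*e + C^3*r^2" if "\<bar>t\<bar> <= r" for t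
    using near_line(1)[OF i(1) refl that] by (simp add: v_def)
   show "norm (xx b (sh (f i) s2) t - xx b g s1 - t *\<^sub>R w) <= 2*e + C^3*r^2" if "\<bar>t\<bar> <= r" for t
    using near_line(1)[OF i(2) eq[symmetric] that] by (simp add: w_def)
   have "0 <= 2*e + C^3*r^2" using e(1) C1 by simp
   hence "4*(norm v + norm w)*(2*e + C^3*r^2) <= 4*(C + C)*(2*e + C^3*r^2)"
    using sp by (intro mult_right_mono) auto
   also have "... = 16*(C*e) + 8*(C^4*r)*r" by (simp add: algebra_simps power_eq_if)
   also have "... <= r*D/4 + D/4*r"
   proof -
    have "8*(C^4*r)*r <= D/4*r" using rC(1) r(1) by (intro mult_right_mono) auto
    thus ?thesis using rC(2) by linarith
   qed
   also have "... <= r*D" using r(1) D by (simp add: algebra_simps)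
   finally show "4*(norm v + norm w)*(2*e + C^3*r^2) <= r*\<bar>cross v w\<bar>" by (simp add: D_def)
  qed
  have fg: "G (f i)" using s by (simp add: simple_complete_geodesic_def)
  let ?v' = "vv b (sh (f i) s1) a" and ?w' = "vv b (sh (f i) s2) a'"
  note n1 = near_line[OF i(1) refl a(1)] and n2 = near_line[OF i(2) eq[symmetric] a(2)]
  have "sh (f i) s1 a = sh (f i) s2 a'" using a(3) chart_inj[OF bA[OF b(1)]] inn_dom[OF n1(3)] inn_dom[OF n2(3)] by (auto simp: inj_on_def)
  hence "f i (a + s1) = f i (a' + s2)" by (simp add: sh_apply)
  hence "line_of (vel (f i) (a + s1)) = line_of (vel (f i) (a' + s2))" using s unfolding simple_complete_geodesic_def by blast
  moreover have "vel (f i) (a' + s2) \<in> line_of (vel (f i) (a' + s2))" unfolding line_of_def by (auto intro!: exI[of _ 1])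
  ultimately have "vel (f i) (a' + s2) \<in> line_of (vel (f i) (a + s1))" by simp
  then obtain q where "vel (f i) (a' + s2) = (%c. q *\<^sub>R vel (f i) (a + s1) c)" unfolding line_of_def by auto
  hence "?w' = q *\<^sub>R ?v'" by (simp add: geodesic_sh(2)[OF fg])
  hence c0: "cross ?v' ?w' = 0" by (simp add: cross_lin(6,7))
  have sw: "norm ?w' <= C" using speed[OF geodesic_sh(1)[OF fg] b(1) n2(3)] by simp
  have "cross v w = - cross (?v' - v) ?w' - cross v (?w' - w)" using c0 unfolding cross_lin(3,4) by simp
  hence "D <= \<bar>cross (?v' - v) ?w'\<bar> + \<bar>cross v (?w' - w)\<bar>" unfolding D_def by linarith
  also have "... <= 2*norm (?v' - v)*norm ?w' + 2*norm v * norm (?w' - w)" by (intro add_mono abs_cross_le)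
  also have "... <= 2*(e + C^3*r)*C + 2*C*(e + C^3*r)"
   using n1(2) n2(2) sw sp(1) C1 e(1) r(1) by (intro add_mono mult_mono) (auto simp: v_def w_def)
  also have "... = 4*(C*e) + 4*(C^4*r)" by (simp add: algebra_simps power_eq_if)
  also have "... < D"
  proof -
   have "r*D <= 1*D" using r(2) t1 D by (intro mult_right_mono) auto
   thus ?thesis using rC D by linarith
  qed
  finally show False by simp
 qed
 thus "line_of (vel g s1) = line_of (vel g s2)" unfolding v_def w_def by (rule line_eqI[OF g b eq])
qed

end

section \<open>Distances in the projective tangent bundle\<close>

lemma displacement_bound:
 fixes x :: "real => 'e::euclidean_space" and \<phi> :: "real => real"
 assumes t: "0 <= t" "t <= 1" and F: "finite F" and x: "continuous_on {0..t} x"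
  and D: "continuous_on ({0<..<t} - F) D" "!!s. s \<in> {0<..<t} - F ==> (x has_vector_derivative D s) (at s)"
  and K: "0 < K" "!!s. s \<in> {0<..<t} - F ==> norm (D s) <= K*\<phi> s"
  and e: "(\<integral>\<^sup>+s\<in>{0..1}. ennreal (\<phi> s) \<partial>lborel) < ennreal e" "0 <= e"
 shows "norm (x t - x 0) <= K*e"
proof -
 let ?T = "{0<..<t} - F"
 let ?A = "x t /\<^sub>R K - x 0 /\<^sub>R K"
 \<comment> \<open>The comparison of integrals runs through \<open>E\<close>, the derivative scaled
   by \<open>1/K\<close> and cut off outside the open set on which it is continuous. It is
   measurable and dominated by \<phi>, and by the fundamental theorem its integral is the scaled
   displacement.\<close>
 define E where "E s = indicator ?T s *\<^sub>R (D s /\<^sub>R K)" for s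
 have "?T \<in> sets borel" using F by (intro borel_open open_Diff) (auto intro: finite_imp_closed)
 hence "E \<in> borel_measurable borel"
  unfolding E_def by (rule borel_measurable_continuous_on_indicator) (intro continuous_intros D(1))
 hence m: "E \<in> borel_measurable lborel" by simp
 have "ennreal (norm (E s)) <= ennreal (\<phi> s)*indicator {0..1} s" for s
 proof (cases "s \<in> ?T")
  case True
  hence "norm (E s) <= \<phi> s" using K(1) K(2)[OF True] by (simp add: E_def field_simps)
  thus ?thesis using True t by (auto simp: indicator_def intro: ennreal_leI)
 qed (simp add: E_def)
 hence le: "(\<integral>\<^sup>+s. ennreal (norm (E s)) \<partial>lborel) <= (\<integral>\<^sup>+s\<in>{0..1}. ennreal (\<phi> s) \<partial>lborel)" by (rule nn_integral_mono)
 have fin: "(\<integral>\<^sup>+s. ennreal (norm (E s)) \<partial>lborel) < ennreal e" using le e(1) by (rule order_le_less_trans)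
 have "(\<integral>\<^sup>+s. ennreal (norm (E s)) \<partial>lborel) < \<infinity>" using order_less_trans[OF fin ennreal_less_top] by (simp only: infinity_ennreal_def)
 hence int: "integrable lborel E" by (rule integrableI_bounded[OF m])
 have "(E has_integral ?A) {0..t}"
 proof (rule fundamental_theorem_of_calculus_interior_strong[OF F t(1)])
  show "((%s. x s /\<^sub>R K) has_vector_derivative E s) (at s)" if "s \<in> {0<..<t} - F" for s
  proof -
   have "E s = D s /\<^sub>R K" using that by (simp add: E_def)
   thus ?thesis using bounded_linear.has_vector_derivative[OF bounded_linear_scaleR_right D(2)[OF that], of "inverse K"] by simp
  qed
  show "continuous_on {0..t} (%s. x s /\<^sub>R K)" by (intro continuous_intros x)
 qed
 hence "(E has_integral ?A) UNIV"
  by (rule has_integral_on_superset) (auto simp: E_def)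
 hence "integral\<^sup>L lborel E = x t /\<^sub>R K - x 0 /\<^sub>R K" by (rule has_integral_unique[OF has_integral_integral_lborel[OF int]])
 moreover have "ennreal (norm (integral\<^sup>L lborel E)) < ennreal e" using integral_norm_bound_ennreal[OF int] fin by (rule order_le_less_trans)
 ultimately have "norm ?A < e" using e(2) by (simp add: ennreal_less_iff)
 moreover have "norm ?A = norm (x t - x 0)/K"
  using K(1) by (simp only: scaleR_diff_right[symmetric] norm_scaleR) (simp add: divide_inverse mult.commute)
 ultimately show ?thesis using K(1) by (simp add: pos_divide_less_eq mult.commute)
qed

lemma (in riem) chart_continuous_on:
 assumes c: "c \<in> \<A>" and f: "continuous_map (top_of_set S) X f" "f ` S <= cdom c"
 shows "continuous_on S (%s. cmap c (f s))"
proof -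
 have 1: "continuous_map (top_of_set S) (subtopology X (cdom c)) f" using f by (auto simp: continuous_map_in_subtopology)
 have "continuous_map (subtopology X (cdom c)) (top_of_set (cimg c)) (cmap c)"
  using chart_homeo[OF c] homeomorphic_imp_continuous_map by blast
 from continuous_map_compose[OF 1 this] have "continuous_map (top_of_set S) (top_of_set (cimg c)) (%s. cmap c (f s))" by (simp add: o_def)
 thus ?thesis by (simp add: continuous_map_in_subtopology)
qed

context tracking begin

abbreviation "rt \<alpha> V t \<equiv> sqrt ((tnm (\<alpha> t) (vel \<alpha> t))^2 + (tnm (\<alpha> t) (cvd \<alpha> V t))^2)"

text \<open>In coordinates the derivative of \<open>V\<close> is its covariant derivative minus a
  Christoffel term, which is bounded by the speed since \<open>V\<close> is a unit field. So both
  coordinate rates are controlled by the integrand of \<open>PT_length\<close>.\<close>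

lemma PT_path_rates:
 assumes p: "PT_path M \<alpha> V" and b: "b \<in> B"
 obtains F Dx Dv where "finite F" "continuous_on {t \<in> {0<..<1} - F. \<alpha> t \<in> cdom (bch b)} Dx" "continuous_on {t \<in> {0<..<1} - F. \<alpha> t \<in> cdom (bch b)} Dv"
  "!!t. t \<in> {0<..<1} - F ==> \<alpha> t \<in> cdom (bch b) ==> ((%s. cmap (bch b) (\<alpha> s)) has_vector_derivative Dx t) (at t)"
  "!!t. t \<in> {0<..<1} - F ==> \<alpha> t \<in> cdom (bch b) ==> ((%s. V s (bch b)) has_vector_derivative Dv t) (at t)"
  "!!t. t \<in> {0<..<1} - F ==> \<alpha> t \<in> inn 3 b ==>
   norm (Dx t) <= C * rt \<alpha> V t"
  "!!t. t \<in> {0<..<1} - F ==> \<alpha> t \<in> inn 3 b ==>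
   norm (Dv t) <= 2*C^3 * rt \<alpha> V t"
proof -
 let ?c = "bch b"
 have c: "?c \<in> \<A>" by (rule bA[OF b])
 have cont: "continuous_map (top_of_set {0..1}) X \<alpha>" and tan: "!!t. t \<in> {0..1} ==> V t \<in> tangent_space M (\<alpha> t) & tnm (\<alpha> t) (V t) = 1"
  using p unfolding PT_path_def by blast+
 obtain F where F: "finite F" "C1_along M ({0<..<1} - F) \<alpha> V" using p unfolding PT_path_def by blast
 have C1d: "(cmap ?c \<circ> \<alpha>) C1_differentiable_on {t \<in> {0<..<1} - F. \<alpha> t \<in> cdom ?c}" "(%t. V t ?c) C1_differentiable_on {t \<in> {0<..<1} - F. \<alpha> t \<in> cdom ?c}"
  using F(2) c unfolding C1_along_def by auto
 obtain Dx where Dx: "!!t. t \<in> {t \<in> {0<..<1} - F. \<alpha> t \<in> cdom ?c} ==> ((cmap ?c \<circ> \<alpha>) has_vector_derivative Dx t) (at t)"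
  "continuous_on {t \<in> {0<..<1} - F. \<alpha> t \<in> cdom ?c} Dx" using C1d(1) unfolding C1_differentiable_on_def by blast
 obtain Dv where Dv: "!!t. t \<in> {t \<in> {0<..<1} - F. \<alpha> t \<in> cdom ?c} ==> ((%t. V t ?c) has_vector_derivative Dv t) (at t)"
  "continuous_on {t \<in> {0<..<1} - F. \<alpha> t \<in> cdom ?c} Dv" using C1d(2) unfolding C1_differentiable_on_def by blast
 have op: "open {t \<in> {0<..<1} - F. \<alpha> t \<in> V}" if V: "openin X V" for V
 proof -
  have "openin (top_of_set {0..1}) {t \<in> {0..1}. \<alpha> t \<in> V}" using cont V unfolding continuous_map_def by simp
  then obtain O' where O': "open O'" "{t \<in> {0..1}. \<alpha> t \<in> V} = {0..1} \<inter> O'" by (auto simp: openin_open)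
  have "{t \<in> {0<..<1} - F. \<alpha> t \<in> V} = ({0<..<1} - F) \<inter> O'" using O'(2) greaterThanLessThan_subseteq_atLeastAtMost_iff[of 0 1 0 "1::real"] by blast
  moreover have "open ({0<..<1::real} - F)" by (rule open_Diff[OF open_greaterThanLessThan finite_imp_closed[OF F(1)]])
  ultimately show ?thesis using O'(1) by auto
 qed
 have rate: "norm (Dx t) <= C * rt \<alpha> V t &
   norm (Dv t) <= 2*C^3 * rt \<alpha> V t"
  if t: "t \<in> {0<..<1} - F" and i: "\<alpha> t \<in> inn 3 b" for t
 proof -
  define tv tc where "tv = tnm (\<alpha> t) (vel \<alpha> t)" and "tc = tnm (\<alpha> t) (cvd \<alpha> V t)"
  let ?l = "sqrt (tv^2 + tc^2)"
  have l: "tv <= ?l" "tc <= ?l" "0 <= ?l" by (auto intro: real_le_rsqrt)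
  have dom: "\<alpha> t \<in> cdom ?c" by (rule inn_dom[OF i])
  have K: "cmap ?c (\<alpha> t) \<in> Kb b" using inn_K[OF b i] by simp
  have tT: "t \<in> {t \<in> {0<..<1} - F. \<alpha> t \<in> cdom ?c}" using t dom by simp
  have dx: "((%s. cmap ?c (\<alpha> s)) has_vector_derivative Dx t) (at t)" using Dx(1)[OF tT] by (simp add: o_def)
  note dv = Dv(1)[OF tT]
  have vel: "vel \<alpha> t ?c = Dx t" by (rule velocity_eq[where g=\<alpha> and t=t, OF c dom dx])
  have cd: "cvd \<alpha> V t ?c = Dv t + Gam ?c (cmap ?c (\<alpha> t)) (Dx t) (V t ?c)"
   using cov_deriv_eq[where g=\<alpha> and t=t and V=V, OF c dom dv] unfolding vel .
  have tr: "vel \<alpha> t d = DT ?c d (cmap ?c (\<alpha> t)) (vel \<alpha> t ?c) & cvd \<alpha> V t d = DT ?c d (cmap ?c (\<alpha> t)) (cvd \<alpha> V t ?c)"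
   if d: "d \<in> \<A>" "\<alpha> t \<in> cdom d" for d
  proof
   define S where "S = {t \<in> {0<..<1} - F. \<alpha> t \<in> cdom ?c \<inter> cdom d}"
   have S: "open S" "t \<in> S" "!!s. s \<in> S ==> \<alpha> s \<in> cdom ?c \<inter> cdom d"
    unfolding S_def using op[OF openin_Int[OF chart_open[OF c] chart_open[OF d(1)]]] t dom d by auto
   show "vel \<alpha> t d = DT ?c d (cmap ?c (\<alpha> t)) (vel \<alpha> t ?c)"
    unfolding vel by (rule velocity_eq[where g=\<alpha> and t=t, OF d velocity_chart[OF S c d(1) dx]])
   have tV: "V s d = DT ?c d (cmap ?c (\<alpha> s)) (V s ?c)" if "s \<in> S" for s
   proof -
    have "V s \<in> tangent_space M (\<alpha> s)" using tan[of s] that by (auto simp: S_def)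
    thus ?thesis using S(3)[OF that] by (intro tangent_space_chart c d) auto
   qed
   show "cvd \<alpha> V t d = DT ?c d (cmap ?c (\<alpha> t)) (cvd \<alpha> V t ?c)"
    by (rule cov_deriv_chart(2)[where g=\<alpha> and t=t and V=V, OF S(1,2) _ c d(1) dx dv]) (erule S(3), erule tV)
  qed
  have tv: "tv = sqrt (ip ?c (cmap ?c (\<alpha> t)) (Dx t) (Dx t))" unfolding tv_def vel[symmetric]
   by (rule tangent_norm_chart[OF c dom]) (use tr in blast)
  have tc: "tc = sqrt (ip ?c (cmap ?c (\<alpha> t)) (cvd \<alpha> V t ?c) (cvd \<alpha> V t ?c))" unfolding tc_def
   by (rule tangent_norm_chart[OF c dom]) (use tr in blast)
  have Vt: "V t \<in> tangent_space M (\<alpha> t)" "tnm (\<alpha> t) (V t) = 1" using tan[of t] t by auto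
  have "tnm (\<alpha> t) (V t) = sqrt (ip ?c (cmap ?c (\<alpha> t)) (V t ?c) (V t ?c))"
   by (rule tangent_norm_chart[OF c dom]) (rule tangent_space_chart[OF Vt(1) c dom])
  hence "sqrt (ip ?c (cmap ?c (\<alpha> t)) (V t ?c) (V t ?c)) = 1" using Vt(2) by simp
  hence vC: "norm (V t ?c) <= C" using norm_le_ip[OF b K, of "V t ?c"] by simp
  have "norm (Dx t) <= C*tv" unfolding tv by (rule norm_le_ip[OF b K])
  also have "... <= C*?l" using l C1 by (intro mult_left_mono) auto
  finally have 1: "norm (Dx t) <= C*?l" .
  have "norm (cvd \<alpha> V t ?c) <= C*tc" unfolding tc by (rule norm_le_ip[OF b K])
  also have "... <= C*?l" using l C1 by (intro mult_left_mono) auto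
  finally have 2: "norm (cvd \<alpha> V t ?c) <= C*?l" .
  have "norm (Gam ?c (cmap ?c (\<alpha> t)) (Dx t) (V t ?c)) <= C*norm (Dx t)*norm (V t ?c)" by (rule GamC[OF b K])
  also have "... <= C*(C*?l)*C" using 1 vC C1 l by (intro mult_mono) auto
  finally have 3: "norm (Gam ?c (cmap ?c (\<alpha> t)) (Dx t) (V t ?c)) <= C^3*?l" by (simp add: power3_eq_cube mult_ac)
  have "C*?l <= C^3*?l" using Cpow(2)[of 1 3] l(3) by (intro mult_right_mono) auto
  moreover have "Dv t = cvd \<alpha> V t ?c - Gam ?c (cmap ?c (\<alpha> t)) (Dx t) (V t ?c)" unfolding cd by simp
  hence "norm (Dv t) <= norm (cvd \<alpha> V t ?c) + norm (Gam ?c (cmap ?c (\<alpha> t)) (Dx t) (V t ?c))"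
   by (simp only: norm_triangle_ineq4)
  ultimately have "norm (Dv t) <= 2*C^3*?l" using 2 3 by linarith
  with 1 show ?thesis unfolding tv_def tc_def by (rule conjI)
 qed
 show ?thesis
 proof (rule that[OF F(1) Dx(2) Dv(2)])
  fix t assume t: "t \<in> {0<..<1} - F"
  show "((%s. cmap ?c (\<alpha> s)) has_vector_derivative Dx t) (at t)" if "\<alpha> t \<in> cdom ?c" using Dx(1)[of t] t that by (simp add: o_def)
  show "((%s. V s ?c) has_vector_derivative Dv t) (at t)" if "\<alpha> t \<in> cdom ?c" using Dv(1)[of t] t that by simp
 qed (erule (1) rate[THEN conjunct1] rate[THEN conjunct2])+
qed

lemma PT_path_close:
 assumes p: "PT_path M \<alpha> V" and b: "b \<in> B" "\<alpha> 0 \<in> inn 2 b" and l: "PT_length M \<alpha> V < ennreal e" and e: "0 <= e" "C*e < brad b"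
 shows "\<alpha> 1 \<in> inn 3 b" "norm (cmap (bch b) (\<alpha> 1) - cmap (bch b) (\<alpha> 0)) <= C*e" "norm (V 1 (bch b) - V 0 (bch b)) <= 2*C^3*e"
proof -
 let ?c = "bch b"
 let ?A = "cmap ?c (\<alpha> 0)" and ?B = "cdom (bch b)"
 have c: "?c \<in> \<A>" by (rule bA[OF b(1)])
 have cont: "continuous_map (top_of_set {0..1}) X \<alpha>" and Vc: "continuous_on {t \<in> {0..1}. \<alpha> t \<in> cdom ?c} (%t. V t ?c)"
  using p c unfolding PT_path_def by blast+
 define \<phi> where "\<phi> t = rt \<alpha> V t" for t
 have lp: "(\<integral>\<^sup>+s\<in>{0..1}. ennreal (\<phi> s) \<partial>lborel) < ennreal e" using l by (simp add: PT_length_def \<phi>_def)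
 obtain F Dx Dv where R: "finite F" "continuous_on {t \<in> {0<..<1} - F. \<alpha> t \<in> ?B} Dx" "continuous_on {t \<in> {0<..<1} - F. \<alpha> t \<in> ?B} Dv"
  "!!t. t \<in> {0<..<1} - F ==> \<alpha> t \<in> ?B ==> ((%s. cmap (bch b) (\<alpha> s)) has_vector_derivative Dx t) (at t)"
  "!!t. t \<in> {0<..<1} - F ==> \<alpha> t \<in> ?B ==> ((%s. V s (bch b)) has_vector_derivative Dv t) (at t)"
  "!!t. t \<in> {0<..<1} - F ==> \<alpha> t \<in> inn 3 b ==> norm (Dx t) <= C*\<phi> t"
  "!!t. t \<in> {0<..<1} - F ==> \<alpha> t \<in> inn 3 b ==> norm (Dv t) <= 2*C^3*\<phi> t"
  by (rule PT_path_rates[OF p b(1), folded \<phi>_def]) (rule that)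
 have C0: "0 < C" "0 < 2*C^3" using C1 by auto
 have mv: "norm (cmap ?c (\<alpha> t) - ?A) <= C*e" if t: "0 <= t" "t <= 1" and st: "!!s. 0 <= s ==> s <= t ==> \<alpha> s \<in> inn 3 b" for t
 proof (rule displacement_bound[OF t R(1) _ _ _ C0(1) _ lp e(1), of _ Dx])
  have dom: "\<alpha> s \<in> cdom ?c" if "0 <= s" "s <= t" for s using inn_dom[OF st[OF that]] .
  show "continuous_on {0..t} (%s. cmap ?c (\<alpha> s))"
   by (rule chart_continuous_on[OF c continuous_map_from_subtopology_mono[OF cont]]) (use dom t in auto)
  show "continuous_on ({0<..<t} - F) Dx" by (rule continuous_on_subset[OF R(2)]) (use dom t in auto)
  fix s assume s: "s \<in> {0<..<t} - F"
  hence s': "s \<in> {0<..<1} - F" "0 <= s" "s <= t" using t by auto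
  show "((%s. cmap ?c (\<alpha> s)) has_vector_derivative Dx s) (at s)" by (rule R(4)[OF s'(1) dom[OF s'(2,3)]])
  show "norm (Dx s) <= C*\<phi> s" by (rule R(6)[OF s'(1) st[OF s'(2,3)]])
 qed
 have stay: "\<alpha> t \<in> inn 3 b" if "t \<in> {0..1}" for t
 proof (rule stay_in_box[OF validB[OF b(1)] cont _ b(2) order_refl _ that])
  fix t assume t: "0 <= t" "t <= 1" "!!s. 0 <= s ==> s <= t ==> \<alpha> s \<in> inn 3 b"
  show "dist (cmap ?c (\<alpha> t)) (?A) < brad b" using mv[OF t] e(2) by (simp add: dist_norm)
 qed simp
 show "\<alpha> 1 \<in> inn 3 b" by (rule stay) simp
 show "norm (cmap ?c (\<alpha> 1) - ?A) <= C*e" by (rule mv) (use stay in auto)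
 show "norm (V 1 ?c - V 0 ?c) <= 2*C^3*e"
 proof (rule displacement_bound[OF _ _ R(1) _ _ _ C0(2) _ lp e(1), of _ _ Dv])
  have dom: "\<alpha> s \<in> cdom ?c" if "s \<in> {0..1}" for s using inn_dom[OF stay[OF that]] .
  show "continuous_on {0..1} (%s. V s ?c)" by (rule continuous_on_subset[OF Vc]) (use dom in auto)
  show "continuous_on ({0<..<1} - F) Dv" by (rule continuous_on_subset[OF R(3)]) (use dom in auto)
  fix s assume s: "s \<in> {0<..<1} - F"
  hence s': "s \<in> {0..1}" by auto
  show "((%s. V s ?c) has_vector_derivative Dv s) (at s)" by (rule R(5)[OF s dom[OF s']])
  show "norm (Dv s) <= 2*C^3*\<phi> s" by (rule R(7)[OF s stay[OF s']])
 qed simp_all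
qed

lemma unit_on_line:
 assumes g: "G g" and b: "b \<in> B" "g t \<in> inn n b" and V: "V \<in> tangent_space M (g t)" "tnm (g t) V = 1"
  and l: "line_of (vel g t) = line_of V"
 obtains r where "r = 1 \<or> r = - 1" "V (bch b) = r *\<^sub>R vv b g t"
proof -
 let ?A = "ip (bch b) (xx b g t) (V (bch b)) (V (bch b))"
 have "V \<in> line_of V" unfolding line_of_def by (auto intro!: exI[of _ 1])
 hence "V \<in> line_of (vel g t)" using l by simp
 then obtain r where "V = (%c. r *\<^sub>R vel g t c)" unfolding line_of_def by blast
 hence r: "V (bch b) = r *\<^sub>R vv b g t" by simp
 note dom = inn_dom[OF b(2)] and c = bA[OF b(1)]
 have "tnm (g t) V = sqrt (?A)"
  by (rule tangent_norm_chart[OF c dom]) (rule tangent_space_chart[OF V(1) c dom])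
 hence "?A = 1" using V(2) by simp
 hence "r*r = 1" unfolding r using geo_unit[OF g b] by simp
 hence "r = 1 \<or> r = - 1" by (simp add: square_eq_1_iff)
 thus ?thesis using that r by blast
qed

text \<open>A short path in the projective tangent bundle carries a unit field that agrees with the
  velocities at its ends only up to sign. Equal signs lead to \<open>sh g' t\<close>, different
  signs to its reversal.\<close>

lemma PT_dist_close:
 assumes e: "0 < e"
 shows "EX \<epsilon>>0. ALL b g g' t. b \<in> B --> G g --> G g' --> g 0 \<in> inn (3/2) b -->
  PT_dist M (g 0, line_of (vel g 0)) (g' t, line_of (vel g' t)) < ennreal \<epsilon> -->
  close b e g (sh g' t) \<or> close b e g (rv (sh g' t))"
proof -
 define \<epsilon> where "\<epsilon> = min T (e/(3*C^3))"
 have p: "0 < 3*C^3" using C1 by simp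
 have eps: "0 < \<epsilon>" "\<epsilon> <= T" "3*C^3*\<epsilon> <= e"
 proof -
  show "0 < \<epsilon>" "\<epsilon> <= T" using tau_pos e p by (auto simp: \<epsilon>_def)
  have "3*C^3*\<epsilon> <= 3*C^3*(e/(3*C^3))" using p by (intro mult_left_mono) (auto simp: \<epsilon>_def)
  thus "3*C^3*\<epsilon> <= e" using p by simp
 qed
 have "close b e g (sh g' t) \<or> close b e g (rv (sh g' t))"
  if b: "b \<in> B" and g: "G g" "G g'" and i: "g 0 \<in> inn (3/2) b"
   and d: "PT_dist M (g 0, line_of (vel g 0)) (g' t, line_of (vel g' t)) < ennreal \<epsilon>" for b g g' t
 proof -
  obtain \<alpha> V where a: "PT_length M \<alpha> V < ennreal \<epsilon>" "PT_path M \<alpha> V" "g 0 = \<alpha> 0" "line_of (vel g 0) = line_of (V 0)"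
   "g' t = \<alpha> 1" "line_of (vel g' t) = line_of (V 1)"
   using d unfolding PT_dist_def Inf_less_iff by auto
  have i2: "\<alpha> 0 \<in> inn 2 b" using inn_le[OF b i, of 2] a(3) by simp
  have Ce: "C*\<epsilon> <= brad b/4" using tau_brad(2)[OF b] mult_left_mono[OF eps(2), of C] C1 by linarith
  hence Cb: "C*\<epsilon> < brad b" using brad_pos[OF b] by linarith
  note P = PT_path_close[OF a(2) b i2 a(1) less_imp_le[OF eps(1)] Cb]
  have tan: "V 0 \<in> tangent_space M (\<alpha> 0)" "tnm (\<alpha> 0) (V 0) = 1" "V 1 \<in> tangent_space M (\<alpha> 1)" "tnm (\<alpha> 1) (V 1) = 1"
   using a(2) unfolding PT_path_def by auto
  obtain r where r: "r = 1 \<or> r = - 1" "V 0 (bch b) = r *\<^sub>R vv b g 0"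
   by (rule unit_on_line[OF g(1) b i _ _ a(4)]) (use tan a(3) in auto)
  have i1: "g' t \<in> inn 3 b" using P(1) a(5) by simp
  obtain q where q: "q = 1 \<or> q = - 1" "V 1 (bch b) = q *\<^sub>R vv b g' t"
   by (rule unit_on_line[OF g(2) b i1 _ _ a(6)]) (use tan a(5) in auto)
  have x: "norm (xx b g' t - xx b g 0) <= C*\<epsilon>" using P(2) a(3,5) by simp
  have i2': "g' t \<in> inn 2 b"
  proof -
   have "dist (xx b g' t) (bpt b) <= C*\<epsilon> + 3/2*brad b"
    using dist_triangle[of "xx b g' t" "bpt b" "xx b g 0"] x i by (simp add: dist_norm inn_def)
   thus ?thesis using i1 Ce brad_pos[OF b] by (simp add: inn_def)
  qed
  have vn: "norm (V 1 (bch b) - V 0 (bch b)) <= 2*C^3*\<epsilon>" by (rule P(3))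
  have "C*\<epsilon> <= C^3*\<epsilon>" using Cpow(2)[of 1 3] eps(1) by (intro mult_right_mono) auto
  hence tot: "C*\<epsilon> + 2*C^3*\<epsilon> <= e" using eps(3) by linarith
  have gs: "G (sh g' t)" "G (rv (sh g' t))" using g(2) by (auto intro: geodesic_sh geodesic_rv)
  have vels: "vv b (sh g' t) 0 = vv b g' t" "vv b (rv (sh g' t)) 0 = - vv b g' t"
   using geodesic_sh(2)[OF g(2), of t 0] geodesic_rv(2)[OF gs(1), of 0 "bch b"] by simp_all
  have main: "close b e g h" if h: "G h" "h 0 = g' t" "norm (vv b h 0 - vv b g 0) <= 2*C^3*\<epsilon>" for h
  proof -
   have "nz b g h <= norm (xx b h 0 - xx b g 0) + norm (vv b h 0 - vv b g 0)"
    using norm_fst_snd(3)[of "Dz b g h"] by (simp add: Dz_def)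
   hence "nz b g h <= e" using x h(2,3) tot by simp
   thus ?thesis using b g(1) h(1,2) i2 i2' a(3) by (simp add: close_def)
  qed
  show ?thesis
  proof (cases "q = r")
   case True
   have "V 1 (bch b) - V 0 (bch b) = r *\<^sub>R (vv b g' t - vv b g 0)" using r q True by (simp add: scaleR_diff_right)
   hence "norm (vv b g' t - vv b g 0) <= 2*C^3*\<epsilon>" using vn r(1) by auto
   hence "close b e g (sh g' t)" by (intro main gs) (simp_all add: vels sh_apply)
   thus ?thesis ..
  next
   case False
   hence "q = - r" using q(1) r(1) by auto
   hence "V 1 (bch b) - V 0 (bch b) = r *\<^sub>R (- vv b g' t - vv b g 0)" using r q by (simp add: scaleR_diff_right)
   hence "norm (- vv b g' t - vv b g 0) <= 2*C^3*\<epsilon>" using vn r(1) by auto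
   hence "close b e g (rv (sh g' t))" by (intro main gs) (simp_all only: vels, simp_all add: sh_apply)
   thus ?thesis ..
  qed
 qed
 note R = this
 show ?thesis
 proof (intro exI[of _ \<epsilon>] conjI allI impI)
  show "0 < \<epsilon>" by (rule eps(1))
 qed (rule R)
qed

end

section \<open>Clopen sets of laminations\<close>

lemma hausdorff_dist_sym: "hausdorff_dist M \<Lambda> \<Lambda>' = hausdorff_dist M \<Lambda>' \<Lambda>"
 unfolding hausdorff_dist_def by (simp only: conj_commute conj_left_commute)

context tracking begin

lemma gconv_closedin:
 assumes f: "gconv f g F" "F ~= bot" and A: "closedin X A" "!!i. f i 0 \<in> A"
 shows "g 0 \<in> A"
proof (rule ccontr)
 assume n: "g 0 \<notin> A"
 have g: "G g" by (rule gconv_G[OF f(1)])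
 note b = bx[OF geo_top[OF g, of 0]]
 let ?b = "bx (g 0)"
 have "openin X (topspace X - A)" "g 0 \<in> topspace X - A" using A(1) n geo_top[OF g] by auto
 from chart_nbhd[OF bA[OF b(1)] inn_dom[OF b(2)] this] obtain d where
  d: "0 < d" "!!y. y \<in> cdom (bch ?b) ==> dist (cmap (bch ?b) y) (xx ?b g 0) < d ==> y \<in> topspace X - A" by blast
 have "0 < d/2" using d(1) by simp
 with f(1) have "eventually (%i. close ?b (d/2) g (f i)) F" unfolding gconv_def by simp
 then obtain i where i: "close ?b (d/2) g (f i)" using eventually_happens'[OF f(2)] by blast
 note D = closeD[OF i]
 have "norm (xx ?b (f i) 0 - xx ?b g 0) <= d/2"
  using norm_fst_snd(1)[of "Dz ?b g (f i)"] D(6) by (simp add: Dz_def)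
 hence "f i 0 \<in> topspace X - A" using d(1) by (intro d(2) inn_dom[OF D(5)]) (simp add: dist_norm)
 thus False using A(2)[of i] by simp
qed

text \<open>Its image under \<open>Dz b g\<close> is the compact set to which the Sura-Bura theorem
  is applied. The condition \<open>Th b g h = 0\<close> in \<open>hit\<close> selects one among the
  nearby time shifts of a geodesic, so that shifts alone cannot form a continuum.\<close>

definition HS :: "'a box => (real => 'a) => real => (real => 'a) set" where
 "HS b g \<rho> = {h. SG h & hit b g h & nz b g h <= \<rho>}"

lemma HS_D:
 assumes "h \<in> HS b g \<rho>"
 shows "SG h" "hit b g h" "nz b g h <= \<rho>" "b \<in> B" "G g" "G h" "g 0 \<in> inn 1 b" "h 0 \<in> inn 2 b"
  "Th b g h = 0" "h 0 \<in> inn (5/4) b"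
 using assms near_inn[of b g h 2] by (auto simp: HS_def hit_def)

lemma Dz_diff: "Dz b h \<zeta> = Dz b g \<zeta> - Dz b g h"
 by (simp add: Dz_def)

text \<open>In the fixed chart of \<open>b\<close>, convergent offsets make a Cauchy sequence of
  geodesics. Its limit is simple by \<open>gconv_simple\<close>, and the remaining conditions are
  closed once positions are confined to \<open>inn (5/4) b\<close>.\<close>

lemma HS_limit:
 assumes f: "!!i. f i \<in> HS b g \<rho>" and l: "(%i. Dz b g (f i)) \<longlonglongrightarrow> l"
 obtains h where "h \<in> HS b g \<rho>" "Dz b g h = l"
proof -
 note H = HS_D[OF f]
 have b: "b \<in> B" by (rule H(4))
 have "gcauchy b f"
  unfolding gcauchy_def
 proof (intro allI impI)
  fix e :: real assume "0 < e"
  then obtain N where N: "!!i j. N <= i ==> N <= j ==> dist (Dz b g (f i)) (Dz b g (f j)) < e"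
   using LIMSEQ_imp_Cauchy[OF l] unfolding Cauchy_def by blast
  have "close b e (f i) (f j)" if "N <= i" "N <= j" for i j
  proof -
   have "nz b (f i) (f j) <= e"
    using N[OF that] unfolding Dz_diff[of b "f i" "f j" g] by (simp add: dist_norm norm_minus_commute)
   thus ?thesis using H by (simp add: close_def)
  qed
  thus "EX N. ALL i>=N. ALL j>=N. close b e (f i) (f j)" by blast
 qed
 then obtain h where eta: "gconv f h sequentially" by (rule gcauchy_convergent)
 have s: "SG h" by (rule gconv_simple[OF eta]) (simp_all add: H(1))
 have i54: "h 0 \<in> inn (5/4) b"
  by (rule gconv_closedin[OF eta _ inn_closed(2)[OF validB[OF b]]]) (simp_all add: H(10))
 have z: "(%i. Dz b g (f i)) \<longlonglongrightarrow> Dz b g h"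
 proof (rule tendstoI)
  fix e :: real assume e: "0 < e"
  hence "0 < e/2" by simp
  from gconvD[OF eta b i54 _ this] have "eventually (%i. close b (e/2) h (f i) & f i 0 \<in> inn (5/4 + 1/2) b) sequentially" by simp
  thus "eventually (%i. dist (Dz b g (f i)) (Dz b g h) < e) sequentially"
  proof (rule eventually_mono)
   fix i assume "close b (e/2) h (f i) & f i 0 \<in> inn (5/4 + 1/2) b"
   hence "nz b h (f i) <= e/2" by (simp add: close_def)
   thus "dist (Dz b g (f i)) (Dz b g h) < e" using e unfolding Dz_diff[of b h "f i" g] by (simp add: dist_norm)
  qed
 qed
 have nrm: "nz b g h <= r" if "!!i. nz b g (f i) <= r" for r
  by (rule LIMSEQ_le_const2[OF tendsto_norm[OF z]]) (use that in blast)
 have dle: "nz b g (f i) <= d0" for i using H(2)[of i] by (simp add: hit_def)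
 have "(%i. Th b g (f i)) \<longlonglongrightarrow> Th b g h"
 proof -
  have T: "Th b g \<zeta> = vv b g 0 \<bullet> (gm (bch b) (xx b g 0) *v fst (Dz b g \<zeta>))" for \<zeta>
   by (simp add: Th_def Dz_def ip_def)
  show ?thesis unfolding T
   by (intro tendsto_inner tendsto_const bounded_linear.tendsto[OF matrix_vector_mul_bounded_linear] tendsto_fst z)
 qed
 hence "Th b g h = 0" using H(9) by (simp add: LIMSEQ_const_iff)
 moreover have "h 0 \<in> inn 2 b" by (rule inn_le[OF b i54]) simp
 moreover have "G h" by (rule gconv_G[OF eta])
 ultimately have "h \<in> HS b g \<rho>" using s nrm[OF H(3)] nrm[OF dle] b H(5,7) by (simp add: HS_def hit_def)
 moreover have "Dz b g h = l" by (rule LIMSEQ_unique[OF z l])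
 ultimately show ?thesis by (rule that)
qed

lemma HS_compact: "compact (Dz b g ` HS b g \<rho>)"
 unfolding compact_eq_bounded_closed
proof
 let ?A = "HS b g \<rho>"
 show "bounded (Dz b g ` ?A)" unfolding bounded_iff by (rule exI[of _ \<rho>]) (auto dest: HS_D(3))
 show "closed (Dz b g ` ?A)" unfolding closed_sequential_limits
 proof (intro allI impI, elim conjE)
  fix x l assume x: "ALL n. x n \<in> Dz b g ` ?A" and l: "x \<longlonglongrightarrow> l"
  from x have "ALL n. EX h. h \<in> ?A & x n = Dz b g h" by blast
  then obtain f where f: "!!n. f n \<in> ?A" "!!n. x n = Dz b g (f n)" by metis
  have "(%n. Dz b g (f n)) \<longlonglongrightarrow> l" using l by (simp add: f(2)[symmetric])
  from HS_limit[OF f(1) this] obtain h where "h \<in> ?A" "Dz b g h = l" .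
  thus "l \<in> Dz b g ` ?A" by blast
 qed
qed

text \<open>Any choice of geodesics over \<open>K\<close> is continuous, because the difference of
  two offsets from \<gamma> is the offset between the two geodesics. It is injective up to small
  shifts, because the crossing time with the normal of \<gamma> is unique.\<close>

lemma HS_no_continuum:
 assumes K: "K <= Dz b \<gamma> ` HS b \<gamma> \<rho>" "compact K" "connected K" and xy: "x \<in> K" "y \<in> K"
 shows "x = y"
proof -
 let ?A = "HS b \<gamma> \<rho>"
 define g where "g z = (SOME h. h \<in> ?A & Dz b \<gamma> h = z)" for z
 have g: "g z \<in> ?A" "Dz b \<gamma> (g z) = z" if "z \<in> K" for z
 proof -
  from that K(1) have "EX h. h \<in> ?A & Dz b \<gamma> h = z" by blast
  from someI_ex[OF this] show "g z \<in> ?A" "Dz b \<gamma> (g z) = z" unfolding g_def by blast+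
 qed
 show ?thesis
 proof (rule no_geodesic_continuum[OF K(2,3) _ _ _ xy, of g])
  show "SG (g s)" if "s \<in> K" for s by (rule HS_D(1)[OF g(1)[OF that]])
  show "gconv g (g s) (at s within K)" if s: "s \<in> K" for s
  proof (rule gconvI[where b=b])
   show "G (g s)" by (rule HS_D(6)[OF g(1)[OF s]])
   fix e :: real assume "0 < e"
   hence "eventually (%z. z \<in> K & dist z s < e) (at s within K)"
    by (auto simp: eventually_at)
   thus "eventually (%z. close b e (g s) (g z)) (at s within K)"
   proof (rule eventually_mono)
    fix z assume z: "z \<in> K & dist z s < e"
    hence "nz b (g s) (g z) <= e" unfolding Dz_diff[of b "g s" "g z" \<gamma>] by (simp add: g s dist_norm)
    thus "close b e (g s) (g z)" using HS_D[OF g(1)[OF s]] HS_D[OF g(1), of z] z by (simp add: close_def)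
   qed
  qed
  show "s' = s" if s: "s \<in> K" "s' \<in> K" and t: "\<bar>t\<bar> <= T" "sh (g s') t = g s" for s s' t
  proof -
   have h: "hit b \<gamma> (sh (g s') 0)" using HS_D(2)[OF g(1)[OF s(2)]] by simp
   have "t = 0" by (rule hit_unique[OF h]) (use t HS_D(9)[OF g(1)[OF s(1)]] tau_pos in auto)
   hence "g s' = g s" using t(2) by simp
   thus ?thesis using g(2)[OF s(1)] g(2)[OF s(2)] by simp
  qed
 qed
qed

lemma HS_self:
 assumes s: "SG g" and r: "0 <= \<rho>"
 shows "g \<in> HS (bx (g 0)) g \<rho>" "Dz (bx (g 0)) g g = 0"
proof -
 have g: "G g" using s by (simp add: simple_complete_geodesic_def)
 note b = bx[OF geo_top[OF g, of 0]]
 show z: "Dz (bx (g 0)) g g = 0" by (simp add: Dz_def zero_prod_def)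
 show "g \<in> HS (bx (g 0)) g \<rho>" using s g b z r d0(1) inn_le[OF b, of 2] by (simp add: HS_def hit_def Th_def)
qed

text \<open>\<open>W\<close> and its complement in the set of offsets are disjoint and compact,
  hence a distance \<open>e\<close> apart. This turns clopenness into a condition uniform over all
  geodesics of \<open>HS b g \<rho>\<close>.\<close>

lemma HS_clopen:
 assumes s: "SG g" and r: "0 <= \<rho>" "0 < r0" and b: "b = bx (g 0)"
 obtains W e where "0 \<in> W" "W <= ball 0 r0" "0 < e"
  "ALL h:HS b g \<rho>. ALL \<zeta>:HS b g \<rho>. Dz b g h \<in> W --> nz b h \<zeta> < e --> Dz b g \<zeta> \<in> W"
proof -
 let ?S = "Dz b g ` HS b g \<rho>"
 define K where "K = connected_component_set ?S 0"
 have "Dz b g g \<in> ?S" by (rule imageI) (unfold b, rule HS_self[OF s r(1)])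
 hence 0: "0 \<in> ?S" using HS_self(2)[OF s r(1)] unfolding b by (simp only:)
 have K: "K \<in> components ?S" unfolding K_def using 0 by (rule componentsI)
 hence Kc: "compact K" using HS_compact by (rule compact_components[rotated])
 have K0: "K <= {0}"
 proof
  fix x assume "x \<in> K"
  moreover have "0 \<in> K" unfolding K_def using 0 by (simp add: connected_component_refl)
  moreover have "K <= ?S" "connected K" unfolding K_def by (rule connected_component_subset, rule connected_connected_component)
  ultimately have "x = 0" using HS_no_continuum[OF _ Kc] by blast
  thus "x \<in> {0}" by simp
 qed
 have lc: "locally compact ?S" by (rule closed_imp_locally_compact[OF compact_imp_closed[OF HS_compact]])
 have "K <= ball 0 r0" using K0 r(2) by auto
 from Sura_Bura_clopen_subset[OF lc K Kc open_ball this] obtain W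
  where W: "openin (top_of_set ?S) W" "compact W" "K <= W" "W <= ball 0 r0" .
 have "closedin (top_of_set ?S) (?S - W)" using W(1) closedin_diff[OF closedin_topspace, of "top_of_set ?S" W] by simp
 hence c: "compact (?S - W)" using HS_compact closedin_compact by blast
 obtain e where e: "0 < e" "!!x y. x \<in> W ==> y \<in> ?S - W ==> e <= dist x y"
  using separate_compact_closed[OF W(2) compact_imp_closed[OF c]] by blast
 have W0: "0 \<in> W" using W(3) 0 by (auto simp: K_def connected_component_refl)
 show ?thesis
 proof (rule that[OF W0 W(4) e(1)], intro ballI impI)
  fix h \<zeta> assume h: "h \<in> HS b g \<rho>" "\<zeta> \<in> HS b g \<rho>" "Dz b g h \<in> W" "nz b h \<zeta> < e"
  show "Dz b g \<zeta> \<in> W"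
  proof (rule ccontr)
   assume "Dz b g \<zeta> \<notin> W"
   hence "e <= dist (Dz b g h) (Dz b g \<zeta>)" using e(2) h(2,3) by blast
   thus False using h(4) unfolding Dz_diff[of b h \<zeta> g] by (simp add: dist_norm norm_minus_commute)
  qed
 qed
qed

definition has_leaf :: "(real => 'a) => 'a set => bool" where
 "has_leaf h \<Lambda> \<longleftrightarrow> SG h & (EX \<L>. leaf_decomposition M \<Lambda> \<L> & range h \<in> \<L>)"

lemma has_leaf_sh: "has_leaf h \<Lambda> ==> has_leaf (sh h t) \<Lambda>" and has_leaf_rv: "has_leaf h \<Lambda> ==> has_leaf (rv h) \<Lambda>"
 by (simp_all add: has_leaf_def simple_sh simple_rv)

lemma has_leaf_sub: "has_leaf h \<Lambda> ==> h t \<in> \<Lambda>"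
 unfolding has_leaf_def leaf_decomposition_def by blast

lemma has_leaf_through:
 assumes "geodesic_lamination M \<Lambda>" "y \<in> \<Lambda>"
 obtains h where "has_leaf h \<Lambda>" "h 0 = y"
proof -
 obtain \<L> where l: "leaf_decomposition M \<Lambda> \<L>" using assms(1) unfolding geodesic_lamination_def by blast
 then obtain L where L: "L \<in> \<L>" "y \<in> L" using assms(2) unfolding leaf_decomposition_def by blast
 obtain g where g: "SG g" "L = range g" using l L(1) unfolding leaf_decomposition_def by blast
 obtain t where t: "y = g t" using L(2) g(2) by blast
 have "has_leaf g \<Lambda>" using l L(1) g unfolding has_leaf_def by blast
 hence "has_leaf (sh g t) \<Lambda>" by (rule has_leaf_sh)
 thus ?thesis by (rule that) (simp add: t sh_apply)
qed

lemma hausdorff_leaf: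
 assumes h: "hausdorff_dist M \<Lambda> \<Lambda>' < ennreal \<epsilon>" and l: "has_leaf h \<Lambda>"
 obtains g' t where "has_leaf g' \<Lambda>'" "PT_dist M (h 0, line_of (vel h 0)) (g' t, line_of (vel g' t)) < ennreal \<epsilon>"
proof -
 let ?A = "(h 0, line_of (vel h 0))"
 obtain \<epsilon>' where e: "ennreal \<epsilon>' < ennreal \<epsilon>" "lamination_lift M \<Lambda> <= PT_nbhd M \<epsilon>' (lamination_lift M \<Lambda>')"
  using h unfolding hausdorff_dist_def Inf_less_iff by blast
 have "?A \<in> lamination_lift M \<Lambda>"
  using l unfolding lamination_lift_def has_leaf_def by blast
 with e(2) obtain Q where Q: "Q \<in> lamination_lift M \<Lambda>'" "PT_dist M ?A Q < ennreal \<epsilon>'"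
  unfolding PT_nbhd_def by blast
 obtain g' t where g: "Q = (g' t, line_of (vel g' t))" "has_leaf g' \<Lambda>'"
  using Q(1) unfolding lamination_lift_def has_leaf_def by blast
 show ?thesis by (rule that[OF g(2) order_less_trans[OF Q(2)[unfolded g(1)] e(1)]])
qed

text \<open>\<epsilon> is the same for all laminations. As the Hausdorff distance is symmetric,
  having a leaf with offset in \<open>W\<close> and having none are then both open
  conditions.\<close>

lemma leaf_class_stable:
 assumes W: "W <= ball 0 (\<rho> / 2)" "0 < \<rho>" "\<rho> <= d0" and e: "0 < e"
  and st: "ALL h:HS b g \<rho>. ALL \<zeta>:HS b g \<rho>. Dz b g h \<in> W --> nz b h \<zeta> < e --> Dz b g \<zeta> \<in> W"
 shows "EX \<epsilon>>0. ALL \<Lambda> \<Lambda>' h. hausdorff_dist M \<Lambda> \<Lambda>' < ennreal \<epsilon> --> has_leaf h \<Lambda> --> h \<in> HS b g \<rho> --> Dz b g h \<in> W -->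
  (EX h'. has_leaf h' \<Lambda>' & h' \<in> HS b g \<rho> & Dz b g h' \<in> W)"
proof -
 define a where "a = min (\<rho> / 2) (e/2)/L"
 have a: "0 < a" "L*a <= \<rho> / 2" "L*a <= e/2" using L1 W(2) e by (auto simp: a_def)
 obtain \<epsilon> where eps: "0 < \<epsilon>" and P: "ALL b g g' t. b \<in> B --> G g --> G g' --> g 0 \<in> inn (3/2) b -->
  PT_dist M (g 0, line_of (vel g 0)) (g' t, line_of (vel g' t)) < ennreal \<epsilon> -->
  close b a g (sh g' t) \<or> close b a g (rv (sh g' t))" using PT_dist_close[OF a(1)] by (elim exE conjE) (rule that)
 have "EX h'. has_leaf h' \<Lambda>' & h' \<in> HS b g \<rho> & Dz b g h' \<in> W"
  if h: "hausdorff_dist M \<Lambda> \<Lambda>' < ennreal \<epsilon>" "has_leaf h \<Lambda>" "h \<in> HS b g \<rho>" "Dz b g h \<in> W" for \<Lambda> \<Lambda>' h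
 proof -
  note H = HS_D[OF h(3)]
  obtain g' t where g: "has_leaf g' \<Lambda>'" "PT_dist M (h 0, line_of (vel h 0)) (g' t, line_of (vel g' t)) < ennreal \<epsilon>"
   by (rule hausdorff_leaf[OF h(1,2)])
  have g': "G g'" using g(1) by (simp add: has_leaf_def simple_complete_geodesic_def)
  have "h 0 \<in> inn (3/2) b" by (rule inn_le[OF H(4,10)]) simp
  hence "close b a h (sh g' t) \<or> close b a h (rv (sh g' t))" using P[rule_format, OF H(4,6) g' _ g(2)] by simp
  then obtain \<zeta> where z: "close b a h \<zeta>" "has_leaf \<zeta> \<Lambda>'"
   using has_leaf_sh[OF g(1), of t] has_leaf_rv[OF has_leaf_sh[OF g(1), of t]] by blast
  have "L*a <= d0" using a(2) W(2,3) by simp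
  from resync_near[OF H(2) z(1) this] obtain u where u: "Th b g (sh \<zeta> u) = 0" "close b (L*a) h (sh \<zeta> u)" by blast
  have l: "has_leaf (sh \<zeta> u) \<Lambda>'" by (rule has_leaf_sh[OF z(2)])
  note D = closeD[OF u(2)]
  \<comment> \<open>\<open>W\<close> lies in the ball of half the radius, so that the leaf found in
    \<Lambda>' is still within \<rho> of \<open>g\<close>.\<close>
  have "nz b g h < \<rho> / 2" using W(1) h(4) by auto
  hence n: "nz b g (sh \<zeta> u) <= \<rho>"
   using Dz_triangle[of b g "sh \<zeta> u" h] D(6) a(2) by linarith
  have hs: "sh \<zeta> u \<in> HS b g \<rho>" using n W(3) l u(1) D H(5,7) by (simp add: HS_def hit_def has_leaf_def)
  have "nz b h (sh \<zeta> u) < e" using D(6) a(3) e by linarith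
  hence "Dz b g (sh \<zeta> u) \<in> W" by (rule st[rule_format, OF h(3) hs h(4)])
  thus ?thesis using l hs by blast
 qed
 note R = this
 show ?thesis
 proof (intro exI[of _ \<epsilon>] conjI allI impI)
  show "0 < \<epsilon>" by (rule eps)
 qed (rule R)
qed

text \<open>The leaf through a point of \<Lambda>1 outside \<Lambda>2 would define a clopen class
  containing \<Lambda>1 but not \<Lambda>2. Used in both directions, the lemma makes any two members
  of a connected set equal.\<close>

lemma connectedin_lamination_subset:
 assumes C: "connectedin (lamination_topology M) \<C>" and L: "\<Lambda>1 \<in> \<C>" "\<Lambda>2 \<in> \<C>"
 shows "\<Lambda>1 <= \<Lambda>2"
proof
 let ?A = "lamination_topology M"
 fix y assume y: "y \<in> \<Lambda>1"
 show "y \<in> \<Lambda>2"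
 proof (rule ccontr)
  assume y2: "y \<notin> \<Lambda>2"
  have lam: "\<Lambda> \<in> \<C> ==> geodesic_lamination M \<Lambda>" for \<Lambda>
   using connectedin_subset_topspace[OF C] by (auto simp: topspace_lamination_topology)
  obtain g where g: "has_leaf g \<Lambda>1" "g 0 = y" by (rule has_leaf_through[OF lam[OF L(1)] y])
  have s: "SG g" using g(1) by (simp add: has_leaf_def)
  hence G: "G g" by (simp add: simple_complete_geodesic_def)
  define b where "b = bx (g 0)"
  have b: "b \<in> B" "g 0 \<in> inn 1 b" unfolding b_def by (rule bx[OF geo_top[OF G]])+
  have "closedin X \<Lambda>2" using lam[OF L(2)] by (simp add: geodesic_lamination_def)
  hence "openin X (topspace X - \<Lambda>2)" "g 0 \<in> topspace X - \<Lambda>2" using y2 g(2) geo_top[OF G, of 0] by auto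
  from chart_nbhd[OF bA[OF b(1)] inn_dom[OF b(2)] this] obtain d where
   d: "0 < d" "!!z. z \<in> cdom (bch b) ==> dist (cmap (bch b) z) (xx b g 0) < d ==> z \<in> topspace X - \<Lambda>2" by blast
  \<comment> \<open>\<open>d\<close> makes every geodesic with offset in \<open>W\<close> start
    outside \<Lambda>2; \<open>d0/2\<close> is the radius that \<open>leaf_class_stable\<close>
    requires.\<close>
  define r0 where "r0 = min d (d0/2)"
  have r0: "0 < r0" "r0 <= d" "r0 <= d0/2" using d(1) d0(1) by (auto simp: r0_def)
  obtain W e where W: "0 \<in> W" "W <= ball 0 r0" "0 < e"
   and st: "ALL h:HS b g d0. ALL \<zeta>:HS b g d0. Dz b g h \<in> W --> nz b h \<zeta> < e --> Dz b g \<zeta> \<in> W"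
   by (rule HS_clopen[OF s less_imp_le[OF d0(1)] r0(1) b_def]) (rule that)
  define Q where "Q \<Lambda> \<longleftrightarrow> (EX h. has_leaf h \<Lambda> & h \<in> HS b g d0 & Dz b g h \<in> W)" for \<Lambda>
  have "W <= ball 0 (d0/2)" using W(2) r0(3) by (meson subset_ball subset_trans)
  from leaf_class_stable[OF this d0(1) order_refl W(3) st] obtain \<epsilon> where eps: "0 < \<epsilon>"
   and R: "ALL \<Lambda> \<Lambda>' h. hausdorff_dist M \<Lambda> \<Lambda>' < ennreal \<epsilon> --> has_leaf h \<Lambda> --> h \<in> HS b g d0 --> Dz b g h \<in> W -->
    (EX h'. has_leaf h' \<Lambda>' & h' \<in> HS b g d0 & Dz b g h' \<in> W)" by (elim exE conjE) (rule that)
  have Q1: "Q \<Lambda>'" if "Q \<Lambda>" "hausdorff_dist M \<Lambda> \<Lambda>' < ennreal \<epsilon>" for \<Lambda> \<Lambda>'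
  proof -
   from that(1) obtain h where h: "has_leaf h \<Lambda>" "h \<in> HS b g d0" "Dz b g h \<in> W" unfolding Q_def by blast
   show ?thesis unfolding Q_def by (rule R[rule_format, OF that(2) h])
  qed
  hence Q2: "Q \<Lambda> \<longleftrightarrow> Q \<Lambda>'" if "hausdorff_dist M \<Lambda> \<Lambda>' < ennreal \<epsilon>" for \<Lambda> \<Lambda>'
   using that hausdorff_dist_sym[of M \<Lambda> \<Lambda>'] by metis
  have op: "openin (?A) {\<Lambda>. geodesic_lamination M \<Lambda> & Q \<Lambda> = v}" for v
   unfolding openin_lamination_topology
  proof (intro conjI ballI)
   fix \<Lambda> assume L: "\<Lambda> \<in> {\<Lambda>. geodesic_lamination M \<Lambda> & Q \<Lambda> = v}"
   show "EX \<epsilon>>0. ALL \<Lambda>'. geodesic_lamination M \<Lambda>' & hausdorff_dist M \<Lambda> \<Lambda>' < \<epsilon> --> \<Lambda>' \<in> {\<Lambda>. geodesic_lamination M \<Lambda> & Q \<Lambda> = v}"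
    using eps L Q2[of \<Lambda>] by (intro exI[of _ "ennreal \<epsilon>"]) auto
  qed auto
  let ?T = "{\<Lambda>. geodesic_lamination M \<Lambda> & Q \<Lambda> = True}"
  have "topspace (?A) - ?T = {\<Lambda>. geodesic_lamination M \<Lambda> & Q \<Lambda> = False}"
   by (auto simp: topspace_lamination_topology)
  hence "closedin (?A) ?T" using op[of False] by (auto simp: closedin_def topspace_lamination_topology)
  hence dis: "\<C> <= ?T \<or> disjnt \<C> ?T" by (rule connectedin_clopen_cases[OF C _ op])
  have "g \<in> HS b g d0" "Dz b g g = 0" unfolding b_def using HS_self[OF s] d0(1) by auto
  hence "Q \<Lambda>1" unfolding Q_def using g(1) W(1) by (intro exI[of _ g]) simp
  moreover have "\<not> Q \<Lambda>2"
  proof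
   assume "Q \<Lambda>2"
   then obtain h where h: "has_leaf h \<Lambda>2" "h \<in> HS b g d0" "Dz b g h \<in> W" unfolding Q_def by blast
   have "nz b g h < d" using W(2) h(3) r0(2) by auto
   hence "norm (xx b h 0 - xx b g 0) < d" using norm_fst_snd(1)[of "Dz b g h"] by (simp add: Dz_def)
   hence "h 0 \<in> topspace X - \<Lambda>2" by (intro d(2) inn_dom[OF HS_D(8)[OF h(2)]]) (simp add: dist_norm)
   thus False using has_leaf_sub[OF h(1), of 0] by simp
  qed
  ultimately show False using dis L lam[OF L(1)] by (auto simp: disjnt_iff)
 qed
qed

lemma laminations_totally_disconnected: "totally_disconnected_space (lamination_topology M)"
 unfolding totally_disconnected_space_def
proof (intro allI impI)
 fix \<C> assume C: "connectedin (lamination_topology M) \<C>"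
 show "EX \<Lambda>. \<C> <= {\<Lambda>}"
 proof (cases "\<C> = {}")
  case False
  then obtain \<Lambda> where "\<Lambda> \<in> \<C>" by blast
  thus ?thesis using connectedin_lamination_subset[OF C] by (intro exI[of _ \<Lambda>] subsetI) (simp add: subset_antisym)
 qed simp
qed

end

section \<open>Existence of boxes and of their constants\<close>

context riem begin

lemma box_at:
 assumes y: "y \<in> topspace X"
 shows "EX U b. openin X U & y \<in> U & valid_box b & U <= inn 1 b"
proof -
 obtain c where c: "c \<in> \<A>" "y \<in> cdom c" using y charts_cover by blast
 have "cmap c y \<in> cimg c" using c(2) by (rule imageI)
 then obtain e where e: "0 < e" "ball (cmap c y) e \<inter> half_plane <= cimg c" by (rule relopen_ball[OF relopen_cimg[OF c(1)]])
 define b :: "'a box" where "b = (c, cmap c y, e/4)"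
 have b: "bch b = c" "bpt b = cmap c y" "brad b = e/4" by (simp_all only: b_def fst_conv snd_conv)
 have "cball (cmap c y) (3*(e/4)) <= ball (cmap c y) e"
 proof
  fix z assume "z \<in> cball (cmap c y) (3*(e/4))"
  hence "dist (cmap c y) z <= 3*(e/4)" by simp
  thus "z \<in> ball (cmap c y) e" using e(1) unfolding mem_ball by linarith
 qed
 from order_trans[OF Int_mono[OF this order_refl] e(2)] have v: "valid_box b"
  unfolding valid_box_def Kb_def b using e(1) c(1) by (simp only: divide_pos_pos zero_less_numeral simp_thms)
 let ?U = "{z \<in> cdom c. cmap c z \<in> ball (cmap c y) (e/4)}"
 have U: "openin X ?U" by (rule chart_preimage_open[OF c(1) open_ball])
 have y: "y \<in> ?U" using c(2) e(1) by simp
 have "?U <= inn 1 b" unfolding inn_def b by (rule subsetI) (simp add: dist_commute less_imp_le)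
 with U v y show ?thesis by (intro exI[of _ ?U] exI[of _ b]) (rule conjI | assumption)+
qed

lemma finite_box_cover:
 assumes "compact_space X"
 obtains B where "finite B" "ALL b:B. valid_box b" "topspace X = (\<Union>b\<in>B. inn 1 b)"
proof -
 let ?A = "topspace X"
 define \<U> where "\<U> = {U. openin X U & (EX b. valid_box b & U <= inn 1 b)}"
 have "?A <= \<Union>\<U>"
 proof
  fix y assume "y \<in> ?A"
  from box_at[OF this] show "y \<in> \<Union>\<U>" unfolding \<U>_def by blast
 qed
 moreover have "ALL U:\<U>. openin X U" by (simp add: \<U>_def)
 ultimately obtain \<F> where F: "finite \<F>" "\<F> <= \<U>" "?A <= \<Union>\<F>" using assms unfolding compact_space_alt by meson
 have "ALL U:\<F>. EX b. valid_box b & U <= inn 1 b" using F(2) unfolding \<U>_def by blast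
 then obtain f where f: "ALL U:\<F>. valid_box (f U) & U <= inn 1 (f U)" by (rule bchoice[THEN exE])
 have "inn 1 b <= ?A" if "valid_box b" for b
  using openin_subset[OF chart_open] that unfolding valid_box_def inn_def by blast
 hence "?A = (\<Union>b\<in>f ` \<F>. inn 1 b)" using F(3) f by fastforce
 thus ?thesis using F(1) f by (intro that[of "f ` \<F>"]) auto
qed

lemma boxes_exist:
 assumes X: "compact_space X" and neg: "negatively_curved M"
 obtains B C T k where "boxes M B C T k"
proof -
 obtain B where B: "finite B" "ALL b:B. valid_box b" "topspace X = (\<Union>b\<in>B. inn 1 b)" by (rule finite_box_cover[OF X])
 have v: "b \<in> B ==> valid_box b" for b using B(2) by blast
 have nn: "0 <= ip (bch b) q u u" if "b \<in> B" "q \<in> Kb b" for b q u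
  using v[OF that(1)] that(2) by (intro ip_nonneg) (auto simp: valid_box_def)
 define P1 where "P1 b C \<longleftrightarrow> (ALL q:Kb b. ALL u. (norm u)^2 <= C*ip (bch b) q u u & ip (bch b) q u u <= C*(norm u)^2)" for b and C :: real
 define P2 where "P2 b C \<longleftrightarrow> (ALL q:Kb b. ALL u w. norm (Gam (bch b) q u w) <= C*norm u*norm w)" for b and C :: real
 define P3 where "P3 b C \<longleftrightarrow> (ALL q:Kb b. ALL q':Kb b. ALL u w. norm (Gam (bch b) q' u w - Gam (bch b) q u w) <= C*dist q' q*norm u*norm w)" for b and C :: real
 have m1: "P1 b C'" if "b \<in> B" "P1 b C" "C <= C'" for b C C'
  unfolding P1_def
 proof (intro ballI allI)
  fix q and u :: "real^2" assume q: "q \<in> Kb b"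
  have "C*ip (bch b) q u u <= C' * ip (bch b) q u u" "C*(norm u)^2 <= C' * (norm u)^2"
   using that(3) by (intro mult_right_mono nn[OF that(1) q] zero_le_power2; simp)+
  thus "(norm u)^2 <= C' * ip (bch b) q u u & ip (bch b) q u u <= C' * (norm u)^2"
   using that(2)[unfolded P1_def, rule_format, OF q, of u] by linarith
 qed
 have m2: "P2 b C'" if "P2 b C" "C <= C'" for b C C'
  unfolding P2_def
 proof (intro ballI allI)
  fix q and u w :: "real^2" assume q: "q \<in> Kb b"
  have "C*norm u*norm w <= C' * norm u*norm w" using that(2) by (intro mult_right_mono) auto
  thus "norm (Gam (bch b) q u w) <= C' * norm u*norm w" using that(1)[unfolded P2_def, rule_format, OF q, of u w] by linarith
 qed
 have m3: "P3 b C'" if "P3 b C" "C <= C'" for b C C'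
  unfolding P3_def
 proof (intro ballI allI)
  fix q q' and u w :: "real^2" assume q: "q \<in> Kb b" "q' \<in> Kb b"
  have "C*dist q' q*norm u*norm w <= C' * dist q' q*norm u*norm w" using that(2) by (intro mult_right_mono) auto
  thus "norm (Gam (bch b) q' u w - Gam (bch b) q u w) <= C' * dist q' q*norm u*norm w"
   using that(1)[unfolded P3_def, rule_format, OF q, of u w] by linarith
 qed
 have "EX C>=1. ALL b:B. P1 b C" by (rule finite_uniform_large[OF B(1)]) (rule ip_bounds[OF v, folded P1_def], assumption, rule m1)
 then obtain C1 where C1: "1 <= C1" "ALL b:B. P1 b C1" by blast
 have "EX C>=1. ALL b:B. P2 b C" by (rule finite_uniform_large[OF B(1)]) (rule Gam_bounds(1)[OF v, folded P2_def], assumption, rule m2)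
 then obtain C2 where C2: "1 <= C2" "ALL b:B. P2 b C2" by blast
 have "EX C>=1. ALL b:B. P3 b C" by (rule finite_uniform_large[OF B(1)]) (rule Gam_bounds(2)[OF v, folded P3_def], assumption, rule m3)
 then obtain C3 where C3: "1 <= C3" "ALL b:B. P3 b C3" by blast
 define C where "C = C1 + C2 + C3"
 have C: "1 <= C" "C1 <= C^2" "C2 <= C" "C3 <= C"
 proof -
  show 1: "1 <= C" "C2 <= C" "C3 <= C" unfolding C_def using C1 C2 C3 by auto
  have "C1 <= C" unfolding C_def using C2 C3 by auto
  also have "C <= C^2" using 1(1) by (simp add: power2_eq_square)
  finally show "C1 <= C^2" .
 qed
 define Q where "Q b k \<longleftrightarrow> (ALL q:Kb b. k <= - gK (bch b) q & - gK (bch b) q <= 1/k)" for b and k :: real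
 have mQ: "Q b k'" if "Q b k" "0 < k'" "k' <= k" for b k k'
 proof -
  have le: "1/k <= 1/k'" using that by (intro divide_left_mono) auto
  show ?thesis unfolding Q_def
  proof (intro ballI)
   fix q assume "q \<in> Kb b"
   from that(1)[unfolded Q_def, rule_format, OF this] show "k' <= - gK (bch b) q & - gK (bch b) q <= 1/k'"
    using le that(3) by linarith
  qed
 qed
 have "EX k>0. ALL b:B. Q b k" by (rule finite_uniform_small[OF B(1)]) (rule curvature_bounds[OF v neg, folded Q_def], assumption, rule mQ)
 then obtain k0 where k0: "0 < k0" "ALL b:B. Q b k0" by blast
 define k where "k = min k0 1"
 have k: "0 < k" "k <= 1" "ALL b:B. Q b k" using k0 mQ[of _ k0 k] by (auto simp: k_def)
 have "EX r>0. ALL b:B. r <= brad b"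
 proof (rule finite_uniform_small[OF B(1)])
  show "EX r>0. r <= brad b" if "b \<in> B" for b using v[OF that] unfolding valid_box_def by blast
 qed linarith
 then obtain r where r: "0 < r" "ALL b:B. r <= brad b" by blast
 \<comment> \<open>The first bound gives \<open>tau_rad\<close>, with a factor 2 to spare for
   strictness. The second gives \<open>40 * C^4 * T <= k^3 <= 1\<close>, which yields
   \<open>tau1\<close>, and also \<open>tau2\<close> because \<open>T <= 1\<close>.\<close>
 define T where "T = min (r/(8*C)) (k^3/(40*C^4))"
 have pos: "0 < 8*C" "0 < 40*C^4" "1 <= 40*C^4" using C(1) one_le_power[OF C(1), of 4] by (simp, simp, linarith)
 have t: "0 < T" "8*C*T <= r" "40*C^4*T <= k^3"
 proof -
  show "0 < T" using r(1) k(1) pos by (simp add: T_def)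
  have "8*C*T <= 8*C*(r/(8*C))" using pos by (intro mult_left_mono) (auto simp: T_def)
  thus "8*C*T <= r" using pos by simp
  have "40*C^4*T <= 40*C^4*(k^3/(40*C^4))" using pos by (intro mult_left_mono) (auto simp: T_def)
  thus "40*C^4*T <= k^3" using pos by simp
 qed
 have k3: "k^3 <= 1" using k by (intro power_le_one) auto
 have "1*T <= 40*C^4*T" using pos(3) t(1) by (intro mult_right_mono) auto
 hence t1: "T <= 1" using t(3) k3 by simp
 show ?thesis
 proof (rule that, unfold_locales)
  fix b assume b: "b \<in> B"
  show "valid_box b" by (rule v[OF b])
  have "4*C*T < 8*C*T" using t(1) C(1) by simp
  thus "4*C*T < brad b" using t(2) r(2) b by fastforce
  fix q assume q: "q \<in> Kb b"
  have "P1 b (C^2)" using m1[OF b] C1 b C(2) by blast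
  thus "(norm u)^2 <= C^2*ip (bch b) q u u & ip (bch b) q u u <= C^2*(norm u)^2" for u using q unfolding P1_def by blast
  have "P2 b C" using m2 C2 b C(3) by blast
  thus "norm (Gam (bch b) q u w) <= C*norm u*norm w" for u w using q unfolding P2_def by blast
  have "P3 b C" using m3 C3 b C(4) by blast
  thus "norm (Gam (bch b) q' u w - Gam (bch b) q u w) <= C*dist q' q*norm u*norm w" if "q' \<in> Kb b" for q' u w
   using q that unfolding P3_def by blast
  show "k <= - gK (bch b) q & - gK (bch b) q <= 1/k" using k(3) b q unfolding Q_def by blast
 next
  have "32*C^4*T^2 <= 40*C^4*T" using t(1) t1 C(1) by (intro mult_mono) (simp_all add: power2_eq_square)
  thus "32*C^4*T^2 <= k^3" using t(3) by linarith
  show "40*C^4*T <= 1" using t(3) k3 by linarith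
 qed (use B C(1) k t(1) in simp_all)
qed

end

theorem corollary2:
  fixes M :: "'a surface"
  assumes "riemannian_surface M"
    and "compact_space (surf_top M)"
    and "euler_characteristic (surf_top M) < 0"
    and "negatively_curved M"
    and "totally_geodesic_boundary M"
  shows "totally_disconnected_space (lamination_topology M)"
proof -
 interpret riem M using assms(1) by unfold_locales
 obtain B C T k where "boxes M B C T k" by (rule boxes_exist[OF assms(2,4)])
 then interpret boxes M B C T k .
 obtain L d0 c where "tracking M B C T k L d0 c" using tracking_exists by blast
 then interpret tracking M B C T k L d0 c .
 show ?thesis by (rule laminations_totally_disconnected)
qed

end
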